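(* Let $c>1$ be a real number with $c\notin\mathbb{N}$ and $\gamma=1/c$. Then, as $N\to\infty$, uniformly for real $S$ with $1\le S\le N^c$, $$\mathfrak{Q}_c(S,N)-\frac{12\gamma}{\pi^2(2\gamma-1)}S^{1/2}N^{1-c/2}\ \le\ \left(S^{1/5}N^{(1+2c)/5}+S^{5/8}N^{3c/8}+S^{1/8}N^{(2+3c)/8}+SN^{1-c}\right)N^{o(1)}$$ in absolute value; that is, for every $\varepsilon>0$ there is $C=C(c,\varepsilon)$ such that for all $N\ge1$ and $1\le S\le N^c$ the absolute value of the left-hand side is at most $C N^{\varepsilon}\left(S^{1/5}N^{(1+2c)/5}+S^{5/8}N^{3c/8}+S^{1/8}N^{(2+3c)/8}+SN^{1-c}\right)$.
   Context: For a real $c>1$ and positive integers $s,N$, $Q_c(s;N)$ denotes the number of integers $n$ with $1\le n\le N$ such that $\lfloor n^c\rfloor=sm^2$ for some integer $m$ (where $\lfloor z\rfloor$ is the integer part). For real $S\ge1$, $\mathfrak{Q}_c(S,N)=\sum_{s\le S,\ s \text{ square-free}}Q_c(s;N)$, the sum over positive square-free integers $s\le S$. *)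

theory Defs
  imports Complex_Main "HOL-Computational_Algebra.Squarefree"
begin

definition Q :: "real \<Rightarrow> nat \<Rightarrow> nat \<Rightarrow> nat" where
  "Q c s N = card {n \<in> {1..N}. \<exists>m::int. \<lfloor>real n powr c\<rfloor> = int s * m ^ 2}"

definition frakQ :: "real \<Rightarrow> real \<Rightarrow> nat \<Rightarrow> nat" where
  "frakQ c S N = (\<Sum>s | 0 < s \<and> real s \<le> S \<and> squarefree s. Q c s N)"

end

theory Submission
imports Defs "HOL-Probability.Probability" "HOL-Real_Asymp.Real_Asymp"
begin

text \<open>An integer \<open>k\<close> equals \<open>\<lfloor>n powr c\<rfloor>\<close> for some \<open>n\<close> iff \<open>[k powr \<gamma>, (k + 1) powr \<gamma>)\<close> contains
an integer, so the sum is a smooth main term plus sums of the sawtooth function \<open>psi\<close> at the points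
\<open>- (s m^2 + \<nu>) powr \<gamma>\<close> with \<open>\<nu> = 0, 1\<close>. On dyadic blocks these are reduced to exponential sums, to which
Hoelder's inequality (a double large sieve) is applied. It needs two spacing estimates. The first counts pairs
\<open>(h, m)\<close>, \<open>(h', m')\<close> with \<open>h m powr (2 \<gamma>)\<close> close to \<open>h' m' powr (2 \<gamma>)\<close>. The second bounds the number of quadruples
with \<open>s1 powr \<gamma> + s2 powr \<gamma> - s3 powr \<gamma> - s4 powr \<gamma>\<close> small (Robert and Sargos). That number, smoothed, is a fourth
moment \<open>energy\<close>; Poisson summation and stationary phase relate the exponents \<open>\<kappa>\<close> and \<open>\<kappa> / (\<kappa> - 1)\<close>
and improve a loss \<open>\<theta>\<close> to \<open>\<theta> / (1 + \<theta>)\<close>, so that iteration from the trivial bound gives any \<open>\<epsilon> > 0\<close>.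
For \<open>c \<ge> 2\<close> the statement is trivial, since \<open>S powr (1/5) * N powr ((1 + 2 c) / 5) \<ge> N\<close>.\<close>

section \<open>Fourth moments of trigonometric polynomials\<close>

text \<open>The coefficients of the sum over s are the indicator of square-free numbers, so no
  cancellation can be taken from them; it must come from the spacing of the points alone. The phase
  h (s m^2) powr \<gamma> is a product of an outer factor h m powr (2 \<gamma>) and an inner factor
  s powr \<gamma>, which is what a double large sieve needs. Two obstacles remain. The condition s
  m^2 \<le> Y makes the range of s depend on m, hence the dyadic treatment of prefix sums. For \<nu>
  = 1 the phase has a second summand of lower order, which is frozen on unit cells and removed by
  partial summation. Moments carry Gaussian weights because their Fourier transforms are positive,
  so that energies can be restricted, enlarged and compared term by term. The loss shrinks because
  the energy decreases in its scale X: the dual estimate may be read at a smaller scale, chosen so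
  that its two competing terms balance. The map from \<kappa> to \<kappa> / (\<kappa> - 1) is an
  involution of the exponents other than 0 and 1, so the induction runs over all of them at
  once.\<close>

definition ec :: "real => complex" where
 "ec x = cis (2 * pi * x)"

lemma norm_ec [simp]: "norm (ec x) = 1"
 by (simp add: ec_def)

lemma ec_add: "ec (x + y) = ec x * ec y"
 by (simp add: ec_def cis_mult ring_distribs)

lemma ec_0 [simp]: "ec 0 = 1"
 by (simp add: ec_def)

lemma cnj_ec: "cnj (ec x) = ec (- x)"
 by (simp add: ec_def cis_cnj)

lemma ec_minus_mult [simp]: "ec (- x) * ec x = 1" "ec x * ec (- x) = 1"
 by (simp_all flip: ec_add)

lemma ec_of_int [simp]: "ec (of_int n) = 1"
 using cis_multiple_2pi[of "of_int n"] by (simp add: ec_def)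

lemma continuous_on_ec [continuous_intros]:
 "continuous_on A f ==> continuous_on A (\<lambda>x. ec (f x))"
 unfolding ec_def by (intro continuous_intros)

lemma measurable_ec [measurable]: "ec \<in> borel_measurable borel"
 by (intro borel_measurable_continuous_onI continuous_intros)

lemma ec_has_vector_derivative:
 fixes f :: "real => real"
 assumes "(f has_real_derivative f') (at x within A)"
 shows "((\<lambda>x. ec (f x)) has_vector_derivative (2 * pi * \<i> * f') * ec (f x)) (at x within A)"
proof -
 have 1: "((\<lambda>x. 2 * pi * f x) has_real_derivative 2 * pi * f') (at x within A)"
  by (rule DERIV_cmult[OF assms])
 have 2: "(exp has_field_derivative exp (\<i> * complex_of_real (2 * pi * f x))) (at (\<i> * complex_of_real (2 * pi * f x)))"
  by (rule DERIV_exp)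
 have 3: "((\<lambda>x. \<i> * complex_of_real (2 * pi * f x)) has_vector_derivative \<i> * complex_of_real (2 * pi * f')) (at x within A)"
  by (rule has_vector_derivative_mult_right has_vector_derivative_of_real 1)+
 have "((exp \<circ> (\<lambda>x. \<i> * complex_of_real (2 * pi * f x))) has_vector_derivative
   (\<i> * complex_of_real (2 * pi * f')) * exp (\<i> * complex_of_real (2 * pi * f x))) (at x within A)"
  by (rule field_vector_diff_chain_within[OF 3 DERIV_subset[OF 2]]) auto
 then show ?thesis
  by (simp add: ec_def cis_conv_exp o_def mult_ac)
qed

section \<open>Gaussian-weighted fourth moments and the energy of quadruples\<close>

definition gauss :: "real => real => real" where
 "gauss X x = exp (- (pi * x^2 / X^2))"

lemma gauss_nonneg [simp]: "gauss X x \<ge> 0" and gauss_pos: "gauss X x > 0" and gauss_le_1: "gauss X x \<le> 1"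
 by (auto simp: gauss_def)

lemma measurable_gauss [measurable]: "gauss X \<in> borel_measurable borel"
 unfolding gauss_def by measurable

text \<open>The characteristic function of the standard normal law, transported by the substitution
  y = sqrt (2 pi) x / X. The transform is positive, and the comparisons of moments with energies
  rest on that.\<close>

lemma gauss_fourier:
 assumes "X > 0"
 shows "integrable lborel (\<lambda>x. complex_of_real (gauss X x) * ec (x * d))"
  and "(CLINT x|lborel. complex_of_real (gauss X x) * ec (x * d)) = of_real (X * exp (- pi * X^2 * d^2))"
proof -
 define t where "t = sqrt (2 * pi) * X * d"
 define c where "c = sqrt (2 * pi) / X"
 have c: "c \<noteq> 0" "c > 0" using assms by (auto simp: c_def)
 define f where "f = (\<lambda>y. std_normal_density y *\<^sub>R iexp (t * y))"
 have c2: "c^2 = 2 * pi / X^2"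
  by (simp add: c_def power_divide)
 have tc: "t * (c * x) = 2 * pi * (x * d)" for x
  using assms by (simp add: t_def c_def)
 have feq: "f (0 + c * x) = (1 / sqrt (2 * pi)) *\<^sub>R (complex_of_real (gauss X x) * ec (x * d))" for x
 proof -
  have "std_normal_density (c * x) = (1 / sqrt (2 * pi)) * gauss X x"
   by (simp add: std_normal_density_def gauss_def power_mult_distrib c2)
  moreover have "iexp (t * (c * x)) = ec (x * d)"
   unfolding tc by (simp add: ec_def cis_conv_exp)
  ultimately show ?thesis by (simp add: f_def scaleR_conv_of_real)
 qed
 have intg: "integrable lborel f"
 proof -
  have "integrable lborel (\<lambda>y. norm (std_normal_density y))"
   using integrable_std_normal_moment[of 0] by simp
  then show ?thesis
   by (rule Bochner_Integration.integrable_bound) (auto simp: f_def)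
 qed
 have "integrable lborel (\<lambda>x. f (0 + c * x))"
  using lborel_integrable_real_affine_iff[OF c(1), of f 0] intg by simp
 then show "integrable lborel (\<lambda>x. complex_of_real (gauss X x) * ec (x * d))"
  unfolding feq using integrable_scaleR_right[of "sqrt (2 * pi)" lborel "\<lambda>x. (1 / sqrt (2 * pi)) *\<^sub>R (complex_of_real (gauss X x) * ec (x * d))"]
  by simp
 have ch: "char std_normal_distribution t = (\<integral>y. f y \<partial>lborel)"
  unfolding char_def f_def by (subst integral_density) (auto simp: normal_density_nonneg)
 have "(\<integral>y. f y \<partial>lborel) = \<bar>c\<bar> *\<^sub>R (\<integral>x. f (0 + c * x) \<partial>lborel)"
  by (rule lborel_integral_real_affine[OF c(1)])
 also have "... = c *\<^sub>R (1 / sqrt (2 * pi)) *\<^sub>R (CLINT x|lborel. complex_of_real (gauss X x) * ec (x * d))"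
  unfolding feq using c by simp
 also have "... = (1 / X) *\<^sub>R (CLINT x|lborel. complex_of_real (gauss X x) * ec (x * d))"
  by (simp add: c_def)
 finally have "(CLINT x|lborel. complex_of_real (gauss X x) * ec (x * d)) = X *\<^sub>R char std_normal_distribution t"
  using assms ch by simp
 also have "... = of_real (X * exp (- (t^2) / 2))"
  by (simp add: char_std_normal_distribution scaleR_conv_of_real)
 also have "- (t^2) / 2 = - pi * X^2 * d^2"
  by (simp add: t_def power_mult_distrib)
 finally show "(CLINT x|lborel. complex_of_real (gauss X x) * ec (x * d)) = of_real (X * exp (- pi * X^2 * d^2))" .
qed

definition tpoly :: "'a set => ('a => real) => ('a => complex) => real => complex" where
 "tpoly I \<theta> a x = (\<Sum>i\<in>I. a i * ec (x * \<theta> i))"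

text \<open>A smoothed count of the quadruples whose alternating sum of frequencies is at most about
  1 / X. The Gaussian replaces a sharp cutoff so that X times this quantity is exactly the
  Gaussian-weighted fourth moment with all coefficients 1.\<close>

definition energy :: "'a set => ('a => real) => real => real" where
 "energy I \<theta> X = (\<Sum>i\<in>I. \<Sum>j\<in>I. \<Sum>k\<in>I. \<Sum>l\<in>I. exp (- pi * X^2 * (\<theta> i + \<theta> j - \<theta> k - \<theta> l)^2))"

lemma continuous_on_tpoly [continuous_intros]:
 "continuous_on A f ==> continuous_on A (\<lambda>x. tpoly I \<theta> a (f x))"
 unfolding tpoly_def by (intro continuous_intros)

lemma measurable_tpoly [measurable]: "tpoly I \<theta> a \<in> borel_measurable borel"
 by (intro borel_measurable_continuous_onI continuous_intros)

lemma tpoly_norm4: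
 "complex_of_real (norm (tpoly I \<theta> a x) ^ 4) =
  (\<Sum>i\<in>I. \<Sum>j\<in>I. \<Sum>k\<in>I. \<Sum>l\<in>I. a i * a j * cnj (a k) * cnj (a l) * ec (x * (\<theta> i + \<theta> j - \<theta> k - \<theta> l)))"
proof -
 define F where "F = tpoly I \<theta> a x"
 have "complex_of_real (norm F ^ 4) = (complex_of_real ((norm F)^2))^2"
  by (simp flip: power_mult)
 also have "... = F * (F * (cnj F * cnj F))"
  unfolding complex_norm_square by (simp add: power2_eq_square mult_ac)
 also have "cnj F = (\<Sum>i\<in>I. cnj (a i) * ec (- (x * \<theta> i)))"
  by (simp add: F_def tpoly_def cnj_sum cnj_ec)
 finally have "complex_of_real (norm F ^ 4) = (\<Sum>i\<in>I. \<Sum>j\<in>I. \<Sum>k\<in>I. \<Sum>l\<in>I.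
   (a i * ec (x * \<theta> i)) * ((a j * ec (x * \<theta> j)) * ((cnj (a k) * ec (- (x * \<theta> k))) * (cnj (a l) * ec (- (x * \<theta> l))))))"
  unfolding F_def tpoly_def by (simp only: sum_distrib_right) (simp only: sum_distrib_left)
 also have "... = (\<Sum>i\<in>I. \<Sum>j\<in>I. \<Sum>k\<in>I. \<Sum>l\<in>I. a i * a j * cnj (a k) * cnj (a l) * ec (x * (\<theta> i + \<theta> j - \<theta> k - \<theta> l)))"
 proof (intro sum.cong refl)
  fix i j k l
  have "ec (x * (\<theta> i + \<theta> j - \<theta> k - \<theta> l)) = ec (x * \<theta> i) * ec (x * \<theta> j) * ec (- (x * \<theta> k)) * ec (- (x * \<theta> l))"
   by (simp add: algebra_simps flip: ec_add)
  then show "(a i * ec (x * \<theta> i)) * ((a j * ec (x * \<theta> j)) * ((cnj (a k) * ec (- (x * \<theta> k))) * (cnj (a l) * ec (- (x * \<theta> l)))))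
   = a i * a j * cnj (a k) * cnj (a l) * ec (x * (\<theta> i + \<theta> j - \<theta> k - \<theta> l))"
   by (simp add: mult_ac)
 qed
 finally show ?thesis by (simp add: F_def)
qed

lemma gauss_moment:
 assumes "X > 0"
 shows "integrable lborel (\<lambda>x. gauss X x * norm (tpoly I \<theta> a x) ^ 4)"
  and "complex_of_real (LINT x|lborel. gauss X x * norm (tpoly I \<theta> a x) ^ 4) =
  (\<Sum>i\<in>I. \<Sum>j\<in>I. \<Sum>k\<in>I. \<Sum>l\<in>I. a i * a j * cnj (a k) * cnj (a l) *
    of_real (X * exp (- pi * X^2 * (\<theta> i + \<theta> j - \<theta> k - \<theta> l)^2)))"
proof -
 define d where "d = (\<lambda>i j k l. \<theta> i + \<theta> j - \<theta> k - \<theta> l)"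
 define G where "G = (\<lambda>i j k l x. complex_of_real (gauss X x) * ec (x * d i j k l))"
 define c where "c = (\<lambda>i j k l. a i * a j * cnj (a k) * cnj (a l))"
 have G: "integrable lborel (G i j k l)" "integral\<^sup>L lborel (G i j k l) = of_real (X * exp (- pi * X^2 * (d i j k l)^2))" for i j k l
  unfolding G_def using gauss_fourier[OF assms] by auto
 have eq: "complex_of_real (gauss X x * norm (tpoly I \<theta> a x) ^ 4) =
   (\<Sum>i\<in>I. \<Sum>j\<in>I. \<Sum>k\<in>I. \<Sum>l\<in>I. c i j k l * G i j k l x)" for x
  unfolding of_real_mult tpoly_norm4 G_def c_def d_def sum_distrib_left
  by (intro sum.cong refl) (simp add: mult_ac)
 have int: "integrable lborel (\<lambda>x. complex_of_real (gauss X x * norm (tpoly I \<theta> a x) ^ 4))"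
  unfolding eq by (intro Bochner_Integration.integrable_sum integrable_mult_right G)
 then show "integrable lborel (\<lambda>x. gauss X x * norm (tpoly I \<theta> a x) ^ 4)"
  by (rule Bochner_Integration.integrable_bound) (auto simp: norm_mult norm_power)
 have "complex_of_real (LINT x|lborel. gauss X x * norm (tpoly I \<theta> a x) ^ 4) =
   (CLINT x|lborel. complex_of_real (gauss X x * norm (tpoly I \<theta> a x) ^ 4))"
  by (rule integral_complex_of_real[symmetric])
 also have "... = (\<Sum>i\<in>I. \<Sum>j\<in>I. \<Sum>k\<in>I. \<Sum>l\<in>I. c i j k l * of_real (X * exp (- pi * X^2 * (d i j k l)^2)))"
  unfolding eq by (simp add: Bochner_Integration.integrable_sum integrable_mult_right G)
 finally show "complex_of_real (LINT x|lborel. gauss X x * norm (tpoly I \<theta> a x) ^ 4) =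
  (\<Sum>i\<in>I. \<Sum>j\<in>I. \<Sum>k\<in>I. \<Sum>l\<in>I. a i * a j * cnj (a k) * cnj (a l) *
    of_real (X * exp (- pi * X^2 * (\<theta> i + \<theta> j - \<theta> k - \<theta> l)^2)))"
  unfolding c_def d_def .
qed

lemma gauss_moment_le:
 assumes "X > 0" and "\<And>i. i \<in> I ==> norm (a i) \<le> 1"
 shows "(LINT x|lborel. gauss X x * norm (tpoly I \<theta> a x) ^ 4) \<le> X * energy I \<theta> X"
proof -
 let ?L = "LINT x|lborel. gauss X x * norm (tpoly I \<theta> a x) ^ 4"
 have "?L \<le> norm (complex_of_real ?L)" by simp
 also have "... \<le> (\<Sum>i\<in>I. \<Sum>j\<in>I. \<Sum>k\<in>I. \<Sum>l\<in>I. X * exp (- pi * X^2 * (\<theta> i + \<theta> j - \<theta> k - \<theta> l)^2))"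
  unfolding gauss_moment(2)[OF assms(1)]
 proof (intro sum_norm_le)
  fix i j k l assume ij: "i \<in> I" "j \<in> I" "k \<in> I" "l \<in> I"
  have "norm (a i) * norm (a j) * norm (a k) * norm (a l) \<le> 1 * 1 * 1 * 1"
   by (intro mult_mono assms ij) auto
  then show "norm (a i * a j * cnj (a k) * cnj (a l) * complex_of_real (X * exp (- pi * X^2 * (\<theta> i + \<theta> j - \<theta> k - \<theta> l)^2)))
   \<le> X * exp (- pi * X^2 * (\<theta> i + \<theta> j - \<theta> k - \<theta> l)^2)"
   using assms(1) by (simp add: norm_mult mult_left_le_one_le)
 qed
 also have "... = X * energy I \<theta> X"
  by (simp add: energy_def sum_distrib_left)
 finally show ?thesis .
qed

text \<open>All weights and all kernel values are nonnegative, so terms outside J can be discarded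
  and the weights on J lowered to 1. This is the place where a positive Fourier transform is
  indispensable.\<close>

lemma gauss_moment_ge:
 assumes "X > 0" "finite I" "J \<subseteq> I" and "\<And>i. i \<in> I ==> w i \<ge> 0" "\<And>i. i \<in> J ==> w i \<ge> 1"
 shows "X * energy J \<theta> X \<le> (LINT x|lborel. gauss X x * norm (tpoly I \<theta> (\<lambda>i. of_real (w i)) x) ^ 4)"
proof -
 let ?L = "LINT x|lborel. gauss X x * norm (tpoly I \<theta> (\<lambda>i. of_real (w i)) x) ^ 4"
 let ?E = "\<lambda>i j k l. X * exp (- pi * X^2 * (\<theta> i + \<theta> j - \<theta> k - \<theta> l)^2)"
 have "complex_of_real ?L = complex_of_real (\<Sum>i\<in>I. \<Sum>j\<in>I. \<Sum>k\<in>I. \<Sum>l\<in>I. w i * w j * w k * w l * ?E i j k l)"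
  unfolding gauss_moment(2)[OF assms(1)] by simp
 then have L: "?L = (\<Sum>i\<in>I. \<Sum>j\<in>I. \<Sum>k\<in>I. \<Sum>l\<in>I. w i * w j * w k * w l * ?E i j k l)"
  by (simp only: of_real_eq_iff)
 have fin: "finite J" using assms(2,3) by (rule finite_subset[rotated])
 have "X * energy J \<theta> X = (\<Sum>i\<in>J. \<Sum>j\<in>J. \<Sum>k\<in>J. \<Sum>l\<in>J. ?E i j k l)"
  by (simp add: energy_def sum_distrib_left)
 also have "... \<le> (\<Sum>i\<in>J. \<Sum>j\<in>J. \<Sum>k\<in>J. \<Sum>l\<in>J. w i * w j * w k * w l * ?E i j k l)"
 proof (intro sum_mono)
  fix i j k l assume ij: "i \<in> J" "j \<in> J" "k \<in> J" "l \<in> J"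
  have "1 * 1 * 1 * 1 \<le> w i * w j * w k * w l"
   using assms(5)[OF ij(1)] assms(5)[OF ij(2)] assms(5)[OF ij(3)] assms(5)[OF ij(4)]
   by (intro mult_mono) auto
  then show "?E i j k l \<le> w i * w j * w k * w l * ?E i j k l"
   using assms(1) by (simp add: mult_right_le_one_le)
 qed
 also have "... \<le> (\<Sum>i\<in>I. \<Sum>j\<in>I. \<Sum>k\<in>I. \<Sum>l\<in>I. w i * w j * w k * w l * ?E i j k l)"
  using assms(1,2,3) assms(4)
  by (intro order.trans[OF sum_mono2 sum_mono]  order.refl)
   (auto intro!: sum_nonneg mult_nonneg_nonneg order.trans[OF sum_mono2 sum_mono] sum_mono2 order.refl simp: subset_iff)
 finally show ?thesis using L by simp
qed

lemma energy_nonneg: "energy I \<theta> X \<ge> 0"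
 unfolding energy_def by (intro sum_nonneg) auto

lemma energy_antimono:
 assumes "0 < X" "X \<le> Y"
 shows "energy I \<theta> Y \<le> energy I \<theta> X"
 unfolding energy_def using assms
 by (intro sum_mono) (auto intro!: mult_right_mono power_mono)

lemma energy_mono_set:
 assumes "finite I" "J \<subseteq> I" "X > 0"
 shows "energy J \<theta> X \<le> energy I \<theta> X"
proof -
 have "X * energy J \<theta> X \<le> X * energy I \<theta> X"
  using order.trans[OF gauss_moment_ge[of X I J "\<lambda>_. 1" \<theta>] gauss_moment_le[of X I "\<lambda>_. of_real 1" \<theta>]] assms
  by auto
 then show ?thesis using assms by simp
qed

lemma energy_le_card: "energy I \<theta> X \<le> real (card I) ^ 4"
proof -
 have "energy I \<theta> X \<le> (\<Sum>i\<in>I. \<Sum>j\<in>I. \<Sum>k\<in>I. \<Sum>l\<in>I. 1)"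
  unfolding energy_def by (intro sum_mono) (auto intro!: mult_nonneg_nonneg)
 then show ?thesis by (simp add: power4_eq_xxxx mult_ac)
qed

lemma energy_scale: "energy I (\<lambda>i. c * \<theta> i) X = energy I \<theta> (c * X)"
 unfolding energy_def
 by (intro sum.cong refl arg_cong[where f = exp]) (simp add: power2_eq_square algebra_simps)

lemma energy_reindex:
 assumes "inj_on f J"
 shows "energy (f ` J) \<theta> X = energy J (\<lambda>i. \<theta> (f i)) X"
 by (simp add: energy_def sum.reindex[OF assms])

lemma energy_cong:
 assumes "\<And>i. i \<in> I ==> \<theta> i = \<theta>' i"
 shows "energy I \<theta> X = energy I \<theta>' X"
 by (simp add: energy_def assms)

lemma power4_add_le: "(a + b :: real) ^ 4 \<le> 8 * (a ^ 4 + b ^ 4)" if "a \<ge> 0" "b \<ge> 0"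
proof -
 have "(a + b)^2 \<le> 2 * (a^2 + b^2)" using sum_squares_bound[of a b] by (simp add: power2_sum)
 then have "((a + b)^2)^2 \<le> (2 * (a^2 + b^2))^2" by (intro power_mono) auto
 also have "... = 4 * (a^2 + b^2)^2" by (subst power_mult_distrib) simp
 also have "(a^2 + b^2)^2 \<le> 2 * ((a^2)^2 + (b^2)^2)" using sum_squares_bound[of "a^2" "b^2"] by (simp add: power2_sum)
 finally show ?thesis by (simp flip: power_mult)
qed

text \<open>Quadruples may mix I and J, so a direct count is awkward. On the side of the moment the
  polynomial splits in two, and \<open>power4_add_le\<close> gives the factor 8 pointwise.\<close>

lemma energy_Un_le:
 assumes "finite I" "finite J" "X > 0"
 shows "energy (I \<union> J) \<theta> X \<le> 8 * (energy I \<theta> X + energy J \<theta> X)"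
proof -
 let ?T = "\<lambda>I x. gauss X x * norm (tpoly I \<theta> (\<lambda>_. 1) x) ^ 4"
 have split: "tpoly (I \<union> J) \<theta> (\<lambda>_. 1) x = tpoly I \<theta> (\<lambda>_. 1) x + tpoly (J - I) \<theta> (\<lambda>_. 1) x" for x
  unfolding tpoly_def using assms by (subst sum.union_disjoint[symmetric]) auto
 have le: "?T (I \<union> J) x \<le> 8 * (?T I x + ?T (J - I) x)" for x
 proof -
  have "norm (tpoly (I \<union> J) \<theta> (\<lambda>_. 1) x) ^ 4 \<le> (norm (tpoly I \<theta> (\<lambda>_. 1) x) + norm (tpoly (J - I) \<theta> (\<lambda>_. 1) x)) ^ 4"
   unfolding split by (intro power_mono norm_triangle_ineq) auto
  also have "... \<le> 8 * (norm (tpoly I \<theta> (\<lambda>_. 1) x) ^ 4 + norm (tpoly (J - I) \<theta> (\<lambda>_. 1) x) ^ 4)"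
   by (intro power4_add_le) auto
  finally have "gauss X x * norm (tpoly (I \<union> J) \<theta> (\<lambda>_. 1) x) ^ 4 \<le> gauss X x * (8 * (norm (tpoly I \<theta> (\<lambda>_. 1) x) ^ 4 + norm (tpoly (J - I) \<theta> (\<lambda>_. 1) x) ^ 4))"
   by (intro mult_left_mono) auto
  then show ?thesis by (simp add: algebra_simps)
 qed
 have "X * energy (I \<union> J) \<theta> X \<le> (LINT x|lborel. ?T (I \<union> J) x)"
  using gauss_moment_ge[of X "I \<union> J" "I \<union> J" "\<lambda>_. 1" \<theta>] assms by auto
 also have "... \<le> (LINT x|lborel. 8 * (?T I x + ?T (J - I) x))"
  using le by (intro integral_mono Bochner_Integration.integrable_add integrable_mult_right gauss_moment assms)
 also have "... = 8 * ((LINT x|lborel. ?T I x) + (LINT x|lborel. ?T (J - I) x))"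
  by (simp add: gauss_moment assms)
 also have "... \<le> 8 * (X * energy I \<theta> X + X * energy (J - I) \<theta> X)"
  by (intro mult_left_mono add_mono gauss_moment_le assms) auto
 also have "... \<le> 8 * (X * energy I \<theta> X + X * energy J \<theta> X)"
  using assms by (intro mult_left_mono add_mono energy_mono_set) auto
 finally have "X * energy (I \<union> J) \<theta> X \<le> X * (8 * (energy I \<theta> X + energy J \<theta> X))"
  by (simp add: algebra_simps)
 then show ?thesis using assms by simp
qed

text \<open>For the bound it is enough to keep the first index in A k and to release the other three
  to I; disjointness then makes the first index run through I at most once.\<close>

lemma sum_energy_disjoint_le:
 assumes "finite I" "finite K" "\<And>k. k \<in> K ==> A k \<subseteq> I" "disjoint_family_on A K"
 shows "(\<Sum>k\<in>K. energy (A k) \<theta> X) \<le> energy I \<theta> X"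
proof -
 let ?f = "\<lambda>i. \<Sum>j\<in>I. \<Sum>k\<in>I. \<Sum>l\<in>I. exp (- pi * X^2 * (\<theta> i + \<theta> j - \<theta> k - \<theta> l)^2)"
 have fin: "finite (A k)" if "k \<in> K" for k using assms that finite_subset by metis
 have "(\<Sum>k\<in>K. energy (A k) \<theta> X) \<le> (\<Sum>k\<in>K. \<Sum>i\<in>A k. ?f i)"
  unfolding energy_def using assms(1,3)
  by (intro sum_mono order.trans[OF sum_mono2 sum_mono] order.refl sum_mono2)
   (auto intro!: sum_nonneg  order.trans[OF sum_mono2 sum_mono] sum_mono2 order.refl simp: subset_iff)
 also have "... = (\<Sum>i\<in>(\<Union>k\<in>K. A k). ?f i)"
  using assms fin by (intro sum.UNION_disjoint[symmetric]) (auto simp: disjoint_family_on_def)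
 also have "... \<le> (\<Sum>i\<in>I. ?f i)"
  using assms by (intro sum_mono2) (auto intro!: sum_nonneg)
 finally show ?thesis by (simp add: energy_def)
qed

lemma tpoly_shift: "tpoly I \<theta> a (x + y) = tpoly I \<theta> (\<lambda>i. a i * ec (y * \<theta> i)) x"
 by (simp add: tpoly_def ring_distribs ec_add mult_ac)

text \<open>Centring the interval at 0 only multiplies the coefficients by unimodular numbers. On
  |x| \<le> X the Gaussian is at least exp (- pi), so it can be inserted at the cost of exp
  pi.\<close>

lemma interval_moment_le:
 assumes "X > 0" "b - a \<le> 2 * X" and c: "\<And>i. i \<in> I ==> norm (c i) \<le> 1"
 shows "integral {a..b} (\<lambda>x. norm (tpoly I \<theta> c x) ^ 4) \<le> exp pi * X * energy I \<theta> X"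
proof -
 define m where "m = (a + b) / 2"
 define c' where "c' = (\<lambda>i. c i * ec (m * \<theta> i))"
 let ?f = "\<lambda>x. norm (tpoly I \<theta> c x) ^ 4"
 let ?g = "\<lambda>x. norm (tpoly I \<theta> c' x) ^ 4"
 have fg: "?f (x + m) = ?g x" for x by (simp add: tpoly_shift c'_def)
 have "integral {a..b} ?f = integral {a - m .. b - m} (\<lambda>x. ?f (x + m))"
  using has_integral_shift_Icc_real[of ?f m "integral {a..b} ?f" "a - m" "b - m"]
  by (intro integral_unique[symmetric])
   (auto simp: o_def add_ac intro!: integrable_integral integrable_continuous_real continuous_intros)
 also have "... = integral {a - m .. b - m} ?g" unfolding fg ..
 also have "... = (LINT x:{a - m .. b - m}|lborel. ?g x)"
 proof (rule set_borel_integral_eq_integral(2)[symmetric])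
  show "set_integrable lborel {a - m..b - m} (\<lambda>x. cmod (tpoly I \<theta> c' x) ^ 4)"
   by (intro borel_integrable_atLeastAtMost' continuous_intros)
 qed
 also have "... \<le> (LINT x|lborel. exp pi * (gauss X x * ?g x))"
  unfolding set_lebesgue_integral_def
 proof (intro integral_mono')
  show "integrable lborel (\<lambda>x. exp pi * (gauss X x * ?g x))"
   by (intro integrable_mult_right gauss_moment assms)
  fix x
  show "indicat_real {a - m..b - m} x *\<^sub>R ?g x \<le> exp pi * (gauss X x * ?g x)"
  proof (cases "x \<in> {a - m..b - m}")
   case True
   then have "\<bar>x\<bar> \<le> X" using assms(2) by (auto simp: m_def abs_le_iff field_simps)
   then have "x^2 \<le> X^2" by (metis abs_ge_zero power2_abs power_mono)
   then have "pi * x^2 / X^2 \<le> pi" using assms(1) by (simp add: field_simps)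
   then have "1 \<le> exp pi * gauss X x" by (simp add: gauss_def flip: exp_add)
   then have "1 * ?g x \<le> (exp pi * gauss X x) * ?g x" by (intro mult_right_mono) auto
   then show ?thesis using True by (simp add: mult_ac)
  qed auto
 qed auto
 also have "... = exp pi * (LINT x|lborel. gauss X x * ?g x)" by simp
 also have "... \<le> exp pi * (X * energy I \<theta> X)"
  using c by (intro mult_left_mono gauss_moment_le assms) (auto simp: c'_def norm_mult)
 finally show ?thesis by (simp add: mult_ac)
qed

section \<open>Poisson summation\<close>

text \<open>The Dirichlet kernel in multiplied-out form, which stays valid where sin (pi x)
  vanishes.\<close>

lemma dirichlet_kernel:
 "sin (pi * x) * (1 + 2 * (\<Sum>k=1..N. cos (2 * pi * real k * x))) = sin ((2 * real N + 1) * pi * x)"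
proof (induction N)
 case (Suc N)
 have "sin ((2 * real (Suc N) + 1) * pi * x) - sin ((2 * real N + 1) * pi * x)
  = 2 * sin (pi * x) * cos (2 * pi * real (Suc N) * x)"
 proof -
  define u v where "u = pi * x" and "v = 2 * pi * real (Suc N) * x"
  have "(2 * real (Suc N) + 1) * pi * x = v + u" "(2 * real N + 1) * pi * x = v - u"
   by (simp_all add: u_def v_def algebra_simps)
  then show ?thesis unfolding u_def[symmetric] v_def[symmetric] by (simp add: sin_add sin_diff)
 qed
 with Suc show ?case by (simp add: algebra_simps)
qed auto

text \<open>The cancellation of the oscillating main term in the derivative of the auxiliary
  function q of the next lemma.\<close>

lemma bernoulli2_partial_bound_aux:
 fixes M s p S C c :: real
 assumes "s > 0" "M > 0"
 shows "2 * p^2 * (S / s) + ((2 * p * (- S * (M * p))) * (M * s) - 2 * p * C * (M * (c * p))) / ((M * s) * (M * s))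
  = - 2 * p^2 * C * c / (M * s^2)"
 using assms by (simp add: field_simps power2_eq_square)

text \<open>The derivative p1 of p N has a Dirichlet kernel as its own derivative, which oscillates
  but is not small. A correction of size 1 / N turns p1 into q, whose derivative is of order 1 / N.
  Integration from 1/2, where q vanishes, bounds q, hence p1, and a second integration bounds the
  variation of p N.\<close>

lemma bernoulli2_partial_bound:
 assumes x: "0 < x" "x \<le> 1/2"
 defines "p \<equiv> \<lambda>N x. pi\<^sup>2 * (x^2 - x + 1/6) - (\<Sum>k=1..N. cos (2 * pi * real k * x) / (real k)^2)"
 shows "\<bar>p N (1/2) - p N x\<bar> \<le> (2 * pi + 2 * pi^2) / ((sin (pi * x))^2 * (2 * real N + 1))"
proof -
 define M where "M = 2 * real N + 1"
 define s where "s = sin (pi * x)"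
 have M: "M \<ge> 1" by (simp add: M_def)
 have s_pos: "s > 0" using x by (auto simp: s_def intro!: sin_gt_zero)
 have s1: "s \<le> 1" by (simp add: s_def)
 have sin_ge: "sin (pi * t) \<ge> s" if "x \<le> t" "t \<le> 1/2" for t
  unfolding s_def using that x by (intro sin_monotone_2pi_le) (auto simp: field_simps intro: order_trans[of _ 0])
 define p1 where "p1 = (\<lambda>x. pi\<^sup>2 * (2 * x - 1) + (\<Sum>k=1..N. 2 * pi * sin (2 * pi * real k * x) / real k))"
 \<comment> \<open>The added term is, to leading order, minus a primitive of 2 pi^2 sin (M pi t) /
   sin (pi t); what is left in q1 carries a factor 1 / M.\<close>
 define q where "q = (\<lambda>x. p1 x + 2 * pi * cos (M * pi * x) / (M * sin (pi * x)))"
 define q1 where "q1 = (\<lambda>x. - 2 * pi^2 * cos (M * pi * x) * cos (pi * x) / (M * (sin (pi * x))^2))"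
 have term1: "((\<lambda>x. cos (2 * pi * real k * x) / (real k)^2) has_real_derivative - (2 * pi * sin (2 * pi * real k * t) / real k)) (at t)"
  if "k \<in> {1..N}" for k t
  using that by (auto intro!: derivative_eq_intros simp: power2_eq_square)
 have term2: "((\<lambda>x. 2 * pi * sin (2 * pi * real k * x) / real k) has_real_derivative (2 * pi)\<^sup>2 * cos (2 * pi * real k * t)) (at t)"
  if "k \<in> {1..N}" for k t
  using that by (auto intro!: derivative_eq_intros simp: power2_eq_square)
 have p_deriv: "(p N has_real_derivative p1 t) (at t)" for t
 proof -
  have "(p N has_real_derivative pi\<^sup>2 * (2 * t - 1) - (\<Sum>k=1..N. - (2 * pi * sin (2 * pi * real k * t) / real k))) (at t)"
   unfolding p_def by (intro DERIV_diff DERIV_sum term1) (auto intro!: derivative_eq_intros)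
  then show ?thesis by (simp add: p1_def sum_negf)
 qed
 have p1_deriv: "(p1 has_real_derivative 2 * pi^2 * (1 + 2 * (\<Sum>k=1..N. cos (2 * pi * real k * t)))) (at t)" for t
 proof -
  have "(p1 has_real_derivative pi\<^sup>2 * 2 + (\<Sum>k=1..N. (2 * pi)\<^sup>2 * cos (2 * pi * real k * t))) (at t)"
   unfolding p1_def by (intro DERIV_add DERIV_sum term2) (auto intro!: derivative_eq_intros)
  then show ?thesis by (simp add: sum_distrib_left[symmetric] power_mult_distrib algebra_simps)
 qed
 have q_deriv: "(q has_real_derivative q1 t) (at t)" if t: "x \<le> t" "t \<le> 1/2" for t
 proof -
  have nz: "sin (pi * t) > 0" using sin_ge[OF t] s_pos by linarith
  have eq: "1 + 2 * (\<Sum>k=1..N. cos (2 * pi * real k * t)) = sin (M * pi * t) / sin (pi * t)"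
   using dirichlet_kernel[of t N] nz by (simp add: M_def field_simps)
  have p1': "(p1 has_real_derivative 2 * pi^2 * (sin (M * pi * t) / sin (pi * t))) (at t)"
   using p1_deriv[of t] unfolding eq .
  have "(q has_real_derivative 2 * pi^2 * (sin (M * pi * t) / sin (pi * t)) +
    ((2 * pi * (- sin (M * pi * t) * (M * pi))) * (M * sin (pi * t)) - 2 * pi * cos (M * pi * t) * (M * (cos (pi * t) * pi)))
     / ((M * sin (pi * t)) * (M * sin (pi * t)))) (at t)"
   unfolding q_def using nz M
   by (intro DERIV_add p1' DERIV_divide) (auto intro!: derivative_eq_intros)
  also have "2 * pi^2 * (sin (M * pi * t) / sin (pi * t)) +
    ((2 * pi * (- sin (M * pi * t) * (M * pi))) * (M * sin (pi * t)) - 2 * pi * cos (M * pi * t) * (M * (cos (pi * t) * pi)))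
     / ((M * sin (pi * t)) * (M * sin (pi * t))) = q1 t"
   unfolding q1_def using nz M by (intro bernoulli2_partial_bound_aux) auto
  finally show ?thesis .
 qed
 have q1_bound: "\<bar>q1 t\<bar> \<le> 2 * pi^2 / (M * s^2)" if t: "x \<le> t" "t \<le> 1/2" for t
 proof -
  have "\<bar>q1 t\<bar> = 2 * pi^2 * \<bar>cos (M * pi * t)\<bar> * \<bar>cos (pi * t)\<bar> / (M * (sin (pi * t))^2)"
   using M by (simp add: q1_def abs_mult)
  also have "... \<le> 2 * pi^2 * 1 * 1 / (M * s^2)"
   using M s_pos sin_ge[OF t] by (intro frac_le mult_mono power_mono) (auto intro!: mult_pos_pos)
  finally show ?thesis by simp
 qed
 \<comment> \<open>M is odd, so cos (M pi / 2) = 0, and every sin (pi k) vanishes as well.\<close>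
 have qhalf: "q (1/2) = 0"
 proof -
  have "sin (2 * pi * real k * (1/2)) = 0" for k
   using sin_npi[of k] by (simp add: mult.commute)
  moreover have "cos (M * pi * (1/2)) = 0"
   unfolding cos_zero_iff_int by (rule exI[of _ "2 * int N + 1"]) (simp add: M_def algebra_simps)
  ultimately show ?thesis by (simp add: q_def p1_def)
 qed
 have q_bound: "\<bar>q t\<bar> \<le> pi^2 / (M * s^2)" if t: "x \<le> t" "t \<le> 1/2" for t
 proof -
  have "\<bar>q t - q (1/2)\<bar> \<le> 2 * pi^2 / (M * s^2) * \<bar>t - 1/2\<bar>"
  proof -
   have "norm (q t - q (1/2)) \<le> 2 * pi^2 / (M * s^2) * norm (t - 1/2)"
    by (rule field_differentiable_bound[of "{x..1/2}" q q1])
     (use t q1_bound in \<open>auto intro: has_field_derivative_at_within[OF q_deriv]\<close>)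
   then show ?thesis by simp
  qed
  also have "... \<le> 2 * pi^2 / (M * s^2) * (1/2)"
   using t x M s_pos by (intro mult_left_mono) (auto intro!: divide_nonneg_pos mult_pos_pos)
  finally show ?thesis using qhalf by simp
 qed
 have p1_bound: "\<bar>p1 t\<bar> \<le> (2 * pi + pi^2) / (M * s^2)" if t: "x \<le> t" "t \<le> 1/2" for t
 proof -
  have nz: "sin (pi * t) > 0" using sin_ge[OF t] s_pos by linarith
  have "\<bar>2 * pi * cos (M * pi * t) / (M * sin (pi * t))\<bar> = 2 * pi * \<bar>cos (M * pi * t)\<bar> / (M * sin (pi * t))"
   using nz M by (simp add: abs_mult)
  also have "... \<le> 2 * pi * 1 / (M * s^2)"
  proof (intro frac_le mult_left_mono)
   have "s^2 \<le> s" using s_pos s1 by (simp add: power2_eq_square mult_left_le)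
   then show "s^2 \<le> sin (pi * t)" using sin_ge[OF t] by linarith
  qed (use M s_pos in \<open>auto intro!: mult_pos_pos\<close>)
  finally have "\<bar>2 * pi * cos (M * pi * t) / (M * sin (pi * t))\<bar> \<le> 2 * pi / (M * s^2)" by simp
  moreover have "p1 t = q t - 2 * pi * cos (M * pi * t) / (M * sin (pi * t))" by (simp add: q_def)
  ultimately show ?thesis using q_bound[OF t] abs_triangle_ineq4[of "q t" "2 * pi * cos (M * pi * t) / (M * sin (pi * t))"]
   unfolding add_divide_distrib by linarith
 qed
 have "\<bar>p N (1/2) - p N x\<bar> \<le> (2 * pi + pi^2) / (M * s^2) * \<bar>1/2 - x\<bar>"
 proof -
  have "norm (p N (1/2) - p N x) \<le> (2 * pi + pi^2) / (M * s^2) * norm (1/2 - x)"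
   by (rule field_differentiable_bound[of "{x..1/2}" "p N" p1])
    (use x p1_bound in \<open>auto intro: has_field_derivative_at_within[OF p_deriv]\<close>)
  then show ?thesis by simp
 qed
 also have "... \<le> (2 * pi + pi^2) / (M * s^2) * 1"
  using x M s_pos by (intro mult_left_mono) (auto intro!: divide_nonneg_pos mult_pos_pos)
 also have "... \<le> (2 * pi + 2 * pi^2) / (s^2 * M)"
  using M s_pos by (auto intro!: frac_le simp: mult.commute)
 finally show ?thesis by (simp add: M_def s_def)
qed

text \<open>The difference d between the Bernoulli polynomial and its cosine series is constant on
  (0, 1/2] by the bound for partial sums. Uniform convergence makes it continuous at 0, and there it
  vanishes by the value of the sum of 1 / n^2.\<close>

lemma bernoulli2_fourier_half:
 assumes "0 \<le> x" "x \<le> 1/2"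
 shows "(\<lambda>n. cos (2 * pi * real (Suc n) * x) / (real (Suc n))^2) sums (pi^2 * (x^2 - x + 1/6))"
proof -
 define f where "f = (\<lambda>x n. cos (2 * pi * real (Suc n) * x) / (real (Suc n))^2)"
 have inv: "(\<lambda>n. 1 / (real (Suc n))^2) sums (pi^2 / 6)"
  using inverse_squares_sums by (simp add: add_ac)
 have summ: "summable (f x)" for x
  by (rule summable_comparison_test'[OF sums_summable[OF inv]]) (auto simp: f_def divide_simps)
 define h where "h = (\<lambda>x. suminf (f x))"
 define d where "d = (\<lambda>x. pi\<^sup>2 * (x^2 - x + 1/6) - h x)"
 have unif: "uniform_limit UNIV (\<lambda>n x. \<Sum>i<n. f x i) h sequentially"
  unfolding h_def
  by (rule Weierstrass_m_test[OF _ sums_summable[OF inv]]) (auto simp: f_def divide_simps)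
 have "continuous_on UNIV h"
  by (rule uniform_limit_theorem[OF _ unif]) (auto simp: f_def intro!: always_eventually continuous_intros)
 then have cont_d: "continuous_on UNIV d"
  unfolding d_def by (intro continuous_intros)
 have d_const: "d y = d (1/2)" if y: "0 < y" "y \<le> 1/2" for y
 proof -
  define p where "p = (\<lambda>N x. pi\<^sup>2 * (x^2 - x + 1/6) - (\<Sum>k=1..N. cos (2 * pi * real k * x) / (real k)^2))"
  have p_lim: "(\<lambda>N. p N z) \<longlonglongrightarrow> d z" for z
  proof -
   have "(\<Sum>k=1..N. cos (2 * pi * real k * z) / (real k)^2) = (\<Sum>n<N. f z n)" for N
    unfolding f_def by (rule sum.reindex_bij_witness[of _ Suc "\<lambda>k. k - 1"]) auto
   then show ?thesis
    unfolding p_def d_def h_def using summable_LIMSEQ[OF summ[of z]] by (auto intro!: tendsto_intros)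
  qed
  have "(\<lambda>N. p N (1/2) - p N y) \<longlonglongrightarrow> 0"
  proof (rule Lim_null_comparison)
   show "\<forall>\<^sub>F N in sequentially. norm (p N (1/2) - p N y) \<le> (2 * pi + 2 * pi^2) / ((sin (pi * y))^2 * (2 * real N + 1))"
    using bernoulli2_partial_bound[OF y] by (auto simp: p_def)
   have "sin (pi * y) > 0" using y by (auto intro!: sin_gt_zero)
   then show "(\<lambda>N. (2 * pi + 2 * pi^2) / ((sin (pi * y))^2 * (2 * real N + 1))) \<longlonglongrightarrow> 0"
    by real_asymp
  qed
  moreover have "(\<lambda>N. p N (1/2) - p N y) \<longlonglongrightarrow> d (1/2) - d y"
   by (intro tendsto_intros p_lim)
  ultimately show ?thesis using LIMSEQ_unique by fastforce
 qed
 have d0: "d 0 = 0"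
  using sums_unique[OF inv] by (simp add: d_def h_def f_def)
 have "d (1/2) = d 0"
 proof -
  \<comment> \<open>The points 1 / (n + 2) lie in (0, 1/2], where d is constant, and tend to
    0.\<close>
  have "(\<lambda>n. inverse (real (Suc (Suc n)))) \<longlonglongrightarrow> 0"
   using LIMSEQ_inverse_real_of_nat LIMSEQ_Suc by blast
  then have "(\<lambda>n. d (inverse (real (Suc (Suc n))))) \<longlonglongrightarrow> d 0"
   by (intro continuous_on_tendsto_compose[OF cont_d]) auto
  moreover have "d (inverse (real (Suc (Suc n)))) = d (1/2)" for n
   by (rule d_const) (auto simp: field_simps)
  ultimately show ?thesis by (simp add: LIMSEQ_const_iff)
 qed
 then have "d x = 0" using d_const[of x] d0 assms by (cases "x = 0") auto
 then have "h x = pi^2 * (x^2 - x + 1/6)" by (simp add: d_def)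
 then show ?thesis using summable_sums[OF summ[of x]] by (simp add: h_def f_def)
qed

lemma bernoulli2_fourier:
 "(\<lambda>n. cos (2 * pi * real (Suc n) * x) / (real (Suc n))^2) sums (pi^2 * ((frac x)^2 - frac x + 1/6))"
proof -
 \<comment> \<open>Reflection to [0, 1/2]: replacing the fractional part f by 1 - f changes neither
   the cosines nor f^2 - f.\<close>
 define y where "y = (if frac x \<le> 1/2 then frac x else 1 - frac x)"
 have y: "0 \<le> y" "y \<le> 1/2" using frac_ge_0[of x] frac_lt_1[of x] by (auto simp: y_def)
 have cos_eq: "cos (2 * pi * real k * x) = cos (2 * pi * real k * y)" for k
 proof -
  have "cos (2 * pi * real k * x) = cos (2 * pi * real k * frac x + 2 * pi * of_int (int k * \<lfloor>x\<rfloor>))"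
   by (simp add: frac_def algebra_simps)
  also have "... = cos (2 * pi * real k * frac x)"
   by (metis cos_int_2pin cos_add sin_int_2pin diff_zero mult.right_neutral mult_zero_right)
  also have "... = cos (2 * pi * real k * y)"
  proof (cases "frac x \<le> 1/2")
   case False
   then have "cos (2 * pi * real k * y) = cos (2 * pi * of_int (int k) - 2 * pi * real k * frac x)"
    by (simp add: y_def algebra_simps)
   also have "... = cos (2 * pi * real k * frac x)"
    by (metis cos_int_2pin cos_diff sin_int_2pin add.right_neutral mult.left_neutral mult_zero_left)
   finally show ?thesis by simp
  qed (simp add: y_def)
  finally show ?thesis .
 qed
 have "(frac x)^2 - frac x = y^2 - y" by (simp add: y_def power2_eq_square algebra_simps)
 then show ?thesis using bernoulli2_fourier_half[OF y] unfolding cos_eq by simp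
qed

section \<open>Euler-Maclaurin and Poisson summation for twice differentiable functions\<close>

lemma euler_maclaurin_unit:
 fixes g g1 g2 :: "real => complex"
 assumes g: "\<And>t. (g has_vector_derivative g1 t) (at t)" "\<And>t. (g1 has_vector_derivative g2 t) (at t)"
 shows "((\<lambda>t. g2 t * of_real (((t - s)^2 - (t - s) + 1/6) / 2) - g t) has_integral
     ((g1 (s + 1) - g1 s) / 12 - (g (s + 1) + g s) / 2)) {s..s+1}"
proof -
 \<comment> \<open>The primitive obtained from two integrations by parts against the Bernoulli
   polynomials of degree 2 and 1 on the unit interval.\<close>
 define G where "G = (\<lambda>t. g1 t * of_real (((t - s)^2 - (t - s) + 1/6) / 2) - g t * of_real (t - s - 1/2))"
 have "(G has_vector_derivative g2 t * of_real (((t - s)^2 - (t - s) + 1/6) / 2) - g t) (at t within {s..s+1})" for t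
 proof -
  have 1: "((\<lambda>t. of_real (((t - s)^2 - (t - s) + 1/6) / 2) :: complex) has_vector_derivative of_real (t - s - 1/2)) (at t)"
   by (rule has_vector_derivative_of_real) (auto intro!: derivative_eq_intros simp: field_simps)
  have 2: "((\<lambda>t. of_real (t - s - 1/2) :: complex) has_vector_derivative of_real 1) (at t)"
   by (rule has_vector_derivative_of_real) (auto intro!: derivative_eq_intros)
  have "(G has_vector_derivative (g1 t * of_real (t - s - 1/2) + g2 t * of_real (((t - s)^2 - (t - s) + 1/6) / 2))
    - (g t * of_real 1 + g1 t * of_real (t - s - 1/2))) (at t)"
   unfolding G_def by (intro has_vector_derivative_diff has_vector_derivative_mult 1 2 g)
  then have "(G has_vector_derivative g2 t * of_real (((t - s)^2 - (t - s) + 1/6) / 2) - g t) (at t)"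
   by (simp add: algebra_simps)
  then show ?thesis by (rule has_vector_derivative_at_within)
 qed
 then have "((\<lambda>t. g2 t * of_real (((t - s)^2 - (t - s) + 1/6) / 2) - g t) has_integral (G (s + 1) - G s)) {s..s+1}"
  by (intro fundamental_theorem_of_calculus) auto
 also have "G (s + 1) - G s = (g1 (s + 1) - g1 s) / 12 - (g (s + 1) + g s) / 2"
  by (simp add: G_def field_simps)
 finally show ?thesis .
qed

text \<open>Euler-Maclaurin expresses the difference of sum and integral through the second
  derivative of g against the periodic Bernoulli function. Its cosine series converges uniformly and
  may be integrated termwise; each term is then carried back to g by parts. The frequencies n and -
  n arrive together because the series is one of cosines.\<close>

lemma poisson_summation:
 fixes g g1 g2 :: "real => complex"
 assumes g: "\<And>t. (g has_vector_derivative g1 t) (at t)" "\<And>t. (g1 has_vector_derivative g2 t) (at t)"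
  and cont: "continuous_on UNIV g2"
  and zero: "g 0 = 0" "g1 0 = 0" "g (real K) = 0" "g1 (real K) = 0"
 shows "(\<lambda>n. integral {0..real K} (\<lambda>t. g t * ec (real (Suc n) * t)) + integral {0..real K} (\<lambda>t. g t * ec (- (real (Suc n) * t))))
     sums ((\<Sum>s<K. g (real s)) - integral {0..real K} g)"
proof -
 define B where "B = (\<lambda>t. ((frac t)^2 - frac t + 1/6) / 2 :: real)"
 define f where "f = (\<lambda>n t. cos (2 * pi * real (Suc n) * t) / (2 * pi^2 * (real (Suc n))^2))"
 have cont_g: "continuous_on A g" and cont_g1: "continuous_on A g1" and cont_g2: "continuous_on A g2" for A
 proof -
  show "continuous_on A g" "continuous_on A g1"
   by (rule continuous_on_vector_derivative, rule has_vector_derivative_at_within, rule g)+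
  show "continuous_on A g2" using cont by (rule continuous_on_subset) auto
 qed
 have f_sums: "(\<lambda>n. f n t) sums B t" for t
  using sums_mult[OF bernoulli2_fourier, of "1 / (2 * pi^2)"] by (simp add: f_def B_def)
 have inv: "summable (\<lambda>n. 1 / (real (Suc n))^2)"
  using inverse_squares_sums by (auto simp: sums_iff add_ac)
 have unif: "uniform_limit UNIV (\<lambda>n t. \<Sum>i<n. f i t) (\<lambda>t. \<Sum>i. f i t) sequentially"
 proof (rule Weierstrass_m_test[OF _ inv])
  fix n t
  have "\<bar>f n t\<bar> \<le> 1 / (2 * pi^2 * (real (Suc n))^2)"
   unfolding f_def by (auto simp: abs_mult intro!: divide_right_mono)
  also have "... \<le> 1 / (real (Suc n))^2"
  proof -
   have "1 \<le> 2 * pi^2" using pi_ge_two power_mono[of 2 pi 2] by simp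
   then show ?thesis by (intro divide_left_mono) (auto intro!: mult_right_mono[of 1, simplified])
  qed
  finally show "norm (f n t) \<le> 1 / (real (Suc n))^2" by simp
 qed
 have B_eq: "(\<lambda>t. \<Sum>i. f i t) = B" using f_sums by (auto simp: sums_iff)
 have cont_B: "continuous_on A B" for A
  unfolding B_eq[symmetric]
  by (rule continuous_on_subset[OF uniform_limit_theorem[OF _ unif]])
   (auto simp: f_def intro!: always_eventually continuous_intros)
 have cont_f: "continuous_on A (f n)" for A n
  unfolding f_def by (intro continuous_intros) (auto simp del: of_nat_Suc)
 have EM: "(\<Sum>s<N. g (real s)) = integral {0..real N} g - integral {0..real N} (\<lambda>t. g2 t * of_real (B t))
   + (g1 (real N) - g1 0) / 12 - (g (real N) - g 0) / 2" for N
 proof (induction N)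
  case (Suc N)
  let ?h = "\<lambda>t. g2 t * of_real (((t - real N)^2 - (t - real N) + 1/6) / 2) - g t"
  have "integral {real N..real N + 1} (\<lambda>t. g2 t * of_real (B t) - g t) = integral {real N..real N + 1} ?h"
  \<comment> \<open>The right end point is removed because \<open>frac t\<close> differs from t -
    real N there.\<close>
  proof (rule integral_spike[of "{real N + 1}"])
   fix t assume t: "t \<in> {real N..real N + 1} - {real N + 1}"
   then have "\<lfloor>t\<rfloor> = int N" by (intro floor_unique) auto
   then have "frac t = t - real N" by (simp add: frac_def)
   then show "?h t = g2 t * of_real (B t) - g t" by (simp add: B_def)
  qed auto
  also have "... = (g1 (real N + 1) - g1 (real N)) / 12 - (g (real N + 1) + g (real N)) / 2"
   by (intro integral_unique euler_maclaurin_unit g)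
  finally have *: "integral {real N..real N + 1} (\<lambda>t. g2 t * of_real (B t)) - integral {real N..real N + 1} g
   = (g1 (real N + 1) - g1 (real N)) / 12 - (g (real N + 1) + g (real N)) / 2"
   by (subst (asm) Henstock_Kurzweil_Integration.integral_diff)
    (auto intro!: integrable_continuous_real continuous_intros cont_B cont_g cont_g2)
  have "integral {0..real (Suc N)} h = integral {0..real N} h + integral {real N..real N + 1} h"
   if "continuous_on UNIV h" for h :: "real => complex"
  proof -
   have "h integrable_on {0..real N + 1}"
    using that by (intro integrable_continuous_real) (rule continuous_on_subset, auto)
   then show ?thesis
    using Henstock_Kurzweil_Integration.integral_combine[of 0 "real N" "real N + 1" h] by (simp add: add_ac)
  qed
  note this[OF cont_g] this[OF continuous_on_mult[OF cont_g2 continuous_on_of_real[OF cont_B]]]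
  then have I: "integral {0..real (Suc N)} g = integral {0..real N} g + integral {real N..real N + 1} g"
    "integral {0..real (Suc N)} (\<lambda>t. g2 t * of_real (B t)) = integral {0..real N} (\<lambda>t. g2 t * of_real (B t)) + integral {real N..real N + 1} (\<lambda>t. g2 t * of_real (B t))"
   by auto
  have "integral {real N..real N + 1} g = integral {real N..real N + 1} (\<lambda>t. g2 t * of_real (B t))
    - ((g1 (real N + 1) - g1 (real N)) / 12 - (g (real N + 1) + g (real N)) / 2)"
   unfolding *[symmetric] by simp
  then show ?case
   using Suc unfolding I by (simp add: add_ac) (simp add: field_simps)
 qed auto
 have coef: "integral {0..real K} (\<lambda>t. g2 t * of_real (f n t)) =
   - (integral {0..real K} (\<lambda>t. g t * ec (real (Suc n) * t)) + integral {0..real K} (\<lambda>t. g t * ec (- (real (Suc n) * t))))" for n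
 proof -
  define m where "m = 2 * pi * real (Suc n)"
  have m: "m > 0" by (simp add: m_def)
  \<comment> \<open>Two integrations by parts in one go: this primitive vanishes at both ends
    together with g and g1.\<close>
  define G where "G = (\<lambda>t. g1 t * of_real (cos (m * t)) + g t * of_real (m * sin (m * t)))"
  have "(G has_vector_derivative g2 t * of_real (cos (m * t)) + g t * of_real (m * (m * cos (m * t)))) (at t within {0..real K})" for t
  proof -
   have 1: "((\<lambda>t. of_real (cos (m * t)) :: complex) has_vector_derivative of_real (- (m * sin (m * t)))) (at t)"
    by (rule has_vector_derivative_of_real) (auto intro!: derivative_eq_intros)
   have 2: "((\<lambda>t. of_real (m * sin (m * t)) :: complex) has_vector_derivative of_real (m * (m * cos (m * t)))) (at t)"
    by (rule has_vector_derivative_of_real) (auto intro!: derivative_eq_intros)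
   have "(G has_vector_derivative (g1 t * of_real (- (m * sin (m * t))) + g2 t * of_real (cos (m * t))) +
    (g t * of_real (m * (m * cos (m * t))) + g1 t * of_real (m * sin (m * t)))) (at t)"
    unfolding G_def by (intro has_vector_derivative_add has_vector_derivative_mult 1 2 g)
   then show ?thesis by (auto intro!: has_vector_derivative_at_within)
  qed
  then have "((\<lambda>t. g2 t * of_real (cos (m * t)) + g t * of_real (m * (m * cos (m * t)))) has_integral (G (real K) - G 0)) {0..real K}"
   by (intro fundamental_theorem_of_calculus) auto
  moreover have "G (real K) - G 0 = 0" using zero by (simp add: G_def)
  ultimately have "integral {0..real K} (\<lambda>t. g2 t * of_real (cos (m * t)) + g t * of_real (m * (m * cos (m * t)))) = 0"
   by (simp add: integral_unique)
  then have 1: "integral {0..real K} (\<lambda>t. g2 t * of_real (cos (m * t))) = - integral {0..real K} (\<lambda>t. g t * of_real (m * (m * cos (m * t))))"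
   by (subst (asm) Henstock_Kurzweil_Integration.integral_add)
    (auto intro!: integrable_continuous_real continuous_intros cont_g cont_g2 simp: add_eq_0_iff2)
  have "(\<lambda>t. g2 t * of_real (f n t)) = (\<lambda>t. (2 / of_real (m^2)) * (g2 t * of_real (cos (m * t))))"
  proof
   fix t
   have "f n t = (2 / m^2) * cos (m * t)"
    unfolding f_def m_def power_mult_distrib by simp
   then show "g2 t * of_real (f n t) = (2 / of_real (m^2)) * (g2 t * of_real (cos (m * t)))" by simp
  qed
  then have "integral {0..real K} (\<lambda>t. g2 t * of_real (f n t)) = (2 / of_real (m^2)) * integral {0..real K} (\<lambda>t. g2 t * of_real (cos (m * t)))"
   by simp
  also have "... = - integral {0..real K} (\<lambda>t. (2 / of_real (m^2)) * (g t * of_real (m * (m * cos (m * t)))))"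
   unfolding 1 by simp
  also have "(\<lambda>t. (2 / of_real (m^2)) * (g t * of_real (m * (m * cos (m * t))))) =
    (\<lambda>t. g t * ec (real (Suc n) * t) + g t * ec (- (real (Suc n) * t)))"
  proof
   fix t
   have "ec (real (Suc n) * t) + ec (- (real (Suc n) * t)) = of_real (2 * cos (m * t))"
    by (simp add: ec_def m_def complex_eq_iff mult_ac)
   then have "g t * ec (real (Suc n) * t) + g t * ec (- (real (Suc n) * t)) = g t * of_real (2 * cos (m * t))"
    by (simp flip: distrib_left)
   then show "(2 / of_real (m^2)) * (g t * of_real (m * (m * cos (m * t)))) = g t * ec (real (Suc n) * t) + g t * ec (- (real (Suc n) * t))"
    using m by (simp add: power2_eq_square)
  qed
  also have "integral {0..real K} (\<lambda>t. g t * ec (real (Suc n) * t) + g t * ec (- (real (Suc n) * t))) =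
   integral {0..real K} (\<lambda>t. g t * ec (real (Suc n) * t)) + integral {0..real K} (\<lambda>t. g t * ec (- (real (Suc n) * t)))"
   by (intro Henstock_Kurzweil_Integration.integral_add integrable_continuous_real continuous_intros cont_g)
  finally show ?thesis .
 qed
 have "uniform_limit {0..real K} (\<lambda>N t. g2 t * of_real (\<Sum>i<N. f i t)) (\<lambda>t. g2 t * of_real (B t)) sequentially"
 proof -
  have "bounded (g2 ` {0..real K})"
   by (intro compact_imp_bounded compact_continuous_image cont_g2) auto
  moreover have "bounded ((\<lambda>t. complex_of_real (B t)) ` {0..real K})"
   by (intro compact_imp_bounded compact_continuous_image continuous_intros cont_B) auto
  moreover have "uniform_limit {0..real K} (\<lambda>N t. complex_of_real (\<Sum>i<N. f i t)) (\<lambda>t. of_real (B t)) sequentially"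
   using uniform_limit_on_subset[OF unif[unfolded B_eq], of "{0..real K}"]
   by (intro bounded_linear.uniform_limit[OF bounded_linear_of_real]) auto
  ultimately show ?thesis
   by (intro uniform_lim_mult uniform_limit_const)
 qed
 then obtain I J where IJ: "\<And>N. ((\<lambda>t. g2 t * of_real (\<Sum>i<N. f i t)) has_integral I N) {0..real K}"
   "((\<lambda>t. g2 t * of_real (B t)) has_integral J) {0..real K}" "I \<longlonglongrightarrow> J"
  by (rule uniform_limit_integral) (auto intro!: continuous_intros cont_g2 cont_f)
 have I_eq: "I N = (\<Sum>n<N. integral {0..real K} (\<lambda>t. g2 t * of_real (f n t)))" for N
 proof -
  have "I N = integral {0..real K} (\<lambda>t. \<Sum>n<N. g2 t * of_real (f n t))"
   using IJ(1)[of N] by (simp add: integral_unique sum_distrib_left)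
  also have "... = (\<Sum>n<N. integral {0..real K} (\<lambda>t. g2 t * of_real (f n t)))"
   by (intro Henstock_Kurzweil_Integration.integral_sum integrable_continuous_real)
    (auto intro!: continuous_intros cont_g2 cont_f)
  finally show ?thesis .
 qed
 have "(\<lambda>n. integral {0..real K} (\<lambda>t. g2 t * of_real (f n t))) sums integral {0..real K} (\<lambda>t. g2 t * of_real (B t))"
  using IJ(3) unfolding sums_def integral_unique[OF IJ(2)] I_eq[symmetric] .
 then have "(\<lambda>n. - integral {0..real K} (\<lambda>t. g2 t * of_real (f n t))) sums (- integral {0..real K} (\<lambda>t. g2 t * of_real (B t)))"
  by (rule sums_minus)
 moreover have "- integral {0..real K} (\<lambda>t. g2 t * of_real (B t)) = (\<Sum>s<K. g (real s)) - integral {0..real K} g"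
  using EM[of K] zero by simp
 ultimately show ?thesis unfolding coef by (simp add: add.commute)
qed

text \<open>Two integrations by parts, each dividing by p1. The higher derivatives are measured
  relative to the lower bound B of |p1|, so every term of the remainder T is a multiple of A^2 C /
  B^2; the multiplicities 1 + 3 + 1 + 3 give the constant 8.\<close>

lemma nonstationary_integral_bound:
 fixes W W1 W2 p p1 p2 p3 :: "real => real"
 assumes ab: "a \<le> b"
  and W: "\<And>t. t \<in> {a..b} ==> (W has_real_derivative W1 t) (at t within {a..b})"
     "\<And>t. t \<in> {a..b} ==> (W1 has_real_derivative W2 t) (at t within {a..b})" "continuous_on {a..b} W2"
  and p: "\<And>t. t \<in> {a..b} ==> (p has_real_derivative p1 t) (at t within {a..b})"
     "\<And>t. t \<in> {a..b} ==> (p1 has_real_derivative p2 t) (at t within {a..b})"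
     "\<And>t. t \<in> {a..b} ==> (p2 has_real_derivative p3 t) (at t within {a..b})" "continuous_on {a..b} p3"
  and zero: "W a = 0" "W1 a = 0" "W b = 0" "W1 b = 0"
  and B: "B > 0" "A \<ge> 1" "C \<ge> 0"
  and bounds: "\<And>t. t \<in> {a..b} ==> \<bar>p1 t\<bar> \<ge> B" "\<And>t. t \<in> {a..b} ==> \<bar>p2 t\<bar> \<le> A * B" "\<And>t. t \<in> {a..b} ==> \<bar>p3 t\<bar> \<le> A * B"
     "\<And>t. t \<in> {a..b} ==> \<bar>W t\<bar> \<le> C" "\<And>t. t \<in> {a..b} ==> \<bar>W1 t\<bar> \<le> C" "\<And>t. t \<in> {a..b} ==> \<bar>W2 t\<bar> \<le> C"
 shows "norm (integral {a..b} (\<lambda>t. of_real (W t) * ec (p t))) \<le> 8 * A^2 * C / B^2 * (b - a)"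
proof -
 define c where "c = 2 * pi * \<i>"
 \<comment> \<open>N = W / p1 and V is its derivative; M = V / p1 and T is its derivative. The
   function U below combines N and M to the primitive of the twofold integration by parts.\<close>
 define N where "N = (\<lambda>t. W t / p1 t)"
 define V where "V = (\<lambda>t. W1 t / p1 t - W t * p2 t / (p1 t)^2)"
 define M where "M = (\<lambda>t. W1 t / (p1 t)^2 - W t * p2 t / (p1 t) ^ 3)"
 define T where "T = (\<lambda>t. W2 t / (p1 t)^2 - 3 * W1 t * p2 t / (p1 t) ^ 3 - W t * p3 t / (p1 t) ^ 3 + 3 * W t * (p2 t)^2 / (p1 t) ^ 4)"
 have c0: "c \<noteq> 0" "norm c \<ge> 1" using pi_ge_two by (auto simp: c_def norm_mult)
 have p1_nz: "p1 t \<noteq> 0" if "t \<in> {a..b}" for t using bounds(1)[OF that] B(1) by auto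
 have N_deriv: "(N has_real_derivative V t) (at t within {a..b})" if t: "t \<in> {a..b}" for t
  unfolding N_def V_def using p1_nz[OF t]
  by (auto intro!: derivative_eq_intros W(1,2)[OF t] p(1,2,3)[OF t] simp: field_simps power2_eq_square)
 have M_deriv: "(M has_real_derivative T t) (at t within {a..b})" if t: "t \<in> {a..b}" for t
  unfolding M_def T_def using p1_nz[OF t]
  apply (auto intro!: derivative_eq_intros W(1,2)[OF t] p(1,2,3)[OF t])
  apply (simp add: field_simps eval_nat_numeral)
  done
 have M_p1: "M t * p1 t = V t" if "t \<in> {a..b}" for t
  using p1_nz[OF that] by (simp add: M_def V_def field_simps eval_nat_numeral)
 define U where "U = (\<lambda>t. of_real (N t) * ec (p t) / c - of_real (M t) * ec (p t) / c^2)"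
 have "(U has_vector_derivative of_real (W t) * ec (p t) - of_real (T t) * ec (p t) / c^2) (at t within {a..b})"
  if t: "t \<in> {a..b}" for t
 proof -
  have e: "((\<lambda>t. ec (p t)) has_vector_derivative c * of_real (p1 t) * ec (p t)) (at t within {a..b})"
   using ec_has_vector_derivative[OF p(1)[OF t]] by (simp add: c_def)
  have "(U has_vector_derivative
   (of_real (N t) * (c * of_real (p1 t) * ec (p t)) + of_real (V t) * ec (p t)) / c
   - (of_real (M t) * (c * of_real (p1 t) * ec (p t)) + of_real (T t) * ec (p t)) / c^2) (at t within {a..b})"
   unfolding U_def
   by (intro has_vector_derivative_diff has_vector_derivative_divide has_vector_derivative_mult e
     has_vector_derivative_of_real N_deriv M_deriv t)
  also have "(of_real (N t) * (c * of_real (p1 t) * ec (p t)) + of_real (V t) * ec (p t)) / c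
   - (of_real (M t) * (c * of_real (p1 t) * ec (p t)) + of_real (T t) * ec (p t)) / c^2
   = of_real (N t * p1 t) * ec (p t) + of_real (V t - M t * p1 t) * ec (p t) / c - of_real (T t) * ec (p t) / c^2"
   using c0 by (simp add: field_simps power2_eq_square)
  also have "... = of_real (W t) * ec (p t) - of_real (T t) * ec (p t) / c^2"
   using M_p1[OF t] p1_nz[OF t] by (simp add: N_def)
  finally show ?thesis .
 qed
 then have "((\<lambda>t. of_real (W t) * ec (p t) - of_real (T t) * ec (p t) / c^2) has_integral (U b - U a)) {a..b}"
  by (intro fundamental_theorem_of_calculus ab)
 moreover have "U b - U a = 0" using zero by (simp add: U_def N_def M_def)
 ultimately have 0: "integral {a..b} (\<lambda>t. of_real (W t) * ec (p t) - of_real (T t) * ec (p t) / c^2) = 0"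
  by (simp add: integral_unique)
 have cont: "continuous_on {a..b} W" "continuous_on {a..b} W1" "continuous_on {a..b} p"
  "continuous_on {a..b} p1" "continuous_on {a..b} p2"
  by (rule DERIV_continuous_on, erule W p)+
 have cont_T: "continuous_on {a..b} T"
  unfolding T_def using p1_nz by (intro continuous_intros cont W p) auto
 have intg: "(\<lambda>t. of_real (T t) * ec (p t) / c^2) integrable_on {a..b}"
  using c0 by (intro integrable_continuous_real continuous_intros cont cont_T) auto
 have "integral {a..b} (\<lambda>t. of_real (W t) * ec (p t)) = integral {a..b} (\<lambda>t. of_real (T t) * ec (p t) / c^2)"
  using 0 by (subst (asm) Henstock_Kurzweil_Integration.integral_diff)
   (auto intro!: integrable_continuous_real continuous_intros cont intg)
 also have "norm ... \<le> 8 * A^2 * C / B^2 * (b - a)"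
 proof -
  have "norm (of_real (T t) * ec (p t) / c^2) \<le> 8 * A^2 * C / B^2" if t: "t \<in> {a..b}" for t
  proof -
   define P where "P = \<bar>p1 t\<bar>"
   have P: "P \<ge> B" "P > 0" using bounds(1)[OF t] B(1) by (auto simp: P_def)
   note bd = bounds[OF t]
   have AP: "A * B \<le> A * P" using P B by (intro mult_left_mono) auto
   have bd2: "\<bar>p2 t\<bar> \<le> A * P" "\<bar>p3 t\<bar> \<le> A * P" using bd(2,3) AP by linarith+
   have A1: "A \<le> A^2" "1 \<le> A^2" using B by (auto simp: power2_eq_square mult_le_cancel_left1 mult_ge1_I)
   have 1: "\<bar>W2 t / (p1 t)^2\<bar> \<le> A^2 * C / P^2"
   proof -
    have "\<bar>W2 t\<bar> \<le> A^2 * C" using bd(6) A1 B(3) mult_right_mono[of 1 "A^2" C] by linarith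
    then show ?thesis by (auto simp: P_def abs_mult intro!: divide_right_mono)
   qed
   have 2: "\<bar>3 * W1 t * p2 t / (p1 t) ^ 3\<bar> \<le> 3 * (A^2 * C / P^2)"
   proof -
    have "\<bar>W1 t\<bar> * \<bar>p2 t\<bar> \<le> C * (A * P)" using bd bd2 B P by (intro mult_mono) auto
    also have "... \<le> C * (A^2 * P)" using A1 B P by (intro mult_left_mono mult_right_mono) auto
    finally have "3 * (\<bar>W1 t\<bar> * \<bar>p2 t\<bar>) / P ^ 3 \<le> 3 * (C * (A^2 * P)) / P ^ 3"
     using P by (intro divide_right_mono) auto
    then show ?thesis using P by (simp add: abs_mult P_def[symmetric] power_abs[symmetric] field_simps eval_nat_numeral)
   qed
   have 3: "\<bar>W t * p3 t / (p1 t) ^ 3\<bar> \<le> A^2 * C / P^2"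
   proof -
    have "\<bar>W t\<bar> * \<bar>p3 t\<bar> \<le> C * (A * P)" using bd bd2 B P by (intro mult_mono) auto
    also have "... \<le> C * (A^2 * P)" using A1 B P by (intro mult_left_mono mult_right_mono) auto
    finally have "(\<bar>W t\<bar> * \<bar>p3 t\<bar>) / P ^ 3 \<le> (C * (A^2 * P)) / P ^ 3"
     using P by (intro divide_right_mono) auto
    then show ?thesis using P by (simp add: abs_mult P_def[symmetric] power_abs[symmetric] field_simps eval_nat_numeral)
   qed
   have 4: "\<bar>3 * W t * (p2 t)^2 / (p1 t) ^ 4\<bar> \<le> 3 * (A^2 * C / P^2)"
   proof -
    have "\<bar>p2 t\<bar>\<^sup>2 \<le> (A * P)^2" using bd2 by (intro power_mono) auto
    then have "\<bar>W t\<bar> * \<bar>p2 t\<bar>\<^sup>2 \<le> C * (A * P)^2" using bd B P by (intro mult_mono) auto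
    then have "3 * (\<bar>W t\<bar> * \<bar>p2 t\<bar>\<^sup>2) / P ^ 4 \<le> 3 * (C * (A * P)^2) / P ^ 4"
     using P by (intro divide_right_mono) auto
    then show ?thesis using P by (simp add: abs_mult P_def[symmetric] power_abs[symmetric] field_simps eval_nat_numeral)
   qed
   have "\<bar>T t\<bar> \<le> 8 * (A^2 * C / P^2)"
   proof -
    have tri: "\<bar>x1 - x2 - x3 + x4\<bar> \<le> \<bar>x1\<bar> + \<bar>x2\<bar> + \<bar>x3\<bar> + \<bar>x4\<bar>" for x1 x2 x3 x4 :: real by linarith
    show ?thesis unfolding T_def
     by (rule order.trans[OF tri], rule order.trans[OF add_mono[OF add_mono[OF add_mono[OF 1 2] 3] 4]]) (simp add: mult_ac)
   qed
   also have "... \<le> 8 * (A^2 * C / B^2)"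
    using P B by (intro mult_left_mono divide_left_mono power_mono) auto
   finally have T: "\<bar>T t\<bar> \<le> 8 * (A^2 * C / B^2)" .
   have "norm (of_real (T t) * ec (p t) / c^2) = \<bar>T t\<bar> / (norm c)^2"
    by (simp add: norm_mult norm_divide norm_power)
   also have "... \<le> \<bar>T t\<bar> / 1" using c0 by (intro divide_left_mono) (auto intro: power_mono[of 1 _ 2, simplified])
   finally show ?thesis using T by simp
  qed
  then show ?thesis
   using c0 by (intro integral_bound[OF ab] continuous_intros cont cont_T) auto
 qed
 finally show ?thesis .
qed

section \<open>Hoelder and Minkowski inequalities for fourth powers\<close>

lemma integral_power4_weighted:
 fixes b \<rho> :: "real => real"
 assumes cd: "c \<le> d" and cont: "continuous_on {c..d} b" "continuous_on {c..d} \<rho>"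
  and nn: "\<And>t. t \<in> {c..d} ==> b t \<ge> 0" "\<And>t. t \<in> {c..d} ==> \<rho> t > 0"
 shows "integral {c..d} b ^ 4 \<le> integral {c..d} \<rho> ^ 3 * integral {c..d} (\<lambda>t. b t ^ 4 / \<rho> t ^ 3)"
proof -
 define I where "I = integral {c..d} b"
 define R where "R = integral {c..d} \<rho>"
 define J where "J = integral {c..d} (\<lambda>t. b t ^ 4 / \<rho> t ^ 3)"
 have nz: "\<forall>t\<in>{c..d}. \<rho> t ^ 3 \<noteq> 0" using nn(2) by fastforce
 have cont3: "continuous_on {c..d} (\<lambda>t. b t ^ 4 / \<rho> t ^ 3)"
  by (intro continuous_intros cont nz)
 have I0: "I \<ge> 0" unfolding I_def using nn by (intro integral_nonneg integrable_continuous_real cont) auto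
 have R0: "R \<ge> 0" unfolding R_def using nn by (intro integral_nonneg integrable_continuous_real cont) (auto intro: less_imp_le)
 have J0: "J \<ge> 0" unfolding J_def using nn by (intro integral_nonneg integrable_continuous_real cont3) (auto intro!: divide_nonneg_pos)
 \<comment> \<open>Hoelder with exponents 4 and 4/3 is derived from the arithmetic-geometric mean
   inequality at x = b and y = u \<rho>; the free parameter u is set to I / R afterwards.\<close>
 have amgm: "4 * y ^ 3 * x \<le> x ^ 4 + 3 * y ^ 4" if "x \<ge> 0" "y \<ge> 0" for x y :: real
 proof -
  have "x ^ 4 + 3 * y ^ 4 - 4 * y ^ 3 * x = (x - y)^2 * (x^2 + 2 * x * y + 3 * y^2)"
   by (simp add: power2_eq_square eval_nat_numeral algebra_simps)
  also have "... \<ge> 0" using that by (intro mult_nonneg_nonneg add_nonneg_nonneg) auto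
  finally show ?thesis by simp
 qed
 have key: "4 * u ^ 3 * I \<le> J + 3 * u ^ 4 * R" if "u \<ge> 0" for u
 proof -
  have "4 * u ^ 3 * I = integral {c..d} (\<lambda>t. 4 * u ^ 3 * b t)"
   by (simp add: I_def)
  also have "... \<le> integral {c..d} (\<lambda>t. b t ^ 4 / \<rho> t ^ 3 + 3 * u ^ 4 * \<rho> t)"
  proof (intro integral_le integrable_continuous_real continuous_intros cont nz)
   fix t assume t: "t \<in> {c..d}"
   have "4 * (u * \<rho> t) ^ 3 * b t \<le> b t ^ 4 + 3 * (u * \<rho> t) ^ 4"
    using nn[OF t] that by (intro amgm) auto
   then have "4 * (u * \<rho> t) ^ 3 * b t / \<rho> t ^ 3 \<le> (b t ^ 4 + 3 * (u * \<rho> t) ^ 4) / \<rho> t ^ 3"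
    using nn[OF t] by (intro divide_right_mono) auto
   then show "4 * u ^ 3 * b t \<le> b t ^ 4 / \<rho> t ^ 3 + 3 * u ^ 4 * \<rho> t"
    using nn(2)[OF t] by (simp add: field_simps eval_nat_numeral)
  qed
  also have "... = J + 3 * u ^ 4 * R"
   unfolding J_def R_def
   by (subst Henstock_Kurzweil_Integration.integral_add) (auto intro!: integrable_continuous_real continuous_intros cont cont3)
  finally show ?thesis .
 qed
 have "I ^ 4 \<le> R ^ 3 * J"
 proof (cases "R = 0")
  case True
  show ?thesis
  proof (cases "I = 0")
   case False
   then have I1: "I > 0" using I0 by simp
   \<comment> \<open>For R = 0 the inequality \<open>key\<close> reads 4 u^3 I \<le> J for all u
     \<ge> 0, which this u violates if I is positive.\<close>
   define u where "u = root 3 ((J + 1) / (4 * I))"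
   have "u ^ 3 = (J + 1) / (4 * I)" unfolding u_def by (rule real_root_pow_pos2) (use J0 I1 in auto)
   moreover have "u \<ge> 0" unfolding u_def using J0 I1 by auto
   ultimately have False using key[of u] True I1 by (auto simp: field_simps)
   then show ?thesis ..
  qed (use True in auto)
 next
  case False
  then have R1: "R > 0" using R0 by simp
  have "4 * (I / R) ^ 3 * I \<le> J + 3 * (I / R) ^ 4 * R" using key[of "I / R"] I0 R1 by auto
  then have "(4 * (I / R) ^ 3 * I - 3 * (I / R) ^ 4 * R) * R ^ 3 \<le> J * R ^ 3"
   using R1 by (intro mult_right_mono) auto
  moreover have "(4 * (I / R) ^ 3 * I - 3 * (I / R) ^ 4 * R) * R ^ 3 = I ^ 4"
   using R1 by (simp add: field_simps eval_nat_numeral)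
  ultimately show ?thesis by (simp add: mult.commute)
 qed
 then show ?thesis unfolding I_def R_def J_def .
qed

text \<open>Minkowski's integral inequality in L4, with \<rho> as a known envelope of the norms:
  Hoelder with weight \<rho> moves the fourth power inside, then the integrals are
  exchanged.\<close>

lemma minkowski_power4:
 fixes f :: "real => real => real" and \<rho> :: "real => real"
 assumes ab: "a \<le> b" "c \<le> d" and cont: "continuous_on ({a..b} \<times> {c..d}) (\<lambda>(x, t). f x t)" "continuous_on {c..d} \<rho>"
  and nn: "\<And>x t. x \<in> {a..b} ==> t \<in> {c..d} ==> f x t \<ge> 0" "\<And>t. t \<in> {c..d} ==> \<rho> t > 0"
  and bound: "\<And>t. t \<in> {c..d} ==> integral {a..b} (\<lambda>x. f x t ^ 4) \<le> \<rho> t ^ 4 * M"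
 shows "integral {a..b} (\<lambda>x. integral {c..d} (f x) ^ 4) \<le> integral {c..d} \<rho> ^ 4 * M"
proof -
 define R where "R = integral {c..d} \<rho>"
 have R0: "R \<ge> 0" unfolding R_def using nn by (intro integral_nonneg integrable_continuous_real cont) (auto intro: less_imp_le)
 define g where "g = (\<lambda>x t. f x t ^ 4 / \<rho> t ^ 3)"
 have contf: "continuous_on {c..d} (f x)" if "x \<in> {a..b}" for x
  by (rule continuous_on_compose2[OF cont(1), of _ "\<lambda>t. (x, t)", simplified]) (use that in \<open>auto intro!: continuous_intros\<close>)
 have contf2: "continuous_on {a..b} (\<lambda>x. f x t)" if "t \<in> {c..d}" for t
  by (rule continuous_on_compose2[OF cont(1), of _ "\<lambda>x. (x, t)", simplified]) (use that in \<open>auto intro!: continuous_intros\<close>)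
 have contg: "continuous_on ({a..b} \<times> {c..d}) (\<lambda>(x, t). g x t)"
 proof -
  have "continuous_on ({a..b} \<times> {c..d}) (\<lambda>z. \<rho> (snd z))"
   by (rule continuous_on_compose2[OF cont(2)]) (auto intro!: continuous_intros)
  moreover have "\<rho> (snd z) ^ 3 \<noteq> 0" if "z \<in> {a..b} \<times> {c..d}" for z
   using nn(2)[of "snd z"] that by auto
  ultimately show ?thesis
   using cont(1) unfolding g_def case_prod_unfold
   by (intro continuous_intros) auto
 qed
 have int_cont: "continuous_on {a..b} (\<lambda>x. integral {c..d} (h x))"
  if "continuous_on ({a..b} \<times> {c..d}) (\<lambda>(x, t). h x t)" for h :: "real => real => real"
  using integral_continuous_on_param[of "{a..b}" c d h] that by simp
 have int_cont': "continuous_on {c..d} (\<lambda>t. integral {a..b} (\<lambda>x. g x t))"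
 proof -
  have "continuous_on ({c..d} \<times> {a..b}) (\<lambda>(t, x). g x t)"
   using continuous_on_compose2[OF contg, of "{c..d} \<times> {a..b}" prod.swap]
   by (force simp: case_prod_unfold intro: continuous_on_swap)
  then show ?thesis using integral_continuous_on_param[of "{c..d}" a b "\<lambda>t x. g x t"] by simp
 qed
 have "integral {a..b} (\<lambda>x. integral {c..d} (f x) ^ 4) \<le> integral {a..b} (\<lambda>x. R ^ 3 * integral {c..d} (g x))"
  unfolding g_def R_def
  by (intro integral_le integrable_continuous_real continuous_intros int_cont cont(1) contg[unfolded g_def]
    integral_power4_weighted ab contf cont(2) nn)
 also have "... = R ^ 3 * integral {a..b} (\<lambda>x. integral {c..d} (g x))" by simp
 also have "integral {a..b} (\<lambda>x. integral {c..d} (g x)) = integral {c..d} (\<lambda>t. integral {a..b} (\<lambda>x. g x t))"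
  using integral_swap_continuous[of a c b d g] contg by (simp only: cbox_Pair_eq interval_cbox)
 also have "... \<le> integral {c..d} (\<lambda>t. \<rho> t * M)"
 proof (intro integral_le integrable_continuous_real continuous_intros int_cont' cont(2))
  fix t assume t: "t \<in> {c..d}"
  have "integral {a..b} (\<lambda>x. g x t) = integral {a..b} (\<lambda>x. f x t ^ 4) / \<rho> t ^ 3"
   by (simp add: g_def)
  also have "... \<le> (\<rho> t ^ 4 * M) / \<rho> t ^ 3"
   using bound[OF t] nn(2)[OF t] by (intro divide_right_mono) auto
  also have "... = \<rho> t * M" using nn(2)[OF t] by (simp add: field_simps eval_nat_numeral)
  finally show "integral {a..b} (\<lambda>x. g x t) \<le> \<rho> t * M" .
 qed
 also have "... = R * M" by (simp add: R_def)
 finally have "integral {a..b} (\<lambda>x. integral {c..d} (f x) ^ 4) \<le> R ^ 3 * (R * M)"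
  using R0 by (simp add: mult_left_mono)
 then show ?thesis by (simp add: R_def eval_nat_numeral mult_ac)
qed

text \<open>Each slowly varying coefficient is its value at a plus the integral of its derivative.
  The derivative part is a superposition of sums with coefficients independent of x, to which
  Minkowski's inequality applies; its total mass is at most A, since A / Y is integrated over a
  length of at most Y. The factor 16 is 8 (1 + 1).\<close>

lemma moment_smooth_coefficients:
 fixes \<alpha> \<alpha>' b :: "'a => real => complex"
 assumes ab: "a \<le> a'" "a' - a \<le> Y" "Y > 0" and I: "finite I" and A: "A > 0"
  and deriv: "\<And>l x. l \<in> I ==> x \<in> {a..a'} ==> (\<alpha> l has_vector_derivative \<alpha>' l x) (at x within {a..a'})"
  and cont: "\<And>l. l \<in> I ==> continuous_on {a..a'} (\<alpha>' l)" "\<And>l. l \<in> I ==> continuous_on {a..a'} (b l)"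
  and bound: "\<And>l x. l \<in> I ==> x \<in> {a..a'} ==> norm (\<alpha> l x) \<le> A" "\<And>l x. l \<in> I ==> x \<in> {a..a'} ==> norm (\<alpha>' l x) \<le> A / Y"
  and M: "\<And>c. (\<And>l. l \<in> I ==> norm (c l) \<le> 1) ==> integral {a..a'} (\<lambda>x. norm (\<Sum>l\<in>I. c l * b l x) ^ 4) \<le> M"
 shows "integral {a..a'} (\<lambda>x. norm (\<Sum>l\<in>I. \<alpha> l x * b l x) ^ 4) \<le> 16 * A ^ 4 * M"
proof -
 have M0: "M \<ge> 0" using M[of "\<lambda>_. 0"] by simp
 have M': "integral {a..a'} (\<lambda>x. norm (\<Sum>l\<in>I. c l * b l x) ^ 4) \<le> r ^ 4 * M"
  if "\<And>l. l \<in> I ==> norm (c l) \<le> r" "r > 0" for c r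
 proof -
  have "(\<Sum>l\<in>I. c l * b l x) = of_real r * (\<Sum>l\<in>I. (c l / of_real r) * b l x)" for x
   using that(2) by (simp add: sum_distrib_left)
  then have "integral {a..a'} (\<lambda>x. norm (\<Sum>l\<in>I. c l * b l x) ^ 4) = r ^ 4 * integral {a..a'} (\<lambda>x. norm (\<Sum>l\<in>I. (c l / of_real r) * b l x) ^ 4)"
   using that(2) by (simp add: norm_mult power_mult_distrib)
  also have "... \<le> r ^ 4 * M"
   using that by (intro mult_left_mono M) (auto simp: norm_divide)
  finally show ?thesis .
 qed
 define f where "f = (\<lambda>x u. norm (\<Sum>l\<in>I. \<alpha>' l u * b l x))"
 have cont_f: "continuous_on ({a..a'} \<times> {a..a'}) (\<lambda>(x, u). f x u)"
  unfolding f_def case_prod_unfold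
  by (intro continuous_intros continuous_on_compose2[OF cont(1)] continuous_on_compose2[OF cont(2)]) auto
 have cont_f1: "continuous_on {a..a'} (f x)" if "x \<in> {a..a'}" for x
  unfolding f_def by (intro continuous_intros cont)
 have int_cont: "continuous_on {a..a'} (\<lambda>x. integral {a..a'} (f x))"
  using integral_continuous_on_param[of "{a..a'}" a a' f] cont_f by simp
 have cont_\<alpha>: "continuous_on {a..a'} (\<alpha> l)" if "l \<in> I" for l
  using deriv[OF that] by (rule continuous_on_vector_derivative)
 have pt: "norm (\<Sum>l\<in>I. \<alpha> l x * b l x) ^ 4 \<le> 8 * (norm (\<Sum>l\<in>I. \<alpha> l a * b l x) ^ 4 + integral {a..a'} (f x) ^ 4)"
  if x: "x \<in> {a..a'}" for x
 proof -
  have "((\<lambda>u. \<Sum>l\<in>I. \<alpha>' l u * b l x) has_integral (\<Sum>l\<in>I. \<alpha> l x * b l x) - (\<Sum>l\<in>I. \<alpha> l a * b l x)) {a..x}"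
  proof (rule fundamental_theorem_of_calculus)
   fix u assume u: "u \<in> {a..x}"
   then have u': "u \<in> {a..a'}" using x by auto
   show "((\<lambda>u. \<Sum>l\<in>I. \<alpha> l u * b l x) has_vector_derivative (\<Sum>l\<in>I. \<alpha>' l u * b l x)) (at u within {a..x})"
    using x by (intro has_vector_derivative_sum has_vector_derivative_mult_left has_vector_derivative_within_subset[OF deriv[OF _ u']]) auto
  qed (use x in auto)
  then have "(\<Sum>l\<in>I. \<alpha> l x * b l x) - (\<Sum>l\<in>I. \<alpha> l a * b l x) = integral {a..x} (\<lambda>u. \<Sum>l\<in>I. \<alpha>' l u * b l x)"
   by (simp add: integral_unique)
  also have "norm ... \<le> integral {a..x} (f x)"
   unfolding f_def using x
   by (intro integral_norm_bound_integral integrable_continuous_real continuous_intros continuous_on_subset[OF cont(1)]) auto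
  also have "... \<le> integral {a..a'} (f x)"
   using x by (intro integral_subset_le integrable_continuous_real cont_f1 continuous_on_subset[OF cont_f1]) (auto simp: f_def)
  finally have "norm (\<Sum>l\<in>I. \<alpha> l x * b l x) \<le> norm (\<Sum>l\<in>I. \<alpha> l a * b l x) + integral {a..a'} (f x)"
   by (smt (verit) norm_triangle_sub)
  then have "norm (\<Sum>l\<in>I. \<alpha> l x * b l x) ^ 4 \<le> (norm (\<Sum>l\<in>I. \<alpha> l a * b l x) + integral {a..a'} (f x)) ^ 4"
   by (intro power_mono) auto
  also have "... \<le> 8 * (norm (\<Sum>l\<in>I. \<alpha> l a * b l x) ^ 4 + integral {a..a'} (f x) ^ 4)"
   using x by (intro power4_add_le integral_nonneg integrable_continuous_real cont_f1) (auto simp: f_def)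
  finally show ?thesis .
 qed
 have 1: "integral {a..a'} (\<lambda>x. norm (\<Sum>l\<in>I. \<alpha> l a * b l x) ^ 4) \<le> A ^ 4 * M"
  using ab A by (intro M' bound) auto
 have 2: "integral {a..a'} (\<lambda>x. integral {a..a'} (f x) ^ 4) \<le> A ^ 4 * M"
 proof -
  have "integral {a..a'} (\<lambda>x. integral {a..a'} (f x) ^ 4) \<le> integral {a..a'} (\<lambda>_. A / Y) ^ 4 * M"
  proof (rule minkowski_power4[OF ab(1) ab(1) cont_f])
   fix u assume "u \<in> {a..a'}"
   then show "integral {a..a'} (\<lambda>x. f x u ^ 4) \<le> (A / Y) ^ 4 * M"
    unfolding f_def using A ab by (intro M' bound) auto
  qed (use A ab in \<open>auto simp: f_def\<close>)
  also have "integral {a..a'} (\<lambda>_. A / Y) = (a' - a) / Y * A" using ab by simp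
  also have "((a' - a) / Y * A) ^ 4 * M \<le> (1 * A) ^ 4 * M"
   using ab A M0 by (intro mult_right_mono power_mono) auto
  finally show ?thesis by simp
 qed
 have "integral {a..a'} (\<lambda>x. norm (\<Sum>l\<in>I. \<alpha> l x * b l x) ^ 4)
  \<le> integral {a..a'} (\<lambda>x. 8 * (norm (\<Sum>l\<in>I. \<alpha> l a * b l x) ^ 4 + integral {a..a'} (f x) ^ 4))"
  by (intro integral_le integrable_continuous_real continuous_intros cont cont_\<alpha> int_cont pt)
 also have "... = 8 * (integral {a..a'} (\<lambda>x. norm (\<Sum>l\<in>I. \<alpha> l a * b l x) ^ 4) + integral {a..a'} (\<lambda>x. integral {a..a'} (f x) ^ 4))"
  unfolding Henstock_Kurzweil_Integration.integral_mult_right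
  by (subst Henstock_Kurzweil_Integration.integral_add)
   (auto intro!: integrable_continuous_real continuous_intros cont int_cont)
 also have "... \<le> 8 * (A ^ 4 * M + A ^ 4 * M)" by (intro mult_left_mono add_mono 1 2) simp
 finally show ?thesis by (simp add: mult_ac)
qed

section \<open>A twice differentiable bump function and the choice of the small widths\<close>

lemma cube_max_deriv:
 "((\<lambda>u::real. max 0 u ^ (n + 2)) has_real_derivative real (n + 2) * max 0 u ^ (n + 1)) (at u)"
proof (cases u "0::real" rule: linorder_cases)
 case less
 have "((\<lambda>u::real. 0) has_real_derivative 0) (at u)" by auto
 then have "((\<lambda>u::real. max 0 u ^ (n + 2)) has_real_derivative 0) (at u)"
  by (rule has_field_derivative_transform_within_open[of _ _ _ "{..<0}"]) (use less in auto)
 then show ?thesis using less by simp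
next
 case greater
 have "((\<lambda>u::real. u ^ (n + 2)) has_real_derivative real (n + 2) * u ^ (n + 1)) (at u)"
  using DERIV_pow[of "n + 2" u] by simp
 then have "((\<lambda>u::real. max 0 u ^ (n + 2)) has_real_derivative real (n + 2) * u ^ (n + 1)) (at u)"
  by (rule has_field_derivative_transform_within_open[of _ _ _ "{0<..}"]) (use greater in auto)
 then show ?thesis using greater by simp
next
 case equal
 \<comment> \<open>At 0 the difference quotient is at most |h| ^ (n + 1) in absolute value; an
   exponent of at least 2 makes it tend to 0.\<close>
 have "((\<lambda>h. max 0 h ^ (n + 2) / h) \<longlongrightarrow> 0) (at (0::real))"
 proof (rule Lim_null_comparison)
  show "\<forall>\<^sub>F h::real in at 0. norm (max 0 h ^ (n + 2) / h) \<le> \<bar>h\<bar> ^ (n + 1)"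
  proof (rule always_eventually, rule allI)
   fix h :: real
   show "norm (max 0 h ^ (n + 2) / h) \<le> \<bar>h\<bar> ^ (n + 1)"
    by (cases "h > 0") (auto simp: max_def mult_nonpos_nonneg)
  qed
  show "((\<lambda>h::real. \<bar>h\<bar> ^ (n + 1)) \<longlongrightarrow> 0) (at 0)"
   by (auto intro!: tendsto_eq_intros)
 qed
 then show ?thesis using equal by (simp add: DERIV_def)
qed

text \<open>The cube of the positive part of a parabola has two continuous derivatives. On the half
  window the parabola is at least 1/2, so the factor 8 lifts the cube to at least 1.\<close>

lemma bump_function:
 assumes "\<eta> > 0"
 obtains w w1 w2 :: "real => real" and C where
  "\<And>t. (w has_real_derivative w1 t) (at t)" "\<And>t. (w1 has_real_derivative w2 t) (at t)"
  "continuous_on UNIV w2" "\<And>t. w t \<ge> 0" "\<And>t. \<bar>t - 1\<bar> \<le> \<eta> / 2 ==> w t \<ge> 1"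
  "\<And>t. \<bar>t - 1\<bar> \<ge> \<eta> ==> w t = 0 \<and> w1 t = 0 \<and> w2 t = 0"
  "\<And>t. \<bar>w t\<bar> \<le> C" "\<And>t. \<bar>w1 t\<bar> \<le> C" "\<And>t. \<bar>w2 t\<bar> \<le> C" "C \<ge> 1"
proof -
 define u where "u = (\<lambda>t. 1 - ((t - 1) / \<eta>)^2)"
 define u1 where "u1 = (\<lambda>t. - (2 * (t - 1) / \<eta>^2))"
 define w where "w = (\<lambda>t. 8 * max 0 (u t) ^ 3)"
 define w1 where "w1 = (\<lambda>t. 8 * (3 * max 0 (u t) ^ 2 * u1 t))"
 define w2 where "w2 = (\<lambda>t. 8 * (3 * (2 * max 0 (u t) * u1 t) * u1 t + 3 * max 0 (u t) ^ 2 * (- (2 / \<eta>^2))))"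
 have u: "(u has_real_derivative u1 t) (at t)" for t
  unfolding u_def u1_def using assms by (auto intro!: derivative_eq_intros simp: power2_eq_square field_simps)
 have u1: "(u1 has_real_derivative - (2 / \<eta>^2)) (at t)" for t
 proof -
  have "((\<lambda>t. - (2 / \<eta>^2) * (t - 1)) has_real_derivative - (2 / \<eta>^2) * (1 - 0)) (at t)"
   by (intro DERIV_cmult DERIV_diff DERIV_ident DERIV_const)
  moreover have "(\<lambda>t. - (2 / \<eta>^2) * (t - 1)) = u1" by (auto simp: u1_def)
  ultimately show ?thesis by simp
 qed
 have c3: "((\<lambda>t. max 0 (u t) ^ 3) has_real_derivative 3 * max 0 (u t) ^ 2 * u1 t) (at t)" for t
  using DERIV_chain2[OF cube_max_deriv[of 1 "u t"] u] by (simp add: eval_nat_numeral)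
 have c2: "((\<lambda>t. max 0 (u t) ^ 2) has_real_derivative 2 * max 0 (u t) * u1 t) (at t)" for t
  using DERIV_chain2[OF cube_max_deriv[of 0 "u t"] u] by (simp add: eval_nat_numeral)
 have d0: "(w has_real_derivative w1 t) (at t)" for t
  unfolding w_def w1_def by (rule DERIV_cmult c3)+
 have d1: "(w1 has_real_derivative w2 t) (at t)" for t
 proof -
  have "(w1 has_real_derivative 8 * ((3 * (2 * max 0 (u t) * u1 t)) * u1 t + - (2 / \<eta>^2) * (3 * max 0 (u t) ^ 2))) (at t)"
   unfolding w1_def by (intro DERIV_cmult DERIV_mult c2 u1)
  then show ?thesis by (simp add: w2_def mult_ac)
 qed
 have cont_u: "continuous_on UNIV u" unfolding u_def using assms by (intro continuous_intros) auto
 have cont_u1: "continuous_on UNIV u1" unfolding u1_def using assms by (intro continuous_intros) auto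
 have cont: "continuous_on UNIV w" "continuous_on UNIV w1" "continuous_on UNIV w2"
  unfolding w_def w1_def w2_def by (intro continuous_intros cont_u cont_u1)+
 have u0: "u t \<le> 0" if "\<bar>t - 1\<bar> \<ge> \<eta>" for t
 proof -
  have "\<eta>^2 \<le> \<bar>t - 1\<bar>\<^sup>2" using that assms by (intro power_mono) auto
  then show ?thesis using assms by (simp add: u_def field_simps)
 qed
 have vanish: "w t = 0 \<and> w1 t = 0 \<and> w2 t = 0" if "\<bar>t - 1\<bar> \<ge> \<eta>" for t
  using u0[OF that] by (simp add: w_def w1_def w2_def max_def)
 have ge1: "w t \<ge> 1" if "\<bar>t - 1\<bar> \<le> \<eta> / 2" for t
 proof -
  have "\<bar>t - 1\<bar>\<^sup>2 \<le> (\<eta> / 2)^2" using that by (intro power_mono) auto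
  then have "(t - 1)^2 / \<eta>^2 \<le> (\<eta> / 2)^2 / \<eta>^2" by (intro divide_right_mono) auto
  moreover have "(\<eta> / 2)^2 / \<eta>^2 = 1/4" using assms by (simp add: power_divide)
  ultimately have "u t \<ge> 1/2" unfolding u_def power_divide by linarith
  then have "(1/2) ^ 3 \<le> max 0 (u t) ^ 3" by (intro power_mono) auto
  then show ?thesis by (simp add: w_def eval_nat_numeral)
 qed
 have bd: "\<exists>C. \<forall>t. \<bar>f t\<bar> \<le> C" if "continuous_on UNIV f" "\<And>t. \<bar>t - 1\<bar> \<ge> \<eta> ==> f t = 0" for f :: "real => real"
 proof -
  have "bounded (f ` {1 - \<eta>..1 + \<eta>})"
   by (intro compact_imp_bounded compact_continuous_image continuous_on_subset[OF that(1)]) auto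
  then have "\<exists>C. \<forall>t\<in>{1 - \<eta>..1 + \<eta>}. \<bar>f t\<bar> \<le> C" by (simp add: bounded_iff)
  then obtain C where C: "\<And>t. t \<in> {1 - \<eta>..1 + \<eta>} ==> \<bar>f t\<bar> \<le> C" by blast
  then have "C \<ge> 0" using C[of 1] assms by force
  have "\<bar>f t\<bar> \<le> C" for t
  proof (cases "t \<in> {1 - \<eta>..1 + \<eta>}")
   case False
   then have "\<bar>t - 1\<bar> \<ge> \<eta>" by (auto simp: abs_if)
   then show ?thesis using that(2) \<open>C \<ge> 0\<close> by simp
  qed (rule C)
  then show ?thesis by blast
 qed
 obtain C0 where "\<And>t. \<bar>w t\<bar> \<le> C0" using bd[OF cont(1)] vanish by blast
 moreover obtain C1 where "\<And>t. \<bar>w1 t\<bar> \<le> C1" using bd[OF cont(2)] vanish by blast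
 moreover obtain C2 where "\<And>t. \<bar>w2 t\<bar> \<le> C2" using bd[OF cont(3)] vanish by blast
 ultimately have C: "\<bar>w t\<bar> \<le> max 1 (max C0 (max C1 C2))" "\<bar>w1 t\<bar> \<le> max 1 (max C0 (max C1 C2))"
   "\<bar>w2 t\<bar> \<le> max 1 (max C0 (max C1 C2))" for t
  by (simp_all add: le_max_iff_disj)
 have "w t \<ge> 0" for t by (simp add: w_def)
 then show ?thesis
  by (intro that[of w w1 w2 "max 1 (max C0 (max C1 C2))"] d0 d1 cont(3) ge1 vanish C) auto
qed

text \<open>Substitution y = z(x): inserting z' / c \<ge> 1 is allowed since G is
  nonnegative.\<close>

lemma integral_substitution_le:
 fixes z z' G :: "real => real"
 assumes ab: "a \<le> b" and c: "c > 0"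
  and z: "\<And>x. x \<in> {a..b} ==> (z has_real_derivative z' x) (at x)"
  and z': "\<And>x. x \<in> {a..b} ==> z' x \<ge> c" "continuous_on {a..b} z'"
  and G: "continuous_on UNIV G" "\<And>y. G y \<ge> 0"
 shows "integral {a..b} (\<lambda>x. G (z x)) \<le> (1 / c) * integral {z a..z b} G"
proof -
 have z_within: "(z has_real_derivative z' x) (at x within {a..b})" if "x \<in> {a..b}" for x
  using z[OF that] by (rule has_field_derivative_at_within)
 have contz: "continuous_on {a..b} z" using z_within by (rule DERIV_continuous_on)
 have mono: "z x \<le> z y" if "x \<in> {a..b}" "y \<in> {a..b}" "x \<le> y" for x y
 proof (rule DERIV_nonneg_imp_nondecreasing[OF that(3)])
  fix t assume "x \<le> t" "t \<le> y"
  then have "t \<in> {a..b}" using that by auto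
  then show "\<exists>D. (z has_real_derivative D) (at t) \<and> 0 \<le> D" using z[of t] z'(1)[of t] c by (intro exI[of _ "z' t"]) auto
 qed
 have cG: "continuous_on A G" for A using G(1) continuous_on_subset by blast
 have sub: "((\<lambda>x. z' x *\<^sub>R G (z x)) has_integral integral {z a..z b} G) {a..b}"
  by (rule has_integral_substitution[OF ab mono[of a b], of "z a" "z b"]) (use ab mono in \<open>auto intro: cG z_within\<close>)
 have "integral {a..b} (\<lambda>x. G (z x)) \<le> integral {a..b} (\<lambda>x. (1 / c) * (z' x *\<^sub>R G (z x)))"
 proof (intro integral_le integrable_continuous_real)
  show "continuous_on {a..b} (\<lambda>x. G (z x))"
   by (rule continuous_on_compose2[OF G(1) contz]) auto
  show "continuous_on {a..b} (\<lambda>x. (1 / c) * (z' x *\<^sub>R G (z x)))"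
   by (intro continuous_intros z' continuous_on_compose2[OF G(1) contz]) auto
  fix x assume x: "x \<in> {a..b}"
  have "1 * G (z x) \<le> (z' x / c) * G (z x)"
   using z'(1)[OF x] c G(2) by (intro mult_right_mono) (auto simp: field_simps)
  then show "G (z x) \<le> (1 / c) * (z' x *\<^sub>R G (z x))" by simp
 qed
 also have "... = (1 / c) * integral {z a..z b} G"
  using sub by (simp add: integral_unique)
 finally show ?thesis .
qed

text \<open>The widths of the stationary phase argument: \<eta> for the support of the bump and the
  range of x, \<beta> for the dual frequencies treated as stationary, \<delta> for the variable
  scaled by the stationary point. They are chosen in the order \<delta>, \<beta>, \<eta>, each small
  in terms of the previous ones, by continuity of powers at 1.\<close>

lemma stationary_constants:
 fixes \<kappa> :: real
 assumes "\<kappa> \<noteq> 1"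
 obtains \<beta> \<eta> \<delta> :: real where
  "0 < \<beta>" "\<beta> \<le> 1/4" "0 < \<eta>" "\<eta> \<le> 1/4" "0 < \<delta>" "\<delta> \<le> 1/2"
  "\<And>t \<xi>. \<bar>t - 1\<bar> \<le> \<eta> ==> 1 \<le> \<xi> ==> \<xi> \<le> 1 + \<eta> ==> \<bar>\<xi> * t powr (\<kappa> - 1) - 1\<bar> \<le> \<beta> / 2"
  "\<And>\<mu> \<xi>. \<bar>\<mu> - 1\<bar> \<le> \<beta> ==> 1 \<le> \<xi> ==> \<xi> \<le> 1 + \<eta> ==> 1/2 \<le> (\<xi> / \<mu>) powr (1 / (1 - \<kappa>)) \<and> (\<xi> / \<mu>) powr (1 / (1 - \<kappa>)) \<le> 2"
  "\<And>t \<mu> \<xi>. \<bar>t - 1\<bar> \<le> \<eta> ==> \<bar>\<mu> - 1\<bar> \<le> \<beta> ==> 1 \<le> \<xi> ==> \<xi> \<le> 1 + \<eta> ==> \<bar>t / (\<xi> / \<mu>) powr (1 / (1 - \<kappa>)) - 1\<bar> < \<delta>"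
  "\<And>\<tau>. \<bar>\<tau> - 1\<bar> \<le> \<delta> ==> \<bar>\<tau> powr \<kappa> - \<kappa> * \<tau> - (1 - \<kappa>)\<bar> \<le> \<bar>1 - \<kappa>\<bar> / 2"
proof -
 define \<nu> where "\<nu> = 1 / (1 - \<kappa>)"
 have powr_near: "\<exists>d>0. \<forall>y. \<bar>y - 1\<bar> \<le> d --> \<bar>y powr a - 1\<bar> \<le> e" if "e > 0" for a e :: real
 proof -
  have "isCont (\<lambda>y. y powr a) 1" by (intro continuous_intros) auto
  then have "\<exists>d>0. \<forall>y. \<bar>y - 1\<bar> < d --> \<bar>y powr a - 1\<bar> < e"
   unfolding continuous_at_eps_delta using that by (simp add: dist_real_def)
  then obtain d where d: "d > 0" "\<And>y. \<bar>y - 1\<bar> < d ==> \<bar>y powr a - 1\<bar> < e" by blast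
  show ?thesis by (rule exI[of _ "d / 2"]) (use d in \<open>force intro: less_imp_le\<close>)
 qed
 have "isCont (\<lambda>\<tau>. \<tau> powr \<kappa> - \<kappa> * \<tau>) 1" by (intro continuous_intros) auto
 moreover have "\<bar>1 - \<kappa>\<bar> / 2 > 0" using assms by simp
 ultimately have "\<exists>d>0. \<forall>\<tau>. \<bar>\<tau> - 1\<bar> < d --> \<bar>\<tau> powr \<kappa> - \<kappa> * \<tau> - (1 - \<kappa>)\<bar> < \<bar>1 - \<kappa>\<bar> / 2"
  unfolding continuous_at_eps_delta dist_real_def by (simp del: less_divide_eq_numeral1)
 then obtain d0 where d0: "d0 > 0" "\<And>\<tau>. \<bar>\<tau> - 1\<bar> < d0 ==> \<bar>\<tau> powr \<kappa> - \<kappa> * \<tau> - (1 - \<kappa>)\<bar> < \<bar>1 - \<kappa>\<bar> / 2"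
  by blast
 define \<delta> where "\<delta> = min (d0 / 2) (1/2)"
 have \<delta>: "0 < \<delta>" "\<delta> \<le> 1/2" "\<delta> < d0" using d0(1) by (auto simp: \<delta>_def)
 have \<delta>3: "\<bar>\<tau> powr \<kappa> - \<kappa> * \<tau> - (1 - \<kappa>)\<bar> \<le> \<bar>1 - \<kappa>\<bar> / 2" if "\<bar>\<tau> - 1\<bar> \<le> \<delta>" for \<tau>
  by (rule less_imp_le[OF d0(2)[OF le_less_trans[OF that \<delta>(3)]]])
 obtain d1 where d1: "d1 > 0" "\<And>y. \<bar>y - 1\<bar> \<le> d1 ==> \<bar>y powr \<nu> - 1\<bar> \<le> \<delta> / 8"
  using powr_near[of "\<delta> / 8" \<nu>] \<delta> by auto
 define \<beta> where "\<beta> = min (1/4) (d1 / 4)"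
 have \<beta>: "0 < \<beta>" "\<beta> \<le> 1/4" "\<beta> \<le> d1 / 4" using d1 by (auto simp: \<beta>_def)
 obtain d2 where d2: "d2 > 0" "\<And>y. \<bar>y - 1\<bar> \<le> d2 ==> \<bar>y powr (\<kappa> - 1) - 1\<bar> \<le> \<beta> / 8"
  using powr_near[of "\<beta> / 8" "\<kappa> - 1"] \<beta> by auto
 define \<eta> where "\<eta> = min (min (1/4) (\<beta> / 8)) (min d2 (\<delta> / 8))"
 have \<eta>: "0 < \<eta>" "\<eta> \<le> 1/4" "\<eta> \<le> \<beta> / 8" "\<eta> \<le> d2" "\<eta> \<le> \<delta> / 8" using \<beta> d2 \<delta> by (auto simp: \<eta>_def)
 have ratio: "\<bar>(\<xi> / \<mu>) powr \<nu> - 1\<bar> \<le> \<delta> / 8" if "\<bar>\<mu> - 1\<bar> \<le> \<beta>" "1 \<le> \<xi>" "\<xi> \<le> 1 + \<eta>" for \<mu> \<xi>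
 proof (rule d1(2))
  have \<mu>: "\<mu> \<ge> 1/2" using that \<beta> by linarith
  have "\<bar>\<xi> / \<mu> - 1\<bar> = \<bar>\<xi> - \<mu>\<bar> / \<mu>" using \<mu> by (simp add: abs_if field_simps)
  also have "... \<le> \<bar>\<xi> - \<mu>\<bar> / (1/2)" using \<mu> by (intro divide_left_mono) auto
  also have "... \<le> d1" using that \<beta> \<eta> by (simp add: abs_if split: if_splits)
  finally show "\<bar>\<xi> / \<mu> - 1\<bar> \<le> d1" .
 qed
 show ?thesis
 proof (rule that[of \<beta> \<eta> \<delta>])
  show "\<bar>\<xi> * t powr (\<kappa> - 1) - 1\<bar> \<le> \<beta> / 2" if "\<bar>t - 1\<bar> \<le> \<eta>" "1 \<le> \<xi>" "\<xi> \<le> 1 + \<eta>" for t \<xi>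
  proof -
   have p: "\<bar>t powr (\<kappa> - 1) - 1\<bar> \<le> \<beta> / 8" using that \<eta> by (intro d2) auto
   have "\<xi> * t powr (\<kappa> - 1) - 1 = \<xi> * (t powr (\<kappa> - 1) - 1) + (\<xi> - 1)" by (simp add: algebra_simps)
   then have "\<bar>\<xi> * t powr (\<kappa> - 1) - 1\<bar> \<le> \<bar>\<xi>\<bar> * \<bar>t powr (\<kappa> - 1) - 1\<bar> + \<bar>\<xi> - 1\<bar>"
    by (metis abs_mult abs_triangle_ineq)
   also have "... \<le> 2 * (\<beta> / 8) + \<eta>" using that \<eta> p by (intro add_mono mult_mono) auto
   finally show ?thesis using \<eta> \<beta> by linarith
  qed
  show "1/2 \<le> (\<xi> / \<mu>) powr (1 / (1 - \<kappa>)) \<and> (\<xi> / \<mu>) powr (1 / (1 - \<kappa>)) \<le> 2"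
   if "\<bar>\<mu> - 1\<bar> \<le> \<beta>" "1 \<le> \<xi>" "\<xi> \<le> 1 + \<eta>" for \<mu> \<xi>
   using ratio[OF that, unfolded abs_le_iff \<nu>_def] \<delta>(1,2) by linarith
  show "\<bar>t / (\<xi> / \<mu>) powr (1 / (1 - \<kappa>)) - 1\<bar> < \<delta>"
   if t: "\<bar>t - 1\<bar> \<le> \<eta>" and "\<bar>\<mu> - 1\<bar> \<le> \<beta>" "1 \<le> \<xi>" "\<xi> \<le> 1 + \<eta>" for t \<mu> \<xi>
  proof -
   define y where "y = (\<xi> / \<mu>) powr (1 / (1 - \<kappa>))"
   have y: "\<bar>y - 1\<bar> \<le> \<delta> / 8" using ratio[OF that(2-4)] by (simp add: y_def \<nu>_def)
   then have y2: "y \<ge> 1/2" using \<delta> by linarith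
   have "\<bar>t / y - 1\<bar> = \<bar>t - y\<bar> / y" using y2 by (simp add: abs_if field_simps)
   also have "... \<le> \<bar>t - y\<bar> / (1/2)" using y2 by (intro divide_left_mono) auto
   also have "... < \<delta>" using y t \<eta> \<delta> by (simp add: abs_if split: if_splits)
   finally show ?thesis by (simp add: y_def)
  qed
 qed (use \<beta> \<eta> \<delta> \<delta>3 in auto)
qed

lemma powr_two_sided_bounds:
 fixes x a :: real
 assumes "1/2 \<le> x" "x \<le> 2"
 shows "2 powr (- \<bar>a\<bar>) \<le> x powr a" "x powr a \<le> 2 powr \<bar>a\<bar>"
proof -
 have "ln x \<le> ln 2" using assms by simp
 moreover have "ln x \<ge> - ln 2" using assms ln_le_cancel_iff[of "1/2" x] by (simp add: ln_div)
 ultimately have "\<bar>a * ln x\<bar> \<le> \<bar>a\<bar> * ln 2" by (auto simp: abs_mult intro!: mult_left_mono)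
 then have "- (\<bar>a\<bar> * ln 2) \<le> a * ln x" "a * ln x \<le> \<bar>a\<bar> * ln 2" by linarith+
 then show "2 powr (- \<bar>a\<bar>) \<le> x powr a" "x powr a \<le> 2 powr \<bar>a\<bar>"
  using assms by (auto simp: powr_def)
qed

text \<open>After scaling by the stationary point, the phase becomes \<open>\<Lambda>\<close> times the function below,
 whose only critical point is \<open>1\<close>.\<close>

section \<open>Stationary phase\<close>

definition ph :: "real => real => real" where
 "ph \<kappa> \<tau> = \<tau> powr \<kappa> - \<kappa> * \<tau>"
definition ph1 :: "real => real => real" where
 "ph1 \<kappa> \<tau> = \<kappa> * (\<tau> powr (\<kappa> - 1) - 1)"
definition ph2 :: "real => real => real" where
 "ph2 \<kappa> \<tau> = \<kappa> * (\<kappa> - 1) * \<tau> powr (\<kappa> - 2)"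
text \<open>Multiplier for an integration by parts that is uniform across the stationary point: near
  1 it is comparable to (\<tau> - 1)^2, so 1 + 2 pi i \<Lambda> \<open>mlt\<close> has size about 1
  + |\<Lambda>| (\<tau> - 1)^2, and its real part 1 keeps it away from 0.\<close>

definition mlt :: "real => real => real" where
 "mlt \<kappa> \<tau> = (\<tau> - 1) * ph1 \<kappa> \<tau>"
definition mlt1 :: "real => real => real" where
 "mlt1 \<kappa> \<tau> = ph1 \<kappa> \<tau> + (\<tau> - 1) * ph2 \<kappa> \<tau>"

lemma ph_deriv: "\<tau> > 0 ==> (ph \<kappa> has_real_derivative ph1 \<kappa> \<tau>) (at \<tau> within A)"
 unfolding ph_def ph1_def
 by (auto intro!: derivative_eq_intros simp: algebra_simps)

lemma ph1_deriv: "\<tau> > 0 ==> (ph1 \<kappa> has_real_derivative ph2 \<kappa> \<tau>) (at \<tau> within A)"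
 unfolding ph1_def ph2_def
 by (auto intro!: derivative_eq_intros simp: algebra_simps)

lemma mlt_deriv: "\<tau> > 0 ==> (mlt \<kappa> has_real_derivative mlt1 \<kappa> \<tau>) (at \<tau> within A)"
 unfolding mlt_def mlt1_def
 by (auto intro!: derivative_eq_intros ph1_deriv simp: algebra_simps)

lemma continuous_on_ph [continuous_intros]:
 assumes "continuous_on A f" "\<And>x. x \<in> A ==> f x > 0"
 shows "continuous_on A (\<lambda>x. ph \<kappa> (f x))" "continuous_on A (\<lambda>x. ph1 \<kappa> (f x))" "continuous_on A (\<lambda>x. ph2 \<kappa> (f x))"
  "continuous_on A (\<lambda>x. mlt \<kappa> (f x))" "continuous_on A (\<lambda>x. mlt1 \<kappa> (f x))"
 unfolding ph_def ph1_def ph2_def mlt_def mlt1_def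
 using assms(2) by (intro continuous_intros assms(1); force)+

text \<open>\<open>ph1\<close> vanishes at 1 and |\<open>ph2\<close>| is bounded from both sides
  near 1, so the mean value theorem makes \<open>ph1\<close> comparable to \<tau> - 1.\<close>

lemma mlt_bounds:
 assumes "\<kappa> \<noteq> 0" "\<kappa> \<noteq> 1"
 obtains c0 C0 where "0 < c0" "c0 \<le> 1" "0 < C0"
  "\<And>\<tau>. \<bar>\<tau> - 1\<bar> \<le> 1/2 ==> \<bar>mlt \<kappa> \<tau>\<bar> \<ge> c0 * (\<tau> - 1)^2"
  "\<And>\<tau>. \<bar>\<tau> - 1\<bar> \<le> 1/2 ==> \<bar>mlt1 \<kappa> \<tau> * (\<tau> - 1)\<bar> \<le> C0 * (\<tau> - 1)^2"
proof -
 define a where "a = \<bar>\<kappa> * (\<kappa> - 1)\<bar>"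
 have a: "a > 0" using assms by (simp add: a_def)
 define m where "m = 2 powr (- \<bar>\<kappa> - 2\<bar>)"
 define M where "M = 2 powr \<bar>\<kappa> - 2\<bar>"
 have mM: "m > 0" "M > 0" by (simp_all add: m_def M_def)
 have ph2: "a * m \<le> \<bar>ph2 \<kappa> \<tau>\<bar>" "\<bar>ph2 \<kappa> \<tau>\<bar> \<le> a * M" if "\<bar>\<tau> - 1\<bar> \<le> 1/2" for \<tau>
 proof -
  have "1/2 \<le> \<tau>" "\<tau> \<le> 2" using that by linarith+
  from powr_two_sided_bounds[OF this, of "\<kappa> - 2"] a
  show "a * m \<le> \<bar>ph2 \<kappa> \<tau>\<bar>" "\<bar>ph2 \<kappa> \<tau>\<bar> \<le> a * M"
  by (auto simp: ph2_def abs_mult[of "\<kappa> * (\<kappa> - 1)"] a_def[symmetric] m_def M_def intro!: mult_left_mono)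
 qed
 have ph1: "a * m * \<bar>\<tau> - 1\<bar> \<le> \<bar>ph1 \<kappa> \<tau>\<bar> \<and> \<bar>ph1 \<kappa> \<tau>\<bar> \<le> a * M * \<bar>\<tau> - 1\<bar>" if \<tau>: "\<bar>\<tau> - 1\<bar> \<le> 1/2" for \<tau>
 proof (cases "\<tau> = 1")
  case False
  have "\<exists>z. \<bar>z - 1\<bar> \<le> 1/2 \<and> ph1 \<kappa> \<tau> = (\<tau> - 1) * ph2 \<kappa> z"
  proof (cases "\<tau> < 1")
   case True
   have "\<exists>z>\<tau>. z < 1 \<and> ph1 \<kappa> 1 - ph1 \<kappa> \<tau> = (1 - \<tau>) * ph2 \<kappa> z"
    using True \<tau> by (intro MVT2 ph1_deriv) auto
   then obtain z where "\<tau> < z" "z < 1" "ph1 \<kappa> 1 - ph1 \<kappa> \<tau> = (1 - \<tau>) * ph2 \<kappa> z" by blast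
   then show ?thesis using \<tau> True by (intro exI[of _ z]) (auto simp: ph1_def[of _ 1] algebra_simps)
  next
   case F: False
   have "\<exists>z>1. z < \<tau> \<and> ph1 \<kappa> \<tau> - ph1 \<kappa> 1 = (\<tau> - 1) * ph2 \<kappa> z"
    using F False \<tau> by (intro MVT2 ph1_deriv) auto
   then obtain z where "1 < z" "z < \<tau>" "ph1 \<kappa> \<tau> - ph1 \<kappa> 1 = (\<tau> - 1) * ph2 \<kappa> z" by blast
   then show ?thesis using \<tau> F by (intro exI[of _ z]) (auto simp: ph1_def[of _ 1] algebra_simps)
  qed
  then obtain z where z: "\<bar>z - 1\<bar> \<le> 1/2" "ph1 \<kappa> \<tau> = (\<tau> - 1) * ph2 \<kappa> z" by blast
  then have "\<bar>ph1 \<kappa> \<tau>\<bar> = \<bar>\<tau> - 1\<bar> * \<bar>ph2 \<kappa> z\<bar>" by (simp add: abs_mult)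
  then show ?thesis using ph2[OF z(1)] mult_left_mono[of "a * m" "\<bar>ph2 \<kappa> z\<bar>" "\<bar>\<tau> - 1\<bar>"] mult_left_mono[of "\<bar>ph2 \<kappa> z\<bar>" "a * M" "\<bar>\<tau> - 1\<bar>"]
   by (simp add: mult_ac)
 qed (simp add: ph1_def)
 show ?thesis
 proof (rule that[of "min 1 (a * m)" "2 * a * M"])
  show "min 1 (a * m) * (\<tau> - 1)^2 \<le> \<bar>mlt \<kappa> \<tau>\<bar>" if "\<bar>\<tau> - 1\<bar> \<le> 1/2" for \<tau>
  proof -
   have "min 1 (a * m) * (\<tau> - 1)^2 \<le> (a * m) * (\<bar>\<tau> - 1\<bar> * \<bar>\<tau> - 1\<bar>)"
    by (simp add: power2_eq_square mult_right_mono)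
   also have "... \<le> \<bar>\<tau> - 1\<bar> * \<bar>ph1 \<kappa> \<tau>\<bar>"
    using ph1[OF that] mult_left_mono[of "a * m * \<bar>\<tau> - 1\<bar>" "\<bar>ph1 \<kappa> \<tau>\<bar>" "\<bar>\<tau> - 1\<bar>"] by (simp add: mult_ac)
   finally show ?thesis by (simp add: mlt_def abs_mult)
  qed
  show "\<bar>mlt1 \<kappa> \<tau> * (\<tau> - 1)\<bar> \<le> 2 * a * M * (\<tau> - 1)^2" if "\<bar>\<tau> - 1\<bar> \<le> 1/2" for \<tau>
  proof -
   have "\<bar>mlt1 \<kappa> \<tau>\<bar> \<le> \<bar>ph1 \<kappa> \<tau>\<bar> + \<bar>\<tau> - 1\<bar> * \<bar>ph2 \<kappa> \<tau>\<bar>"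
    unfolding mlt1_def by (rule order.trans[OF abs_triangle_ineq]) (simp add: abs_mult)
   also have "... \<le> a * M * \<bar>\<tau> - 1\<bar> + \<bar>\<tau> - 1\<bar> * (a * M)"
    using ph1[OF that] ph2[OF that] by (intro add_mono mult_left_mono) auto
   also have "... = 2 * a * M * \<bar>\<tau> - 1\<bar>" by simp
   finally have "\<bar>mlt1 \<kappa> \<tau>\<bar> * \<bar>\<tau> - 1\<bar> \<le> (2 * a * M * \<bar>\<tau> - 1\<bar>) * \<bar>\<tau> - 1\<bar>"
    by (rule mult_right_mono) simp
   then show ?thesis
    unfolding abs_mult power2_abs[of "\<tau> - 1", symmetric] power2_eq_square by (simp only: mult.assoc)
  qed
 qed (use a mM in auto)
qed

lemma has_vector_derivative_inverse_complex:
 fixes f :: "real => complex"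
 assumes "(f has_vector_derivative f') (at x within A)" "f x \<noteq> 0"
 shows "((\<lambda>x. inverse (f x)) has_vector_derivative - (inverse (f x) * f' * inverse (f x))) (at x within A)"
proof -
 have "(inverse has_field_derivative - (inverse (f x) ^ Suc (Suc 0))) (at (f x) within f ` A)"
  using DERIV_inverse[OF assms(2)] by (rule has_field_derivative_at_within)
 from field_vector_diff_chain_within[OF assms(1) this] show ?thesis
  by (simp add: o_def mult_ac)
qed

text \<open>With e the exponential factor, the derivative of (\<tau> - 1) e is exactly D e. Dividing
  by D therefore reproduces the integrand, and the terms left over decay away from 1 like 1 / D. No
  neighbourhood of the stationary point has to be cut out.\<close>

lemma stationary_by_parts:
 fixes W W1 :: "real => real" and \<kappa> \<Lambda> :: real
 assumes \<delta>: "0 < \<delta>" "\<delta> \<le> 1/2"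
  and W: "\<And>\<tau>. (W has_real_derivative W1 \<tau>) (at \<tau>)" "continuous_on UNIV W1"
  and zero: "W (1 - \<delta>) = 0" "W (1 + \<delta>) = 0"
 defines "D \<equiv> \<lambda>\<tau>. 1 + 2 * pi * \<i> * of_real (\<Lambda> * mlt \<kappa> \<tau>)"
 shows "integral {1 - \<delta>..1 + \<delta>} (\<lambda>\<tau>. of_real (W \<tau>) * ec (\<Lambda> * ph \<kappa> \<tau>)) =
  integral {1 - \<delta>..1 + \<delta>} (\<lambda>\<tau>. - (of_real (W1 \<tau> * (\<tau> - 1)) / D \<tau>
    - of_real (W \<tau>) * (2 * pi * \<i> * of_real (\<Lambda> * (mlt1 \<kappa> \<tau> * (\<tau> - 1)))) / (D \<tau>)^2) * ec (\<Lambda> * ph \<kappa> \<tau>))"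
proof -
 let ?I = "{1 - \<delta>..1 + \<delta>}"
 have pos: "\<tau> > 0" if "\<tau> \<in> ?I" for \<tau> using that \<delta> by auto
 have D_nz: "D \<tau> \<noteq> 0" for \<tau>
 proof -
  have "Re (D \<tau>) = 1" by (simp add: D_def)
  then show ?thesis by auto
 qed
 define c where "c = 2 * pi * \<i>"
 define e where "e = (\<lambda>\<tau>. ec (\<Lambda> * ph \<kappa> \<tau>))"
 \<comment> \<open>The product W (\<tau> - 1) e / D; its derivative is W e plus R, where R collects
   the derivatives that fall on W and on 1 / D.\<close>
 define U where "U = (\<lambda>\<tau>. of_real (W \<tau>) * (of_real (\<tau> - 1) * e \<tau>) / D \<tau>)"
 define R where "R = (\<lambda>\<tau>. (of_real (W1 \<tau> * (\<tau> - 1)) / D \<tau>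
    - of_real (W \<tau>) * (2 * pi * \<i> * of_real (\<Lambda> * (mlt1 \<kappa> \<tau> * (\<tau> - 1)))) / (D \<tau>)^2) * e \<tau>)"
 have "(U has_vector_derivative of_real (W \<tau>) * e \<tau> + R \<tau>) (at \<tau> within ?I)" if \<tau>: "\<tau> \<in> ?I" for \<tau>
 proof -
  have e': "(e has_vector_derivative c * of_real (\<Lambda> * ph1 \<kappa> \<tau>) * e \<tau>) (at \<tau> within ?I)"
   unfolding e_def c_def
   using ec_has_vector_derivative[OF DERIV_cmult[OF ph_deriv[OF pos[OF \<tau>]], of \<Lambda> \<kappa> ?I]] by simp
  have D': "(D has_vector_derivative c * of_real (\<Lambda> * mlt1 \<kappa> \<tau>)) (at \<tau> within ?I)"
  proof -
   have "(D has_vector_derivative 0 + c * of_real (\<Lambda> * mlt1 \<kappa> \<tau>)) (at \<tau> within ?I)"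
    unfolding D_def c_def
    by (intro has_vector_derivative_add has_vector_derivative_const has_vector_derivative_mult_right
      has_vector_derivative_of_real DERIV_cmult mlt_deriv pos \<tau>)
   then show ?thesis by simp
  qed
  have W': "((\<lambda>\<tau>. of_real (W \<tau>) :: complex) has_vector_derivative of_real (W1 \<tau>)) (at \<tau> within ?I)"
   by (intro has_vector_derivative_of_real has_field_derivative_at_within[OF W(1)])
  have v': "((\<lambda>\<tau>. of_real (\<tau> - 1) :: complex) has_vector_derivative of_real (1 - 0)) (at \<tau> within ?I)"
   by (intro has_vector_derivative_of_real DERIV_diff DERIV_ident DERIV_const)
  have iD: "((\<lambda>\<tau>. inverse (D \<tau>)) has_vector_derivative - (inverse (D \<tau>) * (c * of_real (\<Lambda> * mlt1 \<kappa> \<tau>)) * inverse (D \<tau>))) (at \<tau> within ?I)"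
   by (rule has_vector_derivative_inverse_complex[OF D' D_nz])
  have num: "((\<lambda>\<tau>. of_real (W \<tau>) * (of_real (\<tau> - 1) * e \<tau>)) has_vector_derivative
   of_real (W \<tau>) * (of_real (\<tau> - 1) * (c * of_real (\<Lambda> * ph1 \<kappa> \<tau>) * e \<tau>) + of_real (1 - 0) * e \<tau>)
    + of_real (W1 \<tau>) * (of_real (\<tau> - 1) * e \<tau>)) (at \<tau> within ?I)"
   by (intro has_vector_derivative_mult e' W' v')
  have "(U has_vector_derivative
   (of_real (W \<tau>) * (of_real (\<tau> - 1) * e \<tau>)) * (- (inverse (D \<tau>) * (c * of_real (\<Lambda> * mlt1 \<kappa> \<tau>)) * inverse (D \<tau>)))
   + (of_real (W \<tau>) * (of_real (\<tau> - 1) * (c * of_real (\<Lambda> * ph1 \<kappa> \<tau>) * e \<tau>) + of_real (1 - 0) * e \<tau>)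
    + of_real (W1 \<tau>) * (of_real (\<tau> - 1) * e \<tau>)) * inverse (D \<tau>)) (at \<tau> within ?I)"
   unfolding U_def divide_inverse by (intro has_vector_derivative_mult num iD)
  also have "(of_real (W \<tau>) * (of_real (\<tau> - 1) * e \<tau>)) * (- (inverse (D \<tau>) * (c * of_real (\<Lambda> * mlt1 \<kappa> \<tau>)) * inverse (D \<tau>)))
   + (of_real (W \<tau>) * (of_real (\<tau> - 1) * (c * of_real (\<Lambda> * ph1 \<kappa> \<tau>) * e \<tau>) + of_real (1 - 0) * e \<tau>)
    + of_real (W1 \<tau>) * (of_real (\<tau> - 1) * e \<tau>)) * inverse (D \<tau>)
   = of_real (W \<tau>) * (1 + c * of_real (\<Lambda> * mlt \<kappa> \<tau>)) * inverse (D \<tau>) * e \<tau> + R \<tau>"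
   unfolding R_def mlt_def c_def by (simp add: divide_inverse power2_eq_square algebra_simps)
  also have "(1 + c * of_real (\<Lambda> * mlt \<kappa> \<tau>)) = D \<tau>" by (simp add: D_def c_def)
  finally show ?thesis using D_nz[of \<tau>] by (simp add: mult.assoc)
 qed
 then have "((\<lambda>\<tau>. of_real (W \<tau>) * e \<tau> + R \<tau>) has_integral U (1 + \<delta>) - U (1 - \<delta>)) ?I"
  using \<delta> by (intro fundamental_theorem_of_calculus) auto
 then have 0: "integral ?I (\<lambda>\<tau>. of_real (W \<tau>) * e \<tau> + R \<tau>) = 0"
  using zero by (simp add: U_def integral_unique)
 have cW: "continuous_on ?I W" using W(1) by (intro DERIV_continuous_on) (auto intro: has_field_derivative_at_within)
 have cW1: "continuous_on ?I W1" using W(2) by (rule continuous_on_subset) auto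
 have ce: "continuous_on ?I e" unfolding e_def by (intro continuous_intros pos)
 have cD: "continuous_on ?I D" unfolding D_def by (intro continuous_intros pos)
 have cR: "continuous_on ?I R" unfolding R_def using D_nz by (intro continuous_intros cW cW1 ce cD pos) auto
 have "integral ?I (\<lambda>\<tau>. of_real (W \<tau>) * e \<tau>) + integral ?I R = 0"
  using 0 by (subst (asm) Henstock_Kurzweil_Integration.integral_add)
   (auto intro!: integrable_continuous_real continuous_intros cW ce cR)
 then have "integral ?I (\<lambda>\<tau>. of_real (W \<tau>) * e \<tau>) = integral ?I (\<lambda>\<tau>. - R \<tau>)"
  by (simp add: add_eq_0_iff2)
 then show ?thesis by (simp only: R_def e_def mult_minus_left)
qed

section \<open>Bounds in C1 for the amplitude as a function of the stationary point\<close>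

definition c1_bounded :: "real => (real => complex) => bool" where
 "c1_bounded A f \<longleftrightarrow> (\<exists>f'. continuous_on {1/2..2} f' \<and>
  (\<forall>s\<in>{1/2..2}. (f has_vector_derivative f' s) (at s within {1/2..2}) \<and> norm (f s) \<le> A \<and> norm (f' s) \<le> A))"

lemma c1_boundedI:
 assumes "continuous_on {1/2..2} f'"
  "\<And>s. s \<in> {1/2..2} ==> (f has_vector_derivative f' s) (at s within {1/2..2})"
  "\<And>s. s \<in> {1/2..2} ==> norm (f s) \<le> A" "\<And>s. s \<in> {1/2..2} ==> norm (f' s) \<le> A"
 shows "c1_bounded A f"
 unfolding c1_bounded_def using assms by blast

lemma c1_bounded_mono: "c1_bounded A f ==> A \<le> B ==> c1_bounded B f"
 unfolding c1_bounded_def by (meson order.trans)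

lemma c1_bounded_mult:
 assumes "c1_bounded A f" "c1_bounded B g"
 shows "c1_bounded (2 * A * B) (\<lambda>s. f s * g s)"
proof -
 obtain f' where f: "continuous_on {1/2..2} f'"
  "\<And>s. s \<in> {1/2..2} ==> (f has_vector_derivative f' s) (at s within {1/2..2})"
  "\<And>s. s \<in> {1/2..2} ==> norm (f s) \<le> A" "\<And>s. s \<in> {1/2..2} ==> norm (f' s) \<le> A"
  using assms(1) unfolding c1_bounded_def by blast
 obtain g' where g: "continuous_on {1/2..2} g'"
  "\<And>s. s \<in> {1/2..2} ==> (g has_vector_derivative g' s) (at s within {1/2..2})"
  "\<And>s. s \<in> {1/2..2} ==> norm (g s) \<le> B" "\<And>s. s \<in> {1/2..2} ==> norm (g' s) \<le> B"
  using assms(2) unfolding c1_bounded_def by blast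
 have cf: "continuous_on {1/2..2} f" and cg: "continuous_on {1/2..2} g"
  by (rule continuous_on_vector_derivative, erule f(2) g(2))+
 have A0: "A \<ge> 0" by (rule order.trans[OF norm_ge_zero f(3)[of 1]]) auto
 have prod: "norm (x * y) \<le> A * B" if "norm x \<le> A" "norm y \<le> B" for x y :: complex
  using that A0 by (auto simp: norm_mult intro!: mult_mono)
 have B0: "B \<ge> 0" by (rule order.trans[OF norm_ge_zero g(3)[of 1]]) auto
 show ?thesis
 proof (rule c1_boundedI)
  show "continuous_on {1/2..2} (\<lambda>s. f s * g' s + f' s * g s)" by (intro continuous_intros f g cf cg)
  fix s :: real assume s: "s \<in> {1/2..2}"
  show "((\<lambda>s. f s * g s) has_vector_derivative f s * g' s + f' s * g s) (at s within {1/2..2})"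
   by (intro has_vector_derivative_mult f g s)
  show "norm (f s * g s) \<le> 2 * A * B"
   using prod[OF f(3)[OF s] g(3)[OF s]] mult_nonneg_nonneg[OF A0 B0] by linarith
  show "norm (f s * g' s + f' s * g s) \<le> 2 * A * B"
   using norm_triangle_ineq[of "f s * g' s" "f' s * g s"] prod[OF f(3)[OF s] g(4)[OF s]] prod[OF f(4)[OF s] g(3)[OF s]]
   by linarith
 qed
qed

lemma c1_bounded_diff:
 assumes "c1_bounded A f" "c1_bounded B g"
 shows "c1_bounded (A + B) (\<lambda>s. f s - g s)"
proof -
 obtain f' where f: "continuous_on {1/2..2} f'"
  "\<And>s. s \<in> {1/2..2} ==> (f has_vector_derivative f' s) (at s within {1/2..2})"
  "\<And>s. s \<in> {1/2..2} ==> norm (f s) \<le> A" "\<And>s. s \<in> {1/2..2} ==> norm (f' s) \<le> A"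
  using assms(1) unfolding c1_bounded_def by blast
 obtain g' where g: "continuous_on {1/2..2} g'"
  "\<And>s. s \<in> {1/2..2} ==> (g has_vector_derivative g' s) (at s within {1/2..2})"
  "\<And>s. s \<in> {1/2..2} ==> norm (g s) \<le> B" "\<And>s. s \<in> {1/2..2} ==> norm (g' s) \<le> B"
  using assms(2) unfolding c1_bounded_def by blast
 show ?thesis
  by (rule c1_boundedI[where f' = "\<lambda>s. f' s - g' s"])
   (auto intro!: continuous_intros f g has_vector_derivative_diff order.trans[OF norm_triangle_ineq4] add_mono)
qed

lemma c1_bounded_const: "c1_bounded (norm c) (\<lambda>_. c)"
 by (rule c1_boundedI[where f' = "\<lambda>_. 0"]) (auto intro!: derivative_eq_intros)

lemma c1_bounded_linear: "\<bar>c\<bar> * 2 \<le> A ==> c1_bounded A (\<lambda>s. of_real (c * s))"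
proof (rule c1_boundedI[where f' = "\<lambda>_. of_real c"])
 fix s :: real assume A: "\<bar>c\<bar> * 2 \<le> A" and s: "s \<in> {1/2..2}"
 show "((\<lambda>s. complex_of_real (c * s)) has_vector_derivative of_real c) (at s within {1/2..2})"
  by (rule has_vector_derivative_of_real) (auto intro!: derivative_eq_intros)
 have "\<bar>c\<bar> * \<bar>s\<bar> \<le> \<bar>c\<bar> * 2" using s by (intro mult_left_mono) auto
 then show "norm (complex_of_real (c * s)) \<le> A" using A by (simp add: norm_mult)
 show "norm (complex_of_real c) \<le> A" using A by simp
qed auto

lemma c1_bounded_compose_scale:
 assumes f: "\<And>t. (f has_real_derivative f' t) (at t)" "continuous_on UNIV f'"
  and bd: "\<And>t. \<bar>f t\<bar> \<le> C" "\<And>t. \<bar>f' t\<bar> \<le> C" and \<tau>: "\<bar>\<tau>\<bar> \<le> 2"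
 shows "c1_bounded (2 * C) (\<lambda>s. of_real (f (s * \<tau>)))"
proof (rule c1_boundedI[where f' = "\<lambda>s. of_real (f' (s * \<tau>) * \<tau>)"])
 have C: "C \<ge> 0" using bd(1)[of 0] by linarith
 show "continuous_on {1/2..2} (\<lambda>s. complex_of_real (f' (s * \<tau>) * \<tau>))"
  by (intro continuous_intros continuous_on_compose2[OF f(2)]) auto
 fix s :: real assume s: "s \<in> {1/2..2}"
 have "((\<lambda>s. f (s * \<tau>)) has_real_derivative f' (s * \<tau>) * \<tau>) (at s)"
  by (rule DERIV_chain2[OF f(1)]) (auto intro!: derivative_eq_intros)
 then show "((\<lambda>s. complex_of_real (f (s * \<tau>))) has_vector_derivative of_real (f' (s * \<tau>) * \<tau>)) (at s within {1/2..2})"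
  by (rule has_vector_derivative_of_real[OF has_field_derivative_at_within])
 show "norm (complex_of_real (f (s * \<tau>))) \<le> 2 * C" using bd(1)[of "s * \<tau>"] C by simp
 have "\<bar>f' (s * \<tau>)\<bar> * \<bar>\<tau>\<bar> \<le> C * 2" using bd(2) \<tau> C by (intro mult_mono) auto
 then show "norm (complex_of_real (f' (s * \<tau>) * \<tau>)) \<le> 2 * C" by (simp add: norm_mult)
qed

text \<open>For s \<ge> 1/2 one has 1 + |y| \<le> 3 |1 + i y s|. The derivative contains two inverse
  factors, whence 9 = 3^2, and its factor |y| is absorbed by one of them.\<close>

lemma c1_bounded_inverse:
 "c1_bounded (9 / (1 + \<bar>y\<bar>)) (\<lambda>s. inverse (1 + \<i> * of_real (y * s)))"
proof (rule c1_boundedI[where f' = "\<lambda>s. - (inverse (1 + \<i> * of_real (y * s)) * (\<i> * of_real y) * inverse (1 + \<i> * of_real (y * s)))"])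
 define D where "D = (\<lambda>s. 1 + \<i> * complex_of_real (y * s))"
 have nz: "D s \<noteq> 0" for s
 proof -
  have "Re (D s) = 1" by (simp add: D_def)
  then show ?thesis by auto
 qed
 show "continuous_on {1/2..2} (\<lambda>s. - (inverse (1 + \<i> * of_real (y * s)) * (\<i> * of_real y) * inverse (1 + \<i> * of_real (y * s))))"
  using nz unfolding D_def by (intro continuous_intros) auto
 fix s :: real assume s: "s \<in> {1/2..2}"
 have "(D has_vector_derivative 0 + \<i> * of_real y) (at s within {1/2..2})"
  unfolding D_def
  by (intro has_vector_derivative_add has_vector_derivative_const has_vector_derivative_mult_right has_vector_derivative_of_real)
   (auto intro!: derivative_eq_intros)
 then have D': "(D has_vector_derivative \<i> * of_real y) (at s within {1/2..2})" by simp
 have "((\<lambda>s. inverse (D s)) has_vector_derivative - (inverse (D s) * (\<i> * of_real y) * inverse (D s))) (at s within {1/2..2})"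
  by (rule has_vector_derivative_inverse_complex[OF D' nz])
 then show "((\<lambda>s. inverse (1 + \<i> * of_real (y * s))) has_vector_derivative - (inverse (1 + \<i> * of_real (y * s)) * (\<i> * of_real y) * inverse (1 + \<i> * of_real (y * s)))) (at s within {1/2..2})"
  by (simp add: D_def)
 have nD: "1 + \<bar>y\<bar> \<le> 3 * norm (D s)"
 proof -
  have "(1 + \<bar>y\<bar>)^2 \<le> 9 * (1 + (y * s)^2)"
  proof -
   have "(1/2)^2 \<le> s^2" using s by (intro power_mono) auto
   then have "y^2 * (1/2)^2 \<le> y^2 * s^2" by (intro mult_left_mono) auto
   moreover have "(1 + \<bar>y\<bar>)^2 \<le> 2 + 2 * y^2" using sum_squares_bound[of 1 "\<bar>y\<bar>"] by (simp add: power2_sum)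
   moreover have "q \<le> 9 * (1 + b)" if "a * (1/2)^2 \<le> b" "q \<le> 2 + 2 * a" "0 \<le> b" for a b q :: real
    using that by (simp add: power2_eq_square)
   ultimately show ?thesis unfolding power_mult_distrib by (metis mult_nonneg_nonneg zero_le_power2)
  qed
  then have "1 + \<bar>y\<bar> \<le> sqrt (9 * (1 + (y * s)^2))" by (intro real_le_rsqrt)
  also have "... = 3 * sqrt (1 + (y * s)^2)" by (subst real_sqrt_mult) simp
  also have "... = 3 * norm (D s)" by (simp add: D_def cmod_def)
  finally show ?thesis .
 qed
 have inv: "norm (inverse (D s)) \<le> 3 / (1 + \<bar>y\<bar>)"
 proof -
  have n: "norm (D s) > 0" using nz by simp
  have "3 / (3 * norm (D s)) \<le> 3 / (1 + \<bar>y\<bar>)"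
   using n nD by (intro divide_left_mono) (auto intro!: mult_pos_pos)
  then show ?thesis by (simp add: norm_inverse divide_inverse[of 1])
 qed
 have le: "3 / (1 + \<bar>y\<bar>) \<le> 9 / (1 + \<bar>y\<bar>)" by (intro divide_right_mono) auto
 show "norm (inverse (1 + \<i> * of_real (y * s))) \<le> 9 / (1 + \<bar>y\<bar>)"
  using inv le unfolding D_def by linarith
 have "norm (inverse (D s) * (\<i> * of_real y) * inverse (D s)) = norm (inverse (D s)) * \<bar>y\<bar> * norm (inverse (D s))"
  by (simp add: norm_mult)
 also have "... \<le> (3 / (1 + \<bar>y\<bar>)) * \<bar>y\<bar> * (3 / (1 + \<bar>y\<bar>))"
  by (intro mult_mono inv) auto
 also have "... = 9 / (1 + \<bar>y\<bar>) * (\<bar>y\<bar> / (1 + \<bar>y\<bar>))" by simp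
 also have "... \<le> 9 / (1 + \<bar>y\<bar>) * 1" by (intro mult_left_mono) auto
 finally show "norm (- (inverse (1 + \<i> * of_real (y * s)) * (\<i> * of_real y) * inverse (1 + \<i> * of_real (y * s)))) \<le> 9 / (1 + \<bar>y\<bar>)"
  by (simp add: D_def)
qed

text \<open>The integrand left by the integration by parts, as a function of the scale s at which
  the stationary point will be inserted; E is 1 / D. It is spelled out as a product of simple
  factors, down to \<open>1 * s\<close>, so that the product rule for \<open>c1_bounded\<close>
  applies factor by factor.\<close>

definition amp :: "real => (real => real) => (real => real) => real => real => real => complex" where
 "amp \<kappa> w w1 \<omega> \<tau> s =
  (let E = inverse (1 + \<i> * of_real ((2 * pi * \<omega> * mlt \<kappa> \<tau>) * s)) in
   of_real (1 * s) * (of_real (w (s * \<tau>)) * ((\<i> * of_real ((2 * pi * \<omega> * (mlt1 \<kappa> \<tau> * (\<tau> - 1))) * s)) * (E * E)))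
   - of_real (1 * s) * (of_real (1 * s) * (of_real (w1 (s * \<tau>)) * (of_real (\<tau> - 1) * E))))"

text \<open>The first product contains a factor of order Y (\<tau> - 1)^2 coming from
  \<open>mlt1\<close>; one of its two factors E absorbs it. Each of the two products then retains
  one E, and with it the decay in \<tau>.\<close>

lemma amp_c1_bounded:
 fixes w w1 w2 :: "real => real"
 assumes \<kappa>: "\<kappa> \<noteq> 0" "\<kappa> \<noteq> 1"
  and w: "\<And>t. (w has_real_derivative w1 t) (at t)" "\<And>t. (w1 has_real_derivative w2 t) (at t)" "continuous_on UNIV w2"
  and bd: "\<And>t. \<bar>w t\<bar> \<le> C" "\<And>t. \<bar>w1 t\<bar> \<le> C" "\<And>t. \<bar>w2 t\<bar> \<le> C" "C \<ge> 1"
 obtains K where "K > 0" "\<And>Y \<omega> \<tau>. Y > 0 ==> Y / 2 \<le> \<omega> ==> \<omega> \<le> 2 * Y ==> \<bar>\<tau> - 1\<bar> \<le> 1/2 ==>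
  c1_bounded (K / (1 + Y * (\<tau> - 1)^2)) (amp \<kappa> w w1 \<omega> \<tau>)"
proof -
 obtain c0 C0 where c0: "0 < c0" "c0 \<le> 1" "0 < C0"
  and mlt: "\<And>\<tau>. \<bar>\<tau> - 1\<bar> \<le> 1/2 ==> \<bar>mlt \<kappa> \<tau>\<bar> \<ge> c0 * (\<tau> - 1)^2"
  "\<And>\<tau>. \<bar>\<tau> - 1\<bar> \<le> 1/2 ==> \<bar>mlt1 \<kappa> \<tau> * (\<tau> - 1)\<bar> \<le> C0 * (\<tau> - 1)^2"
  using mlt_bounds[OF \<kappa>] by metis
 define K1 where "K1 = 9 / c0"
 define K where "K = 128 * pi * C * C0 * (9 / c0) * K1 * 8 + 64 * C * K1"
 have K1: "K1 > 0" using c0 by (simp add: K1_def)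
 have K: "K > 0" unfolding K_def using c0 bd(4) K1 by (intro add_pos_pos mult_pos_pos) auto
 have cw1: "continuous_on UNIV w1" using w(2) by (intro DERIV_continuous_on) auto
 show ?thesis
 proof (rule that[OF K])
  fix Y \<omega> \<tau> :: real
  assume Y: "Y > 0" and \<omega>: "Y / 2 \<le> \<omega>" "\<omega> \<le> 2 * Y" and \<tau>: "\<bar>\<tau> - 1\<bar> \<le> 1/2"
  define v2 where "v2 = (\<tau> - 1)^2"
  have v2: "v2 \<ge> 0" by (simp add: v2_def)
  define y where "y = 2 * pi * \<omega> * mlt \<kappa> \<tau>"
  define h where "h = 2 * pi * \<omega> * (mlt1 \<kappa> \<tau> * (\<tau> - 1))"
  define B where "B = K1 / (1 + Y * v2)"
  have den: "1 + Y * v2 \<ge> 1" using Y v2 by simp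
  have B0: "B \<ge> 0" using K1 den by (simp add: B_def)
  have y_ge: "\<bar>y\<bar> \<ge> c0 * (Y * v2)"
  proof -
   have "c0 * (Y * v2) = 1 * Y * (c0 * v2)" by simp
   also have "... \<le> 2 * pi * \<omega> * \<bar>mlt \<kappa> \<tau>\<bar>"
   proof (rule mult_mono)
    have "2 * pi * (Y / 2) \<le> 2 * pi * \<omega>" using \<omega> by (intro mult_left_mono) auto
    moreover have "1 * Y \<le> pi * Y" using pi_ge_two Y by (intro mult_right_mono) auto
    ultimately show "1 * Y \<le> 2 * pi * \<omega>" by linarith
   qed (use mlt(1)[OF \<tau>] Y \<omega> c0 v2 in \<open>auto simp: v2_def\<close>)
   finally show ?thesis using \<omega> Y by (simp add: y_def abs_mult)
  qed
  have E: "c1_bounded B (\<lambda>s. inverse (1 + \<i> * of_real (y * s)))"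
  proof (rule c1_bounded_mono[OF c1_bounded_inverse])
   have "c0 * (1 + Y * v2) \<le> 1 + \<bar>y\<bar>" using y_ge c0 by (simp add: distrib_left)
   then have "9 / (1 + \<bar>y\<bar>) \<le> 9 / (c0 * (1 + Y * v2))"
    using c0 den by (intro divide_left_mono mult_pos_pos) auto
   then show "9 / (1 + \<bar>y\<bar>) \<le> B" by (simp add: B_def K1_def)
  qed
  define Hb where "Hb = 8 * pi * C0 * (Y * v2)"
  have H: "c1_bounded (2 * 1 * Hb) (\<lambda>s. \<i> * of_real (h * s))"
  proof -
   have "\<bar>h\<bar> = 2 * pi * \<omega> * \<bar>mlt1 \<kappa> \<tau> * (\<tau> - 1)\<bar>" using \<omega> Y by (simp add: h_def abs_mult)
   also have "... \<le> 2 * pi * (2 * Y) * (C0 * v2)"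
    using mlt(2)[OF \<tau>] \<omega> Y by (intro mult_mono) (auto simp: v2_def)
   finally have "\<bar>h\<bar> * 2 \<le> Hb" by (simp add: Hb_def mult_ac)
   from c1_bounded_mult[OF c1_bounded_const[of \<i>] c1_bounded_linear[OF this]] show ?thesis by simp
  qed
  have cw: "c1_bounded (2 * C) (\<lambda>s. of_real (w (s * \<tau>)))" "c1_bounded (2 * C) (\<lambda>s. of_real (w1 (s * \<tau>)))"
   using \<tau> by (intro c1_bounded_compose_scale[OF w(1) cw1 bd(1,2)] c1_bounded_compose_scale[OF w(2,3) bd(2,3)]; linarith)+
  have id: "c1_bounded 2 (\<lambda>s. of_real (1 * s))" by (rule c1_bounded_linear) auto
  have v: "c1_bounded (1/2) (\<lambda>_. of_real (\<tau> - 1))"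
   using \<tau> by (intro c1_bounded_mono[OF c1_bounded_const]) (simp flip: of_real_diff add: norm_of_real del: of_real_diff)
  note P1 = c1_bounded_mult[OF id c1_bounded_mult[OF cw(1) c1_bounded_mult[OF H c1_bounded_mult[OF E E]]]]
  note P2 = c1_bounded_mult[OF id c1_bounded_mult[OF id c1_bounded_mult[OF cw(2) c1_bounded_mult[OF v E]]]]
  have HB: "Hb * B \<le> 8 * pi * C0 * (9 / c0)"
  proof -
   have "(Y * v2) * B \<le> K1"
   proof -
    have "(Y * v2) / (1 + Y * v2) \<le> 1" using den by (subst divide_le_eq_1_pos) auto
    then have "K1 * ((Y * v2) / (1 + Y * v2)) \<le> K1 * 1" using K1 by (intro mult_left_mono) auto
    then show ?thesis by (simp add: B_def mult_ac)
   qed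
   then have "8 * pi * C0 * ((Y * v2) * B) \<le> 8 * pi * C0 * K1" using c0 by (intro mult_left_mono) auto
   then show ?thesis by (simp add: Hb_def K1_def mult_ac)
  qed
  have "2 * 2 * (2 * (2 * C) * (2 * (2 * 1 * Hb) * (2 * B * B))) = 128 * C * (Hb * B) * B" by simp
  also have "... \<le> 128 * C * (8 * pi * C0 * (9 / c0)) * B"
   using HB bd(4) B0 by (intro mult_right_mono mult_left_mono) auto
  finally have 1: "2 * 2 * (2 * (2 * C) * (2 * (2 * 1 * Hb) * (2 * B * B))) \<le> 128 * pi * C * C0 * (9 / c0) * 8 * B"
   by (simp add: mult_ac)
  have "2 * 2 * (2 * (2 * C) * (2 * (2 * 1 * Hb) * (2 * B * B))) + 2 * 2 * (2 * 2 * (2 * (2 * C) * (2 * (1/2) * B)))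
   \<le> 128 * pi * C * C0 * (9 / c0) * 8 * B + 64 * C * B" using 1 by simp
  also have "... = K / (1 + Y * v2)" by (simp add: K_def B_def add_divide_distrib algebra_simps)
  finally show "c1_bounded (K / (1 + Y * (\<tau> - 1)^2)) (amp \<kappa> w w1 \<omega> \<tau>)"
   using c1_bounded_mono[OF c1_bounded_diff[OF P1 P2]]
   unfolding amp_def[abs_def] Let_def y_def[symmetric] h_def[symmetric] v2_def[symmetric] by blast
 qed
qed

text \<open>T is the critical point of t |-> x t powr \<kappa> - \<kappa> \<omega> t. After t = T
  \<tau> the phase is \<omega> T \<open>ph \<kappa>\<close>, because x T powr \<kappa> = \<omega> T.
  The hypothesis \<open>near\<close> puts the support of w inside the scaled interval, so the
  boundary terms vanish.\<close>

lemma stationary_formula: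
 fixes w w1 :: "real => real"
 assumes \<eta>: "0 < \<eta>" "\<eta> \<le> 1/4" and \<delta>: "0 < \<delta>" "\<delta> \<le> 1/2"
  and w: "\<And>t. (w has_real_derivative w1 t) (at t)" "continuous_on UNIV w1"
  and supp: "\<And>t. \<bar>t - 1\<bar> \<ge> \<eta> ==> w t = 0"
  and pos: "x > 0" "\<omega> > 0" and \<kappa>: "\<kappa> \<noteq> 1"
 defines "T \<equiv> (x / \<omega>) powr (1 / (1 - \<kappa>))"
 assumes near: "\<And>t. \<bar>t - 1\<bar> \<le> \<eta> ==> \<bar>t / T - 1\<bar> < \<delta>"
 shows "integral {1 - \<eta>..1 + \<eta>} (\<lambda>t. of_real (w t) * ec (x * t powr \<kappa> - \<kappa> * \<omega> * t)) =
  integral {1 - \<delta>..1 + \<delta>} (\<lambda>\<tau>. amp \<kappa> w w1 \<omega> \<tau> T * ec (\<omega> * T * ph \<kappa> \<tau>))"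
proof -
 have T: "T > 0" using pos by (simp add: T_def)
 \<comment> \<open>The critical point equation T powr (\<kappa> - 1) = \<omega> / x, multiplied by
   T.\<close>
 have xT: "x * T powr \<kappa> = \<omega> * T"
 proof -
  have "T powr (\<kappa> - 1) = (x / \<omega>) powr (-1)"
   unfolding T_def powr_powr using \<kappa> by (intro arg_cong2[where f = "(powr)"]) (auto simp: field_simps)
  then have "T powr (\<kappa> - 1) = \<omega> / x" using pos by (simp add: powr_minus field_simps)
  then have "T powr \<kappa> = (\<omega> / x) * T" using T by (simp add: powr_diff field_simps)
  then show ?thesis using pos by simp
 qed
 define f where "f = (\<lambda>t. of_real (w t) * ec (x * t powr \<kappa> - \<kappa> * \<omega> * t))"
 have cw: "continuous_on A w" for A using w(1) by (intro DERIV_continuous_on) (auto intro: has_field_derivative_at_within)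
 have sub: "{1 - \<eta>..1 + \<eta>} \<subseteq> {T * (1 - \<delta>)..T * (1 + \<delta>)}"
 proof
  fix t assume "t \<in> {1 - \<eta>..1 + \<eta>}"
  then have "\<bar>t - 1\<bar> \<le> \<eta>" by (auto simp: abs_le_iff)
  from near[OF this] show "t \<in> {T * (1 - \<delta>)..T * (1 + \<delta>)}" using T by (auto simp: abs_less_iff field_simps)
 qed
 have wT: "w (T * \<tau>) = 0" if "\<bar>\<tau> - 1\<bar> \<ge> \<delta>" for \<tau>
 proof (rule supp, rule ccontr)
  assume "\<not> \<eta> \<le> \<bar>T * \<tau> - 1\<bar>"
  then have "\<bar>T * \<tau> / T - 1\<bar> < \<delta>" by (intro near) auto
  then show False using that T by simp
 qed
 have contf: "continuous_on {T * (1 - \<delta>)..T * (1 + \<delta>)} f"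
 proof -
  have "T * (1 - \<delta>) > 0" using T \<delta> by simp
  then show ?thesis unfolding f_def by (intro continuous_intros cw) auto
 qed
 have "integral {1 - \<eta>..1 + \<eta>} f = integral ({1 - \<eta>..1 + \<eta>} \<inter> {T * (1 - \<delta>)..T * (1 + \<delta>)}) f"
  by (simp only: Int_absorb2[OF sub])
 also have "... = integral {T * (1 - \<delta>)..T * (1 + \<delta>)} (\<lambda>t. if t \<in> {1 - \<eta>..1 + \<eta>} then f t else 0)"
  by (rule integral_restrict_Int[symmetric])
 also have "... = integral {T * (1 - \<delta>)..T * (1 + \<delta>)} f"
 proof (rule integral_cong)
  fix t
  have "w t = 0" if "t \<notin> {1 - \<eta>..1 + \<eta>}" using that by (intro supp) (auto simp: abs_if)
  then show "(if t \<in> {1 - \<eta>..1 + \<eta>} then f t else 0) = f t" by (auto simp: f_def)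
 qed
 finally have 1: "integral {1 - \<eta>..1 + \<eta>} f = integral {T * (1 - \<delta>)..T * (1 + \<delta>)} f" .
 have "(f has_integral integral {T * (1 - \<delta>)..T * (1 + \<delta>)} f) (cbox (T * (1 - \<delta>)) (T * (1 + \<delta>)))"
  using contf by (auto intro!: integrable_integral integrable_continuous_real)
 from has_integral_affinity'[OF this T, of 0]
 have "((\<lambda>\<tau>. f (T * \<tau>)) has_integral integral {T * (1 - \<delta>)..T * (1 + \<delta>)} f /\<^sub>R T) {1 - \<delta>..1 + \<delta>}"
  using T by (simp add: mult.assoc[symmetric] del: mult.assoc)
 then have 2: "integral {T * (1 - \<delta>)..T * (1 + \<delta>)} f = of_real T * integral {1 - \<delta>..1 + \<delta>} (\<lambda>\<tau>. f (T * \<tau>))"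
  using T by (simp add: integral_unique scaleR_conv_of_real field_simps)
 have "integral {1 - \<delta>..1 + \<delta>} (\<lambda>\<tau>. f (T * \<tau>)) = integral {1 - \<delta>..1 + \<delta>} (\<lambda>\<tau>. of_real (w (T * \<tau>)) * ec (\<omega> * T * ph \<kappa> \<tau>))"
 proof (rule integral_cong)
  fix \<tau> assume "\<tau> \<in> {1 - \<delta>..1 + \<delta>}"
  then have \<tau>: "\<tau> > 0" using \<delta> by auto
  have "x * (T * \<tau>) powr \<kappa> - \<kappa> * \<omega> * (T * \<tau>) = (x * T powr \<kappa>) * \<tau> powr \<kappa> - \<kappa> * \<omega> * (T * \<tau>)"
   using T \<tau> by (simp add: powr_mult)
  also have "... = \<omega> * T * ph \<kappa> \<tau>" unfolding xT by (simp add: ph_def algebra_simps)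
  finally show "f (T * \<tau>) = of_real (w (T * \<tau>)) * ec (\<omega> * T * ph \<kappa> \<tau>)" by (simp add: f_def)
 qed
 also have "... = integral {1 - \<delta>..1 + \<delta>} (\<lambda>\<tau>. - (of_real (T * w1 (T * \<tau>) * (\<tau> - 1)) / (1 + 2 * pi * \<i> * of_real (\<omega> * T * mlt \<kappa> \<tau>))
    - of_real (w (T * \<tau>)) * (2 * pi * \<i> * of_real (\<omega> * T * (mlt1 \<kappa> \<tau> * (\<tau> - 1)))) / (1 + 2 * pi * \<i> * of_real (\<omega> * T * mlt \<kappa> \<tau>))^2) * ec (\<omega> * T * ph \<kappa> \<tau>))"
 proof (rule stationary_by_parts[OF \<delta>])
  show "((\<lambda>\<tau>. w (T * \<tau>)) has_real_derivative T * w1 (T * \<tau>)) (at \<tau>)" for \<tau>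
  proof -
   have "((\<lambda>\<tau>. w (T * \<tau>)) has_real_derivative w1 (T * \<tau>) * T) (at \<tau>)"
    by (rule DERIV_chain2[where f = w, OF w(1)]) (auto intro!: derivative_eq_intros)
   then show ?thesis by (simp add: mult.commute)
  qed
  show "continuous_on UNIV (\<lambda>\<tau>. T * w1 (T * \<tau>))"
   by (intro continuous_intros continuous_on_compose2[OF w(2)]) auto
 qed (use wT[of "1 - \<delta>"] wT[of "1 + \<delta>"] \<delta> in auto)
 finally have 3: "integral {1 - \<delta>..1 + \<delta>} (\<lambda>\<tau>. f (T * \<tau>)) = ..." .
 have "integral {1 - \<eta>..1 + \<eta>} f = integral {1 - \<delta>..1 + \<delta>} (\<lambda>\<tau>. amp \<kappa> w w1 \<omega> \<tau> T * ec (\<omega> * T * ph \<kappa> \<tau>))"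
  unfolding 1 2 3 Henstock_Kurzweil_Integration.integral_mult_right[symmetric]
 proof (rule integral_cong)
  fix \<tau>
  define D where "D = 1 + 2 * pi * \<i> * complex_of_real (\<omega> * T * mlt \<kappa> \<tau>)"
  have D: "1 + \<i> * complex_of_real ((2 * pi * \<omega> * mlt \<kappa> \<tau>) * T) = D" by (simp add: D_def mult_ac)
  show "of_real T * (- (of_real (T * w1 (T * \<tau>) * (\<tau> - 1)) / (1 + 2 * pi * \<i> * of_real (\<omega> * T * mlt \<kappa> \<tau>))
    - of_real (w (T * \<tau>)) * (2 * pi * \<i> * of_real (\<omega> * T * (mlt1 \<kappa> \<tau> * (\<tau> - 1)))) / (1 + 2 * pi * \<i> * of_real (\<omega> * T * mlt \<kappa> \<tau>))^2) * ec (\<omega> * T * ph \<kappa> \<tau>))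
   = amp \<kappa> w w1 \<omega> \<tau> T * ec (\<omega> * T * ph \<kappa> \<tau>)"
   unfolding amp_def Let_def D D_def[symmetric] by (simp add: divide_inverse power2_eq_square algebra_simps)
 qed
 then show ?thesis by (simp add: f_def)
qed

text \<open>The primitive is an arctangent. This integral is the source of the saving Y powr (- 1/2)
  of stationary phase.\<close>

lemma integral_lorentz_le:
 assumes "Y > 0" "a \<le> b"
 shows "integral {a..b} (\<lambda>\<tau>. 1 / (1 + Y * (\<tau> - 1)^2)) \<le> pi / sqrt Y"
proof -
 define r where "r = sqrt Y"
 have r: "r > 0" "r^2 = Y" using assms by (simp_all add: r_def)
 have "((\<lambda>\<tau>. arctan (r * (\<tau> - 1)) / r) has_vector_derivative 1 / (1 + Y * (\<tau> - 1)^2)) (at \<tau> within {a..b})" for \<tau>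
 proof -
  have "((\<lambda>\<tau>. arctan (r * (\<tau> - 1)) / r) has_real_derivative (inverse (1 + (r * (\<tau> - 1))^2) * r) / r) (at \<tau>)"
   by (intro DERIV_cdivide DERIV_chain2[OF DERIV_arctan]) (auto intro!: derivative_eq_intros)
  also have "(inverse (1 + (r * (\<tau> - 1))^2) * r) / r = 1 / (1 + Y * (\<tau> - 1)^2)"
   using r by (simp add: power_mult_distrib divide_inverse)
  finally show ?thesis
   by (simp add: has_real_derivative_iff_has_vector_derivative has_vector_derivative_at_within)
 qed
 then have "((\<lambda>\<tau>. 1 / (1 + Y * (\<tau> - 1)^2)) has_integral (arctan (r * (b - 1)) / r - arctan (r * (a - 1)) / r)) {a..b}"
  using assms by (intro fundamental_theorem_of_calculus) auto
 then have "integral {a..b} (\<lambda>\<tau>. 1 / (1 + Y * (\<tau> - 1)^2)) = (arctan (r * (b - 1)) - arctan (r * (a - 1))) / r"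
  by (simp add: integral_unique diff_divide_distrib)
 also have "... \<le> pi / r"
  using arctan_bounded[of "r * (b - 1)"] arctan_bounded[of "r * (a - 1)"] r by (intro divide_right_mono) auto
 finally show ?thesis by (simp add: r_def)
qed

section \<open>The fourth moment of the stationary terms\<close>

lemma powr_scale_deriv:
 fixes x Y \<nu> :: real
 assumes "x / Y > 0"
 shows "((\<lambda>x. (x / Y) powr \<nu>) has_real_derivative (\<nu> * (x / Y) powr (\<nu> - 1)) * (1 / Y)) (at x)"
proof -
 have lin: "((\<lambda>x. x / Y) has_real_derivative 1 / Y) (at x)" by (rule DERIV_cdivide[OF DERIV_ident])
 have base: "((\<lambda>u. u powr \<nu>) has_real_derivative \<nu> * (x / Y) powr (\<nu> - 1)) (at (x / Y))"
  by (rule has_real_derivative_powr[OF assms])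
 show ?thesis using DERIV_chain2[OF base lin] .
qed

text \<open>For fixed \<tau> the phase separates as z(x) times \<mu> powr (1 - \<nu>), and 1 - \<nu>
  = \<kappa> / (\<kappa> - 1): this is how the dual exponent arises. Since
  \<open>ph \<kappa> \<tau>\<close> is close to 1 - \<kappa>, the function z increases with
  derivative bounded below, and x can be replaced by z.\<close>

lemma scaled_phase_moment:
 fixes \<kappa> :: real
 defines "\<nu> \<equiv> 1 / (1 - \<kappa>)"
 assumes \<kappa>: "\<kappa> \<noteq> 1" and \<eta>: "0 < \<eta>" "\<eta> \<le> 1/4"
 shows "\<exists>K>0. \<forall>Y \<tau> (c :: 'a => complex) (I :: 'a set) (\<mu> :: 'a => real). Y > 0 --> finite I --> (\<forall>l\<in>I. \<mu> l > 0) -->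
  \<bar>ph \<kappa> \<tau> - (1 - \<kappa>)\<bar> \<le> \<bar>1 - \<kappa>\<bar> / 2 --> (\<forall>l\<in>I. norm (c l) \<le> 1) -->
  integral {Y..(1 + \<eta>) * Y} (\<lambda>x. norm (\<Sum>l\<in>I. c l * ec (\<mu> l * Y * (x / (\<mu> l * Y)) powr \<nu> * ph \<kappa> \<tau>)) ^ 4)
   \<le> K * Y * energy I (\<lambda>l. \<mu> l powr (1 - \<nu>)) Y"
proof -
 define c0 where "c0 = 2 powr (- \<bar>\<nu> - 1\<bar>) / 2"
 define X0 where "X0 = max 1 (2 powr \<bar>\<nu>\<bar> * (2 * \<bar>1 - \<kappa>\<bar>))"
 define K where "K = (1 / c0) * (exp pi * X0)"
 have c0: "c0 > 0" by (simp add: c0_def)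
 have X0: "X0 \<ge> 1" by (simp add: X0_def)
 have K: "K > 0" unfolding K_def using c0 X0 by (intro mult_pos_pos) auto
 have \<nu>0: "\<nu> \<noteq> 0" using \<kappa> by (simp add: \<nu>_def)
 show ?thesis
 proof (intro exI[of _ K] conjI K allI impI)
  fix Y \<tau> :: real and c :: "'a => complex" and I :: "'a set" and \<mu> :: "'a => real"
  assume Y: "Y > 0" and I: "finite I" and \<mu>': "\<forall>l\<in>I. \<mu> l > 0"
   and q: "\<bar>ph \<kappa> \<tau> - (1 - \<kappa>)\<bar> \<le> \<bar>1 - \<kappa>\<bar> / 2" and c': "\<forall>l\<in>I. norm (c l) \<le> 1"
  note \<mu> = \<mu>'[rule_format] and c = c'[rule_format]
  define \<theta> where "\<theta> = (\<lambda>l. \<mu> l powr (1 - \<nu>))"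
  define z where "z = (\<lambda>x. Y * (x / Y) powr \<nu> * ph \<kappa> \<tau>)"
  define z' where "z' = (\<lambda>x. \<nu> * ph \<kappa> \<tau> * (x / Y) powr (\<nu> - 1))"
  \<comment> \<open>\<nu> (1 - \<kappa>) = 1, so \<nu> \<open>ph \<kappa> \<tau>\<close> differs
    from 1 by at most 1/2.\<close>
  have \<nu>q: "\<nu> * ph \<kappa> \<tau> \<ge> 1/2"
  proof -
   have "\<bar>\<nu> * ph \<kappa> \<tau> - 1\<bar> = \<bar>\<nu>\<bar> * \<bar>ph \<kappa> \<tau> - (1 - \<kappa>)\<bar>"
    using \<kappa> by (simp add: \<nu>_def flip: abs_mult) (simp add: field_simps)
   also have "... \<le> \<bar>\<nu>\<bar> * (\<bar>1 - \<kappa>\<bar> / 2)" using q by (intro mult_left_mono) auto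
   also have "... = 1/2" using \<kappa> by (simp add: \<nu>_def)
   finally show ?thesis by linarith
  qed
  have xY: "1/2 \<le> x / Y" "x / Y \<le> 2" if "x \<in> {Y..(1 + \<eta>) * Y}" for x
  proof -
   have "1 \<le> x / Y" using that Y by auto
   then show "1/2 \<le> x / Y" by linarith
   have "x / Y \<le> 1 + \<eta>" using that Y by (simp add: field_simps)
   then show "x / Y \<le> 2" using \<eta> by linarith
  qed
  have eq: "(\<Sum>l\<in>I. c l * ec (\<mu> l * Y * (x / (\<mu> l * Y)) powr \<nu> * ph \<kappa> \<tau>)) = tpoly I \<theta> c (z x)"
   if x: "x \<in> {Y..(1 + \<eta>) * Y}" for x
   unfolding tpoly_def
  proof (rule sum.cong[OF refl])
   fix l assume l: "l \<in> I"
   have "x / (\<mu> l * Y) = (x / Y) / \<mu> l" by simp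
   then have "(x / (\<mu> l * Y)) powr \<nu> = (x / Y) powr \<nu> / \<mu> l powr \<nu>"
    using x Y \<mu>[OF l] by (simp only: powr_divide)
   moreover have "\<mu> l powr (1 - \<nu>) = \<mu> l / \<mu> l powr \<nu>" using \<mu>[OF l] by (simp add: powr_diff)
   ultimately have "\<mu> l * Y * (x / (\<mu> l * Y)) powr \<nu> * ph \<kappa> \<tau> = z x * \<theta> l"
    by (simp add: z_def \<theta>_def)
   then show "c l * ec (\<mu> l * Y * (x / (\<mu> l * Y)) powr \<nu> * ph \<kappa> \<tau>) = c l * ec (z x * \<theta> l)"
    by (simp only:)
  qed
  have z_deriv: "(z has_real_derivative z' x) (at x)" if x: "x \<in> {Y..(1 + \<eta>) * Y}" for x
  proof -
   have x0: "x / Y > 0" using x Y by auto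
   have "((\<lambda>x. (x / Y) powr \<nu>) has_real_derivative (\<nu> * (x / Y) powr (\<nu> - 1)) * (1 / Y)) (at x)"
    by (rule powr_scale_deriv[OF x0])
   then have "((\<lambda>x. Y * (x / Y) powr \<nu> * ph \<kappa> \<tau>) has_real_derivative Y * ((\<nu> * (x / Y) powr (\<nu> - 1)) * (1 / Y)) * ph \<kappa> \<tau>) (at x)"
    by (intro DERIV_cmult DERIV_cmult_right)
   then show ?thesis using Y by (simp add: z_def z'_def mult_ac)
  qed
  have z'_ge: "z' x \<ge> c0" if x: "x \<in> {Y..(1 + \<eta>) * Y}" for x
  proof -
   have "c0 = (1/2) * 2 powr (- \<bar>\<nu> - 1\<bar>)" by (simp add: c0_def)
   also have "... \<le> z' x" unfolding z'_def
    using \<nu>q powr_two_sided_bounds(1)[OF xY[OF x], of "\<nu> - 1"] by (intro mult_mono) auto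
   finally show ?thesis .
  qed
  have z_abs: "\<bar>z x\<bar> \<le> X0 * Y" if x: "x \<in> {Y..(1 + \<eta>) * Y}" for x
  proof -
   have "\<bar>ph \<kappa> \<tau>\<bar> \<le> \<bar>ph \<kappa> \<tau> - (1 - \<kappa>)\<bar> + \<bar>1 - \<kappa>\<bar>"
    by (metis abs_triangle_ineq diff_add_cancel)
   also have "... \<le> \<bar>1 - \<kappa>\<bar> / 2 + \<bar>1 - \<kappa>\<bar>" using q by (rule add_right_mono)
   also have "... \<le> 2 * \<bar>1 - \<kappa>\<bar>" by simp
   finally have "\<bar>ph \<kappa> \<tau>\<bar> \<le> 2 * \<bar>1 - \<kappa>\<bar>" .
   then have "\<bar>z x\<bar> \<le> Y * 2 powr \<bar>\<nu>\<bar> * (2 * \<bar>1 - \<kappa>\<bar>)"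
    using Y powr_two_sided_bounds(2)[OF xY[OF x], of \<nu>] unfolding z_def abs_mult
    by (intro mult_mono) auto
   also have "... = (2 powr \<bar>\<nu>\<bar> * (2 * \<bar>1 - \<kappa>\<bar>)) * Y" by simp
   also have "... \<le> X0 * Y" using Y unfolding X0_def by (intro mult_right_mono) auto
   finally show ?thesis .
  qed
  have YY: "Y \<le> (1 + \<eta>) * Y" using Y \<eta> by simp
  have "integral {Y..(1 + \<eta>) * Y} (\<lambda>x. norm (\<Sum>l\<in>I. c l * ec (\<mu> l * Y * (x / (\<mu> l * Y)) powr \<nu> * ph \<kappa> \<tau>)) ^ 4)
   = integral {Y..(1 + \<eta>) * Y} (\<lambda>x. norm (tpoly I \<theta> c (z x)) ^ 4)"
   by (rule integral_cong) (simp only: eq)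
  also have "... \<le> (1 / c0) * integral {z Y..z ((1 + \<eta>) * Y)} (\<lambda>y. norm (tpoly I \<theta> c y) ^ 4)"
   by (rule integral_substitution_le[OF YY c0 z_deriv z'_ge])
    (use Y xY in \<open>force simp: z'_def intro!: continuous_intros\<close>)+
  also have "... \<le> (1 / c0) * (exp pi * (X0 * Y) * energy I \<theta> (X0 * Y))"
  proof (intro mult_left_mono interval_moment_le c)
   show "0 < X0 * Y" using Y X0 by simp
   show "z ((1 + \<eta>) * Y) - z Y \<le> 2 * (X0 * Y)"
    using z_abs[of Y] z_abs[of "(1 + \<eta>) * Y"] YY by auto
  qed (use c0 in auto)
  also have "... \<le> (1 / c0) * (exp pi * (X0 * Y) * energy I \<theta> Y)"
  proof (intro mult_left_mono energy_antimono)
   show "Y \<le> X0 * Y" using Y X0 by simp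
  qed (use Y c0 X0 in auto)
  also have "... = K * Y * energy I \<theta> Y" by (simp add: K_def)
  finally show "integral {Y..(1 + \<eta>) * Y} (\<lambda>x. norm (\<Sum>l\<in>I. c l * ec (\<mu> l * Y * (x / (\<mu> l * Y)) powr \<nu> * ph \<kappa> \<tau>)) ^ 4)
   \<le> K * Y * energy I (\<lambda>l. \<mu> l powr (1 - \<nu>)) Y" unfolding \<theta>_def .
 qed
qed

text \<open>Minkowski's inequality in \<tau> with an envelope decaying like 1 / (1 + Y (\<tau> -
  1)^2); for fixed \<tau> the amplitude varies slowly in x and is removed, which leaves the moment
  of the separated phase. The mass of the envelope is of order Y powr (- 1/2), and its fourth power
  times the length Y gives the factor 1 / Y.\<close>

lemma stationary_moment:
 fixes w w1 w2 :: "real => real"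
 assumes \<kappa>: "\<kappa> \<noteq> 0" "\<kappa> \<noteq> 1"
  and c: "0 < \<beta>" "\<beta> \<le> 1/4" "0 < \<eta>" "\<eta> \<le> 1/4" "0 < \<delta>" "\<delta> \<le> 1/2"
  and T_range: "\<And>\<mu> \<xi>. \<bar>\<mu> - 1\<bar> \<le> \<beta> ==> 1 \<le> \<xi> ==> \<xi> \<le> 1 + \<eta> ==> 1/2 \<le> (\<xi> / \<mu>) powr (1 / (1 - \<kappa>)) \<and> (\<xi> / \<mu>) powr (1 / (1 - \<kappa>)) \<le> 2"
  and near: "\<And>t \<mu> \<xi>. \<bar>t - 1\<bar> \<le> \<eta> ==> \<bar>\<mu> - 1\<bar> \<le> \<beta> ==> 1 \<le> \<xi> ==> \<xi> \<le> 1 + \<eta> ==> \<bar>t / (\<xi> / \<mu>) powr (1 / (1 - \<kappa>)) - 1\<bar> < \<delta>"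
  and ph_near: "\<And>\<tau>. \<bar>\<tau> - 1\<bar> \<le> \<delta> ==> \<bar>\<tau> powr \<kappa> - \<kappa> * \<tau> - (1 - \<kappa>)\<bar> \<le> \<bar>1 - \<kappa>\<bar> / 2"
  and w: "\<And>t. (w has_real_derivative w1 t) (at t)" "\<And>t. (w1 has_real_derivative w2 t) (at t)" "continuous_on UNIV w2"
  and supp: "\<And>t. \<bar>t - 1\<bar> \<ge> \<eta> ==> w t = 0"
  and bd: "\<And>t. \<bar>w t\<bar> \<le> C" "\<And>t. \<bar>w1 t\<bar> \<le> C" "\<And>t. \<bar>w2 t\<bar> \<le> C" "C \<ge> 1"
 obtains K where "K > 0" "\<And>Y (I :: 'a set) \<mu>. Y > 0 ==> finite I ==> (\<And>l. l \<in> I ==> \<bar>\<mu> l - 1\<bar> \<le> \<beta>) ==>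
  continuous_on {Y..(1 + \<eta>) * Y} (\<lambda>x. \<Sum>l\<in>I. integral {1 - \<eta>..1 + \<eta>} (\<lambda>t. of_real (w t) * ec (x * t powr \<kappa> - \<kappa> * (\<mu> l * Y) * t))) \<and>
  integral {Y..(1 + \<eta>) * Y} (\<lambda>x. norm (\<Sum>l\<in>I. integral {1 - \<eta>..1 + \<eta>} (\<lambda>t. of_real (w t) * ec (x * t powr \<kappa> - \<kappa> * (\<mu> l * Y) * t))) ^ 4)
   \<le> K / Y * energy I (\<lambda>l. \<mu> l powr (1 - 1 / (1 - \<kappa>))) Y"
proof -
 define \<nu> where "\<nu> = 1 / (1 - \<kappa>)"
 obtain Ka where Ka: "Ka > 0" "\<And>Y \<omega> \<tau>. Y > 0 ==> Y / 2 \<le> \<omega> ==> \<omega> \<le> 2 * Y ==> \<bar>\<tau> - 1\<bar> \<le> 1/2 ==>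
  c1_bounded (Ka / (1 + Y * (\<tau> - 1)^2)) (amp \<kappa> w w1 \<omega> \<tau>)"
  using amp_c1_bounded[OF \<kappa> w bd] by blast
 obtain Kb where Kb: "Kb > 0" "\<forall>Y \<tau> (c :: 'a => complex) (I :: 'a set) (\<mu> :: 'a => real). Y > 0 --> finite I --> (\<forall>l\<in>I. \<mu> l > 0) -->
  \<bar>ph \<kappa> \<tau> - (1 - \<kappa>)\<bar> \<le> \<bar>1 - \<kappa>\<bar> / 2 --> (\<forall>l\<in>I. norm (c l) \<le> 1) -->
  integral {Y..(1 + \<eta>) * Y} (\<lambda>x. norm (\<Sum>l\<in>I. c l * ec (\<mu> l * Y * (x / (\<mu> l * Y)) powr \<nu> * ph \<kappa> \<tau>)) ^ 4)
   \<le> Kb * Y * energy I (\<lambda>l. \<mu> l powr (1 - \<nu>)) Y"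
  using scaled_phase_moment[OF \<kappa>(2) c(3,4), folded \<nu>_def, where 'a = 'a] by blast
 \<comment> \<open>The amplitude depends on x through T \<le> 2, whose derivative is \<nu> T / x;
   the summand 2 |\<nu>| accounts for it.\<close>
 define Kc where "Kc = Ka * (1 + 2 * \<bar>\<nu>\<bar>)"
 have Kc: "Kc > 0" using Ka(1) by (simp add: Kc_def add_pos_nonneg)
 define K where "K = (2 * Kc * pi) ^ 4 * Kb"
 have K: "K > 0" using Kc Kb(1) by (simp add: K_def)
 have cw: "continuous_on UNIV w" "continuous_on UNIV w1" using w by (auto intro!: DERIV_continuous_on)
 show ?thesis
 proof (rule that[OF K])
  fix Y :: real and I :: "'a set" and \<mu>
  assume Y: "Y > 0" and I: "finite I" and \<mu>: "\<And>l. l \<in> I ==> \<bar>\<mu> l - 1\<bar> \<le> \<beta>"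
  let ?X = "{Y..(1 + \<eta>) * Y}" and ?T = "{1 - \<delta>..1 + \<delta>}"
  define En where "En = energy I (\<lambda>l. \<mu> l powr (1 - \<nu>)) Y"
  define \<omega> where "\<omega> = (\<lambda>l. \<mu> l * Y)"
  define T where "T = (\<lambda>l x. (x / \<omega> l) powr \<nu>)"
  have \<mu>_pos: "\<mu> l > 0" "\<mu> l \<ge> 1/2" "\<mu> l \<le> 2" if "l \<in> I" for l using \<mu>[OF that] c by linarith+
  have \<omega>: "\<omega> l > 0" "Y / 2 \<le> \<omega> l" "\<omega> l \<le> 2 * Y" if "l \<in> I" for l
   using \<mu>_pos[OF that] Y mult_right_mono[of "1/2" "\<mu> l" Y] by (auto simp: \<omega>_def)
  have x_pos: "x > 0" if "x \<in> ?X" for x using that Y by auto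
  have xY: "1 \<le> x / Y" "x / Y \<le> 1 + \<eta>" if "x \<in> ?X" for x using that Y by (auto simp: field_simps)
  have T_eq: "T l x = ((x / Y) / \<mu> l) powr (1 / (1 - \<kappa>))" for l x by (simp add: T_def \<omega>_def \<nu>_def mult.commute)
  have T: "T l x \<in> {1/2..2}" if "l \<in> I" "x \<in> ?X" for l x
   using T_range[OF \<mu>[OF that(1)] xY[OF that(2)]] by (simp add: T_eq)
  define J where "J = (\<lambda>l x. integral {1 - \<eta>..1 + \<eta>} (\<lambda>t. of_real (w t) * ec (x * t powr \<kappa> - \<kappa> * \<omega> l * t)))"
  define A where "A = (\<lambda>\<tau> l x. amp \<kappa> w w1 (\<omega> l) \<tau> (T l x))"
  define b where "b = (\<lambda>\<tau> l x. ec (\<omega> l * T l x * ph \<kappa> \<tau>))"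
  have J_eq: "J l x = integral ?T (\<lambda>\<tau>. A \<tau> l x * b \<tau> l x)" if "l \<in> I" "x \<in> ?X" for l x
  proof -
   have "\<bar>t / (x / \<omega> l) powr (1 / (1 - \<kappa>)) - 1\<bar> < \<delta>" if "\<bar>t - 1\<bar> \<le> \<eta>" for t
    using near[OF that \<mu>[OF \<open>l \<in> I\<close>] xY[OF \<open>x \<in> ?X\<close>]] by (simp add: \<omega>_def mult.commute)
   from stationary_formula[OF c(3-6) w(1) cw(2) supp x_pos[OF that(2)] \<omega>(1)[OF that(1)] \<kappa>(2) this]
   show ?thesis by (simp add: J_def A_def b_def T_def \<nu>_def)
  qed
  have \<tau>_pos: "\<tau> > 0" "\<bar>\<tau> - 1\<bar> \<le> \<delta>" "\<bar>\<tau> - 1\<bar> \<le> 1/2" if "\<tau> \<in> ?T" for \<tau>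
  proof -
   have "1 - \<delta> \<le> \<tau>" "\<tau> \<le> 1 + \<delta>" using that by auto
   then show "\<tau> > 0" "\<bar>\<tau> - 1\<bar> \<le> \<delta>" "\<bar>\<tau> - 1\<bar> \<le> 1/2" using c(5,6) by linarith+
  qed
  have cont_T: "continuous_on ?X (T l)" if "l \<in> I" for l
   unfolding T_def
   by (rule DERIV_continuous_on, rule has_field_derivative_at_within, rule powr_scale_deriv)
    (rule divide_pos_pos[OF x_pos \<omega>(1)[OF that]])
  have x_nz: "\<forall>x\<in>?X. x \<noteq> 0" using x_pos by force
  have nz: "1 + \<i> * complex_of_real r \<noteq> 0" for r
  proof -
   have "Re (1 + \<i> * complex_of_real r) = 1" by simp
   then show ?thesis by force
  qed
  have cont_fT: "continuous_on (?X \<times> ?T) (\<lambda>p. T l (fst p))" if "l \<in> I" for l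
   by (rule continuous_on_compose2[OF cont_T[OF that]]) (auto intro!: continuous_intros)
  have cont_A: "continuous_on (?X \<times> ?T) (\<lambda>p. A (snd p) l (fst p))" if l: "l \<in> I" for l
   unfolding A_def amp_def Let_def using \<tau>_pos(1)
   by (intro continuous_intros cont_fT l continuous_on_compose2[OF cw(1)] continuous_on_compose2[OF cw(2)] nz ballI)
    (auto simp: mem_Times_iff)
  have cont_b: "continuous_on (?X \<times> ?T) (\<lambda>p. b (snd p) l (fst p))" if l: "l \<in> I" for l
   unfolding b_def using \<tau>_pos(1) by (intro continuous_intros cont_fT l) auto
  define f where "f = (\<lambda>x \<tau>. norm (\<Sum>l\<in>I. A \<tau> l x * b \<tau> l x))"
  have cont_sum: "continuous_on (?X \<times> ?T) (\<lambda>p. \<Sum>l\<in>I. A (snd p) l (fst p) * b (snd p) l (fst p))"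
   by (intro continuous_intros cont_A cont_b)
  have cont_f: "continuous_on (?X \<times> ?T) (\<lambda>(x, \<tau>). f x \<tau>)"
   unfolding f_def case_prod_unfold by (intro continuous_intros cont_A cont_b)
  have cont_slice: "continuous_on ?T (\<lambda>\<tau>. A \<tau> l x * b \<tau> l x)" if "l \<in> I" "x \<in> ?X" for l x
  proof -
   have "continuous_on ?T (\<lambda>\<tau>. (\<lambda>p. A (snd p) l (fst p) * b (snd p) l (fst p)) (x, \<tau>))"
    by (rule continuous_on_compose2[OF continuous_on_mult[OF cont_A[OF that(1)] cont_b[OF that(1)]]])
     (use that in \<open>auto intro!: continuous_intros\<close>)
   then show ?thesis by simp
  qed
  have sum_eq: "(\<Sum>l\<in>I. J l x) = integral ?T (\<lambda>\<tau>. \<Sum>l\<in>I. A \<tau> l x * b \<tau> l x)" if x: "x \<in> ?X" for x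
  proof -
   have "(\<Sum>l\<in>I. J l x) = (\<Sum>l\<in>I. integral ?T (\<lambda>\<tau>. A \<tau> l x * b \<tau> l x))"
    by (intro sum.cong refl J_eq x)
   also have "... = integral ?T (\<lambda>\<tau>. \<Sum>l\<in>I. A \<tau> l x * b \<tau> l x)"
    by (intro Henstock_Kurzweil_Integration.integral_sum[symmetric] I integrable_continuous_real cont_slice x)
   finally show ?thesis .
  qed
  have cont_J: "continuous_on ?X (\<lambda>x. \<Sum>l\<in>I. J l x)"
  proof -
   have "continuous_on ?X (\<lambda>x. integral (cbox (1 - \<delta>) (1 + \<delta>)) (\<lambda>\<tau>. \<Sum>l\<in>I. A \<tau> l x * b \<tau> l x))"
    by (rule integral_continuous_on_param) (use cont_sum in \<open>simp add: case_prod_unfold\<close>)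
   then show ?thesis by (rule continuous_on_eq) (simp add: sum_eq)
  qed
  \<comment> \<open>The factor 2 absorbs the constant 16 = 2^4 of
    \<open>moment_smooth_coefficients\<close>.\<close>
  define \<rho> where "\<rho> = (\<lambda>\<tau>. 2 * Kc / (1 + Y * (\<tau> - 1)^2))"
  have den: "1 + Y * (\<tau> - 1)^2 > 0" for \<tau> using Y by (simp add: add_pos_nonneg)
  have fixed: "integral ?X (\<lambda>x. f x \<tau> ^ 4) \<le> \<rho> \<tau> ^ 4 * (Kb * Y * En)" if \<tau>: "\<tau> \<in> ?T" for \<tau>
  proof -
   define a where "a = Ka / (1 + Y * (\<tau> - 1)^2)"
   define a2 where "a2 = Kc / (1 + Y * (\<tau> - 1)^2)"
   have a: "a > 0" using Ka(1) den by (simp add: a_def)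
   have a2: "a2 = a * (1 + 2 * \<bar>\<nu>\<bar>)" by (simp add: a_def a2_def Kc_def)
   have a2_pos: "a2 > 0" using a by (simp add: a2 add_pos_nonneg)
   have "\<forall>l\<in>I. \<exists>g. continuous_on {1/2..2} g \<and>
    (\<forall>s\<in>{1/2..2}. (amp \<kappa> w w1 (\<omega> l) \<tau> has_vector_derivative g s) (at s within {1/2..2}) \<and> norm (amp \<kappa> w w1 (\<omega> l) \<tau> s) \<le> a \<and> norm (g s) \<le> a)"
    using Ka(2)[OF Y _ _ \<tau>_pos(3)[OF \<tau>]] \<omega> unfolding c1_bounded_def a_def by blast
   then obtain g where g: "\<And>l. l \<in> I ==> continuous_on {1/2..2} (g l)"
    "\<And>l s. l \<in> I ==> s \<in> {1/2..2} ==> (amp \<kappa> w w1 (\<omega> l) \<tau> has_vector_derivative g l s) (at s within {1/2..2})"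
    "\<And>l s. l \<in> I ==> s \<in> {1/2..2} ==> norm (amp \<kappa> w w1 (\<omega> l) \<tau> s) \<le> a"
    "\<And>l s. l \<in> I ==> s \<in> {1/2..2} ==> norm (g l s) \<le> a"
    by metis
   define T' where "T' = (\<lambda>l x. \<nu> * T l x / x)"
   have T_deriv: "(T l has_vector_derivative T' l x) (at x within ?X)" if l: "l \<in> I" and x: "x \<in> ?X" for l x
   proof -
    have "x / \<omega> l > 0" using x_pos[OF x] \<omega>[OF l] by simp
    then have "((\<lambda>x. (x / \<omega> l) powr \<nu>) has_real_derivative (\<nu> * (x / \<omega> l) powr (\<nu> - 1)) * (1 / \<omega> l)) (at x)"
     by (rule powr_scale_deriv)
    moreover have "(\<nu> * (x / \<omega> l) powr (\<nu> - 1)) * (1 / \<omega> l) = T' l x"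
     using x_pos[OF x] \<omega>[OF l] by (simp add: T'_def T_def powr_diff)
    ultimately show ?thesis
     by (simp add: T_def[abs_def] has_real_derivative_iff_has_vector_derivative has_vector_derivative_at_within)
   qed
   have T'_bound: "\<bar>T' l x\<bar> \<le> 2 * \<bar>\<nu>\<bar> / Y" if l: "l \<in> I" and x: "x \<in> ?X" for l x
   proof -
    have "\<bar>T' l x\<bar> = \<bar>\<nu>\<bar> * \<bar>T l x\<bar> / x" using x_pos[OF x] by (simp add: T'_def abs_mult)
    also have "... \<le> \<bar>\<nu>\<bar> * 2 / Y"
     using T[OF l x] x Y by (intro frac_le mult_left_mono) auto
    finally show ?thesis by (simp only: mult.commute)
   qed
   have "integral ?X (\<lambda>x. norm (\<Sum>l\<in>I. A \<tau> l x * b \<tau> l x) ^ 4) \<le> 16 * a2 ^ 4 * (Kb * Y * En)"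
   proof (rule moment_smooth_coefficients[where Y = Y and \<alpha>' = "\<lambda>l x. T' l x *\<^sub>R g l (T l x)"])
    show "Y \<le> (1 + \<eta>) * Y" using Y c by simp
    have "\<eta> * Y \<le> 1 * Y" using c Y by (intro mult_right_mono) auto
    then show "(1 + \<eta>) * Y - Y \<le> Y" by (simp add: distrib_right)
    fix l assume l: "l \<in> I"
    have TX: "T l ` ?X \<subseteq> {1/2..2}" using T[OF l] by blast
    show "continuous_on ?X (\<lambda>x. T' l x *\<^sub>R g l (T l x))"
     unfolding T'_def
     by (intro continuous_intros cont_T l continuous_on_compose2[OF g(1)[OF l] cont_T[OF l] TX] x_nz)
    show "continuous_on ?X (b \<tau> l)"
     unfolding b_def by (intro continuous_intros cont_T l)
    fix x assume x: "x \<in> ?X"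
    have "(amp \<kappa> w w1 (\<omega> l) \<tau> \<circ> T l has_vector_derivative T' l x *\<^sub>R g l (T l x)) (at x within ?X)"
     by (rule vector_diff_chain_within[OF T_deriv[OF l x]])
      (rule has_vector_derivative_within_subset[OF g(2)[OF l T[OF l x]] TX])
    then show "(A \<tau> l has_vector_derivative T' l x *\<^sub>R g l (T l x)) (at x within ?X)"
     by (simp add: A_def o_def)
    show "norm (A \<tau> l x) \<le> a2"
    proof -
     have "norm (A \<tau> l x) \<le> a * 1" unfolding A_def using g(3)[OF l T[OF l x]] by simp
     also have "... \<le> a2" unfolding a2 using a by (intro mult_left_mono) auto
     finally show ?thesis .
    qed
    have "norm (T' l x *\<^sub>R g l (T l x)) \<le> (2 * \<bar>\<nu>\<bar> / Y) * a"
     unfolding norm_scaleR by (intro mult_mono T'_bound[OF l x] g(4)[OF l T[OF l x]]) (use Y in auto)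
    also have "... = (a * (2 * \<bar>\<nu>\<bar>)) / Y" by simp
    also have "... \<le> a2 / Y" unfolding a2 using a Y by (intro divide_right_mono mult_left_mono) auto
    finally show "norm (T' l x *\<^sub>R g l (T l x)) \<le> a2 / Y" .
   next
    fix c' :: "'a => complex" assume c': "\<And>l. l \<in> I ==> norm (c' l) \<le> 1"
    have "\<bar>ph \<kappa> \<tau> - (1 - \<kappa>)\<bar> \<le> \<bar>1 - \<kappa>\<bar> / 2"
     using ph_near[OF \<tau>_pos(2)[OF \<tau>]] by (simp add: ph_def)
    with Kb(2)[rule_format, where c = c' and I = I and \<mu> = \<mu> and Y = Y and \<tau> = \<tau>] Y I \<mu>_pos(1) c'
    show "integral ?X (\<lambda>x. norm (\<Sum>l\<in>I. c' l * b \<tau> l x) ^ 4) \<le> Kb * Y * En"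
     by (simp add: b_def T_def \<omega>_def En_def)
   qed (use Y I a2_pos in auto)
   also have "16 * a2 ^ 4 = \<rho> \<tau> ^ 4" by (simp add: \<rho>_def a2_def power_mult_distrib power_divide)
   finally show ?thesis by (simp add: f_def)
  qed
  have mink: "integral ?X (\<lambda>x. integral ?T (f x) ^ 4) \<le> integral ?T \<rho> ^ 4 * (Kb * Y * En)"
  proof (rule minkowski_power4[OF _ _ cont_f _ _ _ fixed])
   show "Y \<le> (1 + \<eta>) * Y" using Y c by simp
   show "1 - \<delta> \<le> 1 + \<delta>" using c by simp
   show "continuous_on ?T \<rho>" unfolding \<rho>_def using den by (intro continuous_intros) (auto dest: less_imp_neq[symmetric] simp: less_imp_neq[symmetric])
   show "\<rho> \<tau> > 0" for \<tau> using den Kc by (simp add: \<rho>_def)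
  qed (auto simp: f_def)
  have rho: "integral ?T \<rho> \<le> 2 * Kc * pi / sqrt Y"
  proof -
   have "integral ?T \<rho> = 2 * Kc * integral ?T (\<lambda>\<tau>. 1 / (1 + Y * (\<tau> - 1)^2))"
    by (simp add: \<rho>_def flip: Henstock_Kurzweil_Integration.integral_mult_right)
   also have "... \<le> 2 * Kc * (pi / sqrt Y)"
    using Kc Y c by (intro mult_left_mono integral_lorentz_le) auto
   finally show ?thesis by simp
  qed
  have En0: "En \<ge> 0" by (simp add: En_def energy_nonneg)
  have "integral ?X (\<lambda>x. norm (\<Sum>l\<in>I. J l x) ^ 4) \<le> integral ?X (\<lambda>x. integral ?T (f x) ^ 4)"
  proof (intro integral_le integrable_continuous_real)
   show "continuous_on ?X (\<lambda>x. norm (\<Sum>l\<in>I. J l x) ^ 4)" by (intro continuous_intros cont_J)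
   have "continuous_on ?X (\<lambda>x. integral (cbox (1 - \<delta>) (1 + \<delta>)) (f x))"
    by (rule integral_continuous_on_param) (use cont_f in simp)
   then show "continuous_on ?X (\<lambda>x. integral ?T (f x) ^ 4)" by (intro continuous_intros) simp
   fix x assume x: "x \<in> ?X"
   have "norm (\<Sum>l\<in>I. J l x) \<le> integral ?T (f x)"
    unfolding sum_eq[OF x] f_def
    by (intro integral_norm_bound_integral integrable_continuous_real continuous_intros cont_slice x) auto
   then show "norm (\<Sum>l\<in>I. J l x) ^ 4 \<le> integral ?T (f x) ^ 4" by (intro power_mono) auto
  qed
  also have "... \<le> integral ?T \<rho> ^ 4 * (Kb * Y * En)" by (rule mink)
  also have "... \<le> (2 * Kc * pi / sqrt Y) ^ 4 * (Kb * Y * En)"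
  proof (intro mult_right_mono power_mono rho)
   show "0 \<le> integral ?T \<rho>"
    unfolding \<rho>_def using Kc den
    by (intro integral_nonneg integrable_continuous_real continuous_intros) (auto simp: less_imp_le less_imp_neq[symmetric])
  qed (use Kb Y En0 in auto)
  also have "... = K / Y * En"
  proof -
   have "sqrt Y ^ 4 = Y^2" using Y by (simp add: power4_eq_xxxx power2_eq_square)
   then show ?thesis using Y by (simp add: K_def power_divide power2_eq_square)
  qed
  finally show "continuous_on ?X (\<lambda>x. \<Sum>l\<in>I. integral {1 - \<eta>..1 + \<eta>} (\<lambda>t. of_real (w t) * ec (x * t powr \<kappa> - \<kappa> * (\<mu> l * Y) * t))) \<and>
  integral ?X (\<lambda>x. norm (\<Sum>l\<in>I. integral {1 - \<eta>..1 + \<eta>} (\<lambda>t. of_real (w t) * ec (x * t powr \<kappa> - \<kappa> * (\<mu> l * Y) * t))) ^ 4)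
   \<le> K / Y * energy I (\<lambda>l. \<mu> l powr (1 - 1 / (1 - \<kappa>))) Y"
   using cont_J by (simp add: J_def \<omega>_def En_def \<nu>_def)
 qed
qed

text \<open>If u is not close to \<kappa> Y, the derivative of the phase is at least a constant
  times Y + |u|, while the higher derivatives are only of order Y. The inverse square is what makes
  the sum over the dual frequencies converge.\<close>

lemma nonstationary_phase:
 fixes w w1 w2 :: "real => real"
 assumes \<kappa>: "\<kappa> \<noteq> 0" and c: "0 < \<beta>" "\<beta> \<le> 1/4" "0 < \<eta>" "\<eta> \<le> 1/4"
  and far: "\<And>t \<xi>. \<bar>t - 1\<bar> \<le> \<eta> ==> 1 \<le> \<xi> ==> \<xi> \<le> 1 + \<eta> ==> \<bar>\<xi> * t powr (\<kappa> - 1) - 1\<bar> \<le> \<beta> / 2"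
  and w: "\<And>t. (w has_real_derivative w1 t) (at t)" "\<And>t. (w1 has_real_derivative w2 t) (at t)" "continuous_on UNIV w2"
  and supp: "\<And>t. \<bar>t - 1\<bar> \<ge> \<eta> ==> w t = 0 \<and> w1 t = 0 \<and> w2 t = 0"
  and bd: "\<And>t. \<bar>w t\<bar> \<le> C" "\<And>t. \<bar>w1 t\<bar> \<le> C" "\<And>t. \<bar>w2 t\<bar> \<le> C" "C \<ge> 1"
 shows "\<exists>K>0. \<forall>Y x u. Y > 0 --> Y \<le> x --> x \<le> (1 + \<eta>) * Y --> \<bar>u / (\<kappa> * Y) - 1\<bar> > \<beta> -->
  norm (integral {1 - \<eta>..1 + \<eta>} (\<lambda>t. of_real (w t) * ec (x * t powr \<kappa> - u * t))) \<le> K / (Y + \<bar>u\<bar>)^2"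
proof -
 \<comment> \<open>With \<mu> = u / (\<kappa> Y) one has \<beta> (1 + |\<mu>|) \<le> 3 |\<mu> - 1|;
   another factor 2 is lost because \<xi> t powr (\<kappa> - 1) is only within \<beta> / 2 of 1. The
   minimum serves the two summands Y and |u| at once.\<close>
 define b0 where "b0 = \<beta> / 6 * min 1 \<bar>\<kappa>\<bar>"
 have b0: "b0 > 0" "b0 \<le> \<beta> / 6 * \<bar>\<kappa>\<bar>" "b0 \<le> \<beta> / 6" using \<kappa> c by (auto simp: b0_def)
 define a2 where "a2 = \<bar>\<kappa> * (\<kappa> - 1)\<bar> * (2 * 2 powr \<bar>\<kappa> - 2\<bar>)"
 define a3 where "a3 = \<bar>\<kappa> * (\<kappa> - 1) * (\<kappa> - 2)\<bar> * (2 * 2 powr \<bar>\<kappa> - 3\<bar>)"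
 have a23: "a2 \<ge> 0" "a3 \<ge> 0" by (simp_all add: a2_def a3_def)
 define A where "A = 1 + (a2 + a3) / b0"
 have A1: "A \<ge> 1" using a23 b0 by (simp add: A_def)
 have Ab: "a2 \<le> A * b0" "a3 \<le> A * b0" using a23 b0 by (auto simp: A_def field_simps)
 define K where "K = 8 * A^2 * C / b0^2"
 have K: "K > 0" using A1 bd(4) b0 by (simp add: K_def)
 show ?thesis
 proof (intro exI[of _ K] conjI K allI impI)
  fix Y x u :: real
  assume Y: "Y > 0" and x: "Y \<le> x" "x \<le> (1 + \<eta>) * Y" and u: "\<bar>u / (\<kappa> * Y) - 1\<bar> > \<beta>"
  define B where "B = b0 * (Y + \<bar>u\<bar>)"
  have B: "B > 0" using b0 Y by (simp add: B_def add_pos_nonneg)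
  have bY: "b0 * Y \<le> B" using b0 by (simp add: B_def)
  let ?I = "{1 - \<eta>..1 + \<eta>}"
  have t: "\<bar>t - 1\<bar> \<le> \<eta>" "t > 0" "1/2 \<le> t" "t \<le> 2" if "t \<in> ?I" for t
  proof -
   have "1 - \<eta> \<le> t" "t \<le> 1 + \<eta>" using that by auto
   then show "\<bar>t - 1\<bar> \<le> \<eta>" "t > 0" "1/2 \<le> t" "t \<le> 2" using c by linarith+
  qed
  have x2: "0 < x" "x \<le> 2 * Y"
  proof -
   show "0 < x" using x Y by linarith
   have "(1 + \<eta>) * Y \<le> 2 * Y" using c Y by (intro mult_right_mono) auto
   then show "x \<le> 2 * Y" using x by linarith
  qed
  define p where "p = (\<lambda>t. x * t powr \<kappa> - u * t)"
  define p1 where "p1 = (\<lambda>t. x * (\<kappa> * t powr (\<kappa> - 1)) - u)"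
  define p2 where "p2 = (\<lambda>t. x * (\<kappa> * ((\<kappa> - 1) * t powr (\<kappa> - 2))))"
  define p3 where "p3 = (\<lambda>t. x * (\<kappa> * ((\<kappa> - 1) * ((\<kappa> - 2) * t powr (\<kappa> - 3)))))"
  have pw: "((\<lambda>t. t powr r) has_real_derivative r * t powr (r - 1)) (at t within A)" if "t > 0" for r t A
   by (rule has_field_derivative_at_within[OF has_real_derivative_powr[OF that]])
  have pd: "(p has_real_derivative p1 t) (at t within ?I)" if "t \<in> ?I" for t
  proof -
   have "(p has_real_derivative x * (\<kappa> * t powr (\<kappa> - 1)) - u * 1) (at t within ?I)"
    unfolding p_def by (intro DERIV_diff DERIV_cmult pw t(2) that DERIV_ident)
   then show ?thesis by (simp add: p1_def)
  qed
  have p1d: "(p1 has_real_derivative p2 t) (at t within ?I)" if "t \<in> ?I" for t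
  proof -
   have "(p1 has_real_derivative x * (\<kappa> * ((\<kappa> - 1) * t powr (\<kappa> - 1 - 1))) - 0) (at t within ?I)"
    unfolding p1_def by (intro DERIV_diff DERIV_cmult pw t(2) that DERIV_const)
   then show ?thesis by (simp add: p2_def)
  qed
  have p2d: "(p2 has_real_derivative p3 t) (at t within ?I)" if "t \<in> ?I" for t
  proof -
   have "(p2 has_real_derivative x * (\<kappa> * ((\<kappa> - 1) * ((\<kappa> - 2) * t powr (\<kappa> - 2 - 1))))) (at t within ?I)"
    unfolding p2_def by (intro DERIV_cmult pw t(2) that)
   then show ?thesis by (simp add: p3_def)
  qed
  have p1_ge: "\<bar>p1 t\<bar> \<ge> B" if ti: "t \<in> ?I" for t
  proof -
   define \<mu> where "\<mu> = u / (\<kappa> * Y)"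
   define \<zeta> where "\<zeta> = (x / Y) * t powr (\<kappa> - 1)"
   have "\<bar>\<zeta> - 1\<bar> \<le> \<beta> / 2"
    unfolding \<zeta>_def using x Y by (intro far t(1)[OF ti]) (auto simp: field_simps)
   moreover have "\<bar>\<mu> - 1\<bar> > \<beta>" using u by (simp add: \<mu>_def)
   moreover have "\<bar>\<mu> - 1\<bar> \<le> \<bar>\<zeta> - \<mu>\<bar> + \<bar>\<zeta> - 1\<bar>"
    using abs_triangle_ineq4[of "\<zeta> - 1" "\<zeta> - \<mu>"] by simp
   moreover have "d \<ge> a / 2" if "z \<le> \<beta> / 2" "\<beta> < a" "a \<le> d + z" for a d z :: real using that by linarith
   ultimately have d: "\<bar>\<zeta> - \<mu>\<bar> \<ge> \<bar>\<mu> - 1\<bar> / 2" by blast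
   have "\<beta> * (1 + \<bar>\<mu>\<bar>) \<le> \<beta> * (2 + \<bar>\<mu> - 1\<bar>)" using c by (intro mult_left_mono) auto
   also have "... = 2 * \<beta> + \<beta> * \<bar>\<mu> - 1\<bar>" by (simp add: algebra_simps)
   also have "... \<le> 2 * \<bar>\<mu> - 1\<bar> + 1 * \<bar>\<mu> - 1\<bar>"
    using \<open>\<bar>\<mu> - 1\<bar> > \<beta>\<close> c by (intro add_mono mult_right_mono) auto
   finally have "\<beta> * (1 + \<bar>\<mu>\<bar>) \<le> 3 * \<bar>\<mu> - 1\<bar>" by simp
   then have "\<beta> / 6 * (1 + \<bar>\<mu>\<bar>) \<le> \<bar>\<zeta> - \<mu>\<bar>" using d by linarith
   then have "\<bar>\<kappa>\<bar> * Y * (\<beta> / 6 * (1 + \<bar>\<mu>\<bar>)) \<le> \<bar>\<kappa>\<bar> * Y * \<bar>\<zeta> - \<mu>\<bar>"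
    using Y by (intro mult_left_mono) auto
   also have "... = \<bar>\<kappa> * Y * (\<zeta> - \<mu>)\<bar>" using Y by (simp add: abs_mult)
   also have "\<kappa> * Y * (\<zeta> - \<mu>) = p1 t" using Y \<kappa> by (simp add: p1_def \<zeta>_def \<mu>_def field_simps)
   finally have "\<bar>\<kappa>\<bar> * Y * (\<beta> / 6 * (1 + \<bar>\<mu>\<bar>)) \<le> \<bar>p1 t\<bar>" .
   moreover have "\<bar>\<kappa>\<bar> * Y * (\<beta> / 6 * (1 + \<bar>\<mu>\<bar>)) = (\<beta> / 6 * \<bar>\<kappa>\<bar>) * Y + \<beta> / 6 * \<bar>u\<bar>"
    using Y \<kappa> by (simp add: \<mu>_def abs_mult field_simps)
   moreover have "b0 * Y + b0 * \<bar>u\<bar> \<le> (\<beta> / 6 * \<bar>\<kappa>\<bar>) * Y + \<beta> / 6 * \<bar>u\<bar>"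
    using b0 Y by (intro add_mono mult_right_mono) auto
   ultimately show ?thesis by (simp add: B_def distrib_left)
  qed
  have p2_le: "\<bar>p2 t\<bar> \<le> A * B" if ti: "t \<in> ?I" for t
  proof -
   have "\<bar>p2 t\<bar> = \<bar>\<kappa> * (\<kappa> - 1)\<bar> * (x * t powr (\<kappa> - 2))" using x2 by (simp add: p2_def abs_mult)
   also have "... \<le> \<bar>\<kappa> * (\<kappa> - 1)\<bar> * (2 * Y * 2 powr \<bar>\<kappa> - 2\<bar>)"
    using x2 powr_two_sided_bounds(2)[OF t(3,4)[OF ti], of "\<kappa> - 2"] by (intro mult_left_mono mult_mono) auto
   also have "... = a2 * Y" by (simp add: a2_def)
   also have "... \<le> (A * b0) * Y" using Ab Y by (intro mult_right_mono) auto
   also have "... \<le> A * B" using bY A1 by (simp add: mult.assoc)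
   finally show ?thesis .
  qed
  have p3_le: "\<bar>p3 t\<bar> \<le> A * B" if ti: "t \<in> ?I" for t
  proof -
   have "\<bar>p3 t\<bar> = \<bar>\<kappa> * (\<kappa> - 1) * (\<kappa> - 2)\<bar> * (x * t powr (\<kappa> - 3))" using x2 by (simp add: p3_def abs_mult)
   also have "... \<le> \<bar>\<kappa> * (\<kappa> - 1) * (\<kappa> - 2)\<bar> * (2 * Y * 2 powr \<bar>\<kappa> - 3\<bar>)"
    using x2 powr_two_sided_bounds(2)[OF t(3,4)[OF ti], of "\<kappa> - 3"] by (intro mult_left_mono mult_mono) auto
   also have "... = a3 * Y" by (simp add: a3_def)
   also have "... \<le> (A * b0) * Y" using Ab Y by (intro mult_right_mono) auto
   also have "... \<le> A * B" using bY A1 by (simp add: mult.assoc)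
   finally show ?thesis .
  qed
  have p3c: "continuous_on ?I p3"
   unfolding p3_def using t(2) by (intro continuous_intros) force
  have "norm (integral ?I (\<lambda>t. of_real (w t) * ec (p t))) \<le> 8 * A^2 * C / B^2 * (1 + \<eta> - (1 - \<eta>))"
   by (rule nonstationary_integral_bound[where W = w and ?W1.0 = w1 and ?W2.0 = w2 and p = p and ?p1.0 = p1 and ?p2.0 = p2 and ?p3.0 = p3])
    (use c supp[of "1 - \<eta>"] supp[of "1 + \<eta>"] A1 bd B in \<open>auto intro: has_field_derivative_at_within[OF w(1)] has_field_derivative_at_within[OF w(2)]
      continuous_on_subset[OF w(3)] pd p1d p2d p3c p1_ge p2_le p3_le\<close>)
  also have "... \<le> 8 * A^2 * C / B^2 * 1"
   using c bd(4) by (intro mult_left_mono) auto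
  also have "... = K / (Y + \<bar>u\<bar>)^2" by (simp add: K_def B_def power_mult_distrib)
  finally show "norm (integral {1 - \<eta>..1 + \<eta>} (\<lambda>t. of_real (w t) * ec (x * t powr \<kappa> - u * t))) \<le> K / (Y + \<bar>u\<bar>)^2"
   by (simp add: p_def)
 qed
qed

text \<open>Poisson summation for w (t / S) times the exponential of x (t / S) powr \<kappa>,
  rescaled by t = S u. The bump vanishes near 0, which hides the singularity of the power, and
  beyond 2 S, which makes a finite range of summation sufficient.\<close>

lemma bump_poisson:
 fixes w w1 w2 :: "real => real" and x \<kappa> S :: real
 assumes \<eta>: "0 < \<eta>" "\<eta> \<le> 1/4" and S: "S \<ge> 1"
  and w: "\<And>t. (w has_real_derivative w1 t) (at t)" "\<And>t. (w1 has_real_derivative w2 t) (at t)" "continuous_on UNIV w2"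
  and supp: "\<And>t. \<bar>t - 1\<bar> \<ge> \<eta> ==> w t = 0 \<and> w1 t = 0 \<and> w2 t = 0"
 defines "J \<equiv> \<lambda>l :: int. integral {1 - \<eta>..1 + \<eta>} (\<lambda>t. of_real (w t) * ec (x * t powr \<kappa> - real_of_int l * S * t))"
 shows "(\<lambda>n. of_real S * (J (int n + 1) + J (- (int n + 1)))) sums
  (tpoly {s. \<bar>real s / S - 1\<bar> \<le> \<eta>} (\<lambda>s. (real s / S) powr \<kappa>) (\<lambda>s. of_real (w (real s / S))) x - of_real S * J 0)"
proof -
 define c where "c = 2 * pi * \<i>"
 define e where "e = (\<lambda>u. ec (x * u powr \<kappa>))"
 define d1 where "d1 = (\<lambda>u. c * of_real (x * (\<kappa> * u powr (\<kappa> - 1))))"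
 define d2 where "d2 = (\<lambda>u. c * of_real (x * (\<kappa> * ((\<kappa> - 1) * u powr (\<kappa> - 2)))))"
 define G where "G = (\<lambda>u. of_real (w u) * e u)"
 define G1 where "G1 = (\<lambda>u. of_real (w u) * (d1 u * e u) + of_real (w1 u) * e u)"
 define G2 where "G2 = (\<lambda>u. (of_real (w u) * (d1 u * (d1 u * e u) + d2 u * e u) + of_real (w1 u) * (d1 u * e u))
   + (of_real (w1 u) * (d1 u * e u) + of_real (w2 u) * e u))"
 have w': "((\<lambda>u. complex_of_real (w u)) has_vector_derivative of_real (w1 u)) (at u)" for u
  by (rule has_vector_derivative_of_real[OF w(1)])
 have w1': "((\<lambda>u. complex_of_real (w1 u)) has_vector_derivative of_real (w2 u)) (at u)" for u
  by (rule has_vector_derivative_of_real[OF w(2)])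
 have e': "(e has_vector_derivative d1 u * e u) (at u)" if "u > 0" for u
  using ec_has_vector_derivative[OF DERIV_cmult[OF has_real_derivative_powr[OF that, of \<kappa>], of x]]
  by (simp add: e_def d1_def c_def mult_ac)
 have d1': "(d1 has_vector_derivative d2 u) (at u)" if "u > 0" for u
 proof -
  have "((\<lambda>u. x * (\<kappa> * u powr (\<kappa> - 1))) has_real_derivative x * (\<kappa> * ((\<kappa> - 1) * u powr (\<kappa> - 1 - 1)))) (at u)"
   by (intro DERIV_cmult has_real_derivative_powr that)
  then show ?thesis unfolding d1_def d2_def
   by (intro has_vector_derivative_mult_right has_vector_derivative_of_real) simp
 qed
 have zero: "w u = 0" "w1 u = 0" "w2 u = 0" if "u < 3/4" for u
  using supp[of u] that \<eta> by auto
 have G0: "G u = 0" "G1 u = 0" "G2 u = 0" if "u < 3/4" for u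
  using zero[OF that] by (simp_all add: G_def G1_def G2_def)
 have vanish: "(f has_vector_derivative 0) (at u)" if "u < 3/4" "\<And>v. v < 3/4 ==> f v = 0" for f :: "real => complex" and u
  by (rule has_vector_derivative_transform_within_open[of "\<lambda>_. 0" _ _ "{..<3/4}"]) (use that in auto)
 have G_deriv: "(G has_vector_derivative G1 u) (at u)" for u
 proof (cases "u < 3/4")
  case False
  then show ?thesis unfolding G_def G1_def
   by (intro has_vector_derivative_mult w' e') auto
 qed (use vanish[of u G] G0 in auto)
 have G1_deriv: "(G1 has_vector_derivative G2 u) (at u)" for u
 proof (cases "u < 3/4")
  case False
  then show ?thesis unfolding G1_def G2_def
   by (intro has_vector_derivative_add has_vector_derivative_mult w' w1' e' d1') auto
 qed (use vanish[of u G1] G0 in auto)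
 have cw: "continuous_on A w" "continuous_on A w1" "continuous_on A w2" for A
 proof -
  show "continuous_on A w" "continuous_on A w1"
   by (rule DERIV_continuous_on, rule has_field_derivative_at_within, rule w)+
  show "continuous_on A w2" using w(3) by (rule continuous_on_subset) auto
 qed
 have G2_cont: "continuous_on UNIV G2"
 proof -
  \<comment> \<open>Continuity is glued from two overlapping open half-lines: on one all factors are
    smooth or continuous, on the other G2 is 0.\<close>
  have "continuous_on {1/2<..} G2"
   unfolding G2_def e_def d1_def d2_def by (intro continuous_intros cw) auto
  moreover have "continuous_on {..<3/4} G2"
   using G0(3) by (intro continuous_on_eq[OF continuous_on_const[of _ 0]]) auto
  ultimately have "continuous_on ({1/2<..} \<union> {..<3/4}) G2" by (intro continuous_on_open_Un) auto
  also have "{1/2<..} \<union> {..<3/4} = (UNIV :: real set)" by auto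
  finally show ?thesis .
 qed
 define K where "K = nat \<lceil>2 * S\<rceil>"
 have K: "real K \<ge> 2 * S" unfolding K_def by linarith
 define g where "g = (\<lambda>t. G (t / S))"
 have sc: "((\<lambda>t. t / S) has_real_derivative 1 / S) (at t)" for t
  by (rule DERIV_cdivide[OF DERIV_ident])
 have chain: "((\<lambda>t. f (t / S)) has_vector_derivative f' / of_real S) (at t)"
  if "(f has_vector_derivative f') (at (t / S))" for f :: "real => complex" and f' t
  using vector_diff_chain_at[OF sc[of t, unfolded has_real_derivative_iff_has_vector_derivative] that]
  by (simp add: o_def scaleR_conv_of_real)
 have g_deriv: "(g has_vector_derivative G1 (t / S) / of_real S) (at t)" for t
  unfolding g_def by (rule chain[OF G_deriv])
 have g1_deriv: "((\<lambda>t. G1 (t / S) / of_real S) has_vector_derivative G2 (t / S) / of_real S / of_real S) (at t)" for t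
  by (rule has_vector_derivative_divide[OF chain[OF G1_deriv]])
 have K1: "\<bar>real K / S - 1\<bar> \<ge> \<eta>"
 proof -
  have "real K / S \<ge> 2" using K S by (simp add: field_simps)
  then show ?thesis using \<eta> by linarith
 qed
 have far: "G u = 0" "G1 u = 0" if "\<bar>u - 1\<bar> \<ge> \<eta>" for u using supp[OF that] by (simp_all add: G_def G1_def)
 have P: "(\<lambda>n. integral {0..real K} (\<lambda>t. g t * ec (real (Suc n) * t)) + integral {0..real K} (\<lambda>t. g t * ec (- (real (Suc n) * t))))
     sums ((\<Sum>s<K. g (real s)) - integral {0..real K} g)"
 proof (rule poisson_summation[OF g_deriv g1_deriv])
  show "continuous_on UNIV (\<lambda>t. G2 (t / S) / of_real S / of_real S)"
   using S by (intro continuous_intros continuous_on_compose2[OF G2_cont]) auto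
 qed (use far[of 0] far[of "real K / S"] K1 \<eta> in \<open>auto simp: g_def\<close>)
 have J_eq: "integral {0..real K} (\<lambda>t. g t * ec (- (real_of_int l * t))) = of_real S * J l" for l
 proof -
  define h where "h = (\<lambda>t. of_real (w t) * ec (x * t powr \<kappa> - real_of_int l * S * t))"
  have h_cont: "continuous_on {0..real K / S} h"
  proof -
   have "continuous_on {0..real K / S} (\<lambda>t. G t * ec (- (real_of_int l * S * t)))"
    using G_deriv by (intro continuous_intros continuous_on_vector_derivative[of _ G]) (auto intro: has_vector_derivative_at_within)
   then show ?thesis by (rule continuous_on_eq) (simp add: G_def h_def e_def mult.assoc flip: ec_add)
  qed
  have sub: "{1 - \<eta>..1 + \<eta>} \<subseteq> {0..real K / S}"
  proof -
   have "real K / S \<ge> 2" using K S by (simp add: field_simps)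
   then show ?thesis using \<eta> by auto
  qed
  have "J l = integral ({1 - \<eta>..1 + \<eta>} \<inter> {0..real K / S}) h"
   unfolding J_def h_def by (simp only: Int_absorb2[OF sub])
  also have "... = integral {0..real K / S} (\<lambda>t. if t \<in> {1 - \<eta>..1 + \<eta>} then h t else 0)"
   by (rule integral_restrict_Int[symmetric])
  also have "... = integral {0..real K / S} h"
  proof (rule integral_cong)
   fix t
   have "w t = 0" if "t \<notin> {1 - \<eta>..1 + \<eta>}" using that supp[of t] by (auto simp: abs_if)
   then show "(if t \<in> {1 - \<eta>..1 + \<eta>} then h t else 0) = h t" by (auto simp: h_def)
  qed
  finally have Jh: "J l = integral {0..real K / S} h" .
  have "(h has_integral integral {0..real K / S} h) (cbox 0 (real K / S))"
   using h_cont by (auto intro!: integrable_integral integrable_continuous_real)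
  from has_integral_affinity'[OF this, of "1 / S" 0]
  have "((\<lambda>t. h (t / S)) has_integral S *\<^sub>R integral {0..real K / S} h) {0..real K}"
   using S by simp
  moreover have "h (t / S) = g t * ec (- (real_of_int l * t))" for t
   using S by (simp add: g_def G_def h_def e_def mult.assoc flip: ec_add)
  ultimately show ?thesis by (simp add: Jh integral_unique scaleR_conv_of_real)
 qed
 have Jp: "integral {0..real K} (\<lambda>t. g t * ec (real (Suc n) * t)) = of_real S * J (- (int n + 1))" for n
 proof -
  have "(\<lambda>t. g t * ec (- (real_of_int (- (int n + 1)) * t))) = (\<lambda>t. g t * ec (real (Suc n) * t))"
   by (rule ext) (simp add: algebra_simps)
  then show ?thesis using J_eq[of "- (int n + 1)"] by simp
 qed
 have Jm: "integral {0..real K} (\<lambda>t. g t * ec (- (real (Suc n) * t))) = of_real S * J (int n + 1)" for n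
 proof -
  have "(\<lambda>t. g t * ec (- (real_of_int (int n + 1) * t))) = (\<lambda>t. g t * ec (- (real (Suc n) * t)))"
   by (rule ext) (simp add: algebra_simps)
  then show ?thesis using J_eq[of "int n + 1"] by simp
 qed
 have "(\<lambda>n. of_real S * (J (int n + 1) + J (- (int n + 1)))) = (\<lambda>n. integral {0..real K} (\<lambda>t. g t * ec (real (Suc n) * t)) + integral {0..real K} (\<lambda>t. g t * ec (- (real (Suc n) * t))))"
  unfolding Jp Jm by (rule ext) (simp add: distrib_left add.commute)
 moreover have "integral {0..real K} g = of_real S * J 0" using J_eq[of 0] by simp
 moreover have "(\<Sum>s<K. g (real s)) = tpoly {s. \<bar>real s / S - 1\<bar> \<le> \<eta>} (\<lambda>s. (real s / S) powr \<kappa>) (\<lambda>s. of_real (w (real s / S))) x"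
  unfolding tpoly_def
 proof (rule sum.mono_neutral_cong_right)
  show "{s. \<bar>real s / S - 1\<bar> \<le> \<eta>} \<subseteq> {..<K}"
  proof
   fix s assume "s \<in> {s. \<bar>real s / S - 1\<bar> \<le> \<eta>}"
   then have "real s / S < 2" using \<eta> by auto
   then show "s \<in> {..<K}" using K S by (simp add: field_simps)
  qed
  show "\<forall>i\<in>{..<K} - {s. \<bar>real s / S - 1\<bar> \<le> \<eta>}. g (real i) = 0"
   using far(1) by (auto simp: g_def)
 qed (auto simp: g_def G_def e_def)
 ultimately show ?thesis using P by simp
qed

section \<open>The spacing of fractional powers\<close>

text \<open>The terms are the expected orders of magnitude: S^2 for diagonal quadruples, and S^4 / X
  for random frequencies at resolution 1 / X. The parameter \<theta> measures the loss in the
  diagonal term. Frequencies are normalised to order 1, so X is the resolution relative to their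
  size.\<close>

definition spacing :: "real => real => bool" where
 "spacing \<kappa> \<theta> \<longleftrightarrow> (\<exists>C\<ge>0. \<forall>S>0. \<forall>X>0.
  energy {s :: nat. S / 2 \<le> real s \<and> real s \<le> 2 * S} (\<lambda>s. (real s / S) powr \<kappa>) X \<le> C * (S powr (2 + \<theta>) + S ^ 4 / X))"

text \<open>Translates the paired enumeration of nonzero integers delivered by Poisson summation
  into a sum over a symmetric interval.\<close>

lemma sum_int_symmetric:
 fixes D :: "int => 'a :: comm_monoid_add"
 shows "(\<Sum>n<M. D (int n + 1) + D (- (int n + 1))) + D 0 = (\<Sum>l\<in>{- int M..int M}. D l)"
proof (induction M)
 case (Suc M)
 have "{- int (Suc M)..int (Suc M)} = insert (int M + 1) (insert (- (int M + 1)) {- int M..int M})" by auto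
 then have "(\<Sum>l\<in>{- int (Suc M)..int (Suc M)}. D l) = D (int M + 1) + (D (- (int M + 1)) + (\<Sum>l\<in>{- int M..int M}. D l))"
  by simp
 also have "... = D (int M + 1) + (D (- (int M + 1)) + ((\<Sum>n<M. D (int n + 1) + D (- (int n + 1))) + D 0))"
  by (simp only: Suc)
 also have "... = (\<Sum>n<Suc M. D (int n + 1) + D (- (int n + 1))) + D 0"
  by (simp add: add_ac)
 finally show ?case by simp
qed simp

text \<open>A stationary frequency l has the sign of \<kappa>, so |l| determines it, and l S /
  (\<kappa> Y) = |l| / L. The stationary frequencies are thus part of a dyadic block around L, where
  the assumed spacing bound applies.\<close>

lemma stationary_energy_le:
 fixes \<kappa> \<theta> :: real
 assumes \<kappa>: "\<kappa> \<noteq> 0" and \<beta>: "0 < \<beta>" "\<beta> \<le> 1/4" and pos: "S > 0" "Y > 0" and C: "C \<ge> 0"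
  and sp: "\<And>S X. S > 0 ==> X > 0 ==> energy {s :: nat. S / 2 \<le> real s \<and> real s \<le> 2 * S} (\<lambda>s. (real s / S) powr r) X \<le> C * (S powr (2 + \<theta>) + S ^ 4 / X)"
 defines "St \<equiv> {l :: int. \<bar>real_of_int l * S / (\<kappa> * Y) - 1\<bar> \<le> \<beta>}" and "L \<equiv> \<bar>\<kappa>\<bar> * Y / S"
 shows "finite St" "0 \<notin> St"
  "energy St (\<lambda>l. (real_of_int l * S / (\<kappa> * Y)) powr r) Y \<le> C * (L powr (2 + \<theta>) + L ^ 4 / Y)"
proof -
 have L: "L > 0" using \<kappa> pos by (simp add: L_def)
 have key: "real (nat \<bar>l\<bar>) / L = real_of_int l * S / (\<kappa> * Y)" "l \<noteq> 0" "sgn (real_of_int l) = sgn \<kappa>"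
  "L / 2 \<le> real (nat \<bar>l\<bar>)" "real (nat \<bar>l\<bar>) \<le> 2 * L" if l: "l \<in> St" for l
 proof -
  have b: "1/2 \<le> real_of_int l * S / (\<kappa> * Y)" "real_of_int l * S / (\<kappa> * Y) \<le> 2" using l \<beta> unfolding St_def mem_Collect_eq abs_le_iff by linarith+
  then have p: "real_of_int l * S / (\<kappa> * Y) > 0" by linarith
  then have "(real_of_int l / \<kappa>) * (S / Y) > 0" by (simp only: times_divide_times_eq)
  then have p2: "real_of_int l / \<kappa> > 0" using zero_less_mult_pos2[OF _ divide_pos_pos[OF pos]] by blast
  then show "l \<noteq> 0" "sgn (real_of_int l) = sgn \<kappa>" by (auto simp: zero_less_divide_iff sgn_if)
  have "real_of_int \<bar>l\<bar> / \<bar>\<kappa>\<bar> = real_of_int l / \<kappa>" using p2 by (auto simp: zero_less_divide_iff abs_if)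
  moreover have "real (nat \<bar>l\<bar>) / L = (real_of_int \<bar>l\<bar> / \<bar>\<kappa>\<bar>) * (S / Y)" by (simp add: L_def)
  ultimately show eq: "real (nat \<bar>l\<bar>) / L = real_of_int l * S / (\<kappa> * Y)" by (simp only: times_divide_times_eq)
  show "L / 2 \<le> real (nat \<bar>l\<bar>)" "real (nat \<bar>l\<bar>) \<le> 2 * L" using b L unfolding eq[symmetric] by (simp_all add: field_simps)
 qed
 show "0 \<notin> St" using key(2) by blast
 have inj: "inj_on (\<lambda>l. nat \<bar>l\<bar>) St"
 proof (rule inj_onI)
  fix l l' assume "l \<in> St" "l' \<in> St" "nat \<bar>l\<bar> = nat \<bar>l'\<bar>"
  then have "\<bar>l\<bar> = \<bar>l'\<bar>" "sgn (real_of_int l) = sgn (real_of_int l')" using key(3) by auto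
  then show "l = l'" by (auto simp: sgn_if abs_if split: if_splits)
 qed
 have sub: "(\<lambda>l. nat \<bar>l\<bar>) ` St \<subseteq> {s. L / 2 \<le> real s \<and> real s \<le> 2 * L}" using key(4,5) by blast
 have fin: "finite {s :: nat. L / 2 \<le> real s \<and> real s \<le> 2 * L}"
  by (rule finite_subset[of _ "{..nat \<lfloor>2 * L\<rfloor>}"]) (auto simp: le_nat_floor)
 show "finite St" using finite_imageD[OF finite_subset[OF sub fin] inj] .
 have "energy St (\<lambda>l. (real_of_int l * S / (\<kappa> * Y)) powr r) Y = energy ((\<lambda>l. nat \<bar>l\<bar>) ` St) (\<lambda>s. (real s / L) powr r) Y"
  unfolding energy_reindex[OF inj] by (rule energy_cong) (simp only: key(1))
 also have "... \<le> energy {s. L / 2 \<le> real s \<and> real s \<le> 2 * L} (\<lambda>s. (real s / L) powr r) Y"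
  by (rule energy_mono_set[OF fin sub pos(2)])
 also have "... \<le> C * (L powr (2 + \<theta>) + L ^ 4 / Y)" by (rule sp[OF L pos(2)])
 finally show "energy St (\<lambda>l. (real_of_int l * S / (\<kappa> * Y)) powr r) Y \<le> C * (L powr (2 + \<theta>) + L ^ 4 / Y)" .
qed

text \<open>The duality step: after Poisson summation the main contribution comes from frequencies
  near L = |\<kappa>| Y / S, and their fourth moment is governed by the energy for the dual
  exponent. Inserting L into S^4 / Y (L powr (2 + \<theta>) + L^4 / Y) gives the first two terms.
  The nonstationary frequencies contribute the last term and a share of Y^2.\<close>

lemma window_moment:
 fixes \<kappa> \<theta> :: real
 assumes \<kappa>: "\<kappa> \<noteq> 0" "\<kappa> \<noteq> 1" and sp: "spacing (\<kappa> / (\<kappa> - 1)) \<theta>"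
 shows "\<exists>\<eta> w C K. 0 < \<eta> \<and> \<eta> \<le> 1/4 \<and> (\<forall>t. 0 \<le> w t \<and> w t \<le> C) \<and> (\<forall>t. \<bar>t - 1\<bar> \<le> \<eta> / 2 --> w t \<ge> 1) \<and>
  (\<forall>S\<ge>1. \<forall>Y\<ge>1. integral {Y..(1 + \<eta>) * Y}
   (\<lambda>x. norm (tpoly {s. \<bar>real s / S - 1\<bar> \<le> \<eta>} (\<lambda>s. (real s / S) powr \<kappa>) (\<lambda>s. of_real (w (real s / S))) x) ^ 4)
   \<le> K * (S powr (2 - \<theta>) * Y powr (1 + \<theta>) + Y^2 + S ^ 4 / Y))"
proof -
 obtain \<beta> \<eta> \<delta> where c: "0 < \<beta>" "\<beta> \<le> 1/4" "0 < \<eta>" "\<eta> \<le> 1/4" "0 < \<delta>" "\<delta> \<le> 1/2"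
  and far: "\<And>t \<xi>. \<bar>t - 1\<bar> \<le> \<eta> ==> 1 \<le> \<xi> ==> \<xi> \<le> 1 + \<eta> ==> \<bar>\<xi> * t powr (\<kappa> - 1) - 1\<bar> \<le> \<beta> / 2"
  and T_range: "\<And>\<mu> \<xi>. \<bar>\<mu> - 1\<bar> \<le> \<beta> ==> 1 \<le> \<xi> ==> \<xi> \<le> 1 + \<eta> ==> 1/2 \<le> (\<xi> / \<mu>) powr (1 / (1 - \<kappa>)) \<and> (\<xi> / \<mu>) powr (1 / (1 - \<kappa>)) \<le> 2"
  and near: "\<And>t \<mu> \<xi>. \<bar>t - 1\<bar> \<le> \<eta> ==> \<bar>\<mu> - 1\<bar> \<le> \<beta> ==> 1 \<le> \<xi> ==> \<xi> \<le> 1 + \<eta> ==> \<bar>t / (\<xi> / \<mu>) powr (1 / (1 - \<kappa>)) - 1\<bar> < \<delta>"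
  and ph_near: "\<And>\<tau>. \<bar>\<tau> - 1\<bar> \<le> \<delta> ==> \<bar>\<tau> powr \<kappa> - \<kappa> * \<tau> - (1 - \<kappa>)\<bar> \<le> \<bar>1 - \<kappa>\<bar> / 2"
  apply (rule stationary_constants[OF \<kappa>(2)])
  subgoal premises prems for \<beta> \<eta> \<delta> by (rule prems(1)[OF prems(2-)])
  done
 obtain w w1 w2 :: "real => real" and C where
  w: "\<And>t. (w has_real_derivative w1 t) (at t)" "\<And>t. (w1 has_real_derivative w2 t) (at t)" "continuous_on UNIV w2"
  and w0: "\<And>t. w t \<ge> 0" "\<And>t. \<bar>t - 1\<bar> \<le> \<eta> / 2 ==> w t \<ge> 1"
  and supp: "\<And>t. \<bar>t - 1\<bar> \<ge> \<eta> ==> w t = 0 \<and> w1 t = 0 \<and> w2 t = 0"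
  and bd: "\<And>t. \<bar>w t\<bar> \<le> C" "\<And>t. \<bar>w1 t\<bar> \<le> C" "\<And>t. \<bar>w2 t\<bar> \<le> C" "C \<ge> 1"
  apply (rule bump_function[OF c(3)])
  subgoal premises prems for w w1 w2 C by (rule prems(1)[OF prems(2-)])
  done
 have supp': "\<And>t. \<bar>t - 1\<bar> \<ge> \<eta> ==> w t = 0" using supp by blast
 obtain K1 where K1: "K1 > 0" "\<And>Y (I :: int set) \<mu>. Y > 0 ==> finite I ==> (\<And>l. l \<in> I ==> \<bar>\<mu> l - 1\<bar> \<le> \<beta>) ==>
  continuous_on {Y..(1 + \<eta>) * Y} (\<lambda>x. \<Sum>l\<in>I. integral {1 - \<eta>..1 + \<eta>} (\<lambda>t. of_real (w t) * ec (x * t powr \<kappa> - \<kappa> * (\<mu> l * Y) * t))) \<and>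
  integral {Y..(1 + \<eta>) * Y} (\<lambda>x. norm (\<Sum>l\<in>I. integral {1 - \<eta>..1 + \<eta>} (\<lambda>t. of_real (w t) * ec (x * t powr \<kappa> - \<kappa> * (\<mu> l * Y) * t))) ^ 4)
   \<le> K1 / Y * energy I (\<lambda>l. \<mu> l powr (1 - 1 / (1 - \<kappa>))) Y"
  apply (rule stationary_moment[OF \<kappa> c T_range near ph_near w supp' bd, where 'a = int])
      apply assumption+
  subgoal premises prems for K by (rule prems(1)[OF prems(2-)])
  done
 obtain K2 where K2: "K2 > 0" "\<forall>Y x u. Y > 0 --> Y \<le> x --> x \<le> (1 + \<eta>) * Y --> \<bar>u / (\<kappa> * Y) - 1\<bar> > \<beta> -->
  norm (integral {1 - \<eta>..1 + \<eta>} (\<lambda>t. of_real (w t) * ec (x * t powr \<kappa> - u * t))) \<le> K2 / (Y + \<bar>u\<bar>)^2"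
  using nonstationary_phase[OF \<kappa>(1) c(1-4) far w supp bd] by blast
 have "1 - 1 / (1 - \<kappa>) = \<kappa> / (\<kappa> - 1)" using \<kappa> by (simp add: field_simps)
 then obtain K3 where K3: "K3 \<ge> 0" "\<And>S X. S > 0 ==> X > 0 ==>
   energy {s :: nat. S / 2 \<le> real s \<and> real s \<le> 2 * S} (\<lambda>s. (real s / S) powr (1 - 1 / (1 - \<kappa>))) X \<le> K3 * (S powr (2 + \<theta>) + S ^ 4 / X)"
  using sp unfolding spacing_def by auto
 define Ka where "Ka = K1 * K3 * (\<bar>\<kappa>\<bar> powr (2 + \<theta>) + \<bar>\<kappa>\<bar> ^ 4)"
 define Kb where "Kb = K2 * (1 + pi^2 / 3)"
 define K where "K = 8 * (Ka + 8 * Kb ^ 4)"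
 have Ka: "Ka \<ge> 0" and Kb: "Kb \<ge> 0" using K1 K2 K3 by (auto simp: Ka_def Kb_def)
 have main: "integral {Y..(1 + \<eta>) * Y}
   (\<lambda>x. norm (tpoly {s. \<bar>real s / S - 1\<bar> \<le> \<eta>} (\<lambda>s. (real s / S) powr \<kappa>) (\<lambda>s. of_real (w (real s / S))) x) ^ 4)
   \<le> K * (S powr (2 - \<theta>) * Y powr (1 + \<theta>) + Y^2 + S ^ 4 / Y)" if S: "S \<ge> 1" and Y: "Y \<ge> 1" for S Y
 proof -
  let ?X = "{Y..(1 + \<eta>) * Y}"
  define F where "F = tpoly {s. \<bar>real s / S - 1\<bar> \<le> \<eta>} (\<lambda>s. (real s / S) powr \<kappa>) (\<lambda>s. of_real (w (real s / S)))"
  define St where "St = {l :: int. \<bar>real_of_int l * S / (\<kappa> * Y) - 1\<bar> \<le> \<beta>}"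
  define L where "L = \<bar>\<kappa>\<bar> * Y / S"
  define \<mu> where "\<mu> = (\<lambda>l :: int. real_of_int l * S / (\<kappa> * Y))"
  have SY: "S > 0" "Y > 0" using S Y by auto
  have St: "finite St" "0 \<notin> St" "energy St (\<lambda>l. \<mu> l powr (1 - 1 / (1 - \<kappa>))) Y \<le> K3 * (L powr (2 + \<theta>) + L ^ 4 / Y)"
   using stationary_energy_le[OF \<kappa>(1) c(1,2) SY K3] unfolding St_def L_def \<mu>_def by blast+
  define J where "J = (\<lambda>x (l :: int). integral {1 - \<eta>..1 + \<eta>} (\<lambda>t. of_real (w t) * ec (x * t powr \<kappa> - real_of_int l * S * t)))"
  have J\<mu>: "J x l = integral {1 - \<eta>..1 + \<eta>} (\<lambda>t. of_real (w t) * ec (x * t powr \<kappa> - \<kappa> * (\<mu> l * Y) * t))" for x l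
   using SY \<kappa> by (simp add: J_def \<mu>_def)
  have \<mu>_near: "\<And>l. l \<in> St ==> \<bar>\<mu> l - 1\<bar> \<le> \<beta>" by (simp add: St_def \<mu>_def)
  have Jcont: "continuous_on ?X (\<lambda>x. \<Sum>l\<in>St. J x l)"
   and Jmom: "integral ?X (\<lambda>x. norm (\<Sum>l\<in>St. J x l) ^ 4) \<le> K1 / Y * energy St (\<lambda>l. \<mu> l powr (1 - 1 / (1 - \<kappa>))) Y"
   using K1(2)[of Y St \<mu>] SY(2) St(1) \<mu>_near unfolding J\<mu> by blast+
  have small: "norm (J x l) \<le> K2 / (Y + \<bar>real_of_int l * S\<bar>)^2" if "x \<in> ?X" "l \<notin> St" for x l
   using K2(2)[rule_format, of Y x "real_of_int l * S"] that SY by (auto simp: J_def St_def not_le)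
  \<comment> \<open>The frequency 0 contributes S / Y^2; the frequencies n \<noteq> 0 contribute the
    sum of S / (n S)^2, of order 1 / S.\<close>
  define R where "R = Kb * (S / Y^2 + 1 / S)"
  have R0: "R \<ge> 0" using Kb SY by (simp add: R_def)
  have pt: "norm (F x) \<le> S * norm (\<Sum>l\<in>St. J x l) + R" if x: "x \<in> ?X" for x
  proof -
   define D where "D = (\<lambda>l. if l \<in> St then J x l else 0)"
   define E where "E = (\<lambda>l. if l \<in> St then 0 else J x l)"
   have DE: "J x l = D l + E l" for l by (simp add: D_def E_def)
   have J0: "J x 0 = E 0" using St(2) by (simp add: E_def)
   obtain M :: nat where M: "St \<subseteq> {- int M..int M}"
   proof -
    have "finite ((\<lambda>l. nat \<bar>l\<bar>) ` St)" using St(1) by simp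
    then obtain M where "\<forall>m\<in>(\<lambda>l. nat \<bar>l\<bar>) ` St. m \<le> M" using finite_nat_set_iff_bounded_le by metis
    then have "St \<subseteq> {- int M..int M}" by force
    then show ?thesis using that by blast
   qed
   have Dsum: "(\<lambda>n. D (int n + 1) + D (- (int n + 1))) sums (\<Sum>l\<in>St. J x l)"
   proof -
    have out: "D (int n + 1) = 0" "D (- (int n + 1)) = 0" if "n \<notin> {..<M}" for n
    proof -
     have "int n + 1 \<notin> {- int M..int M}" "- (int n + 1) \<notin> {- int M..int M}" using that by auto
     then have "int n + 1 \<notin> St" "- (int n + 1) \<notin> St" using M by blast+
     then show "D (int n + 1) = 0" "D (- (int n + 1)) = 0" by (simp_all add: D_def)
    qed
    have "(\<lambda>n. D (int n + 1) + D (- (int n + 1))) sums (\<Sum>n<M. D (int n + 1) + D (- (int n + 1)))"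
     by (rule sums_finite) (use out in auto)
    also have "(\<Sum>n<M. D (int n + 1) + D (- (int n + 1))) = (\<Sum>l\<in>{- int M..int M}. D l)"
     using sum_int_symmetric[of D M] St(2) by (simp add: D_def)
    also have "... = (\<Sum>l\<in>St. J x l)"
     using M by (intro sum.mono_neutral_cong_right) (auto simp: D_def)
    finally show ?thesis .
   qed
   have "(\<lambda>n. of_real S * (J x (int n + 1) + J x (- (int n + 1)))) sums (F x - of_real S * J x 0)"
    unfolding F_def J_def by (rule bump_poisson[OF c(3,4) S w supp])
   from sums_diff[OF this sums_mult[OF Dsum, of "of_real S"]]
   have diff: "(\<lambda>n. of_real S * (J x (int n + 1) + J x (- (int n + 1))) - of_real S * (D (int n + 1) + D (- (int n + 1))))
     sums (F x - of_real S * J x 0 - of_real S * (\<Sum>l\<in>St. J x l))" .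
   have "of_real S * (J x a + J x b) - of_real S * (D a + D b) = of_real S * (E a + E b)" for a b
    unfolding DE by (simp add: algebra_simps)
   then have Esum: "(\<lambda>n. of_real S * (E (int n + 1) + E (- (int n + 1)))) sums (F x - of_real S * E 0 - of_real S * (\<Sum>l\<in>St. J x l))"
    using diff unfolding J0 by simp
   have Ebound: "norm (E l) \<le> K2 / (Y + \<bar>real_of_int l * S\<bar>)^2" for l
    using small[OF x, of l] K2(1) by (auto simp: E_def)
   have Eb: "norm (of_real S * (E (int n + 1) + E (- (int n + 1)))) \<le> 2 * K2 / S * (1 / (real n + 1)^2)" for n
   proof -
    have b: "norm (E l) \<le> K2 / ((real n + 1) * S)^2" if "\<bar>real_of_int l\<bar> = real n + 1" for l
    proof -
     have "(real n + 1) * S \<le> Y + \<bar>real_of_int l * S\<bar>" using that SY by (simp add: abs_mult)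
     then have "K2 / (Y + \<bar>real_of_int l * S\<bar>)^2 \<le> K2 / ((real n + 1) * S)^2"
      using K2(1) SY by (intro divide_left_mono power_mono mult_pos_pos) auto
     then show ?thesis using Ebound[of l] by linarith
    qed
    have "norm (of_real S * (E (int n + 1) + E (- (int n + 1)))) = S * norm (E (int n + 1) + E (- (int n + 1)))"
     using SY by (simp add: norm_mult)
    also have "... \<le> S * (K2 / ((real n + 1) * S)^2 + K2 / ((real n + 1) * S)^2)"
     using SY by (intro mult_left_mono order.trans[OF norm_triangle_ineq] add_mono b) auto
    also have "... = 2 * K2 / S * (1 / (real n + 1)^2)"
    proof -
     have "S * (K2 / (a * S)^2 + K2 / (a * S)^2) = 2 * K2 / S * (1 / a^2)" if "a > 0" for a
      using that SY by (simp add: power2_eq_square field_simps)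
     from this[of "real n + 1"] show ?thesis by simp
    qed
    finally show ?thesis .
   qed
   have isq: "(\<lambda>n. 2 * K2 / S * (1 / (real n + 1)^2)) sums (2 * K2 / S * (pi^2 / 6))"
    using inverse_squares_sums by (intro sums_mult) (simp add: add.commute)
   have "norm (F x - of_real S * E 0 - of_real S * (\<Sum>l\<in>St. J x l)) \<le> 2 * K2 / S * (pi^2 / 6)"
    unfolding sums_unique[OF Esum] sums_unique[OF isq]
    by (rule norm_suminf_le[OF Eb]) (use isq in \<open>simp add: sums_iff\<close>)
   moreover have "norm (of_real S * E 0) \<le> S * (K2 / Y^2)"
    using mult_left_mono[OF Ebound[of 0], of S] SY by (simp add: norm_mult)
   ultimately have "norm (F x) \<le> 2 * K2 / S * (pi^2 / 6) + S * (K2 / Y^2) + S * norm (\<Sum>l\<in>St. J x l)"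
   proof -
    have "F x = (F x - of_real S * E 0 - of_real S * (\<Sum>l\<in>St. J x l)) + of_real S * E 0 + of_real S * (\<Sum>l\<in>St. J x l)" by simp
    moreover have "norm (a + b + d) \<le> norm a + norm b + norm d" for a b d :: complex
     by (meson add_mono_thms_linordered_semiring(3) norm_triangle_le order.refl)
    ultimately have "norm (F x) \<le> norm (F x - of_real S * E 0 - of_real S * (\<Sum>l\<in>St. J x l)) + norm (of_real S * E 0) + norm (of_real S * (\<Sum>l\<in>St. J x l))"
     by metis
    moreover have "norm (of_real S * (\<Sum>l\<in>St. J x l)) = S * norm (\<Sum>l\<in>St. J x l)" using SY by (simp add: norm_mult)
    ultimately show ?thesis using \<open>norm (of_real S * E 0) \<le> S * (K2 / Y^2)\<close>
     \<open>norm (F x - of_real S * E 0 - of_real S * (\<Sum>l\<in>St. J x l)) \<le> 2 * K2 / S * (pi^2 / 6)\<close> by linarith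
   qed
   moreover have "2 * K2 / S * (pi^2 / 6) + S * (K2 / Y^2) \<le> R"
    using K2(1) SY by (simp add: R_def Kb_def field_simps)
   ultimately show ?thesis by linarith
  qed
  have R4: "R ^ 4 * (\<eta> * Y) \<le> 8 * Kb ^ 4 * (S ^ 4 / Y + Y^2)"
  proof -
   have "(S / Y^2 + 1 / S) ^ 4 \<le> 8 * ((S / Y^2) ^ 4 + (1 / S) ^ 4)" using SY by (intro power4_add_le) auto
   also have "... \<le> 8 * (S ^ 4 / Y^2 + Y)"
   proof (intro mult_left_mono add_mono)
    have "S ^ 4 / Y ^ 8 \<le> S ^ 4 / Y^2" using SY Y by (intro divide_left_mono power_increasing mult_pos_pos) auto
    then show "(S / Y^2) ^ 4 \<le> S ^ 4 / Y^2" by (simp add: power_divide flip: power_mult)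
    have "(1 / S) ^ 4 \<le> 1" using S by (intro power_le_one) auto
    then show "(1 / S) ^ 4 \<le> Y" using Y by linarith
   qed auto
   finally have 1: "(S / Y^2 + 1 / S) ^ 4 \<le> 8 * (S ^ 4 / Y^2 + Y)" .
   have "R ^ 4 * (\<eta> * Y) \<le> (Kb ^ 4 * (8 * (S ^ 4 / Y^2 + Y))) * (1 * Y)"
    unfolding R_def power_mult_distrib using 1 Kb SY c by (intro mult_mono) auto
   also have "... = 8 * Kb ^ 4 * (S ^ 4 / Y + Y^2)" using SY by (simp add: power2_eq_square field_simps)
   finally show ?thesis .
  qed
  have main1: "S ^ 4 * (K1 / Y * energy St (\<lambda>l. \<mu> l powr (1 - 1 / (1 - \<kappa>))) Y) \<le> Ka * (S powr (2 - \<theta>) * Y powr (1 + \<theta>) + Y^2)"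
  proof -
   have "S ^ 4 * (K1 / Y * energy St (\<lambda>l. \<mu> l powr (1 - 1 / (1 - \<kappa>))) Y) \<le> S ^ 4 * (K1 / Y * (K3 * (L powr (2 + \<theta>) + L ^ 4 / Y)))"
    using St(3) K1(1) SY by (intro mult_left_mono) auto
   also have "... = K1 * K3 * (S ^ 4 / Y * L powr (2 + \<theta>) + S ^ 4 / Y * (L ^ 4 / Y))" by (simp add: algebra_simps)
   also have "S ^ 4 / Y * L powr (2 + \<theta>) = \<bar>\<kappa>\<bar> powr (2 + \<theta>) * (S powr (2 - \<theta>) * Y powr (1 + \<theta>))"
   proof -
    have "L powr (2 + \<theta>) = \<bar>\<kappa>\<bar> powr (2 + \<theta>) * Y powr (2 + \<theta>) / S powr (2 + \<theta>)"
     using SY by (simp add: L_def powr_divide powr_mult)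
    moreover have "S ^ 4 / S powr (2 + \<theta>) = S powr (2 - \<theta>)"
    proof -
     have "S ^ 4 = S powr 4" using SY by simp
     then have "S ^ 4 / S powr (2 + \<theta>) = S powr (4 - (2 + \<theta>))" by (simp only: powr_diff)
     then show ?thesis by simp
    qed
    moreover have "Y powr (2 + \<theta>) / Y = Y powr (1 + \<theta>)"
     using SY powr_diff[of Y "2 + \<theta>" 1] by simp
    moreover have "S ^ 4 / Y * (k * y / s) = k * ((S ^ 4 / s) * (y / Y))" for k y s by (simp add: mult_ac)
    ultimately show ?thesis by (simp only:)
   qed
   also have "S ^ 4 / Y * (L ^ 4 / Y) = \<bar>\<kappa>\<bar> ^ 4 * Y^2"
    using SY by (simp add: L_def power_divide power_mult_distrib field_simps eval_nat_numeral)
   also have "K1 * K3 * (\<bar>\<kappa>\<bar> powr (2 + \<theta>) * (S powr (2 - \<theta>) * Y powr (1 + \<theta>)) + \<bar>\<kappa>\<bar> ^ 4 * Y^2)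
    \<le> K1 * K3 * ((\<bar>\<kappa>\<bar> powr (2 + \<theta>) + \<bar>\<kappa>\<bar> ^ 4) * (S powr (2 - \<theta>) * Y powr (1 + \<theta>)) + (\<bar>\<kappa>\<bar> powr (2 + \<theta>) + \<bar>\<kappa>\<bar> ^ 4) * Y^2)"
    using K1(1) K3(1) by (intro mult_left_mono add_mono mult_right_mono) auto
   also have "... = Ka * (S powr (2 - \<theta>) * Y powr (1 + \<theta>) + Y^2)" by (simp add: Ka_def algebra_simps)
   finally show ?thesis .
  qed
  have contF: "continuous_on ?X F" unfolding F_def by (intro continuous_intros)
  have "integral ?X (\<lambda>x. norm (F x) ^ 4) \<le> integral ?X (\<lambda>x. 8 * (S ^ 4 * norm (\<Sum>l\<in>St. J x l) ^ 4 + R ^ 4))"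
  proof (rule integral_le)
   show "(\<lambda>x. norm (F x) ^ 4) integrable_on ?X"
    by (intro integrable_continuous_real continuous_on_power continuous_on_norm contF)
   show "(\<lambda>x. 8 * (S ^ 4 * norm (\<Sum>l\<in>St. J x l) ^ 4 + R ^ 4)) integrable_on ?X"
    by (intro integrable_continuous_real continuous_on_mult continuous_on_add continuous_on_power continuous_on_norm Jcont continuous_on_const)
   fix x assume x: "x \<in> ?X"
   have "norm (F x) ^ 4 \<le> (S * norm (\<Sum>l\<in>St. J x l) + R) ^ 4" by (intro power_mono pt x) auto
   also have "... \<le> 8 * ((S * norm (\<Sum>l\<in>St. J x l)) ^ 4 + R ^ 4)" using SY R0 by (intro power4_add_le) auto
   finally show "norm (F x) ^ 4 \<le> 8 * (S ^ 4 * norm (\<Sum>l\<in>St. J x l) ^ 4 + R ^ 4)" by (simp add: power_mult_distrib)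
  qed
  also have "... = 8 * (S ^ 4 * integral ?X (\<lambda>x. norm (\<Sum>l\<in>St. J x l) ^ 4) + R ^ 4 * (\<eta> * Y))"
  proof -
   have i1: "(\<lambda>x. S ^ 4 * norm (\<Sum>l\<in>St. J x l) ^ 4) integrable_on ?X"
    by (intro integrable_continuous_real continuous_on_mult continuous_on_power continuous_on_norm Jcont continuous_on_const)
   have "integral ?X (\<lambda>_. R ^ 4) = R ^ 4 * (\<eta> * Y)" using SY c by (simp add: algebra_simps)
   then show ?thesis
    unfolding Henstock_Kurzweil_Integration.integral_mult_right
    by (subst Henstock_Kurzweil_Integration.integral_add[OF i1]) auto
  qed
  also have "... \<le> 8 * (S ^ 4 * (K1 / Y * energy St (\<lambda>l. \<mu> l powr (1 - 1 / (1 - \<kappa>))) Y) + R ^ 4 * (\<eta> * Y))"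
   by (intro mult_left_mono[OF add_right_mono] mult_left_mono[OF Jmom]) (use SY in auto)
  also have "... \<le> 8 * (Ka * (S powr (2 - \<theta>) * Y powr (1 + \<theta>) + Y^2) + 8 * Kb ^ 4 * (S ^ 4 / Y + Y^2))"
   using main1 R4 by (intro mult_left_mono add_mono) auto
  also have "... \<le> K * (S powr (2 - \<theta>) * Y powr (1 + \<theta>) + Y^2 + S ^ 4 / Y)"
  proof -
   have "Ka * (a + b) + k * (d + b) \<le> (Ka + k) * (a + b + d)" if "a \<ge> 0" "b \<ge> 0" "d \<ge> 0" "k \<ge> 0" for a b d k
   proof -
    have "(Ka + k) * (a + b + d) = Ka * (a + b) + k * (d + b) + (Ka * d + k * a)" by (simp add: algebra_simps)
    then show ?thesis using that Ka by simp
   qed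
   from this[of "S powr (2 - \<theta>) * Y powr (1 + \<theta>)" "Y^2" "S ^ 4 / Y" "8 * Kb ^ 4"]
   have le: "Ka * (S powr (2 - \<theta>) * Y powr (1 + \<theta>) + Y^2) + 8 * Kb ^ 4 * (S ^ 4 / Y + Y^2)
    \<le> (Ka + 8 * Kb ^ 4) * (S powr (2 - \<theta>) * Y powr (1 + \<theta>) + Y^2 + S ^ 4 / Y)"
    using SY Kb by simp
   show ?thesis using mult_left_mono[OF le, of 8] unfolding K_def by (simp only: mult.assoc)
  qed
  finally show ?thesis unfolding F_def .
 qed
 show ?thesis
 proof (rule exI[of _ \<eta>], rule exI[of _ w], rule exI[of _ C], rule exI[of _ K], intro conjI allI impI)
  show "w t \<le> C" for t using bd(1)[of t] by linarith
 qed (use c w0 main in auto)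
qed

text \<open>Terms with r ^ j near X dominate. With u = (r ^ j / X) powr p each term is at most a
  constant times X powr p u / (1 + u^2), and this telescopes against arctan, because u is multiplied
  by the fixed ratio q from one term to the next.\<close>

lemma gaussian_geometric_sum:
 fixes r p :: real
 assumes r: "r > 1" and p: "p > 0"
 shows "\<exists>C\<ge>0. \<forall>X>0. \<forall>n. (\<Sum>j<n. gauss X (r ^ j) * (r ^ j) powr p) \<le> C * X powr p"
proof -
 define m where "m = nat \<lceil>p\<rceil>"
 have m: "real m \<ge> p" unfolding m_def by linarith
 define q where "q = r powr p"
 have q: "q > 1" unfolding q_def using r p by (rule gr_one_powr)
 \<comment> \<open>From (y^2) ^ m \<le> m ^ m exp (y^2), with m an integer not below p.\<close>
 define B where "B = real m ^ m + (1::real)"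
 have B: "B \<ge> 1" by (simp add: B_def)
 define C where "C = 2 * B * (q^2 / (q - 1)) * (pi / 2)"
 have C: "C \<ge> 0" unfolding C_def using B q by (intro mult_nonneg_nonneg divide_nonneg_nonneg) auto
 have pt: "exp (- (pi * y^2)) * y powr p \<le> 2 * B * (y powr p / (1 + (y powr p)^2))" if y: "y > 0" for y
 proof -
  have "exp (- (pi * y^2)) * (1 + (y powr p)^2) \<le> 2 * B"
  proof (cases "y \<le> 1")
   case True
   then have "y powr p \<le> 1" using y p by (simp add: powr_le1)
   then have "(y powr p)^2 \<le> 1" by (simp add: power_le_one)
   moreover have "exp (- (pi * y^2)) \<le> 1" by simp
   ultimately have "exp (- (pi * y^2)) * (1 + (y powr p)^2) \<le> 1 * (1 + 1)" by (intro mult_mono) auto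
   also have "... \<le> 2 * B" using B by simp
   finally show ?thesis .
  next
   case False
   then have y1: "y \<ge> 1" by simp
   have "(y powr p)^2 = y powr (2 * p)" using y by (simp add: powr_power mult.commute)
   also have "... \<le> y powr (2 * real m)" using y1 m by (intro powr_mono) auto
   also have "y powr (2 * real m) = y powr real (2 * m)" by simp
   also have "... = y ^ (2 * m)" using y by (rule powr_realpow)
   also have "... = (y^2) ^ m" by (rule power_mult)
   finally have 1: "(y powr p)^2 \<le> (y^2) ^ m" .
   have m0: "m > 0" using m p by (cases "m = 0") auto
   have "(y^2) ^ m = real m ^ m * (y^2 / real m) ^ m" using m0 by (simp flip: power_mult_distrib)
   also have "... \<le> real m ^ m * (1 + y^2 / real m) ^ m" by (intro mult_left_mono power_mono) auto
   also have "... \<le> real m ^ m * exp (y^2)"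
    by (intro mult_left_mono exp_ge_one_plus_x_over_n_power_n m0 order.trans[OF _ zero_le_power2]) auto
   also have "... \<le> real m ^ m * exp (pi * y^2)"
   proof (intro mult_left_mono iffD2[OF exp_le_cancel_iff])
    have "1 * y^2 \<le> pi * y^2" using pi_ge_two by (intro mult_right_mono) auto
    then show "y^2 \<le> pi * y^2" by simp
   qed simp
   finally have "(y^2) ^ m \<le> real m ^ m * exp (pi * y^2)" .
   moreover have "1 \<le> exp (pi * y^2)" by simp
   ultimately have "1 + (y powr p)^2 \<le> B * exp (pi * y^2)" using 1 unfolding B_def distrib_right by linarith
   then have "exp (- (pi * y^2)) * (1 + (y powr p)^2) \<le> exp (- (pi * y^2)) * (B * exp (pi * y^2))" by (intro mult_left_mono) auto
   also have "... = B * (exp (- (pi * y^2)) * exp (pi * y^2))" by (simp only: mult_ac)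
   also have "... = B" by (simp flip: exp_add)
   finally show ?thesis using B by linarith
  qed
  then have "exp (- (pi * y^2)) * (1 + (y powr p)^2) * (y powr p / (1 + (y powr p)^2)) \<le> 2 * B * (y powr p / (1 + (y powr p)^2))"
   by (intro mult_right_mono) auto
  moreover have "1 + (y powr p)^2 \<noteq> 0" using zero_le_power2[of "y powr p"] by linarith
  ultimately show ?thesis by simp
 qed
 have tel: "u / (1 + u^2) \<le> (q^2 / (q - 1)) * (arctan (q * u) - arctan u)" if u: "u > 0" for u
 proof -
  have uq: "u < q * u" using u q by simp
  have "\<exists>z. u < z \<and> z < q * u \<and> arctan (q * u) - arctan u = (q * u - u) * inverse (1 + z^2)"
   using MVT2[OF uq, of arctan "\<lambda>z. inverse (1 + z^2)"] DERIV_arctan by blast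
  then obtain z where z: "u < z" "z < q * u" "arctan (q * u) - arctan u = (q * u - u) * inverse (1 + z^2)" by blast
  have "1 + z^2 \<le> q^2 * (1 + u^2)"
  proof -
   have "z^2 \<le> (q * u)^2" using z u by (intro power_mono) auto
   moreover have "1 \<le> q^2" using q by (simp add: one_le_power)
   ultimately show ?thesis by (simp add: power_mult_distrib distrib_left)
  qed
  then have "inverse (q^2 * (1 + u^2)) \<le> inverse (1 + z^2)"
   by (intro le_imp_inverse_le) (auto simp: add_pos_nonneg)
  then have "(q - 1) * u * inverse (q^2 * (1 + u^2)) \<le> (q * u - u) * inverse (1 + z^2)"
   using u q by (intro mult_mono) (auto simp: algebra_simps)
  then have "q^2 / (q - 1) * ((q - 1) * u * inverse (q^2 * (1 + u^2))) \<le> q^2 / (q - 1) * (arctan (q * u) - arctan u)"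
   unfolding z(3) using q by (intro mult_left_mono) auto
  moreover have "q^2 / (q - 1) * ((q - 1) * u * inverse (q^2 * (1 + u^2))) = u / (1 + u^2)"
  proof -
   have "q \<noteq> 0" "q - 1 \<noteq> 0" using q by auto
   moreover have "1 + u^2 \<noteq> 0" using zero_le_power2[of u] by linarith
   moreover have gen: "Q / p' * (p' * u * inverse (Q * D)) = u / D" if "Q \<noteq> 0" "p' \<noteq> 0" "D \<noteq> 0" for Q p' D :: real
    using that by (simp add: divide_simps)
   ultimately show ?thesis by (intro gen) auto
  qed
  ultimately show ?thesis by simp
 qed
 show ?thesis
 proof (intro exI[of _ C] conjI C allI impI)
  fix X :: real and n :: nat assume X: "X > 0"
  define u where "u = (\<lambda>j. (r ^ j / X) powr p)"
  have u_pos: "u j > 0" for j using r X by (simp add: u_def)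
  have u_Suc: "u (Suc j) = q * u j" for j using r X by (simp add: u_def q_def powr_mult powr_divide)
  have term_le: "gauss X (r ^ j) * (r ^ j) powr p \<le> X powr p * (2 * B * ((q^2 / (q - 1)) * (arctan (u (Suc j)) - arctan (u j))))" for j
  proof -
   have "(r ^ j) powr p = X powr p * (r ^ j / X) powr p" using r X by (simp add: powr_divide)
   moreover have "gauss X (r ^ j) = exp (- (pi * (r ^ j / X)^2))" by (simp add: gauss_def power_divide)
   ultimately have "gauss X (r ^ j) * (r ^ j) powr p = X powr p * (exp (- (pi * (r ^ j / X)^2)) * (r ^ j / X) powr p)" by simp
   also have "... \<le> X powr p * (2 * B * (u j / (1 + (u j)^2)))"
    unfolding u_def using r X by (intro mult_left_mono pt) auto
   also have "... \<le> X powr p * (2 * B * ((q^2 / (q - 1)) * (arctan (u (Suc j)) - arctan (u j))))"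
    unfolding u_Suc using B by (intro mult_left_mono tel u_pos) auto
   finally show ?thesis .
  qed
  have "(\<Sum>j<n. gauss X (r ^ j) * (r ^ j) powr p) \<le> (\<Sum>j<n. X powr p * (2 * B * ((q^2 / (q - 1)) * (arctan (u (Suc j)) - arctan (u j)))))"
   by (intro sum_mono term_le)
  also have "... = X powr p * (2 * B * ((q^2 / (q - 1)) * (arctan (u n) - arctan (u 0))))"
   unfolding sum_lessThan_telescope[of "\<lambda>j. arctan (u j)" n, symmetric] by (simp only: sum_distrib_left[symmetric])
  also have "... \<le> X powr p * (2 * B * ((q^2 / (q - 1)) * (pi / 2)))"
  proof (intro mult_left_mono)
   have "arctan (u 0) \<ge> 0" using u_pos[of 0] by (simp add: zero_le_arctan_iff less_imp_le)
   then show "arctan (u n) - arctan (u 0) \<le> pi / 2" using arctan_ubound[of "u n"] by linarith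
  qed (use q B in auto)
  also have "... = C * X powr p" by (simp add: C_def)
  finally show "(\<Sum>j<n. gauss X (r ^ j) * (r ^ j) powr p) \<le> C * X powr p" .
 qed
qed

lemma even_integral_bound:
 fixes f :: "real => real"
 assumes int: "integrable lborel f" and cont: "continuous_on UNIV f" and nn: "\<And>x. f x \<ge> 0" and even: "\<And>x. f (- x) = f x"
  and r: "r > 1" and B: "\<And>n :: nat. integral {0..r ^ n} f \<le> B"
 shows "(LINT x|lborel. f x) \<le> 2 * B"
proof -
 have "(\<lambda>n :: nat. LINT x|lborel. indicator {- (r ^ n)..r ^ n} x *\<^sub>R f x) \<longlonglongrightarrow> (LINT x|lborel. f x)"
 proof (rule integral_dominated_convergence[where w = f])
  show "AE x in lborel. (\<lambda>n. indicator {- (r ^ n)..r ^ n} x *\<^sub>R f x) \<longlonglongrightarrow> f x"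
  proof (rule AE_I2)
   fix x :: real
   obtain N where N: "\<bar>x\<bar> < r ^ N" using real_arch_pow[OF r] by blast
   have "\<forall>\<^sub>F n in sequentially. indicator {- (r ^ n)..r ^ n} x *\<^sub>R f x = f x"
    using eventually_ge_at_top[of N]
   proof eventually_elim
    case (elim n)
    have "r ^ N \<le> r ^ n" using r elim by (intro power_increasing) auto
    then have "x \<in> {- (r ^ n)..r ^ n}" using N by (auto simp: abs_less_iff)
    then show ?case by simp
   qed
   then show "(\<lambda>n. indicator {- (r ^ n)..r ^ n} x *\<^sub>R f x) \<longlonglongrightarrow> f x"
    by (rule tendsto_eventually)
  qed
 qed (use int nn in \<open>auto simp: indicator_def\<close>)
 moreover have "(LINT x|lborel. indicator {- (r ^ n)..r ^ n} x *\<^sub>R f x) \<le> 2 * B" for n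
 proof -
  define R where "R = r ^ n"
  have R: "R \<ge> 0" using r by (simp add: R_def)
  have c: "continuous_on A f" for A using cont continuous_on_subset by blast
  have "(LINT x|lborel. indicator {- R..R} x *\<^sub>R f x) = integral {- R..R} f"
   using set_borel_integral_eq_integral(2)[OF borel_integrable_atLeastAtMost'[OF c[of "{-R..R}"]]]
   by (simp add: set_lebesgue_integral_def)
  also have "... = integral {- R..0} f + integral {0..R} f"
   using R by (intro Henstock_Kurzweil_Integration.integral_combine[symmetric] integrable_continuous_real c) auto
  also have "integral {- R..0} f = integral {0..R} f"
   using Henstock_Kurzweil_Integration.integral_reflect_real[of R 0 f] by (simp add: even)
  finally show ?thesis using B[of n] by (simp add: R_def)
 qed
 ultimately show ?thesis by (intro LIMSEQ_le_const2) auto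
qed

text \<open>The Gaussian moment is cut at the points r ^ j. Each window is estimated by duality and
  weighted by the Gaussian at its left end; the interval [0, 1] costs S^4 trivially. The sums are
  dominated by windows near X, and division by X leaves the three terms.\<close>

lemma energy_narrow_bound:
 fixes \<kappa> \<theta> :: real
 assumes \<kappa>: "\<kappa> \<noteq> 0" "\<kappa> \<noteq> 1" and \<theta>: "\<theta> > 0" and sp: "spacing (\<kappa> / (\<kappa> - 1)) \<theta>"
 shows "\<exists>\<eta> C. 0 < \<eta> \<and> \<eta> \<le> 1/4 \<and> C \<ge> 0 \<and> (\<forall>S\<ge>1. \<forall>X\<ge>1.
  energy {s :: nat. \<bar>real s / S - 1\<bar> \<le> \<eta> / 2} (\<lambda>s. (real s / S) powr \<kappa>) X
   \<le> C * (S powr (2 - \<theta>) * X powr \<theta> + X + S ^ 4 / X))"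
proof -
 obtain \<eta> w Cw K where \<eta>: "0 < \<eta>" "\<eta> \<le> 1/4" and w: "\<And>t. 0 \<le> w t" "\<And>t. w t \<le> Cw" "\<And>t. \<bar>t - 1\<bar> \<le> \<eta> / 2 ==> w t \<ge> 1"
  and win: "\<And>S Y. S \<ge> 1 ==> Y \<ge> 1 ==> integral {Y..(1 + \<eta>) * Y}
   (\<lambda>x. norm (tpoly {s. \<bar>real s / S - 1\<bar> \<le> \<eta>} (\<lambda>s. (real s / S) powr \<kappa>) (\<lambda>s. of_real (w (real s / S))) x) ^ 4)
   \<le> K * (S powr (2 - \<theta>) * Y powr (1 + \<theta>) + Y^2 + S ^ 4 / Y)"
  using window_moment[OF \<kappa> sp] by blast
 define r where "r = 1 + \<eta>"
 have r: "r > 1" using \<eta> by (simp add: r_def)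
 define K' where "K' = max K 0"
 have K': "K' \<ge> 0" by (simp add: K'_def)
 obtain C1 where C1: "C1 \<ge> 0" "\<And>X n. X > 0 ==> (\<Sum>j<n. gauss X (r ^ j) * (r ^ j) powr (1 + \<theta>)) \<le> C1 * X powr (1 + \<theta>)"
  using gaussian_geometric_sum[OF r, of "1 + \<theta>"] \<theta> by auto
 obtain C2 where C2: "C2 \<ge> 0" "\<And>X n. X > 0 ==> (\<Sum>j<n. gauss X (r ^ j) * (r ^ j) powr 2) \<le> C2 * X powr 2"
  using gaussian_geometric_sum[OF r, of 2] by auto
 define C3 where "C3 = r / (r - 1)"
 have C3: "C3 \<ge> 0" using r by (simp add: C3_def)
 have Cw: "Cw \<ge> 1" using w(2)[of 1] w(3)[of 1] \<eta> by auto
 define C0 where "C0 = (3 * Cw) ^ 4"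
 define Ct where "Ct = 2 * (C0 + K' * C1 + K' * C2 + K' * C3)"
 have C0: "C0 \<ge> 0" using Cw by (simp add: C0_def)
 have Ct: "Ct \<ge> 0" using C0 K' C1 C2 C3 by (simp add: Ct_def)
 have main: "energy {s :: nat. \<bar>real s / S - 1\<bar> \<le> \<eta> / 2} (\<lambda>s. (real s / S) powr \<kappa>) X
   \<le> Ct * (S powr (2 - \<theta>) * X powr \<theta> + X + S ^ 4 / X)" if S: "S \<ge> 1" and X: "X \<ge> 1" for S X
 proof -
  define I where "I = {s :: nat. \<bar>real s / S - 1\<bar> \<le> \<eta>}"
  define J where "J = {s :: nat. \<bar>real s / S - 1\<bar> \<le> \<eta> / 2}"
  define \<phi> where "\<phi> = (\<lambda>s :: nat. (real s / S) powr \<kappa>)"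
  define F where "F = tpoly I \<phi> (\<lambda>s. of_real (w (real s / S)))"
  have I_sub: "I \<subseteq> {..nat \<lfloor>2 * S\<rfloor>}"
  proof
   fix s assume "s \<in> I"
   then have "real s / S \<le> 2" using \<eta> by (auto simp: I_def abs_le_iff)
   then have "real s \<le> 2 * S" using S by (simp add: field_simps)
   then show "s \<in> {..nat \<lfloor>2 * S\<rfloor>}" by (simp add: le_nat_floor)
  qed
  then have fin: "finite I" by (rule finite_subset) simp
  have cardI: "real (card I) \<le> 3 * S"
  proof -
   have "card I \<le> card {..nat \<lfloor>2 * S\<rfloor>}" using I_sub by (intro card_mono) auto
   then have "real (card I) \<le> real (nat \<lfloor>2 * S\<rfloor>) + 1" by simp
   also have "real (nat \<lfloor>2 * S\<rfloor>) \<le> 2 * S" using S by (simp add: of_nat_nat)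
   finally show ?thesis using S by linarith
  qed
  have F_le: "norm (F x) ^ 4 \<le> C0 * S ^ 4" for x
  proof -
   have "norm (F x) \<le> (\<Sum>s\<in>I. norm (of_real (w (real s / S)) * ec (x * \<phi> s)))" unfolding F_def tpoly_def by (rule norm_sum)
   also have "... \<le> of_nat (card I) * Cw" using w by (intro sum_bounded_above) (auto simp: norm_mult)
   also have "... \<le> (3 * S) * Cw" using cardI Cw by (intro mult_right_mono) auto
   finally have "norm (F x) ^ 4 \<le> ((3 * S) * Cw) ^ 4" by (intro power_mono) auto
   then show ?thesis by (simp add: C0_def power_mult_distrib mult_ac)
  qed
  define f where "f = (\<lambda>x. gauss X x * norm (F x) ^ 4)"
  have cont_gauss: "continuous_on A (gauss X)" for A unfolding gauss_def using X by (intro continuous_intros) auto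
  have cont_F: "continuous_on A F" for A unfolding F_def by (intro continuous_intros)
  have cont_f: "continuous_on A f" for A unfolding f_def by (intro continuous_intros cont_gauss cont_F)
  have int_f: "f integrable_on {a..b}" for a b by (intro integrable_continuous_real cont_f)
  \<comment> \<open>The coefficients are real, so the integrand is even and only x \<ge> 0 has to be
    treated.\<close>
  have F_minus: "norm (F (- x)) = norm (F x)" for x
  proof -
   have "F (- x) = cnj (F x)" by (simp add: F_def tpoly_def cnj_sum cnj_ec)
   then show ?thesis by simp
  qed
  have X0: "X > 0" using X by simp
  have piece: "integral {r ^ j..r ^ Suc j} f \<le> K' * (S powr (2 - \<theta>) * (gauss X (r ^ j) * (r ^ j) powr (1 + \<theta>)) + gauss X (r ^ j) * (r ^ j) powr 2 + S ^ 4 * (1 / r) ^ j)" for j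
  proof -
   define Y where "Y = r ^ j"
   have Y: "Y \<ge> 1" using r by (simp add: Y_def one_le_power)
   have "integral {Y..(1 + \<eta>) * Y} f \<le> integral {Y..(1 + \<eta>) * Y} (\<lambda>x. gauss X Y * norm (F x) ^ 4)"
   proof (rule integral_le[OF int_f])
    show "(\<lambda>x. gauss X Y * norm (F x) ^ 4) integrable_on {Y..(1 + \<eta>) * Y}"
     by (intro integrable_continuous_real continuous_intros cont_F)
    fix x assume x: "x \<in> {Y..(1 + \<eta>) * Y}"
    have "Y^2 \<le> x^2" using x Y by (intro power_mono) auto
    then have "gauss X x \<le> gauss X Y" unfolding gauss_def by (simp add: divide_right_mono)
    then show "f x \<le> gauss X Y * norm (F x) ^ 4" unfolding f_def by (intro mult_right_mono) auto
   qed
   also have "... = gauss X Y * integral {Y..(1 + \<eta>) * Y} (\<lambda>x. norm (F x) ^ 4)" by simp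
   also have "... \<le> gauss X Y * (K' * (S powr (2 - \<theta>) * Y powr (1 + \<theta>) + Y^2 + S ^ 4 / Y))"
   proof (intro mult_left_mono)
    have "integral {Y..(1 + \<eta>) * Y} (\<lambda>x. norm (F x) ^ 4) \<le> K * (S powr (2 - \<theta>) * Y powr (1 + \<theta>) + Y^2 + S ^ 4 / Y)"
     unfolding F_def I_def \<phi>_def by (rule win[OF S Y])
    also have "... \<le> K' * (S powr (2 - \<theta>) * Y powr (1 + \<theta>) + Y^2 + S ^ 4 / Y)"
     using S Y by (intro mult_right_mono) (auto simp: K'_def)
    finally show "integral {Y..(1 + \<eta>) * Y} (\<lambda>x. norm (F x) ^ 4) \<le> K' * (S powr (2 - \<theta>) * Y powr (1 + \<theta>) + Y^2 + S ^ 4 / Y)" .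
   qed simp
   also have "... = K' * (S powr (2 - \<theta>) * (gauss X Y * Y powr (1 + \<theta>)) + gauss X Y * Y^2 + gauss X Y * (S ^ 4 / Y))"
    by (simp add: algebra_simps)
   also have "... \<le> K' * (S powr (2 - \<theta>) * (gauss X Y * Y powr (1 + \<theta>)) + gauss X Y * Y powr 2 + S ^ 4 * (1 / r) ^ j)"
   proof -
    have a: "gauss X Y * Y^2 \<le> gauss X Y * Y powr 2" using Y by simp
    have "gauss X Y * (S ^ 4 / Y) \<le> 1 * (S ^ 4 / Y)" using S Y by (intro mult_right_mono gauss_le_1) auto
    then have b: "gauss X Y * (S ^ 4 / Y) \<le> S ^ 4 * (1 / r) ^ j" by (simp add: Y_def power_one_over)
    show ?thesis by (intro mult_left_mono[OF add_mono[OF add_mono[OF order.refl a] b]] K')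
   qed
   finally show ?thesis by (simp add: Y_def r_def)
  qed
  have part: "integral {0..r ^ n} f \<le> C0 * S ^ 4 + (\<Sum>j<n. integral {r ^ j..r ^ Suc j} f)" for n
  proof (induction n)
   case 0
   have "integral {0..1} f \<le> integral {0..1::real} (\<lambda>_. C0 * S ^ 4)"
   proof (rule integral_le[OF int_f])
    fix x :: real
    have "f x \<le> 1 * norm (F x) ^ 4" unfolding f_def by (intro mult_right_mono gauss_le_1) auto
    then show "f x \<le> C0 * S ^ 4" using F_le[of x] by simp
   qed auto
   then show ?case by simp
  next
   case (Suc n)
   have "integral {0..r ^ Suc n} f = integral {0..r ^ n} f + integral {r ^ n..r ^ Suc n} f"
    using r by (intro Henstock_Kurzweil_Integration.integral_combine[symmetric] int_f) (auto simp: one_le_power mult_le_cancel_right1)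
   then show ?case using Suc by simp
  qed
  define B where "B = C0 * S ^ 4 + K' * (S powr (2 - \<theta>) * (C1 * X powr (1 + \<theta>)) + C2 * X powr 2 + S ^ 4 * C3)"
  have B: "integral {0..r ^ n} f \<le> B" for n
  proof -
   have geo: "(\<Sum>j<n. (1 / r) ^ j) \<le> C3"
   proof -
    have "(\<Sum>j<n. (1 / r) ^ j) \<le> (\<Sum>j. (1 / r) ^ j)"
     using r by (intro sum_le_suminf) auto
    also have "... = 1 / (1 - 1 / r)" using r by (intro suminf_geometric) auto
    also have "... = C3" using r by (simp add: C3_def field_simps)
    finally show ?thesis .
   qed
   have "(\<Sum>j<n. integral {r ^ j..r ^ Suc j} f) \<le> (\<Sum>j<n. K' * (S powr (2 - \<theta>) * (gauss X (r ^ j) * (r ^ j) powr (1 + \<theta>)) + gauss X (r ^ j) * (r ^ j) powr 2 + S ^ 4 * (1 / r) ^ j))"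
    by (intro sum_mono piece)
   also have "... = K' * (S powr (2 - \<theta>) * (\<Sum>j<n. gauss X (r ^ j) * (r ^ j) powr (1 + \<theta>)) + (\<Sum>j<n. gauss X (r ^ j) * (r ^ j) powr 2) + S ^ 4 * (\<Sum>j<n. (1 / r) ^ j))"
    by (simp only: sum_distrib_left[symmetric] sum.distrib)
   also have "... \<le> K' * (S powr (2 - \<theta>) * (C1 * X powr (1 + \<theta>)) + C2 * X powr 2 + S ^ 4 * C3)"
    using S by (intro mult_left_mono add_mono C1(2)[OF X0] C2(2)[OF X0] geo K') auto
   finally show ?thesis using part[of n] by (simp add: B_def)
  qed
  have "X * energy J \<phi> X \<le> (LINT x|lborel. gauss X x * norm (tpoly I \<phi> (\<lambda>s. of_real (w (real s / S))) x) ^ 4)"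
   using \<eta> w by (intro gauss_moment_ge X0 fin) (auto simp: I_def J_def)
  also have "... = (LINT x|lborel. f x)" by (simp add: f_def F_def)
  also have "... \<le> 2 * B"
  proof (rule even_integral_bound[OF _ cont_f _ _ r B])
   show "integrable lborel f" unfolding f_def F_def by (rule gauss_moment(1)[OF X0])
   show "f (- x) = f x" for x by (simp add: f_def F_minus gauss_def)
  qed (simp add: f_def)
  finally have "energy J \<phi> X \<le> 2 * B / X" using X0 by (simp add: field_simps)
  also have "2 * B / X = 2 * (C0 * (S ^ 4 / X) + K' * (S powr (2 - \<theta>) * (C1 * X powr \<theta>) + C2 * X + S ^ 4 / X * C3))"
  proof -
   have "X powr (1 + \<theta>) = X * X powr \<theta>" using X0 by (simp add: powr_add)
   moreover have "X powr 2 = X * X" using X0 by (simp add: power2_eq_square)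
   ultimately show ?thesis using X0 by (simp add: B_def field_simps)
  qed
  also have "... = 2 * (K' * C1) * (S powr (2 - \<theta>) * X powr \<theta>) + 2 * (K' * C2) * X + 2 * (C0 + K' * C3) * (S ^ 4 / X)"
   by (simp add: algebra_simps)
  also have "... \<le> Ct * (S powr (2 - \<theta>) * X powr \<theta>) + Ct * X + Ct * (S ^ 4 / X)"
   using C0 C1(1) C2(1) C3 K' S X0 by (intro add_mono mult_right_mono) (auto simp: Ct_def)
  finally show ?thesis by (simp add: J_def \<phi>_def distrib_left)
 qed
 show ?thesis using \<eta> Ct main by blast
qed

text \<open>The exponential dependence on n is harmless: n will be bounded in terms of the width of
  a window.\<close>

lemma energy_UN_le:
 assumes "X > 0" "B \<ge> 0" "\<And>j. j < n ==> finite (A j)" "\<And>j. j < n ==> energy (A j) \<phi> X \<le> B"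
 shows "energy (\<Union>j<n. A j) \<phi> X \<le> 16 ^ n * B"
 using assms(3,4)
proof (induction n)
 case 0
 then show ?case using assms(2) by (simp add: energy_def)
next
 case (Suc n)
 have "(\<Union>j<Suc n. A j) = (\<Union>j<n. A j) \<union> A n" by (auto simp: less_Suc_eq)
 then have "energy (\<Union>j<Suc n. A j) \<phi> X \<le> 8 * (energy (\<Union>j<n. A j) \<phi> X + energy (A n) \<phi> X)"
  using Suc.prems by (simp only:) (intro energy_Un_le assms(1), auto)
 also have "... \<le> 8 * (16 ^ n * B + B)" using Suc by (intro mult_left_mono add_mono) auto
 also have "... \<le> 8 * (16 ^ n * B + 16 ^ n * B)"
  using assms(2) by (intro mult_left_mono add_mono) (auto simp: mult_le_cancel_right1)
 also have "... = 16 ^ Suc n * B" by simp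
 finally show ?case .
qed

section \<open>Dyadic blocks and the iteration that reduces the loss\<close>

lemma dyadic_card_le:
 fixes S :: real
 assumes "S \<ge> 1/2"
 shows "finite {s :: nat. S / 2 \<le> real s \<and> real s \<le> 2 * S}" "real (card {s :: nat. S / 2 \<le> real s \<and> real s \<le> 2 * S}) \<le> 4 * S"
proof -
 have sub: "{s :: nat. S / 2 \<le> real s \<and> real s \<le> 2 * S} \<subseteq> {..nat \<lfloor>2 * S\<rfloor>}"
  by (auto simp: le_nat_floor)
 then show "finite {s :: nat. S / 2 \<le> real s \<and> real s \<le> 2 * S}" by (rule finite_subset) simp
 have "card {s :: nat. S / 2 \<le> real s \<and> real s \<le> 2 * S} \<le> card {..nat \<lfloor>2 * S\<rfloor>}" using sub by (intro card_mono) auto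
 then have "real (card {s :: nat. S / 2 \<le> real s \<and> real s \<le> 2 * S}) \<le> real (nat \<lfloor>2 * S\<rfloor>) + 1" by simp
 also have "real (nat \<lfloor>2 * S\<rfloor>) \<le> 2 * S" using assms by (simp add: of_nat_nat)
 finally show "real (card {s :: nat. S / 2 \<le> real s \<and> real s \<le> 2 * S}) \<le> 4 * S" using assms by linarith
qed

lemma dyadic_empty: "S < 1/2 ==> S > 0 ==> {s :: nat. S / 2 \<le> real s \<and> real s \<le> 2 * S} = {}"
proof -
 assume S: "S < 1/2" "S > 0"
 have "False" if "S / 2 \<le> real s" "real s \<le> 2 * S" for s :: nat
 proof -
  have "real s > 0" "real s < 1" using that S by linarith+
  then show False by simp
 qed
 then show ?thesis by blast
qed

text \<open>The start of the iteration: for \<theta> = 2 the diagonal term is S^4, which already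
  bounds the number of all quadruples up to the constant 4^4.\<close>

lemma spacing_trivial: "spacing \<kappa> 2"
 unfolding spacing_def
proof (intro exI[of _ 256] conjI allI impI)
 fix S X :: real assume S: "S > 0" and X: "X > 0"
 show "energy {s :: nat. S / 2 \<le> real s \<and> real s \<le> 2 * S} (\<lambda>s. (real s / S) powr \<kappa>) X \<le> 256 * (S powr (2 + 2) + S ^ 4 / X)"
 proof (cases "S < 1/2")
  case True
  show ?thesis unfolding dyadic_empty[OF True S] using S X by (simp add: energy_def)
 next
  case False
  have "energy {s :: nat. S / 2 \<le> real s \<and> real s \<le> 2 * S} (\<lambda>s. (real s / S) powr \<kappa>) X \<le> real (card {s :: nat. S / 2 \<le> real s \<and> real s \<le> 2 * S}) ^ 4"
   by (rule energy_le_card)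
  also have "... \<le> (4 * S) ^ 4" using False by (intro power_mono dyadic_card_le) auto
  also have "... = 256 * S powr (2 + 2)" using S by (simp add: power_mult_distrib)
  also have "... \<le> 256 * (S powr (2 + 2) + S ^ 4 / X)" using S X by (intro mult_left_mono) auto
  finally show ?thesis .
 qed
qed simp

text \<open>The energy decreases in X, so the dual bound may be used at a smaller scale X0. For X0 =
  t powr (2 - a) the terms t powr (2 - \<theta>) X0 powr \<theta> and t^4 / X0 both equal t powr (2
  + a), precisely when \<theta> (1 - a) = a. A bounded number of narrow windows covers the dyadic
  block.\<close>

lemma spacing_step:
 fixes \<kappa> \<theta> :: real
 assumes \<kappa>: "\<kappa> \<noteq> 0" "\<kappa> \<noteq> 1" and \<theta>: "\<theta> > 0" and sp: "spacing (\<kappa> / (\<kappa> - 1)) \<theta>"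
 shows "spacing \<kappa> (\<theta> / (1 + \<theta>))"
proof -
 obtain \<eta> C where \<eta>: "0 < \<eta>" "\<eta> \<le> 1/4" and C: "C \<ge> 0" and narrow: "\<And>S X. S \<ge> 1 ==> X \<ge> 1 ==>
  energy {s :: nat. \<bar>real s / S - 1\<bar> \<le> \<eta> / 2} (\<lambda>s. (real s / S) powr \<kappa>) X
   \<le> C * (S powr (2 - \<theta>) * X powr \<theta> + X + S ^ 4 / X)"
  using energy_narrow_bound[OF assms] by blast
 define a where "a = \<theta> / (1 + \<theta>)"
 have a: "0 < a" "a < 1" "\<theta> * (1 - a) = a" using \<theta> by (auto simp: a_def field_simps)
 define r where "r = 1 + \<eta> / 2"
 have r: "r > 1" using \<eta> by (simp add: r_def)
 obtain n where n: "4 < r ^ n" using real_arch_pow[OF r] by blast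
 \<comment> \<open>The centres t of the windows that meet the block satisfy 1/4 \<le> t / S \<le> 4,
   so renormalising the frequencies from S to t changes the scale X by a factor between 1 / k^2 and
   k^2.\<close>
 define k where "k = 2 powr \<bar>\<kappa>\<bar>"
 have k: "k \<ge> 1" by (simp add: k_def ge_one_powr_ge_zero)
 define Cp where "Cp = C * (3 * 4 powr (2 + a) + 256 * k^2)"
 define Ct where "Ct = 16 ^ n * Cp + 256 * k^2 + 4096 * 2 powr (2 + a)"
 have Cp: "Cp \<ge> 0" using C k by (simp add: Cp_def)
 have Ct: "Ct \<ge> 0" using Cp k by (simp add: Ct_def)
 have main: "energy {s :: nat. S / 2 \<le> real s \<and> real s \<le> 2 * S} (\<lambda>s. (real s / S) powr \<kappa>) X \<le> Ct * (S powr (2 + a) + S ^ 4 / X)"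
  if S: "S > 0" and X: "X > 0" for S X
 proof -
  let ?D = "{s :: nat. S / 2 \<le> real s \<and> real s \<le> 2 * S}"
  let ?E = "energy ?D (\<lambda>s. (real s / S) powr \<kappa>) X"
  have nn: "S powr (2 + a) \<ge> 0" "S ^ 4 / X \<ge> 0" using S X by auto
  have le_card: "?E \<le> 256 * S ^ 4" if "S \<ge> 1/2"
  proof -
   have "?E \<le> real (card ?D) ^ 4" by (rule energy_le_card)
   also have "... \<le> (4 * S) ^ 4" using that by (intro power_mono dyadic_card_le) auto
   finally show ?thesis by (simp add: power_mult_distrib)
  qed
  have goal_if: ?thesis if "?E \<le> x * S powr (2 + a) + y * (S ^ 4 / X)" "x \<le> Ct" "y \<le> Ct" for x y
   using that nn mult_right_mono[OF that(2) nn(1)] mult_right_mono[OF that(3) nn(2)] unfolding distrib_left by linarith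
  consider "S < 1/2" | "1/2 \<le> S" "S < 2" | "S \<ge> 2" "X < k\<^sup>2" | "S \<ge> 2" "X \<ge> k^2" by linarith
  then show ?thesis
  proof cases
   case 1
   show ?thesis unfolding dyadic_empty[OF 1 S] using S Ct nn by (simp add: energy_def)
  next
   case 2
   have "(1/2) powr (2 + a) \<le> S powr (2 + a)" using 2 a by (intro powr_mono2) auto
   then have "2 powr (2 + a) * (1/2) powr (2 + a) \<le> 2 powr (2 + a) * S powr (2 + a)" by (intro mult_left_mono) auto
   then have "1 \<le> 2 powr (2 + a) * S powr (2 + a)" by (simp flip: powr_mult)
   moreover have "S ^ 4 \<le> 16" using 2 power_mono[of S 2 4] by simp
   ultimately have "S ^ 4 \<le> 16 * (2 powr (2 + a) * S powr (2 + a))" by linarith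
   then have "?E \<le> (4096 * 2 powr (2 + a)) * S powr (2 + a) + 0 * (S ^ 4 / X)" using le_card[OF 2(1)] by linarith
   then show ?thesis by (rule goal_if) (use Cp k in \<open>auto simp: Ct_def\<close>)
  next
   case 3
   have "S ^ 4 * 1 \<le> S ^ 4 * (k^2 / X)" using 3 X by (intro mult_left_mono) auto
   moreover have "S ^ 4 * (k^2 / X) = k^2 * (S ^ 4 / X)" by simp
   moreover have "?E \<le> 256 * S ^ 4" using 3 by (intro le_card) auto
   ultimately have "?E \<le> 0 * S powr (2 + a) + 256 * k^2 * (S ^ 4 / X)" by linarith
   then show ?thesis by (rule goal_if) (use Cp k in \<open>auto simp: Ct_def\<close>)
  next
   case 4
   \<comment> \<open>Centres in geometric progression from S / 2 to beyond 2 S, with ratio 1 +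
     \<eta> / 2; each s lies in the narrow window around the last centre not exceeding it.\<close>
   define t where "t = (\<lambda>j. (S / 2) * r ^ j)"
   define A where "A = (\<lambda>j. {s :: nat. \<bar>real s / t j - 1\<bar> \<le> \<eta> / 2} \<inter> ?D)"
   have finD: "finite ?D" using dyadic_card_le(1)[of S] 4 by simp
   have tpos: "t j \<ge> 1" for j using 4 r one_le_power[of r j] mult_mono[of 1 "S/2" 1 "r ^ j"] by (simp add: t_def)
   have "\<exists>j<n. s \<in> A j" if s: "s \<in> ?D" for s
   proof -
    define j where "j = (LEAST j. real s < t (Suc j))"
    have ex: "real s < t (Suc (n - 1))"
    proof -
     have "n \<noteq> 0" using n by (cases n) auto
     then have "t (Suc (n - 1)) = S / 2 * r ^ n" by (simp add: t_def)
     moreover have "S / 2 * 4 < S / 2 * r ^ n" using n S by (intro mult_strict_left_mono) auto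
     ultimately show ?thesis using s by simp
    qed
    have j1: "real s < t (Suc j)" unfolding j_def using ex by (rule LeastI)
    have "j \<le> n - 1" unfolding j_def using ex by (rule Least_le)
    moreover have "n \<noteq> 0" using n by (cases n) auto
    ultimately have jn: "j < n" by simp
    have j2: "t j \<le> real s"
    proof (cases j)
     case 0
     then show ?thesis using s by (simp add: t_def)
    next
     case (Suc i)
     then have "\<not> real s < t (Suc i)" using not_less_Least[of i "\<lambda>j. real s < t (Suc j)"] by (simp add: j_def)
     then show ?thesis using Suc by simp
    qed
    have "t (Suc j) = r * t j" by (simp add: t_def)
    then have "real s / t j < r" "1 \<le> real s / t j" using j1 j2 tpos[of j] by (simp_all add: field_simps)
    then have "\<bar>real s / t j - 1\<bar> \<le> \<eta> / 2" unfolding r_def by linarith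
    then show ?thesis using jn s by (auto simp: A_def)
   qed
   then have D: "?D = (\<Union>j<n. A j)" by (auto simp: A_def)
   define B where "B = Cp * (S powr (2 + a) + S ^ 4 / X)"
   have "energy (\<Union>j<n. A j) (\<lambda>s. (real s / S) powr \<kappa>) X \<le> 16 ^ n * B"
   proof (rule energy_UN_le)
    show "B \<ge> 0" using Cp nn by (simp add: B_def)
    fix j
    show "finite (A j)" using finD by (simp add: A_def)
    show "energy (A j) (\<lambda>s. (real s / S) powr \<kappa>) X \<le> B"
    proof (cases "A j = {}")
     case True
     then show ?thesis using \<open>B \<ge> 0\<close> by (simp add: energy_def)
    next
     case False
     then obtain s where s: "s \<in> A j" by blast
     have q: "real s / t j \<ge> 7/8" "real s / t j \<le> 9/8" "S / 2 \<le> real s" "real s \<le> 2 * S"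
     proof -
      have "\<bar>real s / t j - 1\<bar> \<le> \<eta> / 2" using s by (simp add: A_def)
      then show "real s / t j \<ge> 7/8" "real s / t j \<le> 9/8" using \<eta> by linarith+
     qed (use s in \<open>auto simp: A_def\<close>)
     have t1: "t j \<ge> S / 2" using 4 r one_le_power[of r j] by (simp add: t_def mult_le_cancel_left1)
     have t2: "t j \<le> 16/7 * S" using q tpos[of j] by (simp add: field_simps)
     have tp: "t j > 0" using tpos[of j] by linarith
     let ?q = "t j / S"
     have qb: "1 / 4 \<le> ?q" "?q \<le> 4" using t1 t2 S by (auto simp: field_simps)
     have ck: "1 / k^2 \<le> ?q powr \<kappa>"
     proof -
      have "?q powr (- \<kappa>) \<le> k^2"
      proof (cases "\<kappa> \<ge> 0")
       case True
       have "?q powr (- \<kappa>) = (1 / ?q) powr \<kappa>" using tp S by (simp add: powr_minus powr_divide inverse_eq_divide)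
       also have "... \<le> 4 powr \<kappa>" using True tp S qb by (intro powr_mono2) (auto simp: field_simps)
       also have "... = (2 * 2) powr \<kappa>" by simp
       also have "... = k^2" using True unfolding powr_mult by (simp add: k_def power2_eq_square)
       finally show ?thesis .
      next
       case False
       have "?q powr (- \<kappa>) \<le> 4 powr (- \<kappa>)" using False tp S qb by (intro powr_mono2) auto
       also have "... = (2 * 2) powr (- \<kappa>)" by simp
       also have "... = k^2" using False unfolding powr_mult by (simp add: k_def power2_eq_square)
       finally show ?thesis .
      qed
      moreover have "?q powr (- \<kappa>) > 0" using tp S by simp
      ultimately have "1 / k^2 \<le> 1 / ?q powr (- \<kappa>)" using k by (intro divide_left_mono) auto
      then show ?thesis by (simp add: powr_minus_divide)
     qed
     \<comment> \<open>X / k^2 is what is available after renormalisation, the other value is the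
       balancing scale.\<close>
     define X0 where "X0 = min (X / k^2) (t j powr (2 - a))"
     have X0: "1 \<le> X0" using 4 k tpos[of j] a by (auto simp: X0_def ge_one_powr_ge_zero field_simps)
     have "energy (A j) (\<lambda>s. (real s / S) powr \<kappa>) X = energy (A j) (\<lambda>s. ?q powr \<kappa> * (real s / t j) powr \<kappa>) X"
      using tp S by (intro energy_cong) (simp flip: powr_mult)
     also have "... = energy (A j) (\<lambda>s. (real s / t j) powr \<kappa>) (?q powr \<kappa> * X)" by (rule energy_scale)
     also have "... \<le> energy (A j) (\<lambda>s. (real s / t j) powr \<kappa>) X0"
     proof (rule energy_antimono)
      have "X0 \<le> 1 / k^2 * X" by (simp add: X0_def)
      also have "... \<le> ?q powr \<kappa> * X" using ck X by (intro mult_right_mono) auto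
      finally show "X0 \<le> ?q powr \<kappa> * X" .
     qed (use X0 in auto)
     also have "... \<le> energy {s :: nat. \<bar>real s / t j - 1\<bar> \<le> \<eta> / 2} (\<lambda>s. (real s / t j) powr \<kappa>) X0"
     proof (rule energy_mono_set)
      have "s \<le> nat \<lfloor>2 * t j\<rfloor>" if "\<bar>real s / t j - 1\<bar> \<le> \<eta> / 2" for s :: nat
      proof -
       have "real s / t j \<le> 2" using that \<eta> by linarith
       then have "real s \<le> 2 * t j" using tp by (simp add: field_simps)
       then show ?thesis by (simp add: le_nat_floor)
      qed
      then have "{s :: nat. \<bar>real s / t j - 1\<bar> \<le> \<eta> / 2} \<subseteq> {..nat \<lfloor>2 * t j\<rfloor>}" by auto
      then show "finite {s :: nat. \<bar>real s / t j - 1\<bar> \<le> \<eta> / 2}" by (rule finite_subset) simp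
     qed (use X0 in \<open>auto simp: A_def\<close>)
     also have "... \<le> C * (t j powr (2 - \<theta>) * X0 powr \<theta> + X0 + t j ^ 4 / X0)"
      by (intro narrow tpos X0)
     also have "... \<le> C * (3 * t j powr (2 + a) + t j ^ 4 * k^2 / X)"
     proof (intro mult_left_mono C)
      have "X0 powr \<theta> \<le> (t j powr (2 - a)) powr \<theta>" using X0 \<theta> by (intro powr_mono2) (auto simp: X0_def)
      then have "t j powr (2 - \<theta>) * X0 powr \<theta> \<le> t j powr (2 - \<theta>) * (t j powr (2 - a)) powr \<theta>"
       by (intro mult_left_mono) auto
      also have "... = t j powr (2 - \<theta> + (2 - a) * \<theta>)" by (simp add: powr_powr powr_add)
      also have "2 - \<theta> + (2 - a) * \<theta> = 2 + a" using a(3) by (simp add: algebra_simps)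
      finally have 1: "t j powr (2 - \<theta>) * X0 powr \<theta> \<le> t j powr (2 + a)" .
      have "X0 \<le> t j powr (2 - a)" by (simp add: X0_def)
      also have "... \<le> t j powr (2 + a)" using tpos[of j] a by (intro powr_mono) auto
      finally have 2: "X0 \<le> t j powr (2 + a)" .
      have 3: "t j ^ 4 / X0 \<le> t j powr (2 + a) + t j ^ 4 * k^2 / X"
      proof (cases "X / k^2 \<le> t j powr (2 - a)")
       case True
       then have "t j ^ 4 / X0 = t j ^ 4 * k^2 / X" by (simp add: X0_def)
       then show ?thesis by simp
      next
       case False
       then have "X0 = t j powr (2 - a)" by (simp add: X0_def)
       moreover have "t j ^ 4 = t j powr (2 + a) * t j powr (2 - a)"
        using tp by (simp flip: powr_add)
       ultimately have "t j ^ 4 / X0 = t j powr (2 + a)" using tp by simp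
       then show ?thesis using X k tp by simp
      qed
      show "t j powr (2 - \<theta>) * X0 powr \<theta> + X0 + t j ^ 4 / X0 \<le> 3 * t j powr (2 + a) + t j ^ 4 * k^2 / X"
       using 1 2 3 by linarith
     qed
     also have "... \<le> C * (3 * (4 powr (2 + a) * S powr (2 + a)) + 256 * S ^ 4 * k^2 / X)"
     proof (intro mult_left_mono C add_mono divide_right_mono mult_right_mono)
      have "t j \<le> 4 * S" using qb(2) S by (simp add: field_simps)
      then have "t j powr (2 + a) \<le> (4 * S) powr (2 + a)" and 4: "t j ^ 4 \<le> (4 * S) ^ 4"
       using tp a powr_mono2[of "2 + a" "t j" "4 * S"] power_mono[of "t j" "4 * S" 4] by linarith+
      then show "t j powr (2 + a) \<le> 4 powr (2 + a) * S powr (2 + a)" using S by (simp add: powr_mult)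
      show "t j ^ 4 \<le> 256 * S ^ 4" using 4 by (simp add: power_mult_distrib)
     qed (use X in auto)
     also have "... \<le> B"
     proof -
      have "0 \<le> C * (256 * k^2) * S powr (2 + a)" "0 \<le> C * (3 * 4 powr (2 + a)) * (S ^ 4 / X)" using C X by auto
      then show ?thesis unfolding B_def Cp_def by (simp add: algebra_simps)
     qed
     finally show ?thesis .
    qed
   qed (use X in auto)
   then have "?E \<le> 16 ^ n * Cp * S powr (2 + a) + 16 ^ n * Cp * (S ^ 4 / X)"
    unfolding D B_def by (simp add: algebra_simps)
   then show ?thesis by (rule goal_if) (use Cp k in \<open>auto simp: Ct_def\<close>)
  qed
 qed
 show ?thesis unfolding spacing_def a_def[symmetric] using Ct main by blast
qed

text \<open>The map \<theta> |-> \<theta> / (1 + \<theta>) adds 1 to 1 / \<theta>, so it runs from 2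
  through the values 2 / (2 n + 1). Every step passes to the dual exponent, hence the induction for
  all \<kappa> simultaneously.\<close>

lemma spacing_iterate:
 assumes "\<kappa> \<noteq> 0" "\<kappa> \<noteq> 1"
 shows "spacing \<kappa> (2 / (2 * real n + 1))"
 using assms
proof (induction n arbitrary: \<kappa>)
 case 0
 then show ?case using spacing_trivial by simp
next
 case (Suc n)
 have "\<kappa> / (\<kappa> - 1) \<noteq> 0" "\<kappa> / (\<kappa> - 1) \<noteq> 1" using Suc.prems by (auto simp: divide_eq_eq)
 then have "spacing \<kappa> (2 / (2 * real n + 1) / (1 + 2 / (2 * real n + 1)))"
  using Suc by (intro spacing_step Suc.IH) auto
 also have "2 / (2 * real n + 1) / (1 + 2 / (2 * real n + 1)) = 2 / (2 * real (Suc n) + 1)"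
 proof -
  have "D * (1 + 2 / D) = D + 2" if "D \<noteq> 0" for D :: real using that by (simp add: distrib_left)
  from this[of "2 * real n + 1"] have "(2 * real n + 1) * (1 + 2 / (2 * real n + 1)) = 2 * real (Suc n) + 1" by simp
  then show ?thesis unfolding divide_divide_eq_left by (simp only:)
 qed
 finally show ?case .
qed

theorem spacing_all:
 assumes "\<kappa> \<noteq> 0" "\<kappa> \<noteq> 1" "\<epsilon> > 0"
 shows "spacing \<kappa> \<epsilon>"
proof -
 obtain n :: nat where n: "2 / \<epsilon> < real n" using reals_Archimedean2 by blast
 define \<theta> where "\<theta> = 2 / (2 * real n + 1)"
 have "2 < \<epsilon> * real n" using n assms(3) by (simp add: field_simps)
 also have "... \<le> \<epsilon> * (2 * real n + 1)" using assms(3) by (intro mult_left_mono) auto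
 finally have \<theta>: "\<theta> < \<epsilon>" unfolding \<theta>_def by (simp add: field_simps)
 obtain C where C: "C \<ge> 0" and sp: "\<And>S X. S > 0 ==> X > 0 ==>
   energy {s :: nat. S / 2 \<le> real s \<and> real s \<le> 2 * S} (\<lambda>s. (real s / S) powr \<kappa>) X \<le> C * (S powr (2 + \<theta>) + S ^ 4 / X)"
  using spacing_iterate[OF assms(1,2), of n] unfolding spacing_def \<theta>_def by blast
 define K where "K = C * 2 powr \<epsilon> + C"
 have "energy {s :: nat. S / 2 \<le> real s \<and> real s \<le> 2 * S} (\<lambda>s. (real s / S) powr \<kappa>) X \<le> K * (S powr (2 + \<epsilon>) + S ^ 4 / X)"
  if S: "S > 0" and X: "X > 0" for S X
 proof (cases "S < 1/2")
  case True
  show ?thesis unfolding dyadic_empty[OF True S] using S X C by (simp add: energy_def K_def)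
 next
  case False
  have "(1/2) powr (\<epsilon> - \<theta>) \<le> S powr (\<epsilon> - \<theta>)" using False \<theta> by (intro powr_mono2) auto
  moreover have "(1/2) powr \<epsilon> \<le> (1/2::real) powr (\<epsilon> - \<theta>)" by (rule powr_mono') (auto simp: \<theta>_def)
  ultimately have "(1/2) powr \<epsilon> \<le> S powr (\<epsilon> - \<theta>)" by linarith
  then have "2 powr \<epsilon> * (1/2) powr \<epsilon> * S powr (2 + \<theta>) \<le> 2 powr \<epsilon> * S powr (\<epsilon> - \<theta>) * S powr (2 + \<theta>)"
   by (intro mult_right_mono mult_left_mono) auto
  also have "2 powr \<epsilon> * S powr (\<epsilon> - \<theta>) * S powr (2 + \<theta>) = 2 powr \<epsilon> * S powr (2 + \<epsilon>)"
   using S by (simp add: mult.assoc add.commute flip: powr_add)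
  finally have *: "S powr (2 + \<theta>) \<le> 2 powr \<epsilon> * S powr (2 + \<epsilon>)" by (simp flip: powr_mult)
  have "energy {s :: nat. S / 2 \<le> real s \<and> real s \<le> 2 * S} (\<lambda>s. (real s / S) powr \<kappa>) X \<le> C * (S powr (2 + \<theta>) + S ^ 4 / X)"
   by (rule sp[OF S X])
  also have "... \<le> C * (2 powr \<epsilon> * S powr (2 + \<epsilon>) + S ^ 4 / X)" using * C by (intro mult_left_mono add_right_mono)
  also have "... \<le> K * (S powr (2 + \<epsilon>) + S ^ 4 / X)"
  proof -
   have "0 \<le> C * S powr (2 + \<epsilon>)" "0 \<le> C * 2 powr \<epsilon> * (S ^ 4 / X)" using C X by auto
   then show ?thesis by (simp add: K_def algebra_simps)
  qed
  finally show ?thesis .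
 qed
 moreover have "K \<ge> 0" using C by (simp add: K_def)
 ultimately show ?thesis unfolding spacing_def by blast
qed

section \<open>The double large sieve\<close>

lemma partial_summation:
 fixes b w :: "nat => complex"
 assumes "A \<le> n"
 shows "(\<Sum>s\<in>{A..<n}. b s * w s) = (\<Sum>s\<in>{A..<n}. b s) * w n - (\<Sum>s\<in>{A..<n}. (\<Sum>r\<in>{A..<Suc s}. b r) * (w (Suc s) - w s))"
 using assms by (induction n rule: dec_induct) (simp_all add: algebra_simps)

text \<open>A weight of total variation V is removed at the cost 1 + V, provided all prefix sums of
  b are bounded. This is why prefixes, and not only the full inner sum, have to be controlled
  later.\<close>

lemma partial_summation_le:
 fixes b w :: "nat => complex"
 assumes "\<And>k. A \<le> k ==> k \<le> n ==> norm (\<Sum>s\<in>{A..<k}. b s) \<le> B" "norm (w n) \<le> 1" "(\<Sum>s\<in>{A..<n}. norm (w (Suc s) - w s)) \<le> V" "0 \<le> B" "0 \<le> V"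
 shows "norm (\<Sum>s\<in>{A..<n}. b s * w s) \<le> B * (1 + V)"
proof (cases "A \<le> n")
 case False
 then show ?thesis using assms by simp
next
 case True
 have "norm (\<Sum>s\<in>{A..<n}. b s * w s) \<le> norm ((\<Sum>s\<in>{A..<n}. b s) * w n) + norm (\<Sum>s\<in>{A..<n}. (\<Sum>r\<in>{A..<Suc s}. b r) * (w (Suc s) - w s))"
  by (subst partial_summation[OF True]) (rule norm_triangle_ineq4)
 also have "norm ((\<Sum>s\<in>{A..<n}. b s) * w n) \<le> B * 1"
  unfolding norm_mult using assms True by (intro mult_mono) auto
 also have "norm (\<Sum>s\<in>{A..<n}. (\<Sum>r\<in>{A..<Suc s}. b r) * (w (Suc s) - w s)) \<le> (\<Sum>s\<in>{A..<n}. B * norm (w (Suc s) - w s))"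
  unfolding norm_mult[symmetric] by (intro sum_norm_le) (simp add: norm_mult mult_right_mono assms(1) del: sum.op_ivl_Suc)
 also have "... \<le> B * V" unfolding sum_distrib_left[symmetric] using assms by (intro mult_left_mono) auto
 finally show ?thesis by (simp add: algebra_simps)
qed

lemma norm_ec_diff_le: "norm (ec x - ec y) \<le> 2 * pi * \<bar>x - y\<bar>"
proof -
 have "ec x - ec y = ec y * (ec (x - y) - 1)" using ec_add[of y "x - y"] by (simp add: algebra_simps)
 then have "norm (ec x - ec y) = norm (exp (\<i> * of_real (2 * pi * (x - y))) - 1)"
  by (simp add: norm_mult ec_def cis_conv_exp)
 also have "... \<le> \<bar>2 * pi * (x - y)\<bar>" using iexp_approx1[of "2 * pi * (x - y)" 0] by simp
 finally show ?thesis by (simp add: abs_mult)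
qed

section \<open>Prefix sums through dyadic blocks, and the large sieve over unit cells\<close>

lemma sum_power4_le:
 fixes f :: "'a => real"
 shows "(\<Sum>i\<in>I. f i) ^ 4 \<le> real (card I) ^ 3 * (\<Sum>i\<in>I. f i ^ 4)"
proof -
 have "(\<Sum>i\<in>I. f i) ^ 4 = ((\<Sum>i\<in>I. f i)^2)^2" by simp
 also have "... \<le> ((\<Sum>i\<in>I. (f i)\<^sup>2) * card I)^2"
  by (intro power_mono sum_squared_le_sum_of_squares) auto
 also have "... = (\<Sum>i\<in>I. (f i)\<^sup>2)^2 * (card I)^2" by (simp add: power_mult_distrib)
 also have "... \<le> ((\<Sum>i\<in>I. ((f i)^2)\<^sup>2) * card I) * (card I)^2"
  by (intro mult_right_mono sum_squared_le_sum_of_squares) auto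
 also have "... = real (card I) ^ 3 * (\<Sum>i\<in>I. f i ^ 4)" by (simp add: power3_eq_cube power2_eq_square power4_eq_xxxx mult_ac)
 finally show ?thesis .
qed

text \<open>The prefix sums are split along the binary expansion of their length, as in the
 Rademacher--Menshov inequality.\<close>

lemma prefix_dyadic:
 fixes f :: "nat => 'a :: comm_monoid_add"
 assumes "n < 2 ^ K"
 shows "(\<Sum>s<n. f s) = (\<Sum>j<K. if odd (n div 2 ^ j) then \<Sum>s\<in>{(n div 2 ^ j - 1) * 2 ^ j..<(n div 2 ^ j - 1) * 2 ^ j + 2 ^ j}. f s else 0)"
proof -
 \<comment> \<open>Clearing the binary digit j of n removes a single block of length 2 ^ j if the
   digit is 1, and nothing otherwise.\<close>
 have step: "(\<Sum>s<n div 2 ^ j * 2 ^ j. f s) = (\<Sum>s<n div 2 ^ Suc j * 2 ^ Suc j. f s) +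
   (if odd (n div 2 ^ j) then \<Sum>s\<in>{(n div 2 ^ j - 1) * 2 ^ j..<(n div 2 ^ j - 1) * 2 ^ j + 2 ^ j}. f s else 0)" for j
 proof -
  define q where "q = n div 2 ^ j"
  have q2: "n div 2 ^ Suc j = q div 2" by (simp only: q_def power_Suc mult.commute[of 2] div_mult2_eq)
  show ?thesis
  proof (cases "odd q")
   case False
   then have "q div 2 * 2 ^ Suc j = q * 2 ^ j" by (auto elim!: evenE)
   then have "(\<Sum>s<q * 2 ^ j. f s) = (\<Sum>s<q div 2 * 2 ^ Suc j. f s)" by (simp only:)
   then show ?thesis using False unfolding q2 q_def[symmetric] by (simp only: if_False) simp
  next
   case True
   then obtain r where r: "q = 2 * r + 1" by (auto elim: oddE)
   have "{..<q * 2 ^ j} = {..<q div 2 * 2 ^ Suc j} \<union> {(q - 1) * 2 ^ j..<(q - 1) * 2 ^ j + 2 ^ j}"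
    unfolding r by (auto simp: algebra_simps)
   moreover have "{..<q div 2 * 2 ^ Suc j} \<inter> {(q - 1) * 2 ^ j..<(q - 1) * 2 ^ j + 2 ^ j} = {}" unfolding r by (auto simp: algebra_simps)
   ultimately show ?thesis using True unfolding q2 q_def[symmetric] by (simp add: sum.union_disjoint)
  qed
 qed
 have "(\<Sum>s<n. f s) = (\<Sum>s<n div 2 ^ k * 2 ^ k. f s) + (\<Sum>j<k. if odd (n div 2 ^ j) then \<Sum>s\<in>{(n div 2 ^ j - 1) * 2 ^ j..<(n div 2 ^ j - 1) * 2 ^ j + 2 ^ j}. f s else 0)" for k
 proof (induction k)
  case (Suc k)
  then show ?case by (simp only: step[of k] sum.lessThan_Suc add_ac)
 qed simp
 from this[of K] show ?thesis using assms by simp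
qed

definition dyadic_block :: "nat => nat => nat => nat => nat set" where
 "dyadic_block A B j q = {q * 2 ^ j..<q * 2 ^ j + 2 ^ j} \<inter> {A..<B}"

text \<open>The bound must not depend on n, so the one block used at each level is replaced by all
  blocks of that level. Adding up the levels inside a fourth power costs K^3.\<close>

lemma prefix_power4_le:
 fixes b :: "nat => complex"
 assumes "B < 2 ^ K" "n \<le> B"
 shows "norm (\<Sum>s\<in>{A..<n}. b s) ^ 4 \<le> real K ^ 3 * (\<Sum>j<K. \<Sum>q<2 ^ K. norm (\<Sum>s\<in>dyadic_block A B j q. b s) ^ 4)"
proof -
 define f where "f = (\<lambda>s. if s \<in> {A..<B} then b s else 0)"
 define g where "g = (\<lambda>j. if odd (n div 2 ^ j) then \<Sum>s\<in>{(n div 2 ^ j - 1) * 2 ^ j..<(n div 2 ^ j - 1) * 2 ^ j + 2 ^ j}. f s else 0)"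
 have nK: "n < 2 ^ K" using assms by simp
 have blk: "(\<Sum>s\<in>{q * 2 ^ j..<q * 2 ^ j + 2 ^ j}. f s) = (\<Sum>s\<in>dyadic_block A B j q. b s)" for j q
  unfolding f_def dyadic_block_def by (subst sum.inter_restrict) auto
 have "(\<Sum>s\<in>{A..<n}. b s) = (\<Sum>s<n. f s)"
  using assms(2) by (intro sum.mono_neutral_cong_left) (auto simp: f_def)
 also have "... = (\<Sum>j<K. g j)" unfolding g_def by (rule prefix_dyadic[OF nK])
 finally have "norm (\<Sum>s\<in>{A..<n}. b s) ^ 4 \<le> (\<Sum>j<K. norm (g j)) ^ 4"
  by (intro power_mono) (auto intro: norm_sum)
 also have "... \<le> real K ^ 3 * (\<Sum>j<K. norm (g j) ^ 4)" using sum_power4_le[of "\<lambda>j. norm (g j)" "{..<K}"] by simp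
 also have "... \<le> real K ^ 3 * (\<Sum>j<K. \<Sum>q<2 ^ K. norm (\<Sum>s\<in>dyadic_block A B j q. b s) ^ 4)"
 proof (intro mult_left_mono sum_mono)
  fix j
  have "n div 2 ^ j - 1 < 2 ^ K" using nK by (meson diff_le_self div_le_dividend le_less_trans)
  then have "norm (\<Sum>s\<in>dyadic_block A B j (n div 2 ^ j - 1). b s) ^ 4 \<le> (\<Sum>q<2 ^ K. norm (\<Sum>s\<in>dyadic_block A B j q. b s) ^ 4)"
   by (intro member_le_sum) auto
  moreover have "norm (g j) ^ 4 \<le> norm (\<Sum>s\<in>dyadic_block A B j (n div 2 ^ j - 1). b s) ^ 4"
   unfolding g_def blk by simp
  ultimately show "norm (g j) ^ 4 \<le> (\<Sum>q<2 ^ K. norm (\<Sum>s\<in>dyadic_block A B j q. b s) ^ 4)" by linarith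
 qed auto
 finally show ?thesis .
qed

text \<open>Blocks of one level are disjoint, so admitting all of them does not increase the
  energy.\<close>

lemma sum_energy_blocks_le:
 "(\<Sum>q<2 ^ K. energy (dyadic_block A B j q) \<theta> X) \<le> energy {A..<B} \<theta> X"
proof (rule sum_energy_disjoint_le)
 have "q = q'" if "s \<in> dyadic_block A B j q" "s \<in> dyadic_block A B j q'" for s q q'
 proof -
  have "s div 2 ^ j = q" if "s \<in> dyadic_block A B j q" for q
   using that by (intro div_nat_eqI) (auto simp: dyadic_block_def algebra_simps)
  then show ?thesis using that by metis
 qed
 then show "disjoint_family_on (dyadic_block A B j) {..<2 ^ K}" by (auto simp: disjoint_family_on_def)
qed (auto simp: dyadic_block_def)

text \<open>On a unit cell x p is replaced by an integration variable t and u p by its integer part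
  z. The remaining phase has bounded variation in s and is removed by partial summation, which leads
  to prefixes. Cauchy-Schwarz over points and cells then separates the number of close pairs from
  the fourth moments. Over all cells t covers [0, X + 1], and each of the Z values of z contributes
  one energy.\<close>

lemma cell_large_sieve:
 fixes x u :: "'p => real" and a :: "nat => complex" and \<theta> \<phi> :: "nat => real" and n :: "'p => nat"
 assumes P: "finite P" and K: "B < 2 ^ K" and X: "X \<ge> 1"
  and x: "\<And>p. p \<in> P ==> 0 \<le> x p" "\<And>p. p \<in> P ==> x p \<le> X"
  and u: "\<And>p. p \<in> P ==> 0 \<le> u p" "\<And>p. p \<in> P ==> u p < real Z"
  and n: "\<And>p. p \<in> P ==> n p \<le> B" and a: "\<And>s. norm (a s) \<le> 1"
  and \<theta>: "\<And>n. n \<le> B ==> (\<Sum>s\<in>{A..<n}. \<bar>\<theta> (Suc s) - \<theta> s\<bar>) \<le> 1" and \<phi>: "\<And>n. n \<le> B ==> (\<Sum>s\<in>{A..<n}. \<bar>\<phi> (Suc s) - \<phi> s\<bar>) \<le> 1"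
 shows "(\<Sum>p\<in>P. norm (\<Sum>s\<in>{A..<n p}. a s * ec (x p * \<theta> s + u p * \<phi> s))) ^ 4
  \<le> (card P)^2 * real (card {(p, q) \<in> P \<times> P. \<bar>x p - x q\<bar> \<le> 1}) *
    ((1 + 4 * pi) ^ 4 * exp pi * real K ^ 4 * real Z * (X + 1) * energy {A..<B} \<theta> (X + 1))"
proof -
 define F where "F = (\<lambda>p. norm (\<Sum>s\<in>{A..<n p}. a s * ec (x p * \<theta> s + u p * \<phi> s)))"
 define G where "G = (\<lambda>z j q t. norm (tpoly (dyadic_block A B j q) \<theta> (\<lambda>s. a s * ec (real z * \<phi> s)) t) ^ 4)"
 define c where "c = (1 + 4 * pi) ^ 4 * real K ^ 3"
 have c: "c \<ge> 0" by (simp add: c_def)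
 \<comment> \<open>The fourth moment attached to the cell with corner (i, z), with all dyadic blocks
   of all levels included.\<close>
 define W where "W = (\<lambda>(i::nat, z::nat). c * (\<Sum>j<K. \<Sum>q<2 ^ K. integral {real i..real i + 1} (G z j q)))"
 define cell where "cell = (\<lambda>p. (nat \<lfloor>x p\<rfloor>, nat \<lfloor>u p\<rfloor>))"
 have G_cont: "continuous_on T (G z j q)" for T z j q
  unfolding G_def by (intro continuous_intros)
 have G_int: "G z j q integrable_on {s..t}" for z j q s t
  by (intro integrable_continuous_real G_cont)
 have G_nn: "G z j q t \<ge> 0" for z j q t by (simp add: G_def)
 have W_nn: "W \<kappa> \<ge> 0" for \<kappa>
  using c by (auto simp: W_def split: prod.split intro!: mult_nonneg_nonneg sum_nonneg Henstock_Kurzweil_Integration.integral_nonneg G_int G_nn)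
 have FG: "F p ^ 4 \<le> c * (\<Sum>j<K. \<Sum>q<2 ^ K. G (nat \<lfloor>u p\<rfloor>) j q t)"
  if p: "p \<in> P" and t: "real (nat \<lfloor>x p\<rfloor>) \<le> t" "t \<le> real (nat \<lfloor>x p\<rfloor>) + 1" for p t
 proof -
  define z where "z = nat \<lfloor>u p\<rfloor>"
  define b where "b = (\<lambda>s. a s * ec (real z * \<phi> s) * ec (t * \<theta> s))"
  \<comment> \<open>The residual phase: both differences are at most 1 in absolute value and
    \<theta>, \<phi> have variation at most 1, so the variation of w is at most 4 pi.\<close>
  define w where "w = (\<lambda>s. ec ((x p - t) * \<theta> s + (u p - z) * \<phi> s))"
  define R where "R = real K ^ 3 * (\<Sum>j<K. \<Sum>q<2 ^ K. G z j q t)"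
  have R: "R \<ge> 0" unfolding R_def by (intro mult_nonneg_nonneg sum_nonneg G_nn) auto
  have xt: "\<bar>x p - t\<bar> \<le> 1"
  proof -
   have "real (nat \<lfloor>x p\<rfloor>) \<le> x p" "x p \<le> real (nat \<lfloor>x p\<rfloor>) + 1" using x(1)[OF p] by (auto simp: of_nat_nat)
   then show ?thesis using t by linarith
  qed
  have uz: "\<bar>u p - z\<bar> \<le> 1"
  proof -
   have "real z \<le> u p" "u p \<le> real z + 1" using u(1)[OF p] by (auto simp: z_def of_nat_nat)
   then show ?thesis by linarith
  qed
  have pre: "norm (\<Sum>s\<in>{A..<k}. b s) \<le> root 4 R" if "k \<le> n p" for k
  proof -
   have "norm (\<Sum>s\<in>{A..<k}. b s) ^ 4 \<le> real K ^ 3 * (\<Sum>j<K. \<Sum>q<2 ^ K. norm (\<Sum>s\<in>dyadic_block A B j q. b s) ^ 4)"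
    using K n[OF p] that by (intro prefix_power4_le) auto
   also have "... = R" by (simp add: R_def G_def tpoly_def b_def)
   finally have "root 4 (norm (\<Sum>s\<in>{A..<k}. b s) ^ 4) \<le> root 4 R" by simp
   then show ?thesis by (simp add: real_root_power_cancel)
  qed
  have V: "(\<Sum>s\<in>{A..<n p}. norm (w (Suc s) - w s)) \<le> 4 * pi"
  proof -
   have "(\<Sum>s\<in>{A..<n p}. norm (w (Suc s) - w s)) \<le> (\<Sum>s\<in>{A..<n p}. 2 * pi * (\<bar>\<theta> (Suc s) - \<theta> s\<bar> + \<bar>\<phi> (Suc s) - \<phi> s\<bar>))"
   proof (rule sum_mono)
    fix s
    have "norm (w (Suc s) - w s) \<le> 2 * pi * \<bar>(x p - t) * \<theta> (Suc s) + (u p - z) * \<phi> (Suc s) - ((x p - t) * \<theta> s + (u p - z) * \<phi> s)\<bar>"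
     unfolding w_def by (rule norm_ec_diff_le)
    also have "(x p - t) * \<theta> (Suc s) + (u p - z) * \<phi> (Suc s) - ((x p - t) * \<theta> s + (u p - z) * \<phi> s) =
      (x p - t) * (\<theta> (Suc s) - \<theta> s) + (u p - z) * (\<phi> (Suc s) - \<phi> s)" by (simp add: algebra_simps)
    also have "\<bar>...\<bar> \<le> \<bar>x p - t\<bar> * \<bar>\<theta> (Suc s) - \<theta> s\<bar> + \<bar>u p - z\<bar> * \<bar>\<phi> (Suc s) - \<phi> s\<bar>"
     unfolding abs_mult[symmetric] by (rule abs_triangle_ineq)
    also have "... \<le> 1 * \<bar>\<theta> (Suc s) - \<theta> s\<bar> + 1 * \<bar>\<phi> (Suc s) - \<phi> s\<bar>"
     using xt uz by (intro add_mono mult_right_mono) auto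
    finally show "norm (w (Suc s) - w s) \<le> 2 * pi * (\<bar>\<theta> (Suc s) - \<theta> s\<bar> + \<bar>\<phi> (Suc s) - \<phi> s\<bar>)" by simp
   qed
   also have "... = 2 * pi * ((\<Sum>s\<in>{A..<n p}. \<bar>\<theta> (Suc s) - \<theta> s\<bar>) + (\<Sum>s\<in>{A..<n p}. \<bar>\<phi> (Suc s) - \<phi> s\<bar>))"
    by (simp add: sum.distrib flip: sum_distrib_left)
   also have "... \<le> 2 * pi * (1 + 1)" using n[OF p] by (intro mult_left_mono add_mono \<theta> \<phi>) auto
   finally show ?thesis by simp
  qed
  have "F p = norm (\<Sum>s\<in>{A..<n p}. b s * w s)"
   unfolding F_def b_def w_def by (simp add: mult.assoc flip: ec_add) (simp add: algebra_simps z_def)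
  also have "... \<le> root 4 R * (1 + 4 * pi)"
   using pre V R by (intro partial_summation_le) (auto simp: w_def)
  finally have "F p ^ 4 \<le> (root 4 R * (1 + 4 * pi)) ^ 4" by (intro power_mono) (auto simp: F_def)
  also have "... = R * (1 + 4 * pi) ^ 4" using R by (simp add: power_mult_distrib)
  finally show ?thesis by (simp add: R_def c_def z_def mult_ac)
 qed
 have FW: "F p ^ 4 \<le> W (cell p)" if p: "p \<in> P" for p
 proof -
  define i where "i = real (nat \<lfloor>x p\<rfloor>)"
  have "integral {i..i + 1} (\<lambda>_. F p ^ 4) \<le> integral {i..i + 1} (\<lambda>t. c * (\<Sum>j<K. \<Sum>q<2 ^ K. G (nat \<lfloor>u p\<rfloor>) j q t))"
   using FG[OF p] unfolding i_def
   by (intro integral_le integrable_const_ivl integrable_continuous_real continuous_on_mult continuous_on_sum continuous_on_const G_cont) auto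
  also have "... = W (cell p)"
   unfolding W_def cell_def i_def by (simp add: integral_sum G_int integrable_sum)
  finally show ?thesis by simp
 qed
 define I where "I = nat \<lfloor>X\<rfloor> + 1"
 have I: "real I \<le> X + 1" using X by (simp add: I_def of_nat_nat)
 have cell_in: "cell ` P \<subseteq> {..<I} \<times> {..<Z}"
 proof -
  have "nat \<lfloor>x p\<rfloor> < I" if "p \<in> P" for p
   using floor_mono[OF x(2)[OF that]] unfolding I_def by linarith
  moreover have "nat \<lfloor>u p\<rfloor> < Z" if "p \<in> P" for p
   using u[OF that] by (simp add: nat_less_iff floor_less_iff)
  ultimately show ?thesis by (auto simp: cell_def)
 qed
 have sumW: "(\<Sum>\<kappa>\<in>{..<I} \<times> {..<Z}. W \<kappa>) \<le> c * exp pi * real K * real Z * (X + 1) * energy {A..<B} \<theta> (X + 1)"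
 proof -
  have tele: "(\<Sum>i<k. integral {real i..real i + 1} (G z j q)) = integral {0..real k} (G z j q)" for k z j q
  proof (induction k)
   case (Suc k)
   have "integral {0..real k} (G z j q) + integral {real k..real k + 1} (G z j q) = integral {0..real k + 1} (G z j q)"
    by (intro Henstock_Kurzweil_Integration.integral_combine G_int) auto
   then show ?case using Suc by (simp add: add_ac)
  qed simp
  have "(\<Sum>\<kappa>\<in>{..<I} \<times> {..<Z}. W \<kappa>) = (\<Sum>z<Z. \<Sum>i<I. W (i, z))"
   by (subst sum.swap) (simp add: sum.cartesian_product)
  also have "... \<le> (\<Sum>z<Z. c * (\<Sum>j<K. exp pi * (X + 1) * energy {A..<B} \<theta> (X + 1)))"
  proof (rule sum_mono)
   fix z
   have "(\<Sum>i<I. W (i, z)) = c * (\<Sum>j<K. \<Sum>q<2 ^ K. \<Sum>i<I. integral {real i..real i + 1} (G z j q))"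
    unfolding W_def prod.case sum_distrib_left[symmetric]
    by (subst sum.swap, subst (2) sum.swap) simp
   also have "... = c * (\<Sum>j<K. \<Sum>q<2 ^ K. integral {0..real I} (G z j q))" by (simp add: tele)
   also have "... \<le> c * (\<Sum>j<K. \<Sum>q<2 ^ K. exp pi * (X + 1) * energy (dyadic_block A B j q) \<theta> (X + 1))"
    unfolding G_def using X I a c
    by (intro mult_left_mono sum_mono interval_moment_le) (auto simp: norm_mult)
   also have "... \<le> c * (\<Sum>j<K. exp pi * (X + 1) * energy {A..<B} \<theta> (X + 1))"
    unfolding sum_distrib_left[symmetric] using X c
    by (intro mult_left_mono sum_mono sum_energy_blocks_le) auto
   finally show "(\<Sum>i<I. W (i, z)) \<le> c * (\<Sum>j<K. exp pi * (X + 1) * energy {A..<B} \<theta> (X + 1))" .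
  qed
  also have "... = c * exp pi * real K * real Z * (X + 1) * energy {A..<B} \<theta> (X + 1)" by (simp add: mult_ac)
  finally show ?thesis .
 qed
 define N where "N = (\<lambda>\<kappa>. real (card {p \<in> P. cell p = \<kappa>}))"
 have sumF2: "(\<Sum>p\<in>P. (F p)\<^sup>2) \<le> (\<Sum>\<kappa>\<in>{..<I} \<times> {..<Z}. N \<kappa> * sqrt (W \<kappa>))"
 proof -
  have "(\<Sum>p\<in>P. (F p)\<^sup>2) \<le> (\<Sum>p\<in>P. sqrt (W (cell p)))"
   using FW by (intro sum_mono real_le_rsqrt) (simp add: flip: power_mult)
  also have "... = (\<Sum>\<kappa>\<in>{..<I} \<times> {..<Z}. \<Sum>p\<in>{p \<in> P. cell p = \<kappa>}. sqrt (W (cell p)))"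
   using P cell_in by (intro sum.group[symmetric]) auto
  also have "... = (\<Sum>\<kappa>\<in>{..<I} \<times> {..<Z}. N \<kappa> * sqrt (W \<kappa>))" by (intro sum.cong) (auto simp: N_def)
  finally show ?thesis .
 qed
 have sumN2: "(\<Sum>\<kappa>\<in>{..<I} \<times> {..<Z}. (N \<kappa>)\<^sup>2) \<le> real (card {(p, q) \<in> P \<times> P. \<bar>x p - x q\<bar> \<le> 1})"
 proof -
  let ?A = "\<lambda>\<kappa>. {p \<in> P. cell p = \<kappa>} \<times> {p \<in> P. cell p = \<kappa>}"
  have "(\<Sum>\<kappa>\<in>{..<I} \<times> {..<Z}. (N \<kappa>)\<^sup>2) = real (\<Sum>\<kappa>\<in>{..<I} \<times> {..<Z}. card (?A \<kappa>))"
   by (simp add: N_def card_cartesian_product power2_eq_square)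
  also have "(\<Sum>\<kappa>\<in>{..<I} \<times> {..<Z}. card (?A \<kappa>)) = card (\<Union>\<kappa>\<in>{..<I} \<times> {..<Z}. ?A \<kappa>)"
   using P by (intro card_UN_disjoint[symmetric]) auto
  also have "... \<le> card {(p, q) \<in> P \<times> P. \<bar>x p - x q\<bar> \<le> 1}"
  proof (rule card_mono)
   show "finite {(p, q) \<in> P \<times> P. \<bar>x p - x q\<bar> \<le> 1}" by (rule finite_subset[of _ "P \<times> P"]) (use P in auto)
   have "\<bar>x p - x q\<bar> \<le> 1" if "p \<in> P" "q \<in> P" "cell p = cell q" for p q
   proof -
    have "\<lfloor>x p\<rfloor> = \<lfloor>x q\<rfloor>" using that x(1)[OF that(1)] x(1)[OF that(2)] by (simp add: cell_def eq_nat_nat_iff)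
    then show ?thesis by linarith
   qed
   then show "(\<Union>\<kappa>\<in>{..<I} \<times> {..<Z}. ?A \<kappa>) \<subseteq> {(p, q) \<in> P \<times> P. \<bar>x p - x q\<bar> \<le> 1}" by auto
  qed
  finally show ?thesis by simp
 qed
 \<comment> \<open>Cauchy-Schwarz twice: over the points, then over the cells with their occupation
   numbers N.\<close>
 have "(\<Sum>p\<in>P. F p) ^ 4 = ((\<Sum>p\<in>P. F p)^2)^2" by simp
 also have "... \<le> ((\<Sum>p\<in>P. (F p)\<^sup>2) * card P)^2"
  by (intro power_mono sum_squared_le_sum_of_squares) auto
 also have "... = (card P)^2 * (\<Sum>p\<in>P. (F p)\<^sup>2)^2" by (simp add: power_mult_distrib)
 also have "... \<le> (card P)^2 * (\<Sum>\<kappa>\<in>{..<I} \<times> {..<Z}. N \<kappa> * sqrt (W \<kappa>))^2"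
  by (intro mult_left_mono power_mono sumF2 sum_nonneg) auto
 also have "... \<le> (card P)^2 * ((\<Sum>\<kappa>\<in>{..<I} \<times> {..<Z}. (N \<kappa>)\<^sup>2) * (\<Sum>\<kappa>\<in>{..<I} \<times> {..<Z}. (sqrt (W \<kappa>))\<^sup>2))"
  by (intro mult_left_mono Cauchy_Schwarz_ineq_sum) auto
 also have "... = (card P)^2 * ((\<Sum>\<kappa>\<in>{..<I} \<times> {..<Z}. (N \<kappa>)\<^sup>2) * (\<Sum>\<kappa>\<in>{..<I} \<times> {..<Z}. W \<kappa>))"
  using W_nn by simp
 also have "... \<le> (card P)^2 * (real (card {(p, q) \<in> P \<times> P. \<bar>x p - x q\<bar> \<le> 1}) * (c * exp pi * real K * real Z * (X + 1) * energy {A..<B} \<theta> (X + 1)))"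
  by (intro mult_left_mono mult_mono sumN2 sumW sum_nonneg W_nn) auto
 finally show ?thesis by (simp add: F_def c_def power4_eq_xxxx power3_eq_cube mult_ac)
qed

section \<open>Spacing of the outer variables\<close>

lemma card_spaced_le:
 fixes f :: "'a => real"
 assumes "finite A" "\<delta> > 0" "\<Delta> \<ge> 0" and sp: "\<And>x y. x \<in> A ==> y \<in> A ==> x \<noteq> y ==> \<delta> \<le> \<bar>f x - f y\<bar>"
 shows "real (card {x \<in> A. \<bar>f x - t\<bar> \<le> \<Delta>}) \<le> 1 + 2 * \<Delta> / \<delta>"
proof -
 let ?B = "{x \<in> A. \<bar>f x - t\<bar> \<le> \<Delta>}"
 define g where "g = (\<lambda>x. nat \<lfloor>(f x - t + \<Delta>) / \<delta>\<rfloor>)"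
 have nn: "(f x - t + \<Delta>) / \<delta> \<ge> 0" if "x \<in> ?B" for x using that assms by (auto simp: abs_le_iff)
 have "inj_on g ?B"
 proof (rule inj_onI, rule ccontr)
  fix x y assume xy: "x \<in> ?B" "y \<in> ?B" "g x = g y" "x \<noteq> y"
  have "\<lfloor>(f x - t + \<Delta>) / \<delta>\<rfloor> = \<lfloor>(f y - t + \<Delta>) / \<delta>\<rfloor>"
   using xy(3) nn[OF xy(1)] nn[OF xy(2)] by (simp add: g_def eq_nat_nat_iff)
  then have "\<bar>(f x - t + \<Delta>) / \<delta> - (f y - t + \<Delta>) / \<delta>\<bar> < 1" by linarith
  also have "(f x - t + \<Delta>) / \<delta> - (f y - t + \<Delta>) / \<delta> = (f x - f y) / \<delta>" by (simp flip: diff_divide_distrib)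
  finally have "\<bar>f x - f y\<bar> < \<delta>" using assms(2) by (simp add: abs_divide)
  then show False using sp xy by fastforce
 qed
 then have "card ?B = card (g ` ?B)" by (simp add: card_image)
 also have "... \<le> card {..nat \<lfloor>2 * \<Delta> / \<delta>\<rfloor>}"
 proof (intro card_mono image_subsetI)
  fix x assume "x \<in> ?B"
  then have "f x - t + \<Delta> \<le> 2 * \<Delta>" by (auto simp: abs_le_iff)
  then show "g x \<in> {..nat \<lfloor>2 * \<Delta> / \<delta>\<rfloor>}"
   unfolding g_def atMost_iff using assms(2) by (intro nat_mono floor_mono divide_right_mono) auto
 qed simp
 finally have "real (card ?B) \<le> real (nat \<lfloor>2 * \<Delta> / \<delta>\<rfloor>) + 1" by simp
 also have "real (nat \<lfloor>2 * \<Delta> / \<delta>\<rfloor>) \<le> 2 * \<Delta> / \<delta>" using assms by (simp add: of_nat_nat)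
 finally show ?thesis by simp
qed

text \<open>Encodes the pairs of integers from [H, 2 H) with greatest common divisor d by their
  quotients, so that the ratio of the two integers is the reduced fraction a / b.\<close>

definition reduced_pairs :: "nat => nat => (nat \<times> nat) set" where
 "reduced_pairs H d = {(a, b). coprime a b \<and> d * a \<in> {H..<2 * H} \<and> d * b \<in> {H..<2 * H}}"

lemma reduced_pairs_card:
 assumes "d > 0"
 shows "finite (reduced_pairs H d)" "real (card (reduced_pairs H d)) \<le> (2 * real H / d)^2"
proof -
 let ?n = "2 * H div d"
 have *: "d * a \<in> {H..<2 * H} ==> a \<in> {1..?n}" for a
 proof -
  assume "d * a \<in> {H..<2 * H}"
  then have "d * a < 2 * H" "H \<le> d * a" "H > 0" by auto
  then have "a \<noteq> 0" by (metis mult_0_right le_zero_eq less_numeral_extra(3))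
  moreover have "a \<le> ?n" using \<open>d * a < 2 * H\<close> assms by (simp add: less_eq_div_iff_mult_less_eq mult.commute)
  ultimately show ?thesis by simp
 qed
 have sub: "reduced_pairs H d \<subseteq> {1..?n} \<times> {1..?n}" unfolding reduced_pairs_def using * by blast
 then show "finite (reduced_pairs H d)" by (rule finite_subset) auto
 have "card (reduced_pairs H d) \<le> card ({1..?n} \<times> {1..?n})" using sub by (intro card_mono) auto
 then have "real (card (reduced_pairs H d)) \<le> (real ?n)^2" by (simp add: power2_eq_square flip: of_nat_mult)
 also have "... \<le> (2 * real H / d)^2" using of_nat_div_le_of_nat[of "2 * H" d] by (intro power_mono) auto
 finally show "real (card (reduced_pairs H d)) \<le> (2 * real H / d)^2" .
qed

lemma reduced_pairs_ratio:
 assumes "(a, b) \<in> reduced_pairs H d"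
 shows "a > 0" "b > 0" "1/2 \<le> real a / b" "real a / b \<le> 2"
proof -
 have *: "d * a < 2 * H" "H \<le> d * a" "d * b < 2 * H" "H \<le> d * b" using assms by (auto simp: reduced_pairs_def)
 show a: "a > 0" using * by (cases a) auto
 show b: "b > 0" using * by (cases b) auto
 have "d > 0" using * by (cases d) auto
 have "d * b < d * (2 * a)" "d * a < d * (2 * b)" using * by linarith+
 then have "b < 2 * a" "a < 2 * b" by (simp_all only: nat_mult_less_cancel1 \<open>d > 0\<close> simp_thms)
 then show "1/2 \<le> real a / b" "real a / b \<le> 2" using b by (simp_all add: field_simps)
qed

text \<open>Distinct reduced fractions differ by at least 1 / (b b'), and both denominators are
  below 2 H / d.\<close>

lemma reduced_pairs_spaced:
 assumes "p \<in> reduced_pairs H d" "q \<in> reduced_pairs H d" "p \<noteq> q" "d > 0"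
 shows "(d / (2 * real H))^2 \<le> \<bar>real (fst p) / real (snd p) - real (fst q) / real (snd q)\<bar>"
proof -
 obtain a b a' b' where ab: "p = (a, b)" "q = (a', b')" by fastforce
 note p = reduced_pairs_ratio[OF assms(1)[unfolded ab]] and q = reduced_pairs_ratio[OF assms(2)[unfolded ab]]
 have cop: "coprime a b" "coprime a' b'" and lt: "d * b < 2 * H" "d * b' < 2 * H" using assms by (auto simp: reduced_pairs_def ab)
 have neq: "a * b' \<noteq> a' * b"
 proof
  assume "a * b' = a' * b"
  then have "a = a' \<and> b = b'" using coprime_crossproduct_nat[of a b a' b'] cop by (simp add: mult.commute)
  then show False using assms(3) ab by simp
 qed
 have "real a / b - real a' / b' = (real (a * b') - real (a' * b)) / (real b * real b')"
  using p q by (simp add: field_simps)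
 then have "\<bar>real a / b - real a' / b'\<bar> = \<bar>real (a * b') - real (a' * b)\<bar> / (real b * real b')"
  by (simp add: abs_divide)
 also have "... \<ge> 1 / (real b * real b')"
  proof (rule divide_right_mono)
  show "1 \<le> \<bar>real (a * b') - real (a' * b)\<bar>" using neq by linarith
 qed simp

 finally have 1: "1 / (real b * real b') \<le> \<bar>real a / b - real a' / b'\<bar>" .
 have "real d * real b \<le> 2 * H" "real d * real b' \<le> 2 * H" using lt by (metis of_nat_mult of_nat_less_iff less_imp_le of_nat_numeral)+
 then have "(real d * real b) * (real d * real b') \<le> real (2 * H) * real (2 * H)" by (intro mult_mono) auto
 then have "(d / (2 * real H))^2 \<le> 1 / (real b * real b')"
  using p q lt by (simp add: power2_eq_square field_simps)
 then show ?thesis using 1 ab by simp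
qed

text \<open>For x \<le> y the difference is at least (y - x) x powr (\<alpha> - 1), and x powr
  (\<alpha> - 1) \<ge> (1/2) powr (\<alpha> - 1) \<ge> 1/2.\<close>

lemma powr_spaced:
 fixes x y \<alpha> :: real
 assumes "1/2 \<le> x" "1/2 \<le> y" "1 \<le> \<alpha>" "\<alpha> \<le> 2"
 shows "\<bar>x - y\<bar> / 2 \<le> \<bar>x powr \<alpha> - y powr \<alpha>\<bar>"
proof -
 have *: "(y - x) / 2 \<le> y powr \<alpha> - x powr \<alpha>" if "1/2 \<le> x" "x \<le> y" for x y :: real
 proof -
  have "1/2 = (1/2::real) powr 1" by simp
  also have "... \<le> (1/2) powr (\<alpha> - 1)" using assms by (intro powr_mono') auto
  also have "... \<le> x powr (\<alpha> - 1)" using that assms by (intro powr_mono2) auto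
  finally have h: "1/2 \<le> x powr (\<alpha> - 1)" .
  have "(y - x) * (1/2) \<le> (y - x) * x powr (\<alpha> - 1)" using h that by (intro mult_left_mono) auto
  also have "... = y * x powr (\<alpha> - 1) - x powr \<alpha>" using that by (simp add: left_diff_distrib powr_diff diff_divide_distrib)
  also have "y * x powr (\<alpha> - 1) \<le> y * y powr (\<alpha> - 1)" using that assms by (intro mult_left_mono powr_mono2) auto
  also have "y * y powr (\<alpha> - 1) = y powr \<alpha>" using that by (simp add: powr_diff)
  finally show ?thesis by simp
 qed
 show ?thesis using *[of x y] *[of y x] assms by (cases "x \<le> y") auto
qed

text \<open>Fixing one of the two fractions and using the spacing of the other gives V^2 (1 + 2
  \<Delta> U^2) as well as U^2 (1 + 4 \<Delta> V^2). The bound with the smaller leading square is at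
  most U V + 4 \<Delta> (U V)^2.\<close>

lemma pair_count_reduced:
 assumes d: "d > 0" and g: "g > 0" and \<alpha>: "1 \<le> \<alpha>" "\<alpha> \<le> 2" and \<Delta>: "\<Delta> \<ge> 0"
 shows "finite {(p, q) \<in> reduced_pairs H d \<times> reduced_pairs M g. \<bar>real (fst p) / real (snd p) - (real (fst q) / real (snd q)) powr \<alpha>\<bar> \<le> \<Delta>}"
 and "real (card {(p, q) \<in> reduced_pairs H d \<times> reduced_pairs M g. \<bar>real (fst p) / real (snd p) - (real (fst q) / real (snd q)) powr \<alpha>\<bar> \<le> \<Delta>})
  \<le> 4 * (real H * real M) / (real d * real g) + 64 * \<Delta> * ((real H * real M) / (real d * real g))^2"
proof -
 let ?A = "reduced_pairs H d" and ?B = "reduced_pairs M g"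
 let ?f = "\<lambda>p :: nat \<times> nat. real (fst p) / real (snd p)" and ?h = "\<lambda>q :: nat \<times> nat. (real (fst q) / real (snd q)) powr \<alpha>"
 let ?Q = "{(p, q) \<in> ?A \<times> ?B. \<bar>?f p - ?h q\<bar> \<le> \<Delta>}"
 define U where "U = 2 * real H / d"
 define V where "V = 2 * real M / g"
 have UV: "U \<ge> 0" "V \<ge> 0" by (auto simp: U_def V_def)
 have fin: "finite ?A" "finite ?B" and card: "real (card ?A) \<le> U^2" "real (card ?B) \<le> V^2"
  using reduced_pairs_card d g by (auto simp: U_def V_def)
 show "finite ?Q" by (rule finite_subset[of _ "?A \<times> ?B"]) (use fin in auto)
 have goal_eq: "4 * (real H * real M) / (real d * real g) + 64 * \<Delta> * ((real H * real M) / (real d * real g))^2 = U * V + 4 * \<Delta> * (U * V)^2"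
  by (simp add: U_def V_def power2_eq_square)
 have b1: "real (card ?Q) \<le> V^2 * (1 + 2 * \<Delta> * U^2)"
 proof (cases "H = 0")
  case True
  then show ?thesis using UV \<Delta> by (simp add: reduced_pairs_def)
 next
  case False
  have "?Q = (\<Union>q\<in>?B. (\<lambda>p. (p, q)) ` {p \<in> ?A. \<bar>?f p - ?h q\<bar> \<le> \<Delta>})" by auto
  then have "card ?Q \<le> (\<Sum>q\<in>?B. card ((\<lambda>p. (p, q)) ` {p \<in> ?A. \<bar>?f p - ?h q\<bar> \<le> \<Delta>}))"
   using fin by (simp only: card_UN_le)
  also have "... \<le> (\<Sum>q\<in>?B. card {p \<in> ?A. \<bar>?f p - ?h q\<bar> \<le> \<Delta>})"
   using fin by (intro sum_mono card_image_le) auto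
  finally have "real (card ?Q) \<le> (\<Sum>q\<in>?B. real (card {p \<in> ?A. \<bar>?f p - ?h q\<bar> \<le> \<Delta>}))" by (simp flip: of_nat_sum)
  also have "... \<le> (\<Sum>q\<in>?B. 1 + 2 * \<Delta> / (d / (2 * real H))^2)"
   using fin d \<Delta> False by (intro sum_mono card_spaced_le reduced_pairs_spaced) auto
  also have "... = real (card ?B) * (1 + 2 * \<Delta> * U^2)" by (simp add: U_def power_divide)
  also have "... \<le> V^2 * (1 + 2 * \<Delta> * U^2)" using card \<Delta> by (intro mult_right_mono) auto
  finally show ?thesis .
 qed
 have b2: "real (card ?Q) \<le> U^2 * (1 + 4 * \<Delta> * V^2)"
 proof (cases "M = 0")
  case True
  then show ?thesis using UV \<Delta> by (simp add: reduced_pairs_def)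
 next
  case False
  have sp: "(g / (2 * real M))^2 / 2 \<le> \<bar>?h p - ?h q\<bar>" if "p \<in> ?B" "q \<in> ?B" "p \<noteq> q" for p q
  proof -
   have "1/2 \<le> ?f p" "1/2 \<le> ?f q" using reduced_pairs_ratio(3) that by (metis prod.collapse)+
   then have "\<bar>?f p - ?f q\<bar> / 2 \<le> \<bar>?h p - ?h q\<bar>" using \<alpha> by (intro powr_spaced)
   moreover have "(g / (2 * real M))^2 / 2 \<le> \<bar>?f p - ?f q\<bar> / 2"
    by (rule divide_right_mono[OF reduced_pairs_spaced[OF that g]]) simp
   ultimately show ?thesis by (rule order.trans[rotated])
  qed
  have "?Q = (\<Union>p\<in>?A. (\<lambda>q. (p, q)) ` {q \<in> ?B. \<bar>?h q - ?f p\<bar> \<le> \<Delta>})" by (auto simp: abs_minus_commute)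
  then have "card ?Q \<le> (\<Sum>p\<in>?A. card ((\<lambda>q. (p, q)) ` {q \<in> ?B. \<bar>?h q - ?f p\<bar> \<le> \<Delta>}))"
   using fin by (simp only: card_UN_le)
  also have "... \<le> (\<Sum>p\<in>?A. card {q \<in> ?B. \<bar>?h q - ?f p\<bar> \<le> \<Delta>})"
   using fin by (intro sum_mono card_image_le) auto
  finally have "real (card ?Q) \<le> (\<Sum>p\<in>?A. real (card {q \<in> ?B. \<bar>?h q - ?f p\<bar> \<le> \<Delta>}))" by (simp flip: of_nat_sum)
  also have "... \<le> (\<Sum>p\<in>?A. 1 + 2 * \<Delta> / ((g / (2 * real M))^2 / 2))"
   using fin g \<Delta> False by (intro sum_mono card_spaced_le sp) auto
  also have "... = real (card ?A) * (1 + 4 * \<Delta> * V^2)" by (simp add: V_def power_divide)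
  also have "... \<le> U^2 * (1 + 4 * \<Delta> * V^2)" using card \<Delta> by (intro mult_right_mono) auto
  finally show ?thesis .
 qed
 show "real (card ?Q) \<le> 4 * (real H * real M) / (real d * real g) + 64 * \<Delta> * ((real H * real M) / (real d * real g))^2"
  unfolding goal_eq
 proof (cases "U \<le> V")
  case True
  then have "U^2 \<le> U * V" using UV by (simp add: power2_eq_square mult_left_mono)
  then show "real (card ?Q) \<le> U * V + 4 * \<Delta> * (U * V)^2" using b2 by (simp add: algebra_simps power_mult_distrib)
 next
  case False
  then have "V^2 \<le> U * V" using UV by (simp add: power2_eq_square mult_right_mono)
  moreover have "0 \<le> \<Delta> * (U^2 * V^2)" using \<Delta> by simp
  ultimately show "real (card ?Q) \<le> U * V + 4 * \<Delta> * (U * V)^2" using b1 by (simp add: algebra_simps power_mult_distrib)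
 qed
qed

section \<open>Harmonic sums and the number of close products\<close>

lemma inverse_Suc_le_ln_diff:
 fixes y :: real
 assumes "y > 0"
 shows "1 / (y + 1) \<le> ln (y + 1) - ln y"
proof -
 have "ln (y / (y + 1)) \<le> y / (y + 1) - 1" using assms by (intro ln_le_minus_one) auto
 also have "y / (y + 1) - 1 = - (1 / (y + 1))" using assms by (simp add: divide_simps)
 finally show ?thesis using assms by (simp add: ln_div)
qed

lemma sum_inverse_le: "(\<Sum>d\<in>{1..n}. 1 / real d) \<le> 1 + ln (real n + 1)"
proof -
 have *: "(\<Sum>d\<in>{1..k}. 1 / real d) \<le> 1 + ln (real k)" if "k > 0" for k
  using that
 proof (induction k)
  case (Suc k)
  show ?case
  proof (cases "k = 0")
   case False
   have "(\<Sum>d\<in>{1..Suc k}. 1 / real d) = (\<Sum>d\<in>{1..k}. 1 / real d) + 1 / (real k + 1)" by (simp add: add_ac)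
   also have "... \<le> (1 + ln (real k)) + (ln (real k + 1) - ln (real k))"
    using Suc False by (intro add_mono inverse_Suc_le_ln_diff) auto
   finally show ?thesis by (simp add: add_ac)
  qed simp
 qed simp
 show ?thesis
 proof (cases "n = 0")
  case False
  then have "(\<Sum>d\<in>{1..n}. 1 / real d) \<le> 1 + ln (real n)" by (intro *) auto
  also have "... \<le> 1 + ln (real n + 1)" using False by simp
  finally show ?thesis .
 qed simp
qed

lemma sum_inverse_squares_le: "(\<Sum>d\<in>{1..n}. 1 / (real d)^2) \<le> 2"
proof -
 have "(\<Sum>d\<in>{1..n}. 1 / (real d)^2) \<le> 2 - 1 / real n" if "n > 0" for n
  using that
 proof (induction n)
  case (Suc n)
  show ?case
  proof (cases "n = 0")
   case False
   have "1 / (real n + 1)^2 \<le> 1 / (real n * (real n + 1))"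
    using False by (intro divide_left_mono) (auto simp: power2_eq_square intro!: mult_right_mono)
   also have "... = 1 / real n - 1 / (real n + 1)" using False by (simp add: field_simps)
   finally show ?thesis using Suc False by (simp add: add_ac)
  qed simp
 qed simp
 then have "(\<Sum>d\<in>{1..n}. 1 / (real d)^2) \<le> 2 - 1 / real n" if "n > 0" using that .
 then have "n > 0 ==> (\<Sum>d\<in>{1..n}. 1 / (real d)^2) + 1 / real n \<le> 2" by simp
 moreover have "0 \<le> 1 / real n" by simp
 ultimately have "n > 0 ==> (\<Sum>d\<in>{1..n}. 1 / (real d)^2) \<le> 2" by linarith
 then show ?thesis by (cases "n = 0") simp_all
qed

text \<open>Division by h' m powr \<alpha> turns closeness of the products into closeness of h / h'
  and (m' / m) powr \<alpha>. Sorted by the two greatest common divisors, the leading terms add up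
  to harmonic sums, hence the logarithms; the terms with \<Delta> add up to sums of inverse squares,
  at most 2 each.\<close>

lemma pair_count:
 assumes \<alpha>: "1 \<le> \<alpha>" "\<alpha> \<le> 2" and "\<delta> \<ge> 0" and HM: "H \<ge> 1" "M \<ge> 1"
 defines "P \<equiv> {H..<2 * H} \<times> {M..<2 * M}" and "x \<equiv> \<lambda>(h :: nat, m :: nat). real h * real m powr \<alpha>"
 shows "real (card {(p, q) \<in> P \<times> P. \<bar>x p - x q\<bar> \<le> \<delta>}) \<le>
   4 * (real H * real M) * ((1 + ln (2 * real H + 1)) * (1 + ln (2 * real M + 1))) + 256 * (\<delta> / (real H * real M powr \<alpha>)) * (real H * real M)^2"
proof -
 define \<Delta> where "\<Delta> = \<delta> / (real H * real M powr \<alpha>)"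
 have \<Delta>: "\<Delta> \<ge> 0" using assms by (simp add: \<Delta>_def)
 define R where "R = (\<lambda>d g. {(p, q) \<in> reduced_pairs H d \<times> reduced_pairs M g. \<bar>real (fst p) / real (snd p) - (real (fst q) / real (snd q)) powr \<alpha>\<bar> \<le> \<Delta>})"
 let ?Q = "{(p, q) \<in> P \<times> P. \<bar>x p - x q\<bar> \<le> \<delta>}"
 let ?I = "{1..2 * H} \<times> {1..2 * M}"
 \<comment> \<open>Rebuilds a quadruple from its divisors and reduced pairs. The ratio of the m is
   inverted, so \<nu> belongs to the first point and \<mu> to the second.\<close>
 define F where "F = (\<lambda>(d :: nat, g :: nat) ((a :: nat, b :: nat), (\<mu> :: nat, \<nu> :: nat)). ((d * a, g * \<nu>), (d * b, g * \<mu>)))"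
 have sub: "?Q \<subseteq> (\<Union>i\<in>?I. F i ` R (fst i) (snd i))"
 proof
  fix z assume "z \<in> ?Q"
  then obtain h m h' m' where z: "z = ((h, m), (h', m'))" and r: "h \<in> {H..<2 * H}" "h' \<in> {H..<2 * H}" "m \<in> {M..<2 * M}" "m' \<in> {M..<2 * M}"
   and le: "\<bar>real h * real m powr \<alpha> - real h' * real m' powr \<alpha>\<bar> \<le> \<delta>" by (auto simp: P_def x_def)
  have pos: "h > 0" "h' > 0" "m > 0" "m' > 0" using r HM by auto
  define d where "d = gcd h h'"
  define g where "g = gcd m' m"
  obtain a b where ab: "h = d * a" "h' = d * b" "coprime a b"
   using gcd_coprime_exists[of h h'] pos unfolding d_def by (auto simp: mult.commute)
  obtain \<mu> \<nu> where mn: "m' = g * \<mu>" "m = g * \<nu>" "coprime \<mu> \<nu>"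
   using gcd_coprime_exists[of m' m] pos unfolding g_def by (auto simp: mult.commute)
  have dg: "d > 0" "g > 0" using pos by (auto simp: d_def g_def)
  have "d \<le> h" "g \<le> m" using pos by (auto simp: d_def g_def)
  then have I: "(d, g) \<in> ?I" using r dg by auto
  have "real h / h' - (real m' / m) powr \<alpha> = (real h * real m powr \<alpha> - real h' * real m' powr \<alpha>) / (real h' * real m powr \<alpha>)"
   using pos by (simp add: field_simps powr_divide)
  then have "\<bar>real h / h' - (real m' / m) powr \<alpha>\<bar> = \<bar>real h * real m powr \<alpha> - real h' * real m' powr \<alpha>\<bar> / (real h' * real m powr \<alpha>)"
   using pos by (simp add: abs_divide)
  also have "... \<le> \<delta> / (real h' * real m powr \<alpha>)" using le by (intro divide_right_mono) auto
  also have "... \<le> \<Delta>" unfolding \<Delta>_def using r HM assms(3) \<alpha>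
   by (intro divide_left_mono mult_mono powr_mono2 mult_pos_pos) auto
  finally have "\<bar>real a / b - (real \<mu> / \<nu>) powr \<alpha>\<bar> \<le> \<Delta>" using dg by (simp add: ab mn)
  then have "((a, b), (\<mu>, \<nu>)) \<in> R d g"
   using r ab mn by (auto simp: R_def reduced_pairs_def)
  then have "F (d, g) ((a, b), (\<mu>, \<nu>)) \<in> F (d, g) ` R d g" by (rule imageI)
  then show "z \<in> (\<Union>i\<in>?I. F i ` R (fst i) (snd i))" using I by (force simp: F_def z ab mn)
 qed
 have finR: "finite (R (fst i) (snd i))"
  and cardR: "real (card (R (fst i) (snd i))) \<le> 4 * (real H * real M) / (real (fst i) * real (snd i)) + 64 * \<Delta> * ((real H * real M) / (real (fst i) * real (snd i)))^2"
  if "i \<in> ?I" for i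
 proof -
  have i: "fst i > 0" "snd i > 0" using that by auto
  show "finite (R (fst i) (snd i))" unfolding R_def by (rule pair_count_reduced(1)[OF i \<alpha> \<Delta>])
  show "real (card (R (fst i) (snd i))) \<le> 4 * (real H * real M) / (real (fst i) * real (snd i)) + 64 * \<Delta> * ((real H * real M) / (real (fst i) * real (snd i)))^2"
   unfolding R_def by (rule pair_count_reduced(2)[OF i \<alpha> \<Delta>])
 qed
 have "card ?Q \<le> card (\<Union>i\<in>?I. F i ` R (fst i) (snd i))"
  using sub finR by (intro card_mono finite_UN_I finite_imageI) auto
 also have "... \<le> (\<Sum>i\<in>?I. card (F i ` R (fst i) (snd i)))" by (intro card_UN_le) auto
 also have "... \<le> (\<Sum>i\<in>?I. card (R (fst i) (snd i)))" using finR by (intro sum_mono card_image_le) auto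
 finally have "real (card ?Q) \<le> (\<Sum>i\<in>?I. real (card (R (fst i) (snd i))))" by (simp flip: of_nat_sum)
 also have "... \<le> (\<Sum>i\<in>?I. 4 * (real H * real M) / (real (fst i) * real (snd i)) + 64 * \<Delta> * ((real H * real M) / (real (fst i) * real (snd i)))^2)"
  by (intro sum_mono cardR)
 also have "... = 4 * (real H * real M) * ((\<Sum>d\<in>{1..2 * H}. 1 / real d) * (\<Sum>g\<in>{1..2 * M}. 1 / real g)) +
  64 * \<Delta> * (real H * real M)^2 * ((\<Sum>d\<in>{1..2 * H}. 1 / (real d)^2) * (\<Sum>g\<in>{1..2 * M}. 1 / (real g)^2))"
  unfolding sum_product sum.cartesian_product
  by (simp add: sum.distrib sum_distrib_left power_divide power_mult_distrib case_prod_unfold)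
 also have "... \<le> 4 * (real H * real M) * ((1 + ln (real (2 * H) + 1)) * (1 + ln (real (2 * M) + 1))) + 64 * \<Delta> * (real H * real M)^2 * (2 * 2)"
  using \<Delta> by (intro add_mono mult_left_mono mult_mono sum_inverse_le sum_inverse_squares_le sum_nonneg) (auto intro!: add_nonneg_nonneg)
 finally show ?thesis by (simp add: \<Delta>_def)
qed

section \<open>The exponential sum over one dyadic block\<close>

lemma monotone_variation:
 fixes f :: "nat => real"
 assumes "\<And>s. A \<le> s ==> s < n ==> f s \<le> f (Suc s)" "A \<le> n"
 shows "(\<Sum>s\<in>{A..<n}. \<bar>f (Suc s) - f s\<bar>) = f n - f A"
proof -
 have "(\<Sum>s\<in>{A..<n}. \<bar>f (Suc s) - f s\<bar>) = (\<Sum>s\<in>{A..<n}. f (Suc s) - f s)"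
  using assms(1) by (intro sum.cong) auto
 also have "... = f n - f A" using assms(2) by (simp add: sum_Suc_diff')
 finally show ?thesis .
qed

text \<open>The coefficients a are free so as to carry the square-free condition, and n m carries
  the coupling of s and m. The main phase separates into h m powr (2 \<gamma>) times s powr
  \<gamma>, the second summand likewise with \<gamma> - 1. The range 1/2 < \<gamma> < 1 places 2
  \<gamma> where \<open>pair_count\<close> applies.\<close>

lemma block_sum:
 fixes \<gamma> \<epsilon> :: real
 assumes \<gamma>: "1/2 < \<gamma>" "\<gamma> < 1" and \<epsilon>: "\<epsilon> > 0"
 shows "\<exists>C\<ge>0. \<forall>(J :: nat) (H :: nat) (M :: nat) (a :: nat => complex) (n :: nat => nat) (\<nu> :: real).
  H \<ge> 1 --> M \<ge> 1 --> 0 \<le> \<nu> --> \<nu> \<le> 1 --> (\<forall>s. norm (a s) \<le> 1) --> (\<forall>m. n m \<le> 2 * 2 ^ J) -->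
  (\<Sum>h\<in>{H..<2 * H}. norm (\<Sum>m\<in>{M..<2 * M}. \<Sum>s\<in>{2 ^ J..<n m}. a s *
    ec (real h * ((real s * (real m)^2) powr \<gamma> + \<nu> * \<gamma> * (real s * (real m)^2) powr (\<gamma> - 1))))) ^ 4
   \<le> C * (real (J + 2) ^ 4 * ((1 + ln (2 * real H + 1)) * (1 + ln (2 * real M + 1))) * real H ^ 4 * real M ^ 3 *
     (real H * (2 ^ J * (real M)^2) powr \<gamma> * (2 ^ J) powr (2 + \<epsilon>) + (2 ^ J) ^ 4))"
proof -
 obtain C0 where C0: "C0 \<ge> 0" and sp: "\<And>S X. S > 0 ==> X > 0 ==>
   energy {s :: nat. S / 2 \<le> real s \<and> real s \<le> 2 * S} (\<lambda>s. (real s / S) powr \<gamma>) X \<le> C0 * (S powr (2 + \<epsilon>) + S ^ 4 / X)"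
  using spacing_all[of \<gamma> \<epsilon>] assms unfolding spacing_def by auto
 define c0 where "c0 = (1 + 4 * pi) ^ 4 * exp pi"
 have c0: "c0 \<ge> 0" by (simp add: c0_def)
 define C where "C = 260 * (2 * (9 * (c0 * C0)))"
 have main: "(\<Sum>h\<in>{H..<2 * H}. norm (\<Sum>m\<in>{M..<2 * M}. \<Sum>s\<in>{2 ^ J..<n m}. a s *
    ec (real h * ((real s * (real m)^2) powr \<gamma> + \<nu> * \<gamma> * (real s * (real m)^2) powr (\<gamma> - 1))))) ^ 4
   \<le> C * (real (J + 2) ^ 4 * ((1 + ln (2 * real H + 1)) * (1 + ln (2 * real M + 1))) * real H ^ 4 * real M ^ 3 *
     (real H * (2 ^ J * (real M)^2) powr \<gamma> * (2 ^ J) powr (2 + \<epsilon>) + (2 ^ J) ^ 4))"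
  if H: "H \<ge> 1" and M: "M \<ge> 1" and \<nu>: "0 \<le> \<nu>" "\<nu> \<le> 1" and a: "\<And>s. norm (a s) \<le> 1" and n: "\<And>m. n m \<le> 2 * 2 ^ J"
  for J H M :: nat and a :: "nat => complex" and n :: "nat => nat" and \<nu> :: real
 proof -
  define S where "S = (2 :: real) ^ J"
  have S: "S \<ge> 1" by (simp add: S_def)
  have S0: "S > 0" using S by simp
  define N0 where "N0 = (S * (real M)^2) powr \<gamma>"
  have N0': "N0 = S powr \<gamma> * real M powr (2 * \<gamma>)"
   using S M by (simp add: N0_def powr_mult powr_powr flip: powr_numeral)
  have SM1: "1 \<le> S powr \<gamma>" "1 \<le> real M powr (2 * \<gamma>)" using S M \<gamma> by (auto intro!: ge_one_powr_ge_zero)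
  have "N0 \<ge> 1 * 1" unfolding N0' using SM1 by (intro mult_mono) auto
  then have N0: "N0 \<ge> 1" by simp
  define P where "P = {H..<2 * H} \<times> {M..<2 * M}"
  \<comment> \<open>The powers of S are moved into x and u, so that \<theta> and \<phi> start at 1
    and have variation at most 1 over the block.\<close>
  define x where "x = (\<lambda>(h :: nat, m :: nat). (real h * real m powr (2 * \<gamma>)) * S powr \<gamma>)"
  define u where "u = (\<lambda>(h :: nat, m :: nat). \<nu> * \<gamma> * (real h * real m powr (2 * (\<gamma> - 1)) * S powr (\<gamma> - 1)))"
  define \<theta> where "\<theta> = (\<lambda>s :: nat. (real s / S) powr \<gamma>)"
  define \<phi> where "\<phi> = (\<lambda>s :: nat. (real s / S) powr (\<gamma> - 1))"
  \<comment> \<open>The largest possible x: h \<le> 2 H, and m powr (2 \<gamma>) \<le> 4 M powr (2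
    \<gamma>) for m \<le> 2 M.\<close>
  define X where "X = 8 * real H * N0"
  have HN: "1 \<le> real H * N0" using H N0 mult_mono[of 1 "real H" 1 N0] by simp
  have X1: "X \<ge> 1" "X + 1 \<le> 9 * (real H * N0)" unfolding X_def using HN by linarith+
  define F where "F = (\<lambda>p. norm (\<Sum>s\<in>{2 ^ J..<n (snd p)}. a s * ec (x p * \<theta> s + u p * \<phi> s)))"
  define l where "l = (1 + ln (2 * real H + 1)) * (1 + ln (2 * real M + 1))"
  have l: "l \<ge> 1" unfolding l_def using mult_mono[of 1 "1 + ln (2 * real H + 1)" 1 "1 + ln (2 * real M + 1)"] by simp
  have phase: "real h * ((real s * (real m)^2) powr \<gamma> + \<nu> * \<gamma> * (real s * (real m)^2) powr (\<gamma> - 1)) = x (h, m) * \<theta> s + u (h, m) * \<phi> s"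
   if "m > 0" "s > 0" for h m s :: nat
  proof -
   have "(real s * (real m)^2) powr q = real m powr (2 * q) * S powr q * (real s / S) powr q" for q
    using that S0 by (simp add: powr_mult powr_divide powr_powr flip: powr_numeral)
   then show ?thesis by (simp add: x_def u_def \<theta>_def \<phi>_def algebra_simps)
  qed
  have "(\<Sum>h\<in>{H..<2 * H}. norm (\<Sum>m\<in>{M..<2 * M}. \<Sum>s\<in>{2 ^ J..<n m}. a s *
    ec (real h * ((real s * (real m)^2) powr \<gamma> + \<nu> * \<gamma> * (real s * (real m)^2) powr (\<gamma> - 1))))) \<le> (\<Sum>h\<in>{H..<2 * H}. \<Sum>m\<in>{M..<2 * M}. F (h, m))"
  proof (rule sum_mono, rule sum_norm_le)
   fix h m assume m: "m \<in> {M..<2 * M}"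
   have "0 < s" if "2 ^ J \<le> s" for s :: nat using that by (rule less_le_trans[rotated]) simp
   then show "norm (\<Sum>s\<in>{2 ^ J..<n m}. a s * ec (real h * ((real s * (real m)^2) powr \<gamma> + \<nu> * \<gamma> * (real s * (real m)^2) powr (\<gamma> - 1)))) \<le> F (h, m)"
    unfolding F_def snd_conv using m M by (intro eq_refl arg_cong[of _ _ norm] sum.cong refl) (simp add: phase)
  qed
  also have "... = (\<Sum>p\<in>P. F p)" by (simp add: P_def sum.cartesian_product)
  finally have "(\<Sum>h\<in>{H..<2 * H}. norm (\<Sum>m\<in>{M..<2 * M}. \<Sum>s\<in>{2 ^ J..<n m}. a s *
    ec (real h * ((real s * (real m)^2) powr \<gamma> + \<nu> * \<gamma> * (real s * (real m)^2) powr (\<gamma> - 1))))) ^ 4 \<le> (\<Sum>p\<in>P. F p) ^ 4"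
   by (intro power_mono sum_nonneg) auto
  also have "... \<le> (card P)^2 * real (card {(p, q) \<in> P \<times> P. \<bar>x p - x q\<bar> \<le> 1}) *
    ((1 + 4 * pi) ^ 4 * exp pi * real (J + 2) ^ 4 * real (2 * H) * (X + 1) * energy {2 ^ J..<2 * 2 ^ J} \<theta> (X + 1))"
   unfolding F_def
  proof (rule cell_large_sieve)
   show "finite P" by (simp add: P_def)
   show "2 * 2 ^ J < (2 :: nat) ^ (J + 2)" by simp
   show "norm (a s) \<le> 1" for s by (rule a)
   show "n (snd p) \<le> 2 * 2 ^ J" for p by (rule n)
   show "0 \<le> x p" for p by (auto simp: x_def split: prod.split)
   show "0 \<le> u p" for p using \<nu> \<gamma> by (auto simp: u_def split: prod.split)
   show "x p \<le> X" if "p \<in> P" for p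
   proof -
    obtain h m where p: "p = (h, m)" "h \<le> 2 * H" "m \<le> 2 * M" using \<open>p \<in> P\<close> by (auto simp: P_def)
    have "real m powr (2 * \<gamma>) \<le> (2 * real M) powr (2 * \<gamma>)" using p \<gamma> by (intro powr_mono2) auto
    also have "... = 2 powr (2 * \<gamma>) * real M powr (2 * \<gamma>)" by (simp add: powr_mult)
    also have "... \<le> 2 powr 2 * real M powr (2 * \<gamma>)" using \<gamma> by (intro mult_right_mono powr_mono) auto
    finally have "real m powr (2 * \<gamma>) \<le> 4 * real M powr (2 * \<gamma>)" by simp
    then have "real h * real m powr (2 * \<gamma>) * S powr \<gamma> \<le> (2 * real H) * (4 * real M powr (2 * \<gamma>)) * S powr \<gamma>"
     using p by (intro mult_right_mono mult_mono) auto
    then show ?thesis by (simp add: x_def p X_def N0' mult_ac)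
   qed
   show "u p < real (2 * H)" if "p \<in> P" for p
   proof -
    obtain h m where p: "p = (h, m)" "h < 2 * H" "m \<ge> M" using \<open>p \<in> P\<close> by (auto simp: P_def)
    have "real m powr (2 * (\<gamma> - 1)) \<le> 1" using p M \<gamma> powr_mono[of "2 * (\<gamma> - 1)" 0 "real m"] by simp
    moreover have "S powr (\<gamma> - 1) \<le> 1" using S \<gamma> powr_mono[of "\<gamma> - 1" 0 S] by simp
    ultimately have "real h * real m powr (2 * (\<gamma> - 1)) * S powr (\<gamma> - 1) \<le> real h * 1 * 1"
     by (intro mult_mono) auto
    moreover have "\<nu> * \<gamma> \<le> 1 * 1" using \<nu> \<gamma> by (intro mult_mono) auto
    ultimately have "u p \<le> 1 * (real h * 1 * 1)"
     unfolding u_def p prod.case using \<nu> \<gamma> by - (rule mult_mono; simp)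
    then show ?thesis using p by simp
   qed
   have S_real: "real (2 ^ J) = S" "S / S = 1" using S0 by (auto simp: S_def)
   show "(\<Sum>s\<in>{2 ^ J..<k}. \<bar>\<theta> (Suc s) - \<theta> s\<bar>) \<le> 1" if k: "k \<le> 2 * 2 ^ J" for k
   proof (cases "2 ^ J \<le> k")
    case True
    have "(\<Sum>s\<in>{2 ^ J..<k}. \<bar>\<theta> (Suc s) - \<theta> s\<bar>) = \<theta> k - \<theta> (2 ^ J)"
     using True S0 \<gamma> by (intro monotone_variation) (auto simp: \<theta>_def intro!: powr_mono2 divide_right_mono)
    also have "\<theta> (2 ^ J) = 1" unfolding \<theta>_def S_real by simp
    also have "\<theta> k \<le> 2 powr 1"
    proof -
     have "real k \<le> real (2 * 2 ^ J)" using k by (rule of_nat_mono)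
     then have "real k \<le> 2 * S" by (simp add: S_def)
     then have "real k / S \<le> 2" using S0 by (simp add: field_simps)
     then have "\<theta> k \<le> 2 powr \<gamma>" unfolding \<theta>_def using S0 \<gamma> by (intro powr_mono2) auto
     also have "... \<le> 2 powr 1" using \<gamma> by (intro powr_mono) auto
     finally show ?thesis .
    qed
    finally show ?thesis by simp
   qed simp
   show "(\<Sum>s\<in>{2 ^ J..<k}. \<bar>\<phi> (Suc s) - \<phi> s\<bar>) \<le> 1" if k: "k \<le> 2 * 2 ^ J" for k
   proof (cases "2 ^ J \<le> k")
    case True
    have "(\<Sum>s\<in>{2 ^ J..<k}. \<bar>\<phi> (Suc s) - \<phi> s\<bar>) = (\<Sum>s\<in>{2 ^ J..<k}. \<bar>- \<phi> (Suc s) - - \<phi> s\<bar>)"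
     by (intro sum.cong refl) linarith
    also have "... = - \<phi> k - - \<phi> (2 ^ J)"
    proof (rule monotone_variation)
     fix s :: nat assume "2 ^ J \<le> s"
     then have "real s \<ge> S" by (simp add: S_def)
     then show "- \<phi> s \<le> - \<phi> (Suc s)" unfolding \<phi>_def neg_le_iff_le using S0 \<gamma>
      by (intro powr_mono2') (auto intro!: divide_right_mono)
    qed (use True in auto)
    also have "\<phi> (2 ^ J) = 1" unfolding \<phi>_def S_real by simp
    finally show ?thesis by (simp add: \<phi>_def)
   qed simp
  qed (use X1 in auto)
  also have "... \<le> (real H * real M)^2 * (260 * (real H * real M) * l) *
    (c0 * real (J + 2) ^ 4 * (2 * real H) * (9 * C0 * (real H * N0 * S powr (2 + \<epsilon>) + S ^ 4)))"
  proof -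
   have 1: "real ((card P)^2) = (real H * real M)^2" by (simp add: P_def card_cartesian_product)
   have 2: "real (card {(p, q) \<in> P \<times> P. \<bar>x p - x q\<bar> \<le> 1}) \<le> 260 * (real H * real M) * l"
   proof -
    define y where "y = (\<lambda>(h :: nat, m :: nat). real h * real m powr (2 * \<gamma>))"
    have xy: "x p = y p * S powr \<gamma>" for p by (simp add: x_def y_def split: prod.split)
    \<comment> \<open>Without the factor S powr \<gamma> the points x are the products counted by
      \<open>pair_count\<close>, at distance \<delta>.\<close>
    define \<delta> where "\<delta> = 1 / S powr \<gamma>"
    have "\<bar>x p - x q\<bar> \<le> 1 \<longleftrightarrow> \<bar>y p - y q\<bar> \<le> \<delta>" for p q
    proof -
     have "\<bar>x p - x q\<bar> = \<bar>y p - y q\<bar> * S powr \<gamma>" by (simp add: xy abs_mult flip: left_diff_distrib)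
     then show ?thesis using S0 by (simp add: \<delta>_def pos_le_divide_eq)
    qed
    then have "real (card {(p, q) \<in> P \<times> P. \<bar>x p - x q\<bar> \<le> 1}) = real (card {(p, q) \<in> P \<times> P. \<bar>y p - y q\<bar> \<le> \<delta>})" by simp
    also have "... \<le> 4 * (real H * real M) * l + 256 * (\<delta> / (real H * real M powr (2 * \<gamma>))) * (real H * real M)^2"
     unfolding P_def y_def l_def using \<gamma> H M by (intro pair_count) (auto simp: \<delta>_def)
    \<comment> \<open>M \<le> S powr \<gamma> M powr (2 \<gamma>), so this term is no larger in
      order than the diagonal one; together they give 4 + 256 = 260.\<close>
    also have "256 * (\<delta> / (real H * real M powr (2 * \<gamma>))) * (real H * real M)^2 = 256 * (real H * real M) * (real M / (S powr \<gamma> * real M powr (2 * \<gamma>)))"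
     using H by (simp add: \<delta>_def power2_eq_square)
    also have "... \<le> 256 * (real H * real M) * 1"
    proof (intro mult_left_mono)
     have "real M powr 1 \<le> real M powr (2 * \<gamma>)" using M \<gamma> by (intro powr_mono) auto
     then have "1 * real M \<le> S powr \<gamma> * real M powr (2 * \<gamma>)" using SM1 M by (intro mult_mono) auto
     then show "real M / (S powr \<gamma> * real M powr (2 * \<gamma>)) \<le> 1" using S0 M by simp
    qed auto
    also have "... \<le> 256 * (real H * real M) * l" using l by (intro mult_left_mono) auto
    finally show ?thesis by linarith
   qed
   have 3: "(X + 1) * energy {2 ^ J..<2 * 2 ^ J} \<theta> (X + 1) \<le> 9 * C0 * (real H * N0 * S powr (2 + \<epsilon>) + S ^ 4)"
   proof -
    have "energy {2 ^ J..<2 * 2 ^ J} \<theta> (X + 1) \<le> energy {s :: nat. S / 2 \<le> real s \<and> real s \<le> 2 * S} \<theta> (X + 1)"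
    proof (rule energy_mono_set)
     show "finite {s :: nat. S / 2 \<le> real s \<and> real s \<le> 2 * S}" using dyadic_card_le(1)[of S] S by simp
     have "S / 2 \<le> real s \<and> real s \<le> 2 * S" if "2 ^ J \<le> s" "s < 2 * 2 ^ J" for s :: nat
     proof -
      have "real (2 ^ J) \<le> real s" "real s \<le> real (2 * 2 ^ J)" using that by linarith+
      moreover have "real (2 ^ J) = S" "real (2 * 2 ^ J) = 2 * S" by (simp_all add: S_def)
      ultimately show ?thesis using S0 by linarith
     qed
     then show "{2 ^ J..<2 * 2 ^ J} \<subseteq> {s :: nat. S / 2 \<le> real s \<and> real s \<le> 2 * S}" by auto
    qed (use X1 in simp)
    also have "... \<le> C0 * (S powr (2 + \<epsilon>) + S ^ 4 / (X + 1))"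
     unfolding \<theta>_def using S0 X1 by (intro sp) auto
    finally have "(X + 1) * energy {2 ^ J..<2 * 2 ^ J} \<theta> (X + 1) \<le> (X + 1) * (C0 * (S powr (2 + \<epsilon>) + S ^ 4 / (X + 1)))"
     using X1 by (intro mult_left_mono) auto
    also have "... = C0 * ((X + 1) * S powr (2 + \<epsilon>) + S ^ 4)" using X1 by (simp add: distrib_left)
    also have "... \<le> C0 * (9 * (real H * N0) * S powr (2 + \<epsilon>) + 9 * S ^ 4)"
     using X1 C0 by (intro mult_left_mono add_mono mult_right_mono) auto
    finally show ?thesis by (simp add: algebra_simps)
   qed
   have 4: "(1 + 4 * pi) ^ 4 * exp pi * real (J + 2) ^ 4 * real (2 * H) * (X + 1) * energy {2 ^ J..<2 * 2 ^ J} \<theta> (X + 1)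
    \<le> c0 * real (J + 2) ^ 4 * (2 * real H) * (9 * C0 * (real H * N0 * S powr (2 + \<epsilon>) + S ^ 4))"
    using mult_left_mono[OF 3, of "c0 * real (J + 2) ^ 4 * (2 * real H)"] c0 by (simp add: c0_def mult_ac)
   show ?thesis unfolding 1
    by (intro mult_mono mult_left_mono 2 4 mult_nonneg_nonneg energy_nonneg) (use X1 l in auto)
  qed
  also have "... = C * (real (J + 2) ^ 4 * l * real H ^ 4 * real M ^ 3 * (real H * N0 * S powr (2 + \<epsilon>) + S ^ 4))"
   by (simp only: C_def power4_eq_xxxx power3_eq_cube power2_eq_square mult_ac)
  finally show ?thesis by (simp add: l_def N0_def S_def)
 qed
 have "C \<ge> 0" using c0 C0 by (simp add: C_def)
 then show ?thesis using main by blast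
qed

section \<open>The sawtooth function\<close>

definition psi :: "real => real" where
 "psi x = frac x - 1 / 2"

text \<open>The periodic second Bernoulli function; pi^2 times it is the sum of the cosine series in
  \<open>bernoulli2_fourier\<close>.\<close>

definition bern2 :: "real => real" where
 "bern2 x = (frac x)^2 - frac x + 1 / 6"

lemma abs_psi_le: "\<bar>psi x\<bar> \<le> 1"
 using frac_ge_0[of x] frac_lt_1[of x] unfolding psi_def by linarith

section \<open>Bounding sawtooth sums by exponential sums\<close>

lemma frac_add_small:
 assumes "0 < \<eta>" "\<eta> \<le> 1"
 shows "frac (x + \<eta>) = (if frac x + \<eta> < 1 then frac x + \<eta> else frac x + \<eta> - 1)"
proof -
 define f where "f = frac x"
 have f: "0 \<le> f" "f < 1" by (auto simp: f_def frac_lt_1)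
 have *: "x + \<eta> - (f + \<eta>) \<in> \<int>" "x + \<eta> - (f + \<eta> - 1) \<in> \<int>" by (simp_all add: f_def frac_def)
 show ?thesis unfolding f_def[symmetric] using * assms f by (simp add: frac_unique_iff)
qed

lemma frac_diff_small:
 assumes "0 < \<eta>" "\<eta> \<le> 1"
 shows "frac (x - \<eta>) = (if \<eta> \<le> frac x then frac x - \<eta> else frac x - \<eta> + 1)"
proof -
 define f where "f = frac x"
 have f: "0 \<le> f" "f < 1" by (auto simp: f_def frac_lt_1)
 have *: "x - \<eta> - (f - \<eta>) \<in> \<int>" "x - \<eta> - (f - \<eta> + 1) \<in> \<int>" by (simp_all add: f_def frac_def)
 show ?thesis unfolding f_def[symmetric] using * assms f by (simp add: frac_unique_iff)
qed

text \<open>The derivative of \<open>bern2\<close> is 2 \<open>psi\<close>, so the difference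
  quotient is the mean of \<open>psi\<close> over [x - \<eta>, x]. Going forward, \<open>psi\<close>
  rises with slope 1 and jumps only downwards, so its final value exceeds the mean by at most \<eta>
  / 2. The gain is an absolutely convergent Fourier series.\<close>

lemma psi_le_bern2_diff:
 assumes "0 < \<eta>" "\<eta> \<le> 1"
 shows "psi x \<le> (bern2 x - bern2 (x - \<eta>)) / (2 * \<eta>) + \<eta> / 2"
proof -
 define f where "f = frac x"
 have f: "0 \<le> f" "f < 1" by (auto simp: f_def frac_lt_1)
 have "2 * \<eta> * (f - 1 / 2) \<le> (bern2 x - bern2 (x - \<eta>)) + \<eta>^2"
  unfolding bern2_def frac_diff_small[OF assms] f_def[symmetric] using f assms
  by (auto simp: power2_eq_square algebra_simps)
 then have "2 * \<eta> * (f - 1 / 2) / (2 * \<eta>) \<le> (bern2 x - bern2 (x - \<eta>) + \<eta>^2) / (2 * \<eta>)"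
  using assms by (intro divide_right_mono) auto
 then show ?thesis using assms by (simp add: psi_def f_def add_divide_distrib power2_eq_square)
qed

lemma psi_ge_bern2_diff:
 assumes "0 < \<eta>" "\<eta> \<le> 1"
 shows "(bern2 (x + \<eta>) - bern2 x) / (2 * \<eta>) - \<eta> / 2 \<le> psi x"
proof -
 define f where "f = frac x"
 have f: "0 \<le> f" "f < 1" by (auto simp: f_def frac_lt_1)
 have "(bern2 (x + \<eta>) - bern2 x) - \<eta>^2 \<le> 2 * \<eta> * (f - 1 / 2)"
  unfolding bern2_def frac_add_small[OF assms] f_def[symmetric] using f assms
  by (auto simp: power2_eq_square algebra_simps)
 then have "(bern2 (x + \<eta>) - bern2 x - \<eta>^2) / (2 * \<eta>) \<le> 2 * \<eta> * (f - 1 / 2) / (2 * \<eta>)"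
  using assms by (intro divide_right_mono) auto
 then show ?thesis using assms by (simp add: psi_def f_def diff_divide_distrib power2_eq_square)
qed

lemma sum_dyadic_split:
 fixes f :: "nat => 'a :: comm_monoid_add"
 shows "(\<Sum>n\<in>{1..<2 ^ K}. f n) = (\<Sum>j<K. \<Sum>n\<in>{2 ^ j..<2 * 2 ^ j}. f n)"
proof (induction K)
 case (Suc K)
 have "{1..<2 ^ Suc K} = {1..<2 ^ K} \<union> {2 ^ K..<2 * 2 ^ K :: nat}" by auto
 then have "(\<Sum>n\<in>{1..<2 ^ Suc K}. f n) = (\<Sum>n\<in>{1..<2 ^ K}. f n) + (\<Sum>n\<in>{2 ^ K..<2 * 2 ^ K}. f n)"
  by (simp only:) (intro sum.union_disjoint, auto)
 then show ?case using Suc by simp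
qed simp

text \<open>The shift by \<tau> gives the N-th Fourier term a factor 1 -
  \<open>ec (N * \<tau>)\<close>, of modulus at most 2 and at most 2 pi N \<eta>. This produces the
  weight min(1 / N, 1 / (\<eta> N^2)), which is replaced by its value at the beginning of each
  dyadic range. Ranges from K on are estimated by the number of points.\<close>

lemma bern2_shift_sum:
 fixes x :: "'i => real"
 assumes A: "finite A" and \<eta>: "0 < \<eta>" "\<bar>\<tau>\<bar> = \<eta>"
 shows "\<bar>\<Sum>i\<in>A. bern2 (x i) - bern2 (x i + \<tau>)\<bar> / (2 * \<eta>) \<le>
  (\<Sum>j<K. min (1 / 2 ^ j) (1 / (\<eta> * 4 ^ j)) * (\<Sum>N\<in>{2 ^ j..<2 * 2 ^ j}. norm (\<Sum>i\<in>A. ec (real N * x i)))) + 2 * real (card A) / (\<eta> * 2 ^ K)"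
  (is "_ \<le> ?B")
proof -
 define E where "E = (\<lambda>N :: nat. norm (\<Sum>i\<in>A. ec (real N * x i)))"
 define w where "w = (\<lambda>j. min (1 / 2 ^ j) (1 / (\<eta> * 4 ^ j)))"
 define t where "t = (\<lambda>n. \<Sum>i\<in>A. cos (2 * pi * real (Suc n) * x i) / (real (Suc n))^2 - cos (2 * pi * real (Suc n) * (x i + \<tau>)) / (real (Suc n))^2)"
 have t_sums: "t sums (\<Sum>i\<in>A. pi\<^sup>2 * bern2 (x i) - pi^2 * bern2 (x i + \<tau>))"
  unfolding t_def bern2_def by (intro sums_sum sums_diff bernoulli2_fourier)
 have E: "0 \<le> E N" "E N \<le> real (card A)" for N
  using norm_sum[of "\<lambda>i. ec (real N * x i)" A] by (simp_all add: E_def)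
 have w0: "0 \<le> w j" for j using \<eta> by (simp add: w_def)
 have t_le: "\<bar>t n\<bar> / (2 * \<eta> * pi^2) \<le> min (1 / real (Suc n)) (1 / (\<eta> * (real (Suc n))^2)) * E (Suc n)" for n
 proof -
  define N where "N = real (Suc n)"
  have N: "N > 0" by (simp add: N_def)
  have t_eq: "t n = Re ((\<Sum>i\<in>A. ec (N * x i)) * (1 - ec (N * \<tau>))) / N^2"
  proof -
   have "(\<Sum>i\<in>A. ec (N * x i)) * (1 - ec (N * \<tau>)) = (\<Sum>i\<in>A. ec (N * x i) - ec (N * (x i + \<tau>)))"
    by (simp add: sum_distrib_right right_diff_distrib distrib_left ec_add sum_subtractf)
   also have "Re ... = (\<Sum>i\<in>A. cos (2 * pi * N * x i) - cos (2 * pi * N * (x i + \<tau>)))"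
    by (simp add: ec_def mult.assoc)
   finally show ?thesis by (simp add: t_def N_def diff_divide_distrib sum_divide_distrib)
  qed
  have "\<bar>Re z / N^2\<bar> \<le> norm z / N^2" for z
   using abs_Re_le_cmod[of z] by (simp add: abs_divide divide_right_mono)
  then have "\<bar>t n\<bar> \<le> norm ((\<Sum>i\<in>A. ec (N * x i)) * (1 - ec (N * \<tau>))) / N^2"
   unfolding t_eq .
  also have "... = E (Suc n) * norm (1 - ec (N * \<tau>)) / N^2" by (simp add: norm_mult E_def N_def)
  finally have tb: "\<bar>t n\<bar> \<le> E (Suc n) * norm (1 - ec (N * \<tau>)) / N^2" .
  have "norm (1 - ec (N * \<tau>)) \<le> norm (1 :: complex) + norm (ec (N * \<tau>))" by (rule norm_triangle_ineq4)
  then have n1: "norm (1 - ec (N * \<tau>)) \<le> 2" by simp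
  have n2: "norm (1 - ec (N * \<tau>)) \<le> 2 * pi * (N * \<eta>)"
   using norm_ec_diff_le[of 0 "N * \<tau>"] N \<eta> by (simp add: abs_mult)
  have pi2: "pi^2 \<ge> 1" "pi \<ge> 1" using pi_gt3 by (auto intro!: one_le_power)
  have bnd: "\<bar>t n\<bar> / (2 * \<eta> * pi^2) \<le> q * E (Suc n)" if r: "norm (1 - ec (N * \<tau>)) \<le> r" and q: "r / N^2 / (2 * \<eta> * pi^2) \<le> q" for r q
  proof -
   have "\<bar>t n\<bar> \<le> E (Suc n) * r / N^2" using tb mult_left_mono[OF r E(1)] by (meson divide_right_mono order.trans zero_le_power2)
   then have "\<bar>t n\<bar> / (2 * \<eta> * pi^2) \<le> E (Suc n) * r / N^2 / (2 * \<eta> * pi^2)" using \<eta> by (intro divide_right_mono) auto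
   also have "... = E (Suc n) * (r / N^2 / (2 * \<eta> * pi^2))" by simp
   also have "... \<le> E (Suc n) * q" using q E by (intro mult_left_mono) auto
   finally show ?thesis by (simp add: mult.commute)
  qed
  have q1: "2 / N^2 / (2 * \<eta> * pi^2) \<le> 1 / (\<eta> * N^2)"
   using N \<eta> pi2 by (simp add: field_simps)
  have "2 * pi * (N * \<eta>) / N^2 / (2 * \<eta> * pi^2) = 1 / N / pi"
   using N \<eta> by (simp add: power2_eq_square)
  also have "... \<le> 1 / N / 1" using N pi2 by (intro divide_left_mono) auto
  finally have q2: "2 * pi * (N * \<eta>) / N^2 / (2 * \<eta> * pi^2) \<le> 1 / N" by simp
  show ?thesis using bnd[OF n1 q1] bnd[OF n2 q2] by (auto simp: min_def N_def)
 qed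
 have part: "\<bar>\<Sum>n<m. t n\<bar> / (2 * \<eta> * pi^2) \<le> ?B" for m
 proof -
  define k where "k = K + m"
  have mk: "m < 2 ^ k" unfolding k_def power_add using less_exp[of m] by (metis mult.commute less_le_trans mult_le_mono2 nat_mult_1_right one_le_numeral one_le_power)
  have "\<bar>\<Sum>n<m. t n\<bar> / (2 * \<eta> * pi^2) \<le> (\<Sum>n<m. \<bar>t n\<bar>) / (2 * \<eta> * pi^2)"
   using \<eta> by (intro divide_right_mono sum_abs) auto
  also have "... = (\<Sum>n<m. \<bar>t n\<bar> / (2 * \<eta> * pi^2))" by (simp add: sum_divide_distrib)
  also have "... \<le> (\<Sum>n<m. min (1 / real (Suc n)) (1 / (\<eta> * (real (Suc n))^2)) * E (Suc n))" by (intro sum_mono t_le)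
  also have "... = (\<Sum>n\<in>{1..<Suc m}. min (1 / real n) (1 / (\<eta> * (real n)^2)) * E n)"
   using sum.shift_bounds_nat_ivl[of "\<lambda>n. min (1 / real n) (1 / (\<eta> * (real n)^2)) * E n" 0 1 m] by (simp add: lessThan_atLeast0)
  also have "... \<le> (\<Sum>n\<in>{1..<2 ^ k}. min (1 / real n) (1 / (\<eta> * (real n)^2)) * E n)"
   using mk E \<eta> by (intro sum_mono2) auto
  also have "... = (\<Sum>j<k. \<Sum>n\<in>{2 ^ j..<2 * 2 ^ j}. min (1 / real n) (1 / (\<eta> * (real n)^2)) * E n)" by (rule sum_dyadic_split)
  also have "... \<le> (\<Sum>j<k. \<Sum>n\<in>{2 ^ j..<2 * 2 ^ j}. w j * E n)"
  proof (intro sum_mono mult_right_mono E)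
   fix j n :: nat assume "n \<in> {2 ^ j..<2 * 2 ^ j}"
   then have n: "(2 :: real) ^ j \<le> real n" by simp
   have p: "(0 :: real) < 2 ^ j" by simp
   have "(4 :: real) ^ j = (2 ^ j)^2" by (simp add: power2_eq_square flip: power_mult_distrib)
   also have "... \<le> (real n)^2" using n by (intro power_mono) auto
   finally have n2: "(4 :: real) ^ j \<le> (real n)^2" .
   have n0: "real n > 0" using n p by linarith
   show "min (1 / real n) (1 / (\<eta> * (real n)^2)) \<le> w j"
    unfolding w_def using n n2 n0 p \<eta> by (intro min.mono divide_left_mono mult_left_mono mult_pos_pos) auto
  qed
  also have "... = (\<Sum>j<k. w j * (\<Sum>n\<in>{2 ^ j..<2 * 2 ^ j}. E n))" by (simp add: sum_distrib_left)
  also have "... = (\<Sum>j<K. w j * (\<Sum>n\<in>{2 ^ j..<2 * 2 ^ j}. E n)) + (\<Sum>j\<in>{K..<k}. w j * (\<Sum>n\<in>{2 ^ j..<2 * 2 ^ j}. E n))"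
   unfolding lessThan_atLeast0 by (rule sum.atLeastLessThan_concat[symmetric]) (auto simp: k_def)
  also have "(\<Sum>j\<in>{K..<k}. w j * (\<Sum>n\<in>{2 ^ j..<2 * 2 ^ j}. E n)) \<le> 2 * real (card A) / (\<eta> * 2 ^ K)"
  proof -
   have "(\<Sum>j\<in>{K..<k}. w j * (\<Sum>n\<in>{2 ^ j..<2 * 2 ^ j}. E n)) \<le> (\<Sum>j\<in>{K..<k}. real (card A) / \<eta> * (1 / 2 ^ j))"
   proof (rule sum_mono)
    fix j
    have "(\<Sum>n\<in>{2 ^ j..<2 * 2 ^ j}. E n) \<le> (\<Sum>n\<in>{2 ^ j..<2 * 2 ^ j :: nat}. real (card A))" by (intro sum_mono E)
    also have "... = 2 ^ j * real (card A)" by simp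
    finally have "w j * (\<Sum>n\<in>{2 ^ j..<2 * 2 ^ j}. E n) \<le> (1 / (\<eta> * 4 ^ j)) * (2 ^ j * real (card A))"
     using \<eta> E by (intro mult_mono) (auto simp: w_def intro!: sum_nonneg)
    also have "(4 :: real) ^ j = 2 ^ j * 2 ^ j" by (simp flip: power_mult_distrib)
    finally show "w j * (\<Sum>n\<in>{2 ^ j..<2 * 2 ^ j}. E n) \<le> real (card A) / \<eta> * (1 / 2 ^ j)" by simp
   qed
   also have "... = real (card A) / \<eta> * (\<Sum>j\<in>{K..<k}. 1 / 2 ^ j)" by (simp add: sum_distrib_left)
   also have "(\<Sum>j\<in>{K..<K + m}. 1 / 2 ^ j) = 2 / 2 ^ K - 2 / (2 :: real) ^ (K + m)"
   proof (induction m)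
    case (Suc m)
    have "2 / (2 :: real) ^ (K + Suc m) = 1 / 2 ^ (K + m)" by simp
    then show ?case using Suc by simp
   qed simp
   then have "(\<Sum>j\<in>{K..<k}. 1 / 2 ^ j) \<le> 2 / (2 :: real) ^ K" by (simp add: k_def)
   then have "real (card A) / \<eta> * (\<Sum>j\<in>{K..<k}. 1 / 2 ^ j) \<le> real (card A) / \<eta> * (2 / 2 ^ K)"
    using \<eta> by (intro mult_left_mono) auto
   finally show ?thesis by (simp add: mult.commute)
  qed
  finally show ?thesis by (simp add: w_def E_def)
 qed
 have "(\<lambda>m. \<bar>\<Sum>n<m. t n\<bar> / (2 * \<eta> * pi^2)) \<longlonglongrightarrow> \<bar>\<Sum>i\<in>A. pi\<^sup>2 * bern2 (x i) - pi^2 * bern2 (x i + \<tau>)\<bar> / (2 * \<eta> * pi^2)"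
  using t_sums \<eta> unfolding sums_def by (intro tendsto_divide tendsto_rabs tendsto_const) auto
 then have "\<bar>\<Sum>i\<in>A. pi\<^sup>2 * bern2 (x i) - pi^2 * bern2 (x i + \<tau>)\<bar> / (2 * \<eta> * pi^2) \<le> ?B"
  by (rule LIMSEQ_le_const2) (use part in blast)
 moreover have "\<bar>\<Sum>i\<in>A. pi\<^sup>2 * bern2 (x i) - pi^2 * bern2 (x i + \<tau>)\<bar> / (2 * \<eta> * pi^2) = \<bar>\<Sum>i\<in>A. bern2 (x i) - bern2 (x i + \<tau>)\<bar> / (2 * \<eta>)"
 proof -
  have "(\<Sum>i\<in>A. pi\<^sup>2 * bern2 (x i) - pi^2 * bern2 (x i + \<tau>)) = pi^2 * (\<Sum>i\<in>A. bern2 (x i) - bern2 (x i + \<tau>))"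
   by (simp only: sum_distrib_left right_diff_distrib)
  then show ?thesis by (simp add: abs_mult)
 qed
 ultimately show ?thesis by simp
qed

text \<open>Two parameters remain free for later optimisation: the smoothing length \<eta> and the
  truncation level K. The upper bound uses the shift by - \<eta>, the lower bound the shift by
  \<eta>.\<close>

lemma psi_sum_bound:
 fixes x :: "'i => real"
 assumes A: "finite A" and \<eta>: "0 < \<eta>" "\<eta> \<le> 1"
 shows "\<bar>\<Sum>i\<in>A. psi (x i)\<bar> \<le> \<eta> * real (card A) +
  (\<Sum>j<K. min (1 / 2 ^ j) (1 / (\<eta> * 4 ^ j)) * (\<Sum>N\<in>{2 ^ j..<2 * 2 ^ j}. norm (\<Sum>i\<in>A. ec (real N * x i)))) + 2 * real (card A) / (\<eta> * 2 ^ K)"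
  (is "_ \<le> ?E + ?B + ?T")
proof -
 have "(\<Sum>i\<in>A. psi (x i)) \<le> (\<Sum>i\<in>A. (bern2 (x i) - bern2 (x i + - \<eta>)) / (2 * \<eta>) + \<eta> / 2)"
  using psi_le_bern2_diff[OF \<eta>] by (intro sum_mono) simp
 also have "... = (\<Sum>i\<in>A. bern2 (x i) - bern2 (x i + - \<eta>)) / (2 * \<eta>) + ?E / 2"
  by (simp add: sum.distrib sum_divide_distrib mult.commute)
 also have "... \<le> \<bar>\<Sum>i\<in>A. bern2 (x i) - bern2 (x i + - \<eta>)\<bar> / (2 * \<eta>) + ?E / 2"
  using \<eta> by (intro add_right_mono divide_right_mono) auto
 finally have up: "(\<Sum>i\<in>A. psi (x i)) \<le> ?E / 2 + (?B + ?T)"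
  using bern2_shift_sum[OF A, of \<eta> "- \<eta>" x K] \<eta> by simp
 have "- (\<Sum>i\<in>A. psi (x i)) = (\<Sum>i\<in>A. - psi (x i))" by (simp add: sum_negf)
 also have "... \<le> (\<Sum>i\<in>A. (bern2 (x i) - bern2 (x i + \<eta>)) / (2 * \<eta>) + \<eta> / 2)"
 proof (rule sum_mono)
  fix i
  show "- psi (x i) \<le> (bern2 (x i) - bern2 (x i + \<eta>)) / (2 * \<eta>) + \<eta> / 2"
   using psi_ge_bern2_diff[OF \<eta>, of "x i"] unfolding diff_divide_distrib by linarith
 qed
 also have "... = (\<Sum>i\<in>A. bern2 (x i) - bern2 (x i + \<eta>)) / (2 * \<eta>) + ?E / 2"
  by (simp add: sum.distrib sum_divide_distrib mult.commute)
 also have "... \<le> \<bar>\<Sum>i\<in>A. bern2 (x i) - bern2 (x i + \<eta>)\<bar> / (2 * \<eta>) + ?E / 2"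
  using \<eta> by (intro add_right_mono divide_right_mono) auto
 finally have low: "- (\<Sum>i\<in>A. psi (x i)) \<le> ?E / 2 + (?B + ?T)"
  using bern2_shift_sum[OF A, of \<eta> \<eta> x K] \<eta> by simp
 have "?E \<ge> 0" using \<eta> by simp
 then show ?thesis using up low by (intro abs_leI) linarith+
qed

section \<open>The sawtooth sum over one dyadic block\<close>

lemma powr_Suc_diff:
 fixes k \<gamma> :: real
 assumes "k > 0" "0 < \<gamma>" "\<gamma> < 1"
 shows "\<bar>(k + 1) powr \<gamma> - (k powr \<gamma> + \<gamma> * k powr (\<gamma> - 1))\<bar> \<le> k powr (\<gamma> - 2)"
proof -
 have "\<exists>z. k < z \<and> z < k + 1 \<and> (k + 1) powr \<gamma> - k powr \<gamma> = (k + 1 - k) * (\<gamma> * z powr (\<gamma> - 1))"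
  using assms by (intro MVT2) (auto intro!: has_real_derivative_powr)
 then obtain z where z: "k < z" "z < k + 1" "(k + 1) powr \<gamma> - k powr \<gamma> = \<gamma> * z powr (\<gamma> - 1)" by auto
 have "\<exists>w. k < w \<and> w < z \<and> z powr (\<gamma> - 1) - k powr (\<gamma> - 1) = (z - k) * ((\<gamma> - 1) * w powr (\<gamma> - 1 - 1))"
  by (rule MVT2) (use assms z has_real_derivative_powr[of _ "\<gamma> - 1"] in auto)
 then obtain w where w: "k < w" "w < z" "z powr (\<gamma> - 1) - k powr (\<gamma> - 1) = (z - k) * ((\<gamma> - 1) * w powr (\<gamma> - 2))" by auto
 have "(k + 1) powr \<gamma> - (k powr \<gamma> + \<gamma> * k powr (\<gamma> - 1)) = \<gamma> * (z powr (\<gamma> - 1) - k powr (\<gamma> - 1))"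
  using z(3) by (simp add: algebra_simps)
 also have "\<bar>...\<bar> = \<gamma> * ((z - k) * ((1 - \<gamma>) * w powr (\<gamma> - 2)))"
  unfolding w(3) using assms z by (simp add: abs_mult)
 also have "... \<le> 1 * (1 * (1 * k powr (\<gamma> - 2)))"
  using assms z w by (intro mult_mono powr_mono2') auto
 finally show ?thesis by simp
qed

lemma exists_power2_between:
 fixes y :: real
 assumes "y \<ge> 1"
 shows "\<exists>K :: nat. y \<le> 2 ^ K \<and> 2 ^ K \<le> 2 * y"
proof -
 obtain n0 :: nat where n0: "y < 2 ^ n0" using real_arch_pow[of 2 y] by auto
 define K where "K = (LEAST n. y \<le> 2 ^ n)"
 have K: "y \<le> 2 ^ K" unfolding K_def by (rule LeastI[of _ n0]) (use n0 in simp)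
 have "2 ^ K \<le> 2 * y"
 proof (cases K)
  case 0
  then show ?thesis using assms by simp
 next
  case (Suc k)
  then have "\<not> y \<le> 2 ^ k" using not_less_Least[of k "\<lambda>n. y \<le> 2 ^ n"] by (simp add: K_def)
  then show ?thesis using Suc by simp
 qed
 then show ?thesis using K by blast
qed

lemma exponent_le_ln:
 assumes "(2 :: real) ^ K \<le> y" "y > 0"
 shows "real K \<le> 3 / 2 * ln y"
proof -
 have "real K * ln 2 = ln (2 ^ K)" by (simp add: ln_realpow)
 also have "... \<le> ln y" using assms by simp
 finally have 1: "real K * ln 2 \<le> ln y" .
 have "real K * (2 / 3) \<le> real K * ln 2" using ln2_ge_two_thirds by (intro mult_left_mono) auto
 then show ?thesis using 1 by linarith
qed

text \<open>The smoothing length balances \<eta> S M against the exponential sums, of order M powr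
  (3/4) (N0 / \<eta>) powr (1/4) S powr (1/2); the common value is R. If this \<eta> exceeds 1, the
  trivial bound S M is already below R. The set U will be the square-free condition, and Y bounds
  the logarithms.\<close>

lemma block_psi:
 fixes \<gamma> \<epsilon> :: real
 assumes \<gamma>: "1/2 < \<gamma>" "\<gamma> < 1" and \<epsilon>: "\<epsilon> > 0"
 shows "\<exists>C\<ge>0. \<forall>(J :: nat) (M :: nat) (Y :: real) (U :: nat set) (n :: nat => nat) (\<nu> :: real).
  M \<ge> 1 --> \<nu> = 0 \<or> \<nu> = 1 --> 2 ^ J \<le> Y --> real M \<le> Y --> (\<forall>m. n m \<le> 2 * 2 ^ J) -->
  \<bar>\<Sum>m\<in>{M..<2 * M}. \<Sum>s\<in>{2 ^ J..<n m} \<inter> U. psi (- ((real s * (real m)^2 + \<nu>) powr \<gamma>))\<bar>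
   \<le> C * (1 + ln Y) ^ 3 * (2 ^ J) powr \<epsilon> *
    ((2 ^ J) powr (3/5) * real M powr (4/5) * ((2 ^ J * (real M)^2) powr \<gamma>) powr (1/5) + 2 ^ J * real M powr (3/4))"
proof -
 \<comment> \<open>A fourth root will be taken, after which 4 \<epsilon> becomes \<epsilon>.\<close>
 have "4 * \<epsilon> > 0" using \<epsilon> by simp
 then obtain C0 where C0: "C0 \<ge> 0" and blk: "\<And>J H M a n \<nu>. H \<ge> 1 ==> M \<ge> 1 ==> 0 \<le> \<nu> ==> \<nu> \<le> 1 ==> (\<forall>s. norm (a s) \<le> 1) ==> (\<forall>m. n m \<le> 2 * 2 ^ J) ==>
  (\<Sum>h\<in>{H..<2 * H}. norm (\<Sum>m\<in>{M..<2 * M}. \<Sum>s\<in>{2 ^ J..<n m}. a s *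
    ec (real h * ((real s * (real m)^2) powr \<gamma> + \<nu> * \<gamma> * (real s * (real m)^2) powr (\<gamma> - 1))))) ^ 4
   \<le> C0 * (real (J + 2) ^ 4 * ((1 + ln (2 * real H + 1)) * (1 + ln (2 * real M + 1))) * real H ^ 4 * real M ^ 3 *
     (real H * (2 ^ J * (real M)^2) powr \<gamma> * (2 ^ J) powr (2 + 4 * \<epsilon>) + (2 ^ J) ^ 4))"
  using block_sum[OF \<gamma>, of "4 * \<epsilon>"] by blast
 \<comment> \<open>144 = 2^4 3^2: the factor J + 2 is at most 2 LL, and each of the two logarithmic
   factors at most 3 LL.\<close>
 define d where "d = root 4 (C0 * 144)"
 have d: "d \<ge> 0" "d ^ 4 = C0 * 144" using C0 by (simp_all add: d_def)
 define C where "C = 3 + 4 * d + 16 * pi"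
 have main: "\<bar>\<Sum>m\<in>{M..<2 * M}. \<Sum>s\<in>{2 ^ J..<n m} \<inter> U. psi (- ((real s * (real m)^2 + \<nu>) powr \<gamma>))\<bar>
   \<le> C * (1 + ln Y) ^ 3 * (2 ^ J) powr \<epsilon> *
    ((2 ^ J) powr (3/5) * real M powr (4/5) * ((2 ^ J * (real M)^2) powr \<gamma>) powr (1/5) + 2 ^ J * real M powr (3/4))"
  if M: "M \<ge> 1" and \<nu>: "\<nu> = 0 \<or> \<nu> = 1" and Y: "2 ^ J \<le> Y" "real M \<le> Y" and n: "\<forall>m. n m \<le> 2 * 2 ^ J"
  for J M :: nat and Y \<nu> :: real and U :: "nat set" and n :: "nat => nat"
 proof -
  define S where "S = (2 :: real) ^ J"
  have S: "S \<ge> 1" by (simp add: S_def)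
  have S0: "S > 0" and M0: "real M > 0" using S M by auto
  have Y1: "Y \<ge> 1" "S \<le> Y" using Y M by (auto simp: S_def)
  define LL where "LL = 1 + ln Y"
  have lnY: "ln Y \<ge> 0" using Y1 by simp
  then have LL: "LL \<ge> 1" by (simp add: LL_def)
  \<comment> \<open>The order of magnitude of k powr \<gamma> on the block.\<close>
  define N0 where "N0 = (S * (real M)^2) powr \<gamma>"
  have SM2: "1 \<le> S * (real M)^2" using S M mult_mono[of 1 S 1 "(real M)^2"] by (simp add: one_le_power)
  have N0: "N0 \<ge> 1" unfolding N0_def using SM2 \<gamma> by (intro ge_one_powr_ge_zero) auto
  have N0pos: "N0 > 0" using N0 by simp
  define R where "R = S powr (3/5) * real M powr (4/5) * N0 powr (1/5)"
  define V where "V = S * real M powr (3/4)"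
  define \<eta> where "\<eta> = N0 powr (1/5) * S powr (-2/5) * real M powr (-1/5)"
  have \<eta>0: "\<eta> > 0" using N0pos S0 M0 by (simp add: \<eta>_def)
  have RV: "R \<ge> 0" "V \<ge> 0" using S0 by (auto simp: R_def V_def)
  have pS: "S * S powr q = S powr (1 + q)" and pM: "real M * real M powr q = real M powr (1 + q)" for q
   using S0 M0 by (simp_all add: powr_add)
  have \<eta>R: "\<eta> * (S * real M) = R"
  proof -
   have "\<eta> * (S * real M) = N0 powr (1/5) * (S * S powr (-2/5)) * (real M * real M powr (-1/5))" by (simp add: \<eta>_def mult_ac)
   then show ?thesis unfolding pS pM by (simp add: R_def mult_ac)
  qed
  define A where "A = (SIGMA m:{M..<2 * M}. {2 ^ J..<n m} \<inter> U)"
  define k where "k = (\<lambda>p :: nat \<times> nat. real (snd p) * (real (fst p))^2)"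
  have finA: "finite A" unfolding A_def by (intro finite_SigmaI) auto
  have cardA: "real (card A) \<le> S * real M"
  proof -
   have "card ({2 ^ J..<n m} \<inter> U) \<le> 2 ^ J" for m
   proof -
    have "card ({2 ^ J..<n m} \<inter> U) \<le> card {2 ^ J..<n m}" by (intro card_mono) auto
    also have "... \<le> 2 ^ J" using n[rule_format, of m] by simp
    finally show ?thesis .
   qed
   then have "card A \<le> (\<Sum>m\<in>{M..<2 * M}. 2 ^ J)" unfolding A_def by (subst card_SigmaI) (auto simp del: sum_constant intro!: sum_mono)
   then have "card A \<le> M * 2 ^ J" by simp
   then have "real (card A) \<le> real (M * 2 ^ J)" by linarith
   then show ?thesis by (simp add: S_def mult.commute)
  qed
  have psiA: "(\<Sum>m\<in>{M..<2 * M}. \<Sum>s\<in>{2 ^ J..<n m} \<inter> U. psi (- ((real s * (real m)^2 + \<nu>) powr \<gamma>))) = (\<Sum>p\<in>A. psi (- ((k p + \<nu>) powr \<gamma>)))"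
   unfolding A_def k_def by (subst sum.Sigma) (auto simp: case_prod_unfold)
  have kge: "S * (real M)^2 \<le> k p" if "p \<in> A" for p
  proof -
   have "real (2 ^ J) \<le> real (snd p)" "M \<le> fst p" using that by (auto simp: A_def)
   then show ?thesis unfolding k_def S_def by (intro mult_mono power_mono) auto
  qed
  have Sp: "1 \<le> S powr \<epsilon>" using S \<epsilon> by (intro ge_one_powr_ge_zero) auto
  have goal: ?thesis if "\<bar>\<Sum>p\<in>A. psi (- ((k p + \<nu>) powr \<gamma>))\<bar> \<le> C * LL ^ 3 * S powr \<epsilon> * (R + V)"
   using that unfolding psiA by (simp add: LL_def S_def R_def V_def N0_def)
  have C1: "1 \<le> C" using d pi_gt_zero by (simp add: C_def)
  have l3: "1 \<le> LL ^ 3" using LL by (intro one_le_power)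
  have CC: "1 \<le> C * LL ^ 3 * S powr \<epsilon>"
  proof -
   have "1 * 1 \<le> C * LL ^ 3" using C1 l3 by (intro mult_mono) auto
   then have "1 * 1 \<le> (C * LL ^ 3) * S powr \<epsilon>" using Sp by (intro mult_mono) auto
   then show ?thesis by simp
  qed
  show ?thesis
  proof (cases "\<eta> \<le> 1")
   case False
   have "\<bar>\<Sum>p\<in>A. psi (- ((k p + \<nu>) powr \<gamma>))\<bar> \<le> (\<Sum>p\<in>A. 1)"
    by (rule order.trans[OF sum_abs sum_mono[OF abs_psi_le]])
   also have "... \<le> S * real M" using cardA by simp
   also have "... \<le> \<eta> * (S * real M)" using False S0 mult_right_mono[of 1 \<eta> "S * real M"] by simp
   also have "... \<le> 1 * (R + V)" unfolding \<eta>R using RV by simp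
   also have "... \<le> C * LL ^ 3 * S powr \<epsilon> * (R + V)" using CC RV by (intro mult_right_mono) auto
   finally show ?thesis by (rule goal)
  next
   case True
   define \<eta>i where "\<eta>i = 1 / \<eta>"
   have \<eta>i: "\<eta>i \<ge> 1" using True \<eta>0 by (simp add: \<eta>i_def)
   have \<eta>i_le: "\<eta>i \<le> S powr (2/5) * real M powr (1/5)"
   proof -
    have e: "\<eta>i = 1 / N0 powr (1/5) * (S powr (2/5) * real M powr (1/5))"
     by (simp add: \<eta>i_def \<eta>_def powr_minus_divide)
    have "1 \<le> N0 powr (1/5)" using N0 by (intro ge_one_powr_ge_zero) auto
    then have "1 / N0 powr (1/5) \<le> 1" using N0pos by (simp add: divide_le_eq_1)
    then have "1 / N0 powr (1/5) * (S powr (2/5) * real M powr (1/5)) \<le> 1 * (S powr (2/5) * real M powr (1/5))"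
     by (intro mult_right_mono) auto
    then show ?thesis unfolding e by simp
   qed
   have \<eta>iV: "\<eta>i \<le> V"
   proof -
    have "S powr (2/5) \<le> S powr 1" "real M powr (1/5) \<le> real M powr (3/4)" using S M by (intro powr_mono; simp)+
    then have "S powr (2/5) * real M powr (1/5) \<le> S powr 1 * real M powr (3/4)" by (intro mult_mono) auto
    then show ?thesis using \<eta>i_le S0 by (simp add: V_def)
   qed
   have \<eta>iY: "\<eta>i^2 \<le> Y^2"
   proof -
    have "S powr (2/5) * real M powr (1/5) \<le> Y powr (2/5) * Y powr (1/5)"
     using Y1 Y S0 M0 by (intro mult_mono powr_mono2) auto
    also have "... = Y powr (3/5)" by (simp flip: powr_add)
    also have "... \<le> Y powr 1" using Y1 by (intro powr_mono) auto
    finally have "\<eta>i \<le> Y" using \<eta>i_le Y1 by simp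
    then show ?thesis using \<eta>i by (intro power_mono) auto
   qed
   have "\<eta>i^2 \<ge> 1" using \<eta>i by (intro one_le_power)
   \<comment> \<open>With 2 ^ K of order 1 / \<eta>^2 the tail that is estimated trivially is at
     most 2 R.\<close>
   then obtain K :: nat where K: "\<eta>i^2 \<le> 2 ^ K" "2 ^ K \<le> 2 * \<eta>i^2" using exists_power2_between[of "\<eta>i^2"] by blast
   have KLL: "real K \<le> 4 * LL"
   proof -
    have "real K \<le> 3 / 2 * ln (2 * Y^2)" using K(2) \<eta>iY Y1 by (intro exponent_le_ln) auto
    also have "ln (2 * Y^2) = ln 2 + 2 * ln Y" using Y1 by (simp add: ln_mult ln_realpow)
    also have "ln 2 \<le> (1 :: real)" using ln_2_less_1 by simp
    finally show ?thesis using lnY by (simp add: LL_def)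
   qed
   define E where "E = (\<lambda>N :: nat. norm (\<Sum>p\<in>A. ec (real N * - ((k p + \<nu>) powr \<gamma>))))"
   define a where "a = (\<lambda>s. of_bool (s \<in> U) :: complex)"
   define G where "G = (\<lambda>N :: nat. norm (\<Sum>m\<in>{M..<2 * M}. \<Sum>s\<in>{2 ^ J..<n m}. a s *
    ec (real N * ((real s * (real m)^2) powr \<gamma> + \<nu> * \<gamma> * (real s * (real m)^2) powr (\<gamma> - 1)))))"
   have G_eq: "G N = norm (\<Sum>p\<in>A. ec (real N * (k p powr \<gamma> + \<nu> * \<gamma> * k p powr (\<gamma> - 1))))" for N
   proof -
    have inter: "(\<Sum>s\<in>{2 ^ J..<n m}. a s * f s) = (\<Sum>s\<in>{2 ^ J..<n m} \<inter> U. f s)" for m and f :: "nat => complex"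
    proof -
     have "(\<Sum>s\<in>{2 ^ J..<n m}. a s * f s) = (\<Sum>s\<in>{2 ^ J..<n m}. if s \<in> U then f s else 0)"
      unfolding a_def by (intro sum.cong) auto
     then show ?thesis by (simp only: sum.inter_restrict finite_atLeastLessThan)
    qed
    show ?thesis unfolding G_def A_def k_def inter by (subst sum.Sigma) (auto simp: case_prod_unfold)
   qed
   \<comment> \<open>The power of k + \<nu> is replaced by its linear approximation at k. Each point
     costs at most 2 pi N / k with k \<ge> S M^2, and there are at most S M points, so the total is
     at most 2 pi N.\<close>
   have EG: "E N \<le> G N + 2 * pi * real N" for N
   proof -
    let ?f = "\<lambda>p. (k p + \<nu>) powr \<gamma>" and ?g = "\<lambda>p. k p powr \<gamma> + \<nu> * \<gamma> * k p powr (\<gamma> - 1)"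
    have "E N = norm (cnj (\<Sum>p\<in>A. ec (real N * - ?f p)))" by (simp only: E_def complex_mod_cnj)
    also have "... = norm (\<Sum>p\<in>A. ec (real N * ?f p))" by (simp only: cnj_sum cnj_ec mult_minus_right minus_minus)
    also have "(\<Sum>p\<in>A. ec (real N * ?f p)) = (\<Sum>p\<in>A. ec (real N * ?g p)) + (\<Sum>p\<in>A. ec (real N * ?f p) - ec (real N * ?g p))"
     by (simp add: sum_subtractf)
    also have "norm ... \<le> G N + norm (\<Sum>p\<in>A. ec (real N * ?f p) - ec (real N * ?g p))" unfolding G_eq by (rule norm_triangle_ineq)
    also have "norm (\<Sum>p\<in>A. ec (real N * ?f p) - ec (real N * ?g p)) \<le> (\<Sum>p\<in>A. 2 * pi * real N * (1 / (S * (real M)^2)))"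
    proof (rule sum_norm_le)
     fix p assume p: "p \<in> A"
     have kp: "k p \<ge> 1" "k p > 0" using kge[OF p] SM2 by auto
     have "norm (ec (real N * ?f p) - ec (real N * ?g p)) \<le> 2 * pi * \<bar>real N * ?f p - real N * ?g p\<bar>" by (rule norm_ec_diff_le)
     also have "\<bar>real N * ?f p - real N * ?g p\<bar> = real N * \<bar>?f p - ?g p\<bar>" by (simp add: abs_mult flip: right_diff_distrib)
     also have "\<bar>?f p - ?g p\<bar> \<le> 1 / (S * (real M)^2)"
     proof -
      have "\<bar>?f p - ?g p\<bar> \<le> k p powr (\<gamma> - 2)" using \<nu> powr_Suc_diff[OF kp(2), of \<gamma>] \<gamma> by auto
      also have "... \<le> k p powr (- 1)" using kp \<gamma> by (intro powr_mono) auto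
      also have "... = 1 / k p" using kp by (simp add: powr_minus_divide)
      also have "... \<le> 1 / (S * (real M)^2)" using kge[OF p] SM2 by (intro divide_left_mono) auto
      finally show ?thesis .
     qed
     finally show "norm (ec (real N * ?f p) - ec (real N * ?g p)) \<le> 2 * pi * real N * (1 / (S * (real M)^2))"
      by (simp add: mult_left_mono mult.assoc)
    qed
    also have "... = real (card A) * (2 * pi * real N * (1 / (S * (real M)^2)))" by simp
    also have "... \<le> (S * real M) * (2 * pi * real N * (1 / (S * (real M)^2)))" using cardA S0 by (intro mult_right_mono) auto
    also have "... = 2 * pi * real N * (1 / real M)" using S0 M0 by (simp add: power2_eq_square)
    also have "... \<le> 2 * pi * real N * 1" using M by (intro mult_left_mono) auto
    finally show ?thesis by simp
   qed
   have block: "min (1 / 2 ^ j) (1 / (\<eta> * 4 ^ j)) * (\<Sum>N\<in>{2 ^ j..<2 * 2 ^ j}. E N) \<le> (d * LL^2 + 4 * pi) * (S powr \<epsilon> * (R + V))"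
    if j: "j < K" for j
   proof -
    define H where "H = (2 :: real) ^ j"
    have H: "H \<ge> 1" "H > 0" by (simp_all add: H_def)
    have H2: "(4 :: real) ^ j = H * H" by (simp add: H_def flip: power_mult_distrib)
    define w where "w = min (1 / H) (1 / (\<eta> * (H * H)))"
    have w: "w \<ge> 0" "w * H \<le> 1" "w * (H * H) \<le> \<eta>i"
    proof -
     show "w \<ge> 0" using H \<eta>0 by (simp add: w_def)
     have "w * H \<le> (1 / H) * H" using H by (intro mult_right_mono) (auto simp: w_def)
     then show "w * H \<le> 1" using H by simp
     have "w * (H * H) \<le> (1 / (\<eta> * (H * H))) * (H * H)" using H by (intro mult_right_mono) (auto simp: w_def)
     then show "w * (H * H) \<le> \<eta>i" using H \<eta>0 by (simp add: \<eta>i_def)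
    qed
    \<comment> \<open>The left-hand side is largest at H = 1 / \<eta>, where the two weights
      agree.\<close>
    have wH4: "w * H * H powr (1/4) \<le> \<eta>i powr (1/4)"
    proof (cases "H \<le> \<eta>i")
     case True
     have "w * H * H powr (1/4) \<le> 1 * \<eta>i powr (1/4)" using w True H by (intro mult_mono powr_mono2) auto
     then show ?thesis by simp
    next
     case False
     have "w * H * H powr (1/4) = (w * (H * H)) * H powr (- 3/4)"
     proof -
      have "H powr (1/4) = H powr (1 + (- 3/4))" by simp
      also have "... = H * H powr (- 3/4)" using H by (subst powr_add) simp
      finally show ?thesis by simp
     qed
     also have "... \<le> \<eta>i * \<eta>i powr (- 3/4)" using w False \<eta>i by (intro mult_mono powr_mono2') auto
     also have "... = \<eta>i powr (1 + (- 3/4))" using \<eta>i by (subst powr_add) simp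
     finally show ?thesis by simp
    qed
    define T where "T = (\<Sum>N\<in>{2 ^ j..<2 * 2 ^ j}. G N)"
    define y where "y = (d * LL^2) * H * real M powr (3/4) * ((H * N0) powr (1/4) * S powr (1/2 + \<epsilon>) + S)"
    have y0: "y \<ge> 0" unfolding y_def using d LL H S0 by (intro mult_nonneg_nonneg add_nonneg_nonneg) auto
    have "T ^ 4 \<le> y ^ 4"
    proof -
     have "T ^ 4 \<le> C0 * (real (J + 2) ^ 4 * ((1 + ln (2 * real (2 ^ j) + 1)) * (1 + ln (2 * real M + 1))) * real (2 ^ j) ^ 4 * real M ^ 3 *
      (real (2 ^ j) * (2 ^ J * (real M)^2) powr \<gamma> * (2 ^ J) powr (2 + 4 * \<epsilon>) + (2 ^ J) ^ 4))"
      unfolding T_def G_def using M \<nu> n by (intro blk) (auto simp: a_def)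
     also have "... = C0 * (real (J + 2) ^ 4 * ((1 + ln (2 * H + 1)) * (1 + ln (2 * real M + 1))) * H ^ 4 * real M ^ 3 * (H * N0 * S powr (2 + 4 * \<epsilon>) + S ^ 4))"
      by (simp add: H_def N0_def S_def)
     also have "... \<le> C0 * ((2 * LL) ^ 4 * ((3 * LL) * (3 * LL)) * H ^ 4 * real M ^ 3 * (H * N0 * S powr (2 + 4 * \<epsilon>) + S ^ 4))"
     proof -
      have "real J \<le> 3 / 2 * ln Y" using Y Y1 by (intro exponent_le_ln) auto
      then have Jl: "real (J + 2) \<le> 2 * LL" using lnY by (simp add: LL_def)
      have e2: "exp 2 \<ge> (3 :: real)" using exp_ge_add_one_self[of 2] by simp
      have lnb: "1 + ln z \<le> 3 * LL" if "0 < z" "z \<le> 3 * Y^2" for z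
      proof -
       have "z \<le> exp 2 * Y^2" using that e2 by (meson mult_right_mono order.trans zero_le_power2)
       then have "ln z \<le> ln (exp 2 * Y^2)" using that Y1 by simp
       also have "... = 2 + 2 * ln Y" using Y1 by (simp add: ln_mult ln_realpow)
       finally show ?thesis using lnY by (simp add: LL_def)
      qed
      have YY: "Y \<le> Y^2" "1 \<le> Y^2" using Y1 by (auto simp: self_le_power one_le_power)
      have "H \<le> Y^2"
      proof -
       have "2 * H = 2 ^ Suc j" by (simp add: H_def)
       also have "... \<le> 2 ^ K" using j by (intro power_increasing) auto
       finally show ?thesis using K(2) \<eta>iY by linarith
      qed
      then have 1: "1 + ln (2 * H + 1) \<le> 3 * LL" using H YY by (intro lnb) auto
      have 2: "1 + ln (2 * real M + 1) \<le> 3 * LL" using Y YY M by (intro lnb) auto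
      have "real (J + 2) ^ 4 \<le> (2 * LL) ^ 4" using Jl by (intro power_mono) auto
      moreover have "(1 + ln (2 * H + 1)) * (1 + ln (2 * real M + 1)) \<le> (3 * LL) * (3 * LL)"
       by (rule mult_mono[OF 1 2]) (use H LL in auto)
      ultimately have "real (J + 2) ^ 4 * ((1 + ln (2 * H + 1)) * (1 + ln (2 * real M + 1))) \<le> (2 * LL) ^ 4 * ((3 * LL) * (3 * LL))"
       by (rule mult_mono) (use H in \<open>auto intro!: mult_nonneg_nonneg\<close>)
      then have "real (J + 2) ^ 4 * ((1 + ln (2 * H + 1)) * (1 + ln (2 * real M + 1))) * (H ^ 4 * real M ^ 3 * (H * N0 * S powr (2 + 4 * \<epsilon>) + S ^ 4))
       \<le> (2 * LL) ^ 4 * ((3 * LL) * (3 * LL)) * (H ^ 4 * real M ^ 3 * (H * N0 * S powr (2 + 4 * \<epsilon>) + S ^ 4))"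
       by (rule mult_right_mono) (use H N0 S0 in \<open>auto intro!: mult_nonneg_nonneg add_nonneg_nonneg\<close>)
      from mult_left_mono[OF this C0] show ?thesis by (simp only: mult.assoc)
     qed
     also have "... = (C0 * 144) * LL ^ 6 * (H ^ 4 * real M ^ 3 * (H * N0 * S powr (2 + 4 * \<epsilon>) + S ^ 4))"
      by (simp add: eval_nat_numeral)
     \<comment> \<open>The power of LL is raised from 6 to 8 so that the whole expression is an
       exact fourth power.\<close>
     also have "... \<le> (C0 * 144) * LL ^ 8 * (H ^ 4 * real M ^ 3 * ((H * N0) powr (1/4) * S powr (1/2 + \<epsilon>) + S) ^ 4)"
     proof -
      have "LL ^ 6 \<le> LL ^ 8" using LL by (intro power_increasing) auto
      moreover have "H * N0 * S powr (2 + 4 * \<epsilon>) + S ^ 4 \<le> ((H * N0) powr (1/4) * S powr (1/2 + \<epsilon>) + S) ^ 4"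
      proof -
       have "((H * N0) powr (1/4)) ^ 4 = H * N0" using H N0pos by (simp add: powr_power)
       moreover have "(S powr (1/2 + \<epsilon>)) ^ 4 = S powr (2 + 4 * \<epsilon>)" using S0 by (simp add: powr_power algebra_simps)
       ultimately have "H * N0 * S powr (2 + 4 * \<epsilon>) = ((H * N0) powr (1/4) * S powr (1/2 + \<epsilon>)) ^ 4" by (simp add: power_mult_distrib)
       moreover have "x ^ 4 + z ^ 4 \<le> (x + z) ^ 4" if "x \<ge> 0" "z \<ge> 0" for x z :: real
        using that by (simp add: power4_eq_xxxx algebra_simps add_nonneg_nonneg)
       ultimately show ?thesis using S0 by simp
      qed
      ultimately have "LL ^ 6 * (H * N0 * S powr (2 + 4 * \<epsilon>) + S ^ 4) \<le> LL ^ 8 * ((H * N0) powr (1/4) * S powr (1/2 + \<epsilon>) + S) ^ 4"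
       by (rule mult_mono) (use H N0 S0 LL in \<open>auto intro!: mult_nonneg_nonneg add_nonneg_nonneg\<close>)
      from mult_left_mono[OF this, of "C0 * 144 * (H ^ 4 * real M ^ 3)"] show ?thesis
       using C0 H by (simp add: mult_ac)
     qed
     also have "... = y ^ 4"
     proof -
      have "(real M powr (3/4)) ^ 4 = real M ^ 3" using M0 by (simp add: powr_power)
      then show ?thesis unfolding y_def power_mult_distrib d(2) by (simp flip: power_mult)
     qed
     finally show ?thesis .
    qed
    then have Ty: "T \<le> y" using y0 power_mono_iff[of T y 4] by (auto simp: T_def G_def sum_nonneg)
    have "(\<Sum>N\<in>{2 ^ j..<2 * 2 ^ j}. E N) \<le> (\<Sum>N\<in>{2 ^ j..<2 * 2 ^ j}. G N + 2 * pi * (2 * H))"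
    proof (rule sum_mono)
     fix N :: nat assume "N \<in> {2 ^ j..<2 * 2 ^ j}"
     then have "real N \<le> real (2 * 2 ^ j)" by (intro of_nat_mono) simp
     then have "2 * pi * real N \<le> 2 * pi * (2 * H)" by (intro mult_left_mono) (auto simp: H_def)
     then show "E N \<le> G N + 2 * pi * (2 * H)" using EG[of N] by linarith
    qed
    also have "... = T + 4 * pi * (H * H)" by (simp add: sum.distrib T_def H_def)
    finally have "w * (\<Sum>N\<in>{2 ^ j..<2 * 2 ^ j}. E N) \<le> w * (y + 4 * pi * (H * H))" using Ty w by (intro mult_left_mono) linarith+
    also have "... = (d * LL^2) * (real M powr (3/4) * ((w * H * H powr (1/4)) * N0 powr (1/4) * S powr (1/2 + \<epsilon>) + w * H * S)) + 4 * pi * (w * (H * H))"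
     using H N0pos by (simp add: y_def powr_mult algebra_simps)
    also have "... \<le> (d * LL^2) * (real M powr (3/4) * (\<eta>i powr (1/4) * N0 powr (1/4) * S powr (1/2 + \<epsilon>) + 1 * S)) + 4 * pi * V"
     using w wH4 \<eta>iV d LL S0 by (intro add_mono mult_left_mono mult_right_mono) auto
    also have "real M powr (3/4) * (\<eta>i powr (1/4) * N0 powr (1/4) * S powr (1/2 + \<epsilon>) + 1 * S) = S powr \<epsilon> * R + V"
    proof -
     have "\<eta>i powr (1/4) = \<eta> powr (- (1/4))" using \<eta>0 by (simp add: \<eta>i_def powr_minus_divide powr_divide)
     also have "... = N0 powr (- 1/20) * S powr (1/10) * real M powr (1/20)"
      unfolding \<eta>_def by (simp add: powr_mult powr_powr)
     finally have e: "\<eta>i powr (1/4) = N0 powr (- 1/20) * S powr (1/10) * real M powr (1/20)" .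
     have "real M powr (3/4) * (\<eta>i powr (1/4) * N0 powr (1/4) * S powr (1/2 + \<epsilon>)) =
      (real M powr (3/4) * real M powr (1/20)) * (N0 powr (- 1/20) * N0 powr (1/4)) * (S powr (1/10) * S powr (1/2 + \<epsilon>))"
      unfolding e by (simp only: mult_ac)
     also have "... = real M powr (4/5) * N0 powr (1/5) * S powr (3/5 + \<epsilon>)"
      by (simp flip: powr_add)
     also have "... = S powr \<epsilon> * R" by (simp add: R_def powr_add mult_ac)
     finally show ?thesis by (simp add: V_def distrib_left mult.commute)
    qed
    also have "(d * LL^2) * (S powr \<epsilon> * R + V) + 4 * pi * V \<le> (d * LL^2) * (S powr \<epsilon> * (R + V)) + 4 * pi * (S powr \<epsilon> * (R + V))"
    proof -
     have "1 * V \<le> S powr \<epsilon> * V" using Sp RV by (intro mult_right_mono) auto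
     moreover have "0 \<le> S powr \<epsilon> * R" using RV by simp
     ultimately have "S powr \<epsilon> * R + V \<le> S powr \<epsilon> * (R + V)" "V \<le> S powr \<epsilon> * (R + V)" by (simp_all add: distrib_left)
     then show ?thesis using d by (intro add_mono mult_left_mono) auto
    qed
    finally show ?thesis unfolding H2 unfolding H_def[symmetric] w_def[symmetric] by (simp add: distrib_right)
   qed
   have "\<bar>\<Sum>p\<in>A. psi (- ((k p + \<nu>) powr \<gamma>))\<bar> \<le> \<eta> * real (card A) +
    (\<Sum>j<K. min (1 / 2 ^ j) (1 / (\<eta> * 4 ^ j)) * (\<Sum>N\<in>{2 ^ j..<2 * 2 ^ j}. E N)) + 2 * real (card A) / (\<eta> * 2 ^ K)"
    unfolding E_def using finA \<eta>0 True by (intro psi_sum_bound)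
   also have "... \<le> R + (\<Sum>j<K. (d * LL^2 + 4 * pi) * (S powr \<epsilon> * (R + V))) + 2 * R"
   proof (intro add_mono)
    show "\<eta> * real (card A) \<le> R" unfolding \<eta>R[symmetric] using cardA \<eta>0 by (intro mult_left_mono) auto
    show "(\<Sum>j<K. min (1 / 2 ^ j) (1 / (\<eta> * 4 ^ j)) * (\<Sum>N\<in>{2 ^ j..<2 * 2 ^ j}. E N)) \<le> (\<Sum>j<K. (d * LL^2 + 4 * pi) * (S powr \<epsilon> * (R + V)))"
     by (intro sum_mono block) auto
    have "1 / (\<eta> * 2 ^ K) \<le> 1 / (\<eta> * \<eta>i^2)" using K \<eta>0 \<eta>i by (intro divide_left_mono mult_left_mono) auto
    also have "... = \<eta>" using \<eta>0 by (simp add: \<eta>i_def power2_eq_square)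
    finally have "2 * real (card A) * (1 / (\<eta> * 2 ^ K)) \<le> 2 * (S * real M) * \<eta>" using cardA \<eta>0 S0 by (intro mult_mono) auto
    also have "... = 2 * R" by (simp flip: \<eta>R)
    finally show "2 * real (card A) / (\<eta> * 2 ^ K) \<le> 2 * R" by simp
   qed
   also have "... = 3 * R + real K * ((d * LL^2 + 4 * pi) * (S powr \<epsilon> * (R + V)))" by simp
   also have "... \<le> 3 * LL ^ 3 * (S powr \<epsilon> * (R + V)) + (4 * LL) * ((d * LL^2 + 4 * pi * LL^2) * (S powr \<epsilon> * (R + V)))"
   proof (intro add_mono)
    have "1 * (1 * R) \<le> LL ^ 3 * (S powr \<epsilon> * (R + V))" using l3 Sp RV LL by (intro mult_mono) auto
    then show "3 * R \<le> 3 * LL ^ 3 * (S powr \<epsilon> * (R + V))" by simp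
    have "4 * pi * 1 \<le> 4 * pi * LL^2" using LL by (intro mult_left_mono one_le_power) auto
    then have "d * LL^2 + 4 * pi \<le> d * LL^2 + 4 * pi * LL^2" by simp
    then show "real K * ((d * LL^2 + 4 * pi) * (S powr \<epsilon> * (R + V))) \<le> (4 * LL) * ((d * LL^2 + 4 * pi * LL^2) * (S powr \<epsilon> * (R + V)))"
     using KLL RV d LL by (intro mult_mono mult_right_mono) (auto intro!: mult_nonneg_nonneg add_nonneg_nonneg)
   qed
   also have "... = C * LL ^ 3 * S powr \<epsilon> * (R + V)"
    by (simp add: C_def power3_eq_cube power2_eq_square algebra_simps)
   finally show ?thesis by (rule goal)
  qed
 qed
 have "C \<ge> 0" using d by (simp add: C_def)
 then show ?thesis using main by blast
qed

section \<open>Square-free integers\<close>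

text \<open>The Moebius function, taken with real values because it enters only weighted
  sums.\<close>

definition mu :: "nat => real" where
 "mu d = (if squarefree d then (- 1) ^ card (prime_factors d) else 0)"

lemma abs_mu_le: "\<bar>mu d\<bar> \<le> 1"
 by (simp add: mu_def power_abs)

lemma mu_prime_mult:
 assumes "prime p" "\<not> p dvd e"
 shows "mu (p * e) = - mu e"
proof (cases "e = 0")
 case True
 then show ?thesis using assms by simp
next
 case False
 have cop: "coprime p e" using assms by (simp add: prime_imp_coprime)
 have "squarefree (p * e) \<longleftrightarrow> squarefree e"
  using cop assms(1) squarefree_mult_coprime[OF cop squarefree_prime[OF assms(1)]] squarefree_mono[of e "p * e"] by auto
 moreover have "prime_factors (p * e) = insert p (prime_factors e)"
  using assms False by (subst prime_factors_product) (auto simp: prime_prime_factors)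
 moreover have "p \<notin> prime_factors e" using assms by (auto dest: in_prime_factors_imp_dvd)
 ultimately show ?thesis by (simp add: mu_def)
qed

text \<open>For a prime p dividing n, a divisor d not divisible by p is cancelled by p d, and
  divisors divisible by p^2 contribute 0.\<close>

lemma sum_mu_divisors:
 assumes "n > 0"
 shows "(\<Sum>d | d dvd n. mu d) = of_bool (n = 1)"
proof (cases "n = 1")
 case True
 then show ?thesis by (simp add: mu_def)
next
 case False
 then obtain p where p: "prime p" "p dvd n" using prime_factor_nat by blast
 have fin: "finite {d. d dvd n}" using assms by simp
 have "(\<Sum>d | d dvd n. mu d) = (\<Sum>d | d dvd n \<and> \<not> p dvd d. mu d) + (\<Sum>d | d dvd n \<and> p dvd d. mu d)"
  using fin by (subst sum.union_disjoint[symmetric]) (auto intro!: sum.cong finite_subset[OF _ fin])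
 also have "(\<Sum>d | d dvd n \<and> p dvd d. mu d) = (\<Sum>d\<in>(*) p ` {e. e dvd n \<and> \<not> p dvd e}. mu d)"
 proof (rule sum.mono_neutral_right)
  show "finite {d. d dvd n \<and> p dvd d}" by (rule finite_subset[OF _ fin]) auto
  have "p * e dvd n" if "e dvd n" "\<not> p dvd e" for e
   using that p by (intro divides_mult) (auto simp: prime_imp_coprime)
  then show "(*) p ` {e. e dvd n \<and> \<not> p dvd e} \<subseteq> {d. d dvd n \<and> p dvd d}" by (intro image_subsetI) simp
  have "mu d = 0" if d: "d dvd n" "p dvd d" "d \<notin> (*) p ` {e. e dvd n \<and> \<not> p dvd e}" for d
  proof -
   obtain e where e: "d = p * e" using d by (auto elim: dvdE)
   have "e dvd n" using d e by (metis dvd_mult_right)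
   then have "p dvd e" using d e by auto
   then have "p^2 dvd d" by (simp add: e power2_eq_square)
   then have "\<not> squarefree d" using p by (intro not_squarefreeI) (auto dest: prime_gt_1_nat)
   then show ?thesis by (simp add: mu_def)
  qed
  then show "\<forall>d\<in>{d. d dvd n \<and> p dvd d} - (*) p ` {e. e dvd n \<and> \<not> p dvd e}. mu d = 0" by auto
 qed
 also have "... = (\<Sum>e | e dvd n \<and> \<not> p dvd e. mu (p * e))"
  using p by (subst sum.reindex) (auto intro!: inj_onI)
 also have "... = (\<Sum>e | e dvd n \<and> \<not> p dvd e. - mu e)" using p by (intro sum.cong) (auto simp: mu_prime_mult)
 finally show ?thesis using False by (simp add: sum_negf)
qed

text \<open>d^2 divides n exactly when d divides \<open>square_part n\<close>, and this number is 1
  exactly for square-free n.\<close>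

lemma squarefree_mu:
 assumes "n > 0"
 shows "of_bool (squarefree n) = (\<Sum>d | d\<^sup>2 dvd n. mu d)"
proof -
 have pos: "square_part n > 0" using assms by (metis gr0I square_part_0_iff less_irrefl)
 have "square_part n = 1 \<longleftrightarrow> squarefree n"
  unfolding squarefree_def dvd_square_part_iff[symmetric] by (metis dvd_refl nat_dvd_1_iff_1 one_dvd)
 then show ?thesis using sum_mu_divisors[OF pos] by (simp add: dvd_square_part_iff)
qed

text \<open>Exchange of summation along n = g(d) e, needed for g(d) = d and for g(d) = d^2. The
  condition on g 0 keeps d = 0 out of the inner sum.\<close>

lemma sum_divisor_swap:
 fixes f :: "nat => nat => real" and g :: "nat => nat"
 assumes g: "\<And>d. d \<ge> 1 ==> d \<le> g d" and g0: "g 0 = 0"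
 shows "(\<Sum>n\<in>{1..N}. \<Sum>d | g d dvd n. f d (n div g d)) = (\<Sum>d\<in>{1..N}. \<Sum>e\<in>{1..N div g d}. f d e)"
proof -
 have set: "{d. g d dvd n} = {d \<in> {1..N}. g d dvd n}" if "n \<in> {1..N}" for n
 proof -
  have "d \<in> {1..N}" if d: "g d dvd n" for d
  proof -
   have "d \<noteq> 0" using d g0 \<open>n \<in> {1..N}\<close> by (intro notI) simp
   moreover have "g d \<le> n" using d \<open>n \<in> {1..N}\<close> by (intro dvd_imp_le) auto
   ultimately show ?thesis using g[of d] \<open>n \<in> {1..N}\<close> by simp
  qed
  then show ?thesis by blast
 qed
 have "(\<Sum>n\<in>{1..N}. \<Sum>d | g d dvd n. f d (n div g d)) = (\<Sum>n\<in>{1..N}. \<Sum>d\<in>{1..N}. if g d dvd n then f d (n div g d) else 0)"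
 proof (rule sum.cong[OF refl])
  fix n assume n: "n \<in> {1..N}"
  show "(\<Sum>d | g d dvd n. f d (n div g d)) = (\<Sum>d\<in>{1..N}. if g d dvd n then f d (n div g d) else 0)"
   by (simp only: set[OF n] sum.inter_filter finite_atLeastAtMost)
 qed
 also have "... = (\<Sum>d\<in>{1..N}. \<Sum>n\<in>{1..N}. if g d dvd n then f d (n div g d) else 0)" by (rule sum.swap)
 also have "... = (\<Sum>d\<in>{1..N}. \<Sum>e\<in>{1..N div g d}. f d e)"
 proof (rule sum.cong[OF refl])
  fix d assume "d \<in> {1..N}"
  then have gd: "g d > 0" using g[of d] by simp
  have "{n \<in> {1..N}. g d dvd n} = (*) (g d) ` {1..N div g d}"
  proof (intro equalityI subsetI)
   fix n assume n: "n \<in> {n \<in> {1..N}. g d dvd n}"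
   then obtain e where e: "n = g d * e" by (auto elim: dvdE)
   have "e \<ge> 1" using n e by (cases e) auto
   moreover have "e \<le> N div g d" using n e gd by (simp add: less_eq_div_iff_mult_less_eq mult.commute)
   ultimately show "n \<in> (*) (g d) ` {1..N div g d}" using e by auto
  next
   fix n assume "n \<in> (*) (g d) ` {1..N div g d}"
   then obtain e where e: "n = g d * e" "e \<in> {1..N div g d}" by blast
   then have e1: "e \<ge> 1" "e \<le> N div g d" by auto
   then have "g d * e \<le> N" using gd by (simp add: less_eq_div_iff_mult_less_eq mult.commute)
   then show "n \<in> {n \<in> {1..N}. g d dvd n}" using e(1) e1 gd by auto
  qed
  moreover have "(\<Sum>n\<in>{1..N}. if g d dvd n then f d (n div g d) else 0) = (\<Sum>n\<in>{n \<in> {1..N}. g d dvd n}. f d (n div g d))"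
   by (intro sum.inter_filter[symmetric]) simp
  moreover have "(\<Sum>n\<in>(*) (g d) ` {1..N div g d}. f d (n div g d)) = (\<Sum>e\<in>{1..N div g d}. f d e)"
   using gd by (subst sum.reindex) (auto intro!: inj_onI)
  ultimately show "(\<Sum>n\<in>{1..N}. if g d dvd n then f d (n div g d) else 0) = (\<Sum>e\<in>{1..N div g d}. f d e)" by simp
 qed
 finally show ?thesis .
qed

section \<open>Partial sums over the Moebius function and over square-free numbers\<close>

lemma real_div_bounds: "real (N div d) \<le> real N / real d" "real N / real d < real (N div d) + 1"
 using floor_divide_of_nat_eq[of N d, where 'a = real] by linarith+

lemma zeta2_tail:
 assumes "k \<ge> 1"
 shows "(\<Sum>e\<in>{1..k}. 1 / (real e)^2) \<le> pi^2 / 6" "pi^2 / 6 \<le> (\<Sum>e\<in>{1..k}. 1 / (real e)^2) + 1 / real k"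
proof -
 have eq: "(\<Sum>n<m. 1 / (real n + 1)^2) = (\<Sum>e\<in>{1..m}. 1 / (real e)^2)" for m
  by (induction m) (simp_all add: add_ac)
 have lim: "(\<lambda>m. \<Sum>e\<in>{1..m}. 1 / (real e)^2) \<longlonglongrightarrow> pi\<^sup>2 / 6"
 proof -
  have "(\<lambda>m. \<Sum>n<m. 1 / (real n + 1)^2) \<longlonglongrightarrow> pi\<^sup>2 / 6"
   using inverse_squares_sums unfolding sums_def by (simp add: add.commute)
  then show ?thesis unfolding eq .
 qed
 have mono: "(\<Sum>e\<in>{1..k}. 1 / (real e)^2) \<le> (\<Sum>e\<in>{1..m}. 1 / (real e)^2)" if "k \<le> m" for k m :: nat
  using that by (intro sum_mono2) auto
 show "(\<Sum>e\<in>{1..k}. 1 / (real e)^2) \<le> pi^2 / 6"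
  by (rule LIMSEQ_le_const[OF lim]) (use mono in blast)
 have ub: "(\<Sum>e\<in>{1..m}. 1 / (real e)^2) \<le> (\<Sum>e\<in>{1..k}. 1 / (real e)^2) + (1 / real k - 1 / real m)" if "k \<le> m" for m
  using that
 proof (induction m rule: dec_induct)
  case (step m)
  have "1 / (real m + 1)^2 \<le> 1 / (real m * (real m + 1))"
   using step assms by (intro divide_left_mono) (auto simp: power2_eq_square intro!: mult_right_mono)
  also have "... = 1 / real m - 1 / (real m + 1)" using step assms by (simp add: field_simps)
  finally show ?case using step by (simp add: add_ac)
 qed simp
 show "pi^2 / 6 \<le> (\<Sum>e\<in>{1..k}. 1 / (real e)^2) + 1 / real k"
 proof (rule LIMSEQ_le_const2[OF lim], intro exI[of _ k] allI impI)
  fix m assume "k \<le> m"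
  then show "(\<Sum>e\<in>{1..m}. 1 / (real e)^2) \<le> (\<Sum>e\<in>{1..k}. 1 / (real e)^2) + 1 / real k"
   using ub[of m] divide_nonneg_nonneg[of 1 "real m"] by linarith
 qed
qed

text \<open>A finite form of the identity between the series of mu(d) / d^2 and 1 / \<zeta>(2):
  mu(d) / d^2 times the zeta sum truncated at N / d adds up to exactly 1. Completing each truncated
  sum to pi^2 / 6 costs at most 2 d / N, and these errors sum to a logarithm over N.\<close>

lemma sum_mu_squares:
 assumes N: "N \<ge> 1"
 shows "\<bar>(\<Sum>d\<in>{1..N}. mu d / (real d)^2) - 6 / pi^2\<bar> \<le> 2 * (1 + ln (real N + 1)) / real N"
proof -
 define Z where "Z = (\<lambda>k. \<Sum>e\<in>{1..k}. 1 / (real e)^2)"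
 have "(\<Sum>n\<in>{1..N}. \<Sum>d | d dvd n. mu d / (real d)^2 * (1 / (real (n div d))^2)) = (\<Sum>d\<in>{1..N}. \<Sum>e\<in>{1..N div d}. mu d / (real d)^2 * (1 / (real e)^2))"
  using sum_divisor_swap[of "\<lambda>d. d" "\<lambda>d e. mu d / (real d)^2 * (1 / (real e)^2)" N] by simp
 also have "(\<Sum>n\<in>{1..N}. \<Sum>d | d dvd n. mu d / (real d)^2 * (1 / (real (n div d))^2)) = (\<Sum>n\<in>{1..N}. 1 / (real n)^2 * (\<Sum>d | d dvd n. mu d))"
 proof (intro sum.cong refl)
  fix n assume n: "n \<in> {1..N}"
  have "mu d / (real d)^2 * (1 / (real (n div d))^2) = 1 / (real n)^2 * mu d" if "d dvd n" for d
  proof -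
   have "real n = real d * real (n div d)" using that by (simp flip: of_nat_mult)
   then show ?thesis by (simp add: power_mult_distrib)
  qed
  then show "(\<Sum>d | d dvd n. mu d / (real d)^2 * (1 / (real (n div d))^2)) = 1 / (real n)^2 * (\<Sum>d | d dvd n. mu d)"
   unfolding sum_distrib_left by (intro sum.cong) auto
 qed
 also have "... = (\<Sum>n\<in>{1..N}. if n = 1 then 1 else 0)" by (intro sum.cong) (auto simp: sum_mu_divisors)
 also have "... = 1" using N by simp
 finally have one: "(\<Sum>d\<in>{1..N}. mu d / (real d)^2 * Z (N div d)) = 1" by (simp add: Z_def sum_distrib_left)
 have "\<bar>pi^2 / 6 * (\<Sum>d\<in>{1..N}. mu d / (real d)^2) - 1\<bar> = \<bar>\<Sum>d\<in>{1..N}. mu d / (real d)^2 * (pi^2 / 6 - Z (N div d))\<bar>"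
  using one by (simp add: right_diff_distrib sum_subtractf sum_distrib_left mult.commute)
 also have "... \<le> (\<Sum>d\<in>{1..N}. 2 / real N * (1 / real d))"
 proof (rule order.trans[OF sum_abs sum_mono])
  fix d assume d: "d \<in> {1..N}"
  \<comment> \<open>The tail is at most 1 / (N div d), and the integer quotient is at least half of
    N / d because it is not 0.\<close>
  have gen: "1 / k \<le> 2 / a" if "a \<le> 2 * k" "a > 0" "k > 0" for a k :: real using that by (simp add: field_simps)
  have k: "N div d \<ge> 1" using d by (simp add: Suc_le_eq div_greater_zero_iff)
  have "real N / real d \<le> 2 * real (N div d)"
   using real_div_bounds(2)[of N d] k by linarith
  moreover have "real N / real d > 0" using d by simp
  ultimately have "1 / real (N div d) \<le> 2 / (real N / real d)" using k by (intro gen) auto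
  then have zt: "\<bar>pi^2 / 6 - Z (N div d)\<bar> \<le> 2 * real d / real N"
   using zeta2_tail[OF k] by (simp add: Z_def)
  have "\<bar>mu d / (real d)^2 * (pi^2 / 6 - Z (N div d))\<bar> \<le> (1 / (real d)^2) * (2 * real d / real N)"
   unfolding abs_mult using zt abs_mu_le[of d] by (intro mult_mono) (auto simp: abs_divide divide_right_mono)
  also have "... = 2 / real N * (1 / real d)" using d by (simp add: power2_eq_square)
  finally show "\<bar>mu d / (real d)^2 * (pi^2 / 6 - Z (N div d))\<bar> \<le> 2 / real N * (1 / real d)" .
 qed
 also have "... \<le> 2 / real N * (1 + ln (real N + 1))"
  unfolding sum_distrib_left[symmetric] by (intro mult_left_mono sum_inverse_le) simp
 finally have *: "\<bar>pi^2 / 6 * (\<Sum>d\<in>{1..N}. mu d / (real d)^2) - 1\<bar> \<le> 2 * (1 + ln (real N + 1)) / real N" by simp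
 have "3^2 \<le> pi^2" using pi_gt3 by (intro power_mono) auto
 then have p6: "6 / pi^2 \<le> 1" "6 / pi^2 > 0" by auto
 have gen: "\<bar>M - 6 / p\<bar> = 6 / p * \<bar>p / 6 * M - 1\<bar>" if "p > 0" for M p :: real
 proof -
  have eq: "M - 6 / p = 6 / p * (p / 6 * M - 1)" using that by (simp add: field_simps)
  show ?thesis unfolding eq by (simp only: abs_mult) (use that in simp)
 qed
 have "\<bar>(\<Sum>d\<in>{1..N}. mu d / (real d)^2) - 6 / pi^2\<bar> = 6 / pi^2 * \<bar>pi^2 / 6 * (\<Sum>d\<in>{1..N}. mu d / (real d)^2) - 1\<bar>"
  by (rule gen) simp
 also have "... \<le> 1 * (2 * (1 + ln (real N + 1)) / real N)" using * p6 by (intro mult_mono) auto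
 finally show ?thesis by simp
qed

text \<open>Comparison with the integral of t powr (q - 1). Any real x with integer part k is
  allowed, so N / d^2 and sqrt (Y / s) can be inserted without rounding.\<close>

lemma sum_powr_bounds:
 fixes q x :: real
 assumes q: "0 < q" "q < 1" and x: "real k \<le> x" "x < real k + 1"
 shows "x powr q / q - 1 / q \<le> (\<Sum>t\<in>{1..k}. real t powr (q - 1))" "(\<Sum>t\<in>{1..k}. real t powr (q - 1)) \<le> x powr q / q"
proof -
 \<comment> \<open>The mean value theorem for t powr q; at t = 0 the first inequality reads 1 \<le>
   1 / q.\<close>
 have step: "(t + 1) powr (q - 1) \<le> ((t + 1) powr q - t powr q) / q" "t > 0 ==> ((t + 1) powr q - t powr q) / q \<le> t powr (q - 1)" if "t \<ge> 0" for t :: real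
 proof -
  have "\<exists>z. t < z \<and> z < t + 1 \<and> (t + 1) powr q - t powr q = q * z powr (q - 1)" if t: "t > 0" for t
  proof -
   have "\<exists>z. t < z \<and> z < t + 1 \<and> (t + 1) powr q - t powr q = (t + 1 - t) * (q * z powr (q - 1))"
    using t by (intro MVT2) (auto intro!: has_real_derivative_powr)
   then show ?thesis by simp
  qed
  note mvt = this
  show "((t + 1) powr q - t powr q) / q \<le> t powr (q - 1)" if tp: "t > 0"
  proof -
   obtain z where z: "t < z" "(t + 1) powr q - t powr q = q * z powr (q - 1)" using mvt[OF tp] by blast
   then show ?thesis using q tp by (simp add: powr_mono2')
  qed
  show "(t + 1) powr (q - 1) \<le> ((t + 1) powr q - t powr q) / q"
  proof (cases "t > 0")
   case True
   obtain z where z: "t < z" "z < t + 1" "(t + 1) powr q - t powr q = q * z powr (q - 1)" using mvt[OF True] by blast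
   then show ?thesis using q True by (simp add: powr_mono2')
  next
   case False
   then have "t = 0" using \<open>t \<ge> 0\<close> by simp
   then show ?thesis using q by simp
  qed
 qed
 have up: "(\<Sum>t\<in>{1..k}. real t powr (q - 1)) \<le> real k powr q / q" for k
 proof (induction k)
  case (Suc k)
  then show ?case using step(1)[of "real k"] by (simp add: add_ac diff_divide_distrib)
 qed (use q in simp)
 have low: "(real k + 1) powr q / q - 1 / q \<le> (\<Sum>t\<in>{1..k}. real t powr (q - 1))" for k
 proof (induction k)
  case (Suc k)
  then show ?case using step(2)[of "real k + 1"] by (simp add: add_ac diff_divide_distrib)
 qed (use q in simp)
 have "x powr q / q \<le> (real k + 1) powr q / q" using x q by (intro divide_right_mono powr_mono2) auto
 then show "x powr q / q - 1 / q \<le> (\<Sum>t\<in>{1..k}. real t powr (q - 1))" using low[of k] by linarith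
 have "real k powr q / q \<le> x powr q / q" using x q by (intro divide_right_mono powr_mono2) auto
 then show "(\<Sum>t\<in>{1..k}. real t powr (q - 1)) \<le> x powr q / q" using up[of k] by linarith
qed

text \<open>The Moebius expansion leads to mu(d) / d times the sum of e powr (- 1/2) up to N / d^2,
  which is 2 sqrt N / d + O(1). The main part is 2 sqrt N times the partial sum of mu(d) / d^2, and
  the errors 1 / d give the logarithm.\<close>

lemma sum_squarefree_inverse_sqrt:
 assumes N: "N \<ge> 1"
 shows "\<bar>(\<Sum>s\<in>{1..N}. of_bool (squarefree s) * real s powr (- 1/2)) - 12 / pi^2 * sqrt (real N)\<bar> \<le> 10 * (1 + ln (real N + 1))"
proof -
 define P where "P = (\<lambda>k :: nat. \<Sum>t\<in>{1..k}. real t powr (- 1/2))"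
 have P: "2 * sqrt x - 2 \<le> P k" "P k \<le> 2 * sqrt x" if "real k \<le> x" "x < real k + 1" for k x
 proof -
  have "x \<ge> 0" using that by linarith
  then show "2 * sqrt x - 2 \<le> P k" "P k \<le> 2 * sqrt x"
   using sum_powr_bounds[of "1/2", OF _ _ that] by (simp_all add: P_def powr_half_sqrt mult.commute)
 qed
 \<comment> \<open>For d > sqrt N the inner sum is empty, so d stops at D.\<close>
 define D where "D = nat \<lfloor>sqrt (real N)\<rfloor>"
 have D: "real D \<le> sqrt (real N)" "sqrt (real N) < real D + 1" by (auto simp: D_def)
 have sN: "1 \<le> sqrt (real N)" using N by simp
 then have D1: "D \<ge> 1" using D by linarith
 have "sqrt (real N) \<le> real N" using N by (simp add: real_le_lsqrt self_le_power)
 then have DN: "D \<le> N" using D by linarith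
 have "(\<Sum>s\<in>{1..N}. of_bool (squarefree s) * real s powr (- 1/2)) = (\<Sum>s\<in>{1..N}. \<Sum>d | d\<^sup>2 dvd s. mu d / real d * real (s div d^2) powr (- 1/2))"
 proof (intro sum.cong refl)
  fix s assume s: "s \<in> {1..N}"
  have "mu d * real s powr (- 1/2) = mu d / real d * real (s div d^2) powr (- 1/2)" if d: "d^2 dvd s" for d
  proof -
   have d0: "d > 0" using d s by (intro gr0I) auto
   have "real s = (real d)^2 * real (s div d^2)" using d by (simp flip: of_nat_mult of_nat_power)
   moreover have "((real d)^2) powr (- 1/2) = 1 / real d"
    using d0 by (simp add: powr_minus_divide powr_half_sqrt)
   ultimately show ?thesis by (simp add: powr_mult)
  qed
  then show "of_bool (squarefree s) * real s powr (- 1/2) = (\<Sum>d | d\<^sup>2 dvd s. mu d / real d * real (s div d^2) powr (- 1/2))"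
   using s squarefree_mu[of s] by (simp add: sum_distrib_right)
 qed
 also have "... = (\<Sum>d\<in>{1..N}. \<Sum>e\<in>{1..N div d^2}. mu d / real d * real e powr (- 1/2))"
  by (intro sum_divisor_swap[of "\<lambda>d. d\<^sup>2" "\<lambda>d e. mu d / real d * real e powr (- 1/2)"]) (auto simp: self_le_power)
 also have "... = (\<Sum>d\<in>{1..N}. mu d / real d * P (N div d^2))" by (simp add: P_def sum_distrib_left)
 also have "... = (\<Sum>d\<in>{1..D}. mu d / real d * P (N div d^2))"
 proof (rule sum.mono_neutral_right)
  show "\<forall>d\<in>{1..N} - {1..D}. mu d / real d * P (N div d^2) = 0"
  proof
   fix d assume "d \<in> {1..N} - {1..D}"
   then have "sqrt (real N) < real d" using D by auto
   then have "(sqrt (real N))^2 < (real d)\<^sup>2" by (intro power_strict_mono) auto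
   then have "real N < real (d^2)" by simp
   then have "N < d\<^sup>2" by linarith
   then show "mu d / real d * P (N div d^2) = 0" by (simp add: P_def)
  qed
 qed (use DN in auto)
 finally have F: "(\<Sum>s\<in>{1..N}. of_bool (squarefree s) * real s powr (- 1/2)) = (\<Sum>d\<in>{1..D}. mu d / real d * P (N div d^2))" .
 let ?L = "1 + ln (real D + 1)"
 have L0: "?L \<ge> 0" by (simp add: add_nonneg_nonneg)
 have "\<bar>(\<Sum>d\<in>{1..D}. mu d / real d * P (N div d^2)) - (\<Sum>d\<in>{1..D}. mu d / real d * (2 * (sqrt (real N) / real d)))\<bar> \<le> (\<Sum>d\<in>{1..D}. 2 * (1 / real d))"
  unfolding sum_subtractf[symmetric]
 proof (rule order.trans[OF sum_abs sum_mono])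
  fix d assume d: "d \<in> {1..D}"
  define k where "k = N div d^2"
  have k: "real k \<le> real N / (real d)^2" "real N / (real d)^2 < real k + 1"
   using real_div_bounds[of N "d^2"] by (simp_all add: k_def)
  have "sqrt (real N / (real d)^2) = sqrt (real N) / real d" by (simp add: real_sqrt_divide)
  then have "\<bar>P k - 2 * (sqrt (real N) / real d)\<bar> \<le> 2" using P[OF k] by (simp add: abs_le_iff)
  then have "\<bar>mu d / real d\<bar> * \<bar>P k - 2 * (sqrt (real N) / real d)\<bar> \<le> (1 / real d) * 2"
   using abs_mu_le[of d] by (intro mult_mono) (auto simp: abs_divide divide_right_mono)
  then show "\<bar>mu d / real d * P (N div d^2) - mu d / real d * (2 * (sqrt (real N) / real d))\<bar> \<le> 2 * (1 / real d)"
   unfolding right_diff_distrib[symmetric] abs_mult k_def by simp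
 qed
 also have "... \<le> 2 * ?L" unfolding sum_distrib_left[symmetric] by (intro mult_left_mono sum_inverse_le) simp
 finally have 1: "\<bar>(\<Sum>d\<in>{1..D}. mu d / real d * P (N div d^2)) - (\<Sum>d\<in>{1..D}. mu d / real d * (2 * (sqrt (real N) / real d)))\<bar> \<le> 2 * ?L" .
 have "(\<Sum>d\<in>{1..D}. mu d / real d * (2 * (sqrt (real N) / real d))) - 12 / pi^2 * sqrt (real N) = 2 * sqrt (real N) * ((\<Sum>d\<in>{1..D}. mu d / (real d)^2) - 6 / pi^2)"
  by (simp add: right_diff_distrib sum_distrib_left power2_eq_square mult_ac)
 then have "\<bar>(\<Sum>d\<in>{1..D}. mu d / real d * (2 * (sqrt (real N) / real d))) - 12 / pi^2 * sqrt (real N)\<bar> = 2 * sqrt (real N) * \<bar>(\<Sum>d\<in>{1..D}. mu d / (real d)^2) - 6 / pi^2\<bar>"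
  by (simp add: abs_mult)
 also have "... \<le> 2 * (2 * real D) * (2 * ?L / real D)"
  using D D1 by (intro mult_mono sum_mu_squares) auto
 also have "... = 8 * ?L" using D1 by simp
 finally have 2: "\<bar>(\<Sum>d\<in>{1..D}. mu d / real d * (2 * (sqrt (real N) / real d))) - 12 / pi^2 * sqrt (real N)\<bar> \<le> 8 * ?L" .
 have tri: "\<bar>a - c\<bar> \<le> 10 * l" if "\<bar>a - b\<bar> \<le> 2 * l" "\<bar>b - c\<bar> \<le> 8 * l" for a b c l :: real using that by linarith
 have "\<bar>(\<Sum>s\<in>{1..N}. of_bool (squarefree s) * real s powr (- 1/2)) - 12 / pi^2 * sqrt (real N)\<bar> \<le> 10 * ?L"
  unfolding F by (rule tri[OF 1 2])
 also have "... \<le> 10 * (1 + ln (real N + 1))" using DN by simp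
 finally show ?thesis .
qed

section \<open>Assembling the estimates\<close>

definition sqf_upto :: "real => nat set" where
 "sqf_upto S = {s \<in> {1..nat \<lfloor>S\<rfloor>}. squarefree s}"

definition roots_upto :: "real => nat => nat set" where
 "roots_upto Y s = {1..nat \<lfloor>sqrt (Y / real s)\<rfloor>}"

lemma finite_sqf_upto [simp]: "finite (sqf_upto S)" and finite_roots_upto [simp]: "finite (roots_upto Y s)"
 by (simp_all add: sqf_upto_def roots_upto_def)

lemma mem_sqf_upto: "S \<ge> 0 ==> s \<in> sqf_upto S \<longleftrightarrow> s \<ge> 1 \<and> real s \<le> S \<and> squarefree s"
 by (auto simp: sqf_upto_def le_nat_iff le_floor_iff)

lemma mem_roots_upto:
 assumes "s \<ge> 1" "Y \<ge> 0"
 shows "m \<in> roots_upto Y s \<longleftrightarrow> m \<ge> 1 \<and> real s * (real m)^2 \<le> Y"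
proof -
 have "real m \<le> sqrt (Y / real s) \<longleftrightarrow> (real m)^2 \<le> Y / real s"
  using assms by (metis abs_of_nat real_le_rsqrt real_sqrt_le_iff real_sqrt_abs)
 also have "... \<longleftrightarrow> real s * (real m)^2 \<le> Y" using assms by (simp add: pos_le_divide_eq mult.commute)
 finally have "real m \<le> sqrt (Y / real s) \<longleftrightarrow> real s * (real m)^2 \<le> Y" .
 moreover have "m \<in> roots_upto Y s \<longleftrightarrow> m \<ge> 1 \<and> real m \<le> sqrt (Y / real s)"
  using assms by (auto simp: roots_upto_def le_nat_iff le_floor_iff)
 ultimately show ?thesis by simp
qed

text \<open>The fifth power covers three logarithms from each block and one from each of the two
  dyadic decompositions.\<close>

lemma ln_power5_le:
 fixes Y \<epsilon> :: real
 assumes "Y \<ge> 1" "\<epsilon> > 0"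
 shows "(1 + ln Y) ^ 5 \<le> (1 + 5 / \<epsilon>) ^ 5 * Y powr \<epsilon>"
proof -
 have "ln Y \<le> Y powr (\<epsilon> / 5) / (\<epsilon> / 5)" using assms by (intro ln_powr_bound) auto
 moreover have "1 \<le> Y powr (\<epsilon> / 5)" using assms by (intro ge_one_powr_ge_zero) auto
 ultimately have "1 + ln Y \<le> (1 + 5 / \<epsilon>) * Y powr (\<epsilon> / 5)" by (simp add: distrib_right mult.commute)
 then have "(1 + ln Y) ^ 5 \<le> ((1 + 5 / \<epsilon>) * Y powr (\<epsilon> / 5)) ^ 5" using assms by (intro power_mono) auto
 also have "... = (1 + 5 / \<epsilon>) ^ 5 * Y powr \<epsilon>" using assms by (simp add: power_mult_distrib powr_power)
 finally show ?thesis .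
qed

text \<open>Both variables are cut dyadically, and a block is nonempty only if its corner satisfies
  S1 \<le> S and S1 M^2 \<le> Y. Written in S1 and K1 = S1 M^2, the block bound contains only
  positive powers of both, so it is largest at S1 = S and K1 = Y.\<close>

lemma psi_total:
 fixes \<gamma> \<epsilon> :: real
 assumes \<gamma>: "1/2 < \<gamma>" "\<gamma> < 1" and \<epsilon>: "\<epsilon> > 0"
 shows "\<exists>C\<ge>0. \<forall>Y S \<nu>. 1 \<le> S --> S \<le> Y --> \<nu> = 0 \<or> \<nu> = 1 -->
  \<bar>\<Sum>s\<in>sqf_upto S. \<Sum>m\<in>roots_upto Y s. psi (- ((real s * (real m)^2 + \<nu>) powr \<gamma>))\<bar>
   \<le> C * Y powr (2 * \<epsilon>) * (S powr (1/5) * Y powr ((2 + \<gamma>) / 5) + S powr (5/8) * Y powr (3/8))"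
proof -
 obtain C0 where C0: "C0 \<ge> 0" and blk: "\<And>J M Y U n \<nu>. M \<ge> 1 ==> \<nu> = 0 \<or> \<nu> = 1 ==> 2 ^ J \<le> Y ==> real M \<le> Y ==> (\<forall>m. n m \<le> 2 * 2 ^ J) ==>
  \<bar>\<Sum>m\<in>{M..<2 * M}. \<Sum>s\<in>{2 ^ J..<n m} \<inter> U. psi (- ((real s * (real m)^2 + \<nu>) powr \<gamma>))\<bar>
   \<le> C0 * (1 + ln Y) ^ 3 * (2 ^ J) powr \<epsilon> *
    ((2 ^ J) powr (3/5) * real M powr (4/5) * ((2 ^ J * (real M)^2) powr \<gamma>) powr (1/5) + 2 ^ J * real M powr (3/4))"
  using block_psi[OF assms] by blast
 define C where "C = 9 * C0 * (1 + 5 / \<epsilon>) ^ 5"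
 have "\<bar>\<Sum>s\<in>sqf_upto S. \<Sum>m\<in>roots_upto Y s. psi (- ((real s * (real m)^2 + \<nu>) powr \<gamma>))\<bar>
   \<le> C * Y powr (2 * \<epsilon>) * (S powr (1/5) * Y powr ((2 + \<gamma>) / 5) + S powr (5/8) * Y powr (3/8))"
  if S: "1 \<le> S" "S \<le> Y" and \<nu>: "\<nu> = 0 \<or> \<nu> = 1" for Y S \<nu>
 proof -
  define f where "f = (\<lambda>m s :: nat. psi (- ((real s * (real m)^2 + \<nu>) powr \<gamma>)))"
  define E where "E = S powr (1/5) * Y powr ((2 + \<gamma>) / 5) + S powr (5/8) * Y powr (3/8)"
  have E0: "E \<ge> 0" by (simp add: E_def)
  have Y: "Y \<ge> 1" using S by simp
  have lnY: "ln Y \<ge> 0" using Y by simp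
  obtain K :: nat where K: "Y + 1 \<le> 2 ^ K" "2 ^ K \<le> 2 * (Y + 1)" using exists_power2_between[of "Y + 1"] Y by auto
  have KL: "real K \<le> 3 * (1 + ln Y)"
  proof -
   have "real K \<le> 3 / 2 * ln (4 * Y)" using K Y by (intro exponent_le_ln) auto
   moreover have "ln (4 * Y) = 2 * ln 2 + ln Y" using Y ln_mult[of 4 Y] ln_realpow[of 2 2] by simp
   moreover have "ln 2 \<le> (1 :: real)" using ln_le_minus_one[of 2] by simp
   ultimately show ?thesis using lnY unfolding distrib_left by linarith
  qed
  define U where "U = {s. real s \<le> S \<and> squarefree s}"
  define h where "h = (\<lambda>m s. if s \<in> U \<and> real s * (real m)^2 \<le> Y then f m s else 0)"
  \<comment> \<open>For fixed m the condition s m^2 \<le> Y ends the range of s at the floor of Y /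
    m^2; the bound is exclusive, hence + 1.\<close>
  define n where "n = (\<lambda>J m :: nat. min (2 * 2 ^ J) (nat \<lfloor>Y / (real m)^2\<rfloor> + 1))"
  have lt: "s < 2 ^ K" if "real s \<le> Y" for s :: nat
  proof -
   have "real s < 2 ^ K" using that K by linarith
   then show ?thesis by simp
  qed
  have sq: "real m \<le> real s * (real m)^2" if "s \<ge> 1" for s m :: nat
  proof -
   have "m * 1 \<le> m * (s * m)" using that by (cases "m = 0") auto
   then have "real (m * 1) \<le> real (m * (s * m))" by (rule of_nat_mono)
   then show ?thesis by (simp add: power2_eq_square mult_ac)
  qed
  have "(\<Sum>s\<in>sqf_upto S. \<Sum>m\<in>roots_upto Y s. f m s) = (\<Sum>s\<in>sqf_upto S. \<Sum>m\<in>{1..<2 ^ K}. h m s)"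
  proof (rule sum.cong[OF refl])
   fix s assume s: "s \<in> sqf_upto S"
   then have s1: "s \<ge> 1" "s \<in> U" using S by (auto simp: mem_sqf_upto U_def)
   have mem: "m \<in> roots_upto Y s \<longleftrightarrow> m \<ge> 1 \<and> real s * (real m)^2 \<le> Y" for m
    using s1 Y by (intro mem_roots_upto) auto
   show "(\<Sum>m\<in>roots_upto Y s. f m s) = (\<Sum>m\<in>{1..<2 ^ K}. h m s)"
   proof (rule sum.mono_neutral_cong_left)
    show "roots_upto Y s \<subseteq> {1..<2 ^ K}"
     using mem lt order.trans[OF sq[OF s1(1)]] by auto
   qed (use mem s1 in \<open>auto simp: h_def\<close>)
  qed
  also have "... = (\<Sum>s\<in>{1..<2 ^ K}. \<Sum>m\<in>{1..<2 ^ K}. h m s)"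
  proof (rule sum.mono_neutral_left)
   show "sqf_upto S \<subseteq> {1..<2 ^ K}" using S lt by (auto simp: mem_sqf_upto)
   show "\<forall>s\<in>{1..<2 ^ K} - sqf_upto S. (\<Sum>m\<in>{1..<2 ^ K}. h m s) = 0"
    using S by (auto simp: mem_sqf_upto h_def U_def)
  qed simp
  also have "... = (\<Sum>m\<in>{1..<2 ^ K}. \<Sum>s\<in>{1..<2 ^ K}. h m s)" by (rule sum.swap)
  also have "... = (\<Sum>j<K. \<Sum>m\<in>{2 ^ j..<2 * 2 ^ j}. \<Sum>J<K. \<Sum>s\<in>{2 ^ J..<2 * 2 ^ J}. h m s)"
   by (simp only: sum_dyadic_split)
  also have "... = (\<Sum>j<K. \<Sum>J<K. \<Sum>m\<in>{2 ^ j..<2 * 2 ^ j}. \<Sum>s\<in>{2 ^ J..<2 * 2 ^ J}. h m s)"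
   by (intro sum.cong[OF refl] sum.swap)
  finally have split: "(\<Sum>s\<in>sqf_upto S. \<Sum>m\<in>roots_upto Y s. f m s) = ..." .
  define B where "B = C0 * (1 + ln Y) ^ 3 * Y powr \<epsilon> * E"
  have B0: "B \<ge> 0" using C0 lnY E0 by (simp add: B_def)
  have block: "\<bar>\<Sum>m\<in>{2 ^ j..<2 * 2 ^ j}. \<Sum>s\<in>{2 ^ J..<2 * 2 ^ J}. h m s\<bar> \<le> B" for j J :: nat
  proof (cases "2 ^ J \<le> S \<and> 2 ^ J * 4 ^ j \<le> Y")
   case False
   have "h m s = 0" if "m \<in> {2 ^ j..<2 * 2 ^ j}" "s \<in> {2 ^ J..<2 * 2 ^ J}" for m s
   proof -
    have s: "(2 :: real) ^ J \<le> real s" and m: "(2 :: real) ^ j \<le> real m" using that by auto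
    have "(2 ^ J) * (2 ^ j)^2 \<le> real s * (real m)^2" using s m by (intro mult_mono power_mono) auto
    moreover have "((2 :: real) ^ j)^2 = 4 ^ j" by (simp add: power2_eq_square flip: power_mult_distrib)
    ultimately have "2 ^ J * 4 ^ j \<le> real s * (real m)^2" by simp
    then have "\<not> (real s \<le> S \<and> real s * (real m)^2 \<le> Y)" using False s by (meson order.trans)
    then show ?thesis by (auto simp: h_def U_def)
   qed
   then have "(\<Sum>m\<in>{2 ^ j..<2 * 2 ^ j}. \<Sum>s\<in>{2 ^ J..<2 * 2 ^ J}. h m s) = 0" by simp
   then show ?thesis using B0 by simp
  next
   case True
   define S1 where "S1 = (2 :: real) ^ J"
   define M where "M = (2 :: nat) ^ j"
   have M: "M \<ge> 1" "real M = 2 ^ j" by (simp_all add: M_def)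
   have MM: "(real M)^2 = 4 ^ j" by (simp add: M power2_eq_square flip: power_mult_distrib)
   define K1 where "K1 = S1 * (real M)^2"
   have K1: "S1 \<le> S" "K1 \<le> Y" using True by (simp_all add: S1_def K1_def MM)
   have S1: "S1 \<ge> 1" by (simp add: S1_def)
   have pos: "S1 > 0" "real M > 0" "K1 > 0" using S1 M by (auto simp: K1_def)
   have "(\<Sum>m\<in>{2 ^ j..<2 * 2 ^ j}. \<Sum>s\<in>{2 ^ J..<2 * 2 ^ J}. h m s) = (\<Sum>m\<in>{M..<2 * M}. \<Sum>s\<in>{2 ^ J..<n J m} \<inter> U. f m s)"
    unfolding M_def[symmetric]
   proof (rule sum.cong[OF refl])
    fix m assume m: "m \<in> {M..<2 * M}"
    then have m0: "real m > 0" using M by auto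
    have iff: "real s * (real m)^2 \<le> Y \<longleftrightarrow> s < nat \<lfloor>Y / (real m)^2\<rfloor> + 1" for s :: nat
    proof -
     have "real s * (real m)^2 \<le> Y \<longleftrightarrow> real s \<le> Y / (real m)^2" using m0 by (simp add: pos_le_divide_eq)
     also have "... \<longleftrightarrow> int s \<le> \<lfloor>Y / (real m)^2\<rfloor>" by (simp add: le_floor_iff)
     also have "... \<longleftrightarrow> s < nat \<lfloor>Y / (real m)^2\<rfloor> + 1"
     proof -
      have "0 \<le> \<lfloor>Y / (real m)^2\<rfloor>" using Y by simp
      then show ?thesis by linarith
     qed
     finally show ?thesis .
    qed
    show "(\<Sum>s\<in>{2 ^ J..<2 * 2 ^ J}. h m s) = (\<Sum>s\<in>{2 ^ J..<n J m} \<inter> U. f m s)"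
     unfolding h_def iff by (rule sum.mono_neutral_cong_right) (auto simp: n_def)
   qed
   also have "\<bar>...\<bar> \<le> C0 * (1 + ln Y) ^ 3 * (2 ^ J) powr \<epsilon> *
    ((2 ^ J) powr (3/5) * real M powr (4/5) * ((2 ^ J * (real M)^2) powr \<gamma>) powr (1/5) + 2 ^ J * real M powr (3/4))"
    unfolding f_def
   proof (rule blk)
    show "2 ^ J \<le> Y" using True S by linarith
    have "real M \<le> (real M)^2" using M by (intro self_le_power) auto
    also have "... \<le> K1" using S1 mult_right_mono[of 1 S1 "(real M)^2"] by (simp add: K1_def)
    finally show "real M \<le> Y" using K1 by linarith
    show "\<forall>m. n J m \<le> 2 * 2 ^ J" by (simp add: n_def)
   qed (use M \<nu> in auto)
   also have "... \<le> C0 * (1 + ln Y) ^ 3 * Y powr \<epsilon> * E"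
   proof (rule mult_mono)
    show "C0 * (1 + ln Y) ^ 3 * (2 ^ J) powr \<epsilon> \<le> C0 * (1 + ln Y) ^ 3 * Y powr \<epsilon>"
     using C0 lnY True S \<epsilon> by (intro mult_left_mono powr_mono2) auto
    \<comment> \<open>Eliminates M in favour of K1 and S1.\<close>
    have M_eq: "real M powr (2 * q) = K1 powr q * S1 powr (- q)" for q
    proof -
     have "K1 powr q = S1 powr q * real M powr (2 * q)"
      using pos by (simp add: K1_def powr_mult powr_powr flip: powr_numeral)
     then show ?thesis using pos by (simp add: powr_minus_divide)
    qed
    have "S1 powr (3/5) * real M powr (4/5) * (K1 powr \<gamma>) powr (1/5) = (S1 powr (3/5) * S1 powr (- (2/5))) * (K1 powr (2/5) * K1 powr (\<gamma> * (1/5)))"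
     using M_eq[of "2/5"] by (simp add: powr_powr mult_ac)
    also have "... = S1 powr (1/5) * K1 powr ((2 + \<gamma>) / 5)" by (simp add: add_divide_distrib flip: powr_add)
    also have "... \<le> S powr (1/5) * Y powr ((2 + \<gamma>) / 5)"
     using K1 pos \<gamma> by (intro mult_mono powr_mono2) auto
    finally have e1: "S1 powr (3/5) * real M powr (4/5) * (K1 powr \<gamma>) powr (1/5) \<le> S powr (1/5) * Y powr ((2 + \<gamma>) / 5)" .
    have "S1 * real M powr (3/4) = (S1 powr 1 * S1 powr (- (3/8))) * K1 powr (3/8)"
     using M_eq[of "3/8"] pos by (simp add: mult_ac)
    also have "... = S1 powr (5/8) * K1 powr (3/8)" unfolding powr_add[symmetric] by simp
    also have "... \<le> S powr (5/8) * Y powr (3/8)" using K1 pos by (intro mult_mono powr_mono2) auto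
    finally have e2: "S1 * real M powr (3/4) \<le> S powr (5/8) * Y powr (3/8)" .
    show "(2 ^ J) powr (3/5) * real M powr (4/5) * ((2 ^ J * (real M)^2) powr \<gamma>) powr (1/5) + 2 ^ J * real M powr (3/4) \<le> E"
     using add_mono[OF e1 e2] unfolding E_def S1_def K1_def .
   qed (use C0 lnY in \<open>auto intro!: add_nonneg_nonneg\<close>)
   finally show ?thesis by (simp add: B_def)
  qed
  have "\<bar>\<Sum>s\<in>sqf_upto S. \<Sum>m\<in>roots_upto Y s. f m s\<bar> \<le> (\<Sum>j<K. \<Sum>J<K. B)"
   unfolding split by (rule order.trans[OF sum_abs sum_mono], rule order.trans[OF sum_abs sum_mono], rule block)
  also have "... = real K * real K * B" by simp
  also have "... \<le> (3 * (1 + ln Y)) * (3 * (1 + ln Y)) * B"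
   using KL lnY B0 by (intro mult_right_mono mult_mono) auto
  also have "... = 9 * C0 * (1 + ln Y) ^ 5 * Y powr \<epsilon> * E"
  proof -
   have "(3 * L) * (3 * L) * (C0 * L ^ 3 * p * E) = 9 * C0 * L ^ 5 * p * E" for L p :: real
    by algebra
   then show ?thesis unfolding B_def .
  qed
  also have "... \<le> 9 * C0 * ((1 + 5 / \<epsilon>) ^ 5 * Y powr \<epsilon>) * Y powr \<epsilon> * E"
   using ln_power5_le[OF Y \<epsilon>] C0 E0 by (intro mult_right_mono mult_left_mono) auto
  also have "... = C * Y powr (2 * \<epsilon>) * E"
  proof -
   have "Y powr (2 * \<epsilon>) = Y powr \<epsilon> * Y powr \<epsilon>" unfolding powr_add[symmetric] by simp
   then show ?thesis by (simp only: C_def mult_ac)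
  qed
  finally show ?thesis by (simp add: f_def E_def)
 qed
 moreover have "C \<ge> 0" using C0 \<epsilon> by (simp add: C_def)
 ultimately show ?thesis by blast
qed

lemma squarefree_partial_sum:
 assumes S: "S \<ge> 1"
 shows "\<bar>(\<Sum>s\<in>sqf_upto S. real s powr (- 1/2)) - 12 / pi^2 * sqrt S\<bar> \<le> 12 * (1 + ln (S + 1))"
proof -
 define N where "N = nat \<lfloor>S\<rfloor>"
 have N: "N \<ge> 1" "real N \<le> S" "S < real N + 1" using S by (auto simp: N_def le_nat_iff of_nat_nat)
 have F: "(\<Sum>s\<in>sqf_upto S. real s powr (- 1/2)) = (\<Sum>s\<in>{1..N}. of_bool (squarefree s) * real s powr (- 1/2))"
  unfolding sqf_upto_def N_def by (rule sum.mono_neutral_cong_left) auto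
 have r: "sqrt (real N) \<le> sqrt S" "sqrt S \<le> sqrt (real N) + 1"
 proof -
  show "sqrt (real N) \<le> sqrt S" using N by simp
  have "(sqrt (real N) + 1)^2 = real N + 1 + 2 * sqrt (real N)" by (simp add: power2_sum)
  moreover have "0 \<le> sqrt (real N)" by simp
  ultimately have "S \<le> (sqrt (real N) + 1)^2" using N by linarith
  then show "sqrt S \<le> sqrt (real N) + 1" by (intro real_le_lsqrt) auto
 qed
 have "3^2 \<le> pi^2" using pi_gt3 by (intro power_mono) auto
 then have p: "12 / pi^2 \<le> 2" "12 / pi^2 \<ge> 0" by (simp_all add: divide_le_eq)
 have "12 / pi^2 * (sqrt S - sqrt (real N)) \<le> 2 * 1" using p r by (intro mult_mono) auto
 moreover have "12 / pi^2 * (sqrt S - sqrt (real N)) \<ge> 0" using p r by (intro mult_nonneg_nonneg) auto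
 ultimately have d: "\<bar>12 / pi^2 * sqrt (real N) - 12 / pi^2 * sqrt S\<bar> \<le> 2" unfolding right_diff_distrib by linarith
 have l: "10 * (1 + ln (real N + 1)) \<le> 10 * (1 + ln (S + 1))" "0 \<le> ln (S + 1)" using N S by auto
 have tri: "\<bar>a - e\<bar> \<le> 12 * (1 + z)" if "\<bar>a - b\<bar> \<le> w" "\<bar>b - e\<bar> \<le> 2" "w \<le> 10 * (1 + z)" "0 \<le> z" for a b e w z :: real using that unfolding distrib_left by linarith
 show ?thesis unfolding F by (rule tri[OF sum_squarefree_inverse_sqrt[OF N(1)] d l])
qed

text \<open>To first order the difference at k = s m^2 is \<gamma> s powr (\<gamma> - 1) m powr (2
  \<gamma> - 2). Summed over m up to sqrt (Y / s) it gives \<gamma> / (2 \<gamma> - 1) Y powr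
  (\<gamma> - 1/2) s powr (- 1/2), and the square-free sum over s contributes 12 / pi^2 sqrt
  S.\<close>

lemma main_total:
 fixes \<gamma> :: real
 assumes \<gamma>: "1/2 < \<gamma>" "\<gamma> < 1" and S: "1 \<le> S" "S \<le> Y"
 shows "\<bar>(\<Sum>s\<in>sqf_upto S. \<Sum>m\<in>roots_upto Y s. (real s * (real m)^2 + 1) powr \<gamma> - (real s * (real m)^2) powr \<gamma>)
   - 12 * \<gamma> / (pi^2 * (2 * \<gamma> - 1)) * S powr (1/2) * Y powr (\<gamma> - 1/2)\<bar>
  \<le> 2 * (1 + ln (S + 1)) + S / (2 * \<gamma> - 1) + \<gamma> / (2 * \<gamma> - 1) * Y powr (\<gamma> - 1/2) * (12 * (1 + ln (S + 1)))"
proof -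
 define q where "q = 2 * \<gamma> - 1"
 have q: "0 < q" "q < 1" using \<gamma> by (auto simp: q_def)
 have Y: "Y \<ge> 1" using S by simp
 define A where "A = \<gamma> / q * Y powr (\<gamma> - 1/2)"
 have A0: "A \<ge> 0" using \<gamma> q by (simp add: A_def)
 have inner: "\<bar>(\<Sum>m\<in>roots_upto Y s. (real s * (real m)^2 + 1) powr \<gamma> - (real s * (real m)^2) powr \<gamma>) - A * real s powr (- 1/2)\<bar> \<le> 2 * (1 / real s) + 1 / q"
  if s: "s \<in> sqf_upto S" for s
 proof -
  have s1: "s \<ge> 1" "real s \<le> S" using s S by (auto simp: mem_sqf_upto)
  then have s0: "real s > 0" by simp
  define k where "k = nat \<lfloor>sqrt (Y / real s)\<rfloor>"
  define x where "x = sqrt (Y / real s)"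
  have x0: "x > 0" using Y s0 by (simp add: x_def)
  have kx: "real k \<le> x" "x < real k + 1" using x0 unfolding k_def x_def[symmetric] by (auto simp: of_nat_nat)
  define P where "P = (\<Sum>m\<in>{1..k}. real m powr (q - 1))"
  have P: "x powr q / q - 1 / q \<le> P" "P \<le> x powr q / q" using sum_powr_bounds[OF q kx] by (simp_all add: P_def)
  have g1: "real s powr (\<gamma> - 1) \<le> 1" using s1 \<gamma> powr_mono[of "\<gamma> - 1" 0 "real s"] by simp
  have xq: "real s powr (\<gamma> - 1) * x powr q = Y powr (\<gamma> - 1/2) * real s powr (- 1/2)"
  proof -
   have "x powr q = (Y / real s) powr (\<gamma> - 1/2)"
    using Y s0 by (simp add: x_def q_def powr_powr diff_divide_distrib flip: powr_half_sqrt)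
   also have "... = Y powr (\<gamma> - 1/2) * real s powr (- (\<gamma> - 1/2))"
   proof -
    have "(Y / real s) powr (\<gamma> - 1/2) = Y powr (\<gamma> - 1/2) / real s powr (\<gamma> - 1/2)" using Y s0 by (simp add: powr_divide)
    then show ?thesis by (simp only: powr_minus divide_inverse)
   qed
   finally have "real s powr (\<gamma> - 1) * x powr q = Y powr (\<gamma> - 1/2) * (real s powr (\<gamma> - 1) * real s powr (- (\<gamma> - 1/2)))" by simp
   then show ?thesis by (simp flip: powr_add)
  qed
  define c where "c = \<gamma> * real s powr (\<gamma> - 1)"
  have c: "0 \<le> c" "c \<le> 1" using \<gamma> g1 mult_mono[of \<gamma> 1 "real s powr (\<gamma> - 1)" 1] by (auto simp: c_def)
  have "c * (x powr q / q) = \<gamma> / q * (real s powr (\<gamma> - 1) * x powr q)" by (simp add: c_def)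
  then have cA: "c * (x powr q / q) = A * real s powr (- 1/2)" unfolding xq A_def by (simp only: mult.assoc)
  have "c * (x powr q / q - 1 / q) \<le> c * P" "c * P \<le> c * (x powr q / q)" by (rule mult_left_mono[OF P(1) c(1)], rule mult_left_mono[OF P(2) c(1)])
  moreover have "c * (1 / q) \<le> 1 * (1 / q)" using c q by (intro mult_right_mono) auto
  ultimately have 1: "\<bar>c * P - A * real s powr (- 1/2)\<bar> \<le> 1 / q" unfolding right_diff_distrib cA by linarith
  have "\<bar>(\<Sum>m\<in>{1..k}. (real s * (real m)^2 + 1) powr \<gamma> - (real s * (real m)^2) powr \<gamma>) - c * P\<bar> \<le> (\<Sum>m\<in>{1..k}. 1 / real s * (1 / (real m)^2))"
   unfolding P_def sum_distrib_left sum_subtractf[symmetric]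
  proof (rule order.trans[OF sum_abs sum_mono])
   fix m assume m: "m \<in> {1..k}"
   define z where "z = real s * (real m)^2"
   have z: "z \<ge> 1" "z > 0" using m s1 mult_mono[of 1 "real s" 1 "(real m)^2"] by (auto simp: z_def one_le_power)
   have "c * real m powr (q - 1) = \<gamma> * z powr (\<gamma> - 1)"
   proof -
    have "z powr (\<gamma> - 1) = real s powr (\<gamma> - 1) * real m powr (2 * (\<gamma> - 1))"
     using m by (simp add: z_def powr_mult powr_powr flip: powr_numeral)
    moreover have "2 * (\<gamma> - 1) = q - 1" by (simp add: q_def)
    ultimately show ?thesis by (simp add: c_def)
   qed
   then have "\<bar>(z + 1) powr \<gamma> - z powr \<gamma> - c * real m powr (q - 1)\<bar> \<le> z powr (\<gamma> - 2)"
    using powr_Suc_diff[OF z(2), of \<gamma>] \<gamma> by (simp add: diff_diff_eq)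
   also have "... \<le> z powr (- 1)" using z \<gamma> by (intro powr_mono) auto
   also have "... = 1 / real s * (1 / (real m)^2)" using z by (simp add: powr_minus_divide z_def)
   finally show "\<bar>(real s * (real m)^2 + 1) powr \<gamma> - (real s * (real m)^2) powr \<gamma> - c * real m powr (q - 1)\<bar> \<le> 1 / real s * (1 / (real m)^2)"
    by (simp add: z_def)
  qed
  also have "... \<le> 1 / real s * 2" unfolding sum_distrib_left[symmetric] by (intro mult_left_mono sum_inverse_squares_le) simp
  finally have 2: "\<bar>(\<Sum>m\<in>{1..k}. (real s * (real m)^2 + 1) powr \<gamma> - (real s * (real m)^2) powr \<gamma>) - c * P\<bar> \<le> 2 * (1 / real s)" by simp
  have tri: "\<bar>a - b\<bar> \<le> u + v" if "\<bar>a - w\<bar> \<le> u" "\<bar>w - b\<bar> \<le> v" for a b w u v :: real using that by linarith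
  show ?thesis unfolding roots_upto_def k_def[symmetric] by (rule tri[OF 2 1])
 qed
 let ?F = "\<Sum>s\<in>sqf_upto S. real s powr (- 1/2)"
 have "\<bar>(\<Sum>s\<in>sqf_upto S. \<Sum>m\<in>roots_upto Y s. (real s * (real m)^2 + 1) powr \<gamma> - (real s * (real m)^2) powr \<gamma>) - A * ?F\<bar> \<le> (\<Sum>s\<in>sqf_upto S. 2 * (1 / real s) + 1 / q)"
  unfolding sum_distrib_left sum_subtractf[symmetric] by (rule order.trans[OF sum_abs sum_mono[OF inner]])
 also have "... \<le> (\<Sum>s\<in>{1..nat \<lfloor>S\<rfloor>}. 2 * (1 / real s) + 1 / q)"
  using q by (intro sum_mono2) (auto simp: sqf_upto_def)
 also have "... = 2 * (\<Sum>s\<in>{1..nat \<lfloor>S\<rfloor>}. 1 / real s) + real (nat \<lfloor>S\<rfloor>) * (1 / q)" by (simp add: sum.distrib sum_distrib_left)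
 also have "... \<le> 2 * (1 + ln (real (nat \<lfloor>S\<rfloor>) + 1)) + S * (1 / q)"
  using q S by (intro add_mono mult_left_mono mult_right_mono sum_inverse_le) auto
 also have "... \<le> 2 * (1 + ln (S + 1)) + S / q"
 proof -
  have "ln (r + 1) \<le> ln (S + 1)" if "0 \<le> r" "r \<le> S" for r using that by simp
  from this[of "real (nat \<lfloor>S\<rfloor>)"] have "ln (real (nat \<lfloor>S\<rfloor>) + 1) \<le> ln (S + 1)" using S by auto
  then show ?thesis by simp
 qed
 finally have 1: "\<bar>(\<Sum>s\<in>sqf_upto S. \<Sum>m\<in>roots_upto Y s. (real s * (real m)^2 + 1) powr \<gamma> - (real s * (real m)^2) powr \<gamma>) - A * ?F\<bar> \<le> 2 * (1 + ln (S + 1)) + S / q" .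
 have "A * ?F - 12 * \<gamma> / (pi^2 * q) * S powr (1/2) * Y powr (\<gamma> - 1/2) = A * (?F - 12 / pi^2 * sqrt S)"
  using S by (simp add: A_def right_diff_distrib powr_half_sqrt mult_ac)
 then have 2: "\<bar>A * ?F - 12 * \<gamma> / (pi^2 * q) * S powr (1/2) * Y powr (\<gamma> - 1/2)\<bar> \<le> A * (12 * (1 + ln (S + 1)))"
  using mult_left_mono[OF squarefree_partial_sum[OF S(1)] A0] A0 by (simp add: abs_mult)
 have tri: "\<bar>a - b\<bar> \<le> u + v" if "\<bar>a - w\<bar> \<le> u" "\<bar>w - b\<bar> \<le> v" for a b w u v :: real using that by linarith
 show ?thesis using tri[OF 1 2] by (simp add: A_def q_def)
qed

section \<open>From the counting function to the main term and the sawtooth sums\<close>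

lemma le_powr_iff:
 fixes c \<gamma> x y :: real
 assumes "c > 0" "\<gamma> = 1 / c" "x \<ge> 0" "y \<ge> 0"
 shows "x \<le> y powr c \<longleftrightarrow> x powr \<gamma> \<le> y"
proof
 assume "x \<le> y powr c"
 then have "x powr \<gamma> \<le> (y powr c) powr \<gamma>" using assms by (intro powr_mono2) auto
 also have "... = y" using assms by (simp add: powr_powr)
 finally show "x powr \<gamma> \<le> y" .
next
 assume "x powr \<gamma> \<le> y"
 then have "(x powr \<gamma>) powr c \<le> y powr c" using assms by (intro powr_mono2) auto
 moreover have "(x powr \<gamma>) powr c = x" using assms by (simp add: powr_powr)
 ultimately show "x \<le> y powr c" by simp
qed

text \<open>A half-open interval contains a difference of two ceilings many integers, and the
  ceiling of x is x + \<open>psi (- x)\<close> + 1/2; hence the minus signs inside the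
  sawtooth.\<close>

lemma card_floor_powr_eq:
 fixes c \<gamma> :: real
 assumes c: "c > 1" and \<gamma>: "\<gamma> = 1 / c" and k: "k \<ge> 1" "real k \<le> real N powr c"
 shows "real (card {n \<in> {1..N}. \<lfloor>real n powr c\<rfloor> = int k}) =
  ((real k + 1) powr \<gamma> - real k powr \<gamma>) + (psi (- ((real k + 1) powr \<gamma>)) - psi (- (real k powr \<gamma>)))"
proof -
 define a where "a = \<lceil>real k powr \<gamma>\<rceil>"
 define b where "b = \<lceil>(real k + 1) powr \<gamma>\<rceil>"
 have c0: "c > 0" using c by simp
 have iff: "\<lfloor>real n powr c\<rfloor> = int k \<longleftrightarrow> a \<le> int n \<and> int n < b" for n :: nat
 proof -
  have "\<lfloor>real n powr c\<rfloor> = int k \<longleftrightarrow> real k \<le> real n powr c \<and> \<not> (real k + 1 \<le> real n powr c)"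
   by (auto simp: floor_eq_iff not_le)
  also have "... \<longleftrightarrow> real k powr \<gamma> \<le> real n \<and> \<not> ((real k + 1) powr \<gamma> \<le> real n)"
   using le_powr_iff[OF c0 \<gamma>, of "real k" "real n"] le_powr_iff[OF c0 \<gamma>, of "real k + 1" "real n"] by simp
  also have "... \<longleftrightarrow> a \<le> int n \<and> int n < b"
   unfolding a_def b_def by (simp add: ceiling_le_iff not_le[symmetric])
  finally show ?thesis .
 qed
 have "1 \<le> real k powr \<gamma>" using k c \<gamma> by (intro ge_one_powr_ge_zero) auto
 then have a1: "a \<ge> 1" unfolding a_def by linarith
 have "real k powr \<gamma> \<le> (real k + 1) powr \<gamma>" using \<gamma> c by (intro powr_mono2) auto
 then have ab: "a \<le> b" unfolding a_def b_def by (rule ceiling_mono)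
 have set: "{n \<in> {1..N}. \<lfloor>real n powr c\<rfloor> = int k} = {nat a..<nat b}"
 proof (intro equalityI subsetI)
  fix n assume "n \<in> {n \<in> {1..N}. \<lfloor>real n powr c\<rfloor> = int k}"
  then have "a \<le> int n" "int n < b" by (auto simp: iff)
  then show "n \<in> {nat a..<nat b}" using a1 by auto
 next
  fix n assume "n \<in> {nat a..<nat b}"
  then have n: "a \<le> int n" "int n < b" using a1 by auto
  then have fl: "\<lfloor>real n powr c\<rfloor> = int k" by (simp add: iff)
  \<comment> \<open>n \<ge> N + 1 would give n powr c \<ge> (N + 1) powr c \<ge> N powr c + 1 \<ge>
    k + 1; the middle inequality uses c > 1.\<close>
  have "n \<le> N"
  proof (rule ccontr)
   assume "\<not> n \<le> N"
   then have nN: "real N + 1 \<le> real n" by linarith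
   have N0: "N \<ge> 1" using k c by (cases "N = 0") auto
   have "real N powr c + 1 \<le> real N powr c + real N powr (c - 1)"
    using N0 c by (intro add_left_mono ge_one_powr_ge_zero) auto
   also have "... = (real N + 1) * real N powr (c - 1)" using N0 powr_add[of "real N" 1 "c - 1"] by (simp add: distrib_right)
   also have "... \<le> (real N + 1) * (real N + 1) powr (c - 1)" using c by (intro mult_left_mono powr_mono2) auto
   also have "... = (real N + 1) powr c" using powr_add[of "real N + 1" 1 "c - 1"] by simp
   also have "... \<le> real n powr c" using nN c by (intro powr_mono2) auto
   also have "... < real k + 1" using fl by linarith
   finally show False using k by linarith
  qed
  then show "n \<in> {n \<in> {1..N}. \<lfloor>real n powr c\<rfloor> = int k}" using fl n a1 by auto
 qed
 have "real (card {n \<in> {1..N}. \<lfloor>real n powr c\<rfloor> = int k}) = real_of_int b - real_of_int a"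
  unfolding set using a1 ab by (simp add: of_nat_diff nat_mono)
 moreover have "real_of_int \<lceil>x\<rceil> = x + psi (- x) + 1 / 2" for x :: real by (simp add: psi_def frac_def ceiling_def)
 ultimately show ?thesis unfolding a_def b_def by simp
qed

text \<open>The n are sorted by m, which may be taken positive since n powr c \<ge> 1; different m
  give different values, so the classes are disjoint. The summand \<open>+ 0\<close> is kept so that
  both sawtooth terms fit \<open>psi_total\<close>, with \<nu> = 1 and \<nu> = 0.\<close>

lemma Q_eq_sum:
 fixes c \<gamma> :: real
 assumes c: "c > 1" and \<gamma>: "\<gamma> = 1 / c" and s: "s \<ge> 1"
 shows "real (Q c s N) = (\<Sum>m\<in>roots_upto (real N powr c) s.
  ((real s * (real m)^2 + 1) powr \<gamma> - (real s * (real m)^2) powr \<gamma>) +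
  (psi (- ((real s * (real m)^2 + 1) powr \<gamma>)) - psi (- ((real s * (real m)^2 + 0) powr \<gamma>))))"
proof -
 let ?C = "\<lambda>m. {n \<in> {1..N}. \<lfloor>real n powr c\<rfloor> = int (s * m^2)}"
 let ?M = "roots_upto (real N powr c) s"
 have mem: "m \<in> ?M \<longleftrightarrow> m \<ge> 1 \<and> real (s * m^2) \<le> real N powr c" for m
  using mem_roots_upto[OF s, of "real N powr c" m] by simp
 have "{n \<in> {1..N}. \<exists>m::int. \<lfloor>real n powr c\<rfloor> = int s * m ^ 2} = (\<Union>m\<in>?M. ?C m)"
 proof (intro equalityI subsetI)
  fix n assume "n \<in> {n \<in> {1..N}. \<exists>m::int. \<lfloor>real n powr c\<rfloor> = int s * m ^ 2}"
  then obtain m :: int where n: "n \<ge> 1" "n \<le> N" and m: "\<lfloor>real n powr c\<rfloor> = int s * m ^ 2" by auto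
  define m' where "m' = nat \<bar>m\<bar>"
  have m': "\<lfloor>real n powr c\<rfloor> = int (s * m'^2)" using m by (simp add: m'_def)
  have "1 \<le> real n powr c" using n c by (intro ge_one_powr_ge_zero) auto
  then have "1 \<le> \<lfloor>real n powr c\<rfloor>" by simp
  then have "m' \<ge> 1" using m' by (cases m') auto
  moreover have "real (s * m'^2) \<le> real n powr c" using m' by linarith
  moreover have "real n powr c \<le> real N powr c" using n c by (intro powr_mono2) auto
  ultimately have "m' \<in> ?M" unfolding mem by linarith
  then show "n \<in> (\<Union>m\<in>?M. ?C m)" using n m' by auto
 next
  fix n assume "n \<in> (\<Union>m\<in>?M. ?C m)"
  then obtain m where n: "n \<in> {1..N}" "\<lfloor>real n powr c\<rfloor> = int (s * m^2)" by blast
  then have "\<lfloor>real n powr c\<rfloor> = int s * (int m) ^ 2" by simp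
  then show "n \<in> {n \<in> {1..N}. \<exists>m::int. \<lfloor>real n powr c\<rfloor> = int s * m ^ 2}" using n by blast
 qed
 then have "Q c s N = card (\<Union>m\<in>?M. ?C m)" by (simp add: Q_def)
 also have "... = (\<Sum>m\<in>?M. card (?C m))"
 proof (rule card_UN_disjoint)
  have "m = m'" if "int (s * m^2) = int (s * m'^2)" for m m'
  proof -
   have "m^2 = m'^2" using that s by simp
   then show ?thesis by (simp add: power2_eq_iff_nonneg)
  qed
  then show "\<forall>i\<in>?M. \<forall>j\<in>?M. i \<noteq> j --> ?C i \<inter> ?C j = {}" by fastforce
 qed auto
 finally have "real (Q c s N) = (\<Sum>m\<in>?M. real (card (?C m)))" by simp
 also have "... = (\<Sum>m\<in>?M. ((real s * (real m)^2 + 1) powr \<gamma> - (real s * (real m)^2) powr \<gamma>) +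
  (psi (- ((real s * (real m)^2 + 1) powr \<gamma>)) - psi (- ((real s * (real m)^2 + 0) powr \<gamma>))))"
 proof (rule sum.cong[OF refl])
  fix m assume "m \<in> ?M"
  then have "s * m^2 \<ge> 1" "real (s * m^2) \<le> real N powr c" using s by (auto simp: mem Suc_le_eq)
  from card_floor_powr_eq[OF c \<gamma> this]
  show "real (card (?C m)) = ((real s * (real m)^2 + 1) powr \<gamma> - (real s * (real m)^2) powr \<gamma>) +
  (psi (- ((real s * (real m)^2 + 1) powr \<gamma>)) - psi (- ((real s * (real m)^2 + 0) powr \<gamma>)))" by simp
 qed
 finally show ?thesis .
qed

text \<open>The multiplicities of a prime in s and t have the same parity, and in a square-free
  number the multiplicity is 0 or 1, hence determined by its parity.\<close>

lemma squarefree_mult_square_unique: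
 fixes s t :: nat and m n :: int
 assumes "squarefree s" "squarefree t" "int s * m^2 = int t * n^2" "m \<noteq> 0" "n \<noteq> 0"
 shows "s = t"
proof -
 define m' where "m' = nat \<bar>m\<bar>"
 define n' where "n' = nat \<bar>n\<bar>"
 have pos: "s > 0" "t > 0" "m' > 0" "n' > 0" using assms by (auto simp: m'_def n'_def intro!: gr0I)
 have "int (s * m'^2) = int (t * n'^2)" using assms(3) by (simp add: m'_def n'_def)
 then have eq: "s * m'^2 = t * n'^2" by (simp only: of_nat_eq_iff)
 have "multiplicity p s = multiplicity p t" if p: "prime p" for p
 proof -
  have mult: "multiplicity p (a * b^2) = multiplicity p a + 2 * multiplicity p b" if "a > 0" "b > 0" for a b :: nat
   using that p by (simp add: prime_elem_multiplicity_mult_distrib prime_elem_multiplicity_power_distrib)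
  have le1: "multiplicity p a \<le> 1" if "squarefree a" for a :: nat
  proof (rule ccontr)
   assume "\<not> multiplicity p a \<le> 1"
   then have "p^2 dvd a" by (intro multiplicity_dvd') auto
   then have "is_unit p" using that by (rule squarefreeD[rotated])
   then show False using p by (auto dest: not_prime_unit)
  qed
  have "multiplicity p s + 2 * multiplicity p m' = multiplicity p t + 2 * multiplicity p n'"
   using mult[of s m'] mult[of t n'] pos eq by simp
  then show ?thesis using le1[OF assms(1)] le1[OF assms(2)] by presburger
 qed
 then show ?thesis using multiplicity_eq_nat[of s t] pos by blast
qed

text \<open>The square-free part of the floor of n powr c is unique, so each n is counted for at
  most one s.\<close>

lemma frakQ_le: "frakQ c S N \<le> N" if "c > 1"
proof (cases "finite {s. 0 < s \<and> real s \<le> S \<and> squarefree s}")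
 case False
 then show ?thesis by (simp add: frakQ_def)
next
 case True
 let ?T = "{s. 0 < s \<and> real s \<le> S \<and> squarefree s}"
 let ?A = "\<lambda>s. {n \<in> {1..N}. \<exists>m::int. \<lfloor>real n powr c\<rfloor> = int s * m ^ 2}"
 have "frakQ c S N = (\<Sum>s\<in>?T. card (?A s))" by (simp add: frakQ_def Q_def)
 also have "... = card (\<Union>s\<in>?T. ?A s)"
 proof (rule card_UN_disjoint[symmetric])
  have False if st: "s \<in> ?T" "t \<in> ?T" "s \<noteq> t" and n: "n \<in> ?A s" "n \<in> ?A t" for s t n
  proof -
   have "\<exists>m::int. \<lfloor>real n powr c\<rfloor> = int s * m ^ 2" "\<exists>m::int. \<lfloor>real n powr c\<rfloor> = int t * m ^ 2" using n by blast+
   then obtain m m' :: int where m: "\<lfloor>real n powr c\<rfloor> = int s * m ^ 2" "\<lfloor>real n powr c\<rfloor> = int t * m' ^ 2" by blast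
   have "1 \<le> real n powr c" using n \<open>c > 1\<close> by (intro ge_one_powr_ge_zero) auto
   then have "1 \<le> \<lfloor>real n powr c\<rfloor>" by simp
   then have "m \<noteq> 0" "m' \<noteq> 0" using m by auto
   then show False using squarefree_mult_square_unique[of s t m m'] st m by auto
  qed
  then show "\<forall>i\<in>?T. \<forall>j\<in>?T. i \<noteq> j --> ?A i \<inter> ?A j = {}" by blast
 qed (use True in auto)
 also have "... \<le> card {1..N}" by (intro card_mono) auto
 finally show ?thesis by simp
qed

text \<open>With Y = N powr c the errors of the main term fit into those of the sawtooth sums: S
  \<le> S powr (5/8) Y powr (3/8), and \<gamma> - 1/2 \<le> (2 + \<gamma>) / 5 for the other power;
  logarithms go into Y powr (2 \<delta>).\<close>

lemma frakQ_asymptotic: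
 fixes c \<gamma> \<delta> :: real
 assumes c: "1 < c" "c < 2" and \<gamma>: "\<gamma> = 1 / c" and \<delta>: "\<delta> > 0"
 shows "\<exists>C\<ge>0. \<forall>(N::nat) (S::real) Y. N \<ge> 1 --> 1 \<le> S --> Y = real N powr c --> S \<le> Y -->
  \<bar>real (frakQ c S N) - 12 * \<gamma> / (pi^2 * (2 * \<gamma> - 1)) * S powr (1/2) * Y powr (\<gamma> - 1/2)\<bar>
   \<le> C * Y powr (2 * \<delta>) * (S powr (1/5) * Y powr ((2 + \<gamma>) / 5) + S powr (5/8) * Y powr (3/8))"
proof -
 have g: "1/2 < \<gamma>" "\<gamma> < 1" using c by (auto simp: \<gamma> field_simps)
 define q where "q = 2 * \<gamma> - 1"
 have q: "q > 0" using g by (simp add: q_def)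
 obtain C0 where C0: "C0 \<ge> 0" and ps: "\<And>Y S \<nu>. 1 \<le> S ==> S \<le> Y ==> \<nu> = 0 \<or> \<nu> = 1 ==>
  \<bar>\<Sum>s\<in>sqf_upto S. \<Sum>m\<in>roots_upto Y s. psi (- ((real s * (real m)^2 + \<nu>) powr \<gamma>))\<bar>
   \<le> C0 * Y powr (2 * \<delta>) * (S powr (1/5) * Y powr ((2 + \<gamma>) / 5) + S powr (5/8) * Y powr (3/8))"
  using psi_total[OF g \<delta>] by blast
 define D where "D = (1 + 5 / (2 * \<delta>)) ^ 5"
 define C where "C = 4 * D + 1 / q + \<gamma> / q * (24 * D) + 2 * C0"
 have D: "D \<ge> 0" using \<delta> by (simp add: D_def)
 have "\<bar>real (frakQ c S N) - 12 * \<gamma> / (pi^2 * (2 * \<gamma> - 1)) * S powr (1/2) * Y powr (\<gamma> - 1/2)\<bar>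
   \<le> C * Y powr (2 * \<delta>) * (S powr (1/5) * Y powr ((2 + \<gamma>) / 5) + S powr (5/8) * Y powr (3/8))"
  if N: "N \<ge> 1" and S: "1 \<le> S" "S \<le> Y" and Y: "Y = real N powr c" for N S Y
 proof -
  have Y1: "Y \<ge> 1" using S by simp
  define E where "E = S powr (1/5) * Y powr ((2 + \<gamma>) / 5) + S powr (5/8) * Y powr (3/8)"
  define X where "X = Y powr (2 * \<delta>) * E"
  define \<Psi> where "\<Psi> = (\<lambda>\<nu>. \<Sum>s\<in>sqf_upto S. \<Sum>m\<in>roots_upto Y s. psi (- ((real s * (real m)^2 + \<nu>) powr \<gamma>)))"
  define A where "A = (\<Sum>s\<in>sqf_upto S. \<Sum>m\<in>roots_upto Y s. (real s * (real m)^2 + 1) powr \<gamma> - (real s * (real m)^2) powr \<gamma>)"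
  have T: "{s. 0 < s \<and> real s \<le> S \<and> squarefree s} = sqf_upto S" using S by (auto simp: mem_sqf_upto)
  have "real (frakQ c S N) = (\<Sum>s\<in>sqf_upto S. real (Q c s N))" by (simp add: frakQ_def T)
  also have "... = (\<Sum>s\<in>sqf_upto S. \<Sum>m\<in>roots_upto Y s. ((real s * (real m)^2 + 1) powr \<gamma> - (real s * (real m)^2) powr \<gamma>) +
  (psi (- ((real s * (real m)^2 + 1) powr \<gamma>)) - psi (- ((real s * (real m)^2 + 0) powr \<gamma>))))"
   unfolding Y using S by (intro sum.cong Q_eq_sum c \<gamma>) (auto simp: mem_sqf_upto)
  also have "... = A + (\<Psi> 1 - \<Psi> 0)" by (simp only: A_def \<Psi>_def sum.distrib sum_subtractf)
  finally have Q: "real (frakQ c S N) = A + (\<Psi> 1 - \<Psi> 0)" .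
  have \<Psi>: "\<bar>\<Psi> 1\<bar> \<le> C0 * X" "\<bar>\<Psi> 0\<bar> \<le> C0 * X"
   using ps[OF S, of 1] ps[OF S, of 0] by (simp_all add: \<Psi>_def X_def E_def mult.assoc)
  have e1: "1 \<le> S powr (1/5)" "1 \<le> Y powr ((2 + \<gamma>) / 5)" "1 \<le> Y powr (2 * \<delta>)"
   using S Y1 g \<delta> by (auto intro!: ge_one_powr_ge_zero)
  have E2: "0 \<le> S powr (5/8) * Y powr (3/8)" by simp
  have E1: "1 \<le> E" using mult_mono[of 1 "S powr (1/5)" 1 "Y powr ((2 + \<gamma>) / 5)"] e1 E2 unfolding E_def by linarith
  have SE: "S \<le> E"
  proof -
   have "S = S powr (5/8) * S powr (3/8)" using S by (simp flip: powr_add)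
   also have "... \<le> S powr (5/8) * Y powr (3/8)" using S by (intro mult_left_mono powr_mono2) auto
   also have "... \<le> E" by (simp add: E_def)
   finally show ?thesis .
  qed
  have YE: "Y powr (\<gamma> - 1/2) \<le> E"
  proof -
   have "Y powr (\<gamma> - 1/2) \<le> Y powr ((2 + \<gamma>) / 5)" using Y1 g by (intro powr_mono) auto
   also have "... \<le> S powr (1/5) * Y powr ((2 + \<gamma>) / 5)" using e1 mult_right_mono[of 1 "S powr (1/5)" "Y powr ((2 + \<gamma>) / 5)"] by simp
   also have "... \<le> E" by (simp add: E_def)
   finally show ?thesis .
  qed
  have L: "1 + ln (S + 1) \<le> 2 * D * Y powr (2 * \<delta>)" "0 \<le> ln (S + 1)"
  proof -
   show "0 \<le> ln (S + 1)" using S by simp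
   have "ln (S + 1) \<le> ln (2 * Y)" using S by simp
   also have "... = ln 2 + ln Y" using Y1 by (simp add: ln_mult)
   finally have "ln (S + 1) \<le> ln 2 + ln Y" .
   moreover have "ln 2 \<le> (1 :: real)" using ln_le_minus_one[of 2] by simp
   ultimately have 1: "1 + ln (S + 1) \<le> 2 * (1 + ln Y)" using ln_ge_zero[OF Y1] unfolding distrib_left by linarith
   have "1 + ln Y \<le> (1 + ln Y) ^ 5" using Y1 by (intro self_le_power) auto
   also have "... \<le> D * Y powr (2 * \<delta>)" unfolding D_def using Y1 \<delta> by (intro ln_power5_le) auto
   finally show "1 + ln (S + 1) \<le> 2 * D * Y powr (2 * \<delta>)" using 1 by simp
  qed
  have X: "1 * E \<le> X" unfolding X_def using e1 E1 by (intro mult_right_mono) auto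
  have t1: "2 * (1 + ln (S + 1)) \<le> 4 * D * X"
  proof -
   have "2 * (1 + ln (S + 1)) \<le> (4 * D * Y powr (2 * \<delta>)) * 1" using L by simp
   also have "... \<le> (4 * D * Y powr (2 * \<delta>)) * E" using E1 D by (intro mult_left_mono) auto
   finally show ?thesis by (simp add: X_def mult.assoc)
  qed
  have "S * (1 / q) \<le> X * (1 / q)" using SE X q by (intro mult_right_mono) auto
  then have t2: "S / q \<le> 1 / q * X" by simp
  have t3: "\<gamma> / q * Y powr (\<gamma> - 1/2) * (12 * (1 + ln (S + 1))) \<le> \<gamma> / q * (24 * D) * X"
  proof -
   have "Y powr (\<gamma> - 1/2) * (12 * (1 + ln (S + 1))) \<le> E * (24 * D * Y powr (2 * \<delta>))"
   proof (rule mult_mono[OF YE])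
    show "12 * (1 + ln (S + 1)) \<le> 24 * D * Y powr (2 * \<delta>)" using mult_left_mono[OF L(1), of 12] by (simp add: mult.assoc)
   qed (use L E1 in auto)
   then have "\<gamma> / q * (Y powr (\<gamma> - 1/2) * (12 * (1 + ln (S + 1)))) \<le> \<gamma> / q * (E * (24 * D * Y powr (2 * \<delta>)))"
    using g q by (intro mult_left_mono) auto
   then show ?thesis by (simp add: X_def mult_ac)
  qed
  have m: "\<bar>A - 12 * \<gamma> / (pi^2 * q) * S powr (1/2) * Y powr (\<gamma> - 1/2)\<bar> \<le> 4 * D * X + 1 / q * X + \<gamma> / q * (24 * D) * X"
   using main_total[OF g S] t1 t2 t3 unfolding A_def q_def by linarith
  have tri: "\<bar>a + (p1 - p0) - b\<bar> \<le> u + (w + w)" if "\<bar>a - b\<bar> \<le> u" "\<bar>p1\<bar> \<le> w" "\<bar>p0\<bar> \<le> w" for a b p1 p0 u w :: real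
   using that by linarith
  have "\<bar>A + (\<Psi> 1 - \<Psi> 0) - 12 * \<gamma> / (pi^2 * q) * S powr (1/2) * Y powr (\<gamma> - 1/2)\<bar> \<le> 4 * D * X + 1 / q * X + \<gamma> / q * (24 * D) * X + (C0 * X + C0 * X)"
   by (rule tri[OF m \<Psi>])
  also have "... = C * X" unfolding C_def by (simp only: distrib_right mult_2 add.assoc)
  finally show ?thesis unfolding Q by (simp add: X_def E_def q_def mult.assoc)
 qed
 moreover have "C \<ge> 0" using D C0 q g by (simp add: C_def)
 ultimately show ?thesis by blast
qed

theorem theorem2p3:
  fixes c \<gamma> :: real
  assumes "c > 1" and "c \<notin> \<nat>" and "\<gamma> = 1 / c"
  shows "\<forall>\<epsilon>>0. \<exists>C::real. \<forall>(N::nat) (S::real).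
           N \<ge> 1 \<longrightarrow> 1 \<le> S \<longrightarrow> S \<le> real N powr c \<longrightarrow>
           \<bar>real (frakQ c S N)
              - 12 * \<gamma> / (pi ^ 2 * (2 * \<gamma> - 1)) * S powr (1 / 2) * real N powr (1 - c / 2)\<bar>
           \<le> C * real N powr \<epsilon> *
              (S powr (1 / 5) * real N powr ((1 + 2 * c) / 5)
               + S powr (5 / 8) * real N powr (3 * c / 8)
               + S powr (1 / 8) * real N powr ((2 + 3 * c) / 8)
               + S * real N powr (1 - c))"
proof (intro allI impI)
 fix \<epsilon> :: real assume \<epsilon>: "\<epsilon> > 0"
 define E where "E = (\<lambda>(N::nat) S. S powr (1 / 5) * real N powr ((1 + 2 * c) / 5)
       + S powr (5 / 8) * real N powr (3 * c / 8)
       + S powr (1 / 8) * real N powr ((2 + 3 * c) / 8)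
       + S * real N powr (1 - c))"
 have "\<exists>C::real. \<forall>(N::nat) (S::real). N \<ge> 1 --> 1 \<le> S --> S \<le> real N powr c -->
     \<bar>real (frakQ c S N) - 12 * \<gamma> / (pi ^ 2 * (2 * \<gamma> - 1)) * S powr (1 / 2) * real N powr (1 - c / 2)\<bar>
     \<le> C * real N powr \<epsilon> * E N S"
 proof (cases "c < 2")
  case True
  \<comment> \<open>With Y = N powr c this makes Y powr (2 \<delta>) equal to N powr
    \<epsilon>.\<close>
  define \<delta> where "\<delta> = \<epsilon> / (2 * c)"
  have \<delta>: "\<delta> > 0" using \<epsilon> assms by (simp add: \<delta>_def)
  obtain C where C: "C \<ge> 0" and as: "\<And>(N::nat) (S::real) Y. N \<ge> 1 ==> 1 \<le> S ==> Y = real N powr c ==> S \<le> Y ==>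
  \<bar>real (frakQ c S N) - 12 * \<gamma> / (pi^2 * (2 * \<gamma> - 1)) * S powr (1/2) * Y powr (\<gamma> - 1/2)\<bar>
   \<le> C * Y powr (2 * \<delta>) * (S powr (1/5) * Y powr ((2 + \<gamma>) / 5) + S powr (5/8) * Y powr (3/8))"
   using frakQ_asymptotic[OF assms(1) True assms(3) \<delta>] by blast
  show ?thesis
  proof (intro exI[of _ C] allI impI)
   fix N :: nat and S :: real assume N: "N \<ge> 1" and S: "1 \<le> S" "S \<le> real N powr c"
   have c0: "c \<noteq> 0" using assms by simp
   have e: "c * (\<gamma> - 1/2) = 1 - c / 2" "c * (2 * \<delta>) = \<epsilon>" "c * ((2 + \<gamma>) / 5) = (1 + 2 * c) / 5" "c * (3 / 8) = 3 * c / 8"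
    using c0 assms(3) by (simp_all add: \<delta>_def right_diff_distrib distrib_left)
   have "\<bar>real (frakQ c S N) - 12 * \<gamma> / (pi^2 * (2 * \<gamma> - 1)) * S powr (1/2) * real N powr (1 - c / 2)\<bar>
    \<le> C * real N powr \<epsilon> * (S powr (1/5) * real N powr ((1 + 2 * c) / 5) + S powr (5/8) * real N powr (3 * c / 8))"
    using as[OF N S(1) refl S(2)] unfolding powr_powr e .
   also have "... \<le> C * real N powr \<epsilon> * E N S"
    using C S by (intro mult_left_mono) (auto simp: E_def)
   finally show "\<bar>real (frakQ c S N) - 12 * \<gamma> / (pi ^ 2 * (2 * \<gamma> - 1)) * S powr (1 / 2) * real N powr (1 - c / 2)\<bar> \<le> C * real N powr \<epsilon> * E N S" .
  qed
 next
  case False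
  \<comment> \<open>S \<le> N powr c makes the main term at most |\<kappa>| N, with |\<kappa>|
    depending on c only, while the count itself is at most N.\<close>
  define \<kappa> where "\<kappa> = 12 * \<gamma> / (pi ^ 2 * (2 * \<gamma> - 1))"
  show ?thesis
  proof (intro exI[of _ "1 + \<bar>\<kappa>\<bar>"] allI impI)
   fix N :: nat and S :: real assume N: "N \<ge> 1" and S: "1 \<le> S" "S \<le> real N powr c"
   have NE: "real N \<le> E N S"
   proof -
    have "real N powr 1 \<le> real N powr ((1 + 2 * c) / 5)" using N False by (intro powr_mono) auto
    moreover have "1 \<le> S powr (1/5)" using S by (intro ge_one_powr_ge_zero) auto
    ultimately have "1 * real N powr 1 \<le> S powr (1/5) * real N powr ((1 + 2 * c) / 5)" by (intro mult_mono) auto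
    also have "... \<le> E N S" using S by (simp add: E_def)
    finally show ?thesis by simp
   qed
   have "S powr (1/2) * real N powr (1 - c / 2) \<le> (real N powr c) powr (1/2) * real N powr (1 - c / 2)"
    using S by (intro mult_right_mono powr_mono2) auto
   also have "... = real N powr (c * (1/2) + (1 - c / 2))" by (simp only: powr_powr powr_add)
   also have "... = real N" by simp
   finally have "\<bar>\<kappa>\<bar> * (S powr (1/2) * real N powr (1 - c / 2)) \<le> \<bar>\<kappa>\<bar> * real N" by (intro mult_left_mono) auto
   then have "\<bar>\<kappa> * S powr (1/2) * real N powr (1 - c / 2)\<bar> \<le> \<bar>\<kappa>\<bar> * real N" by (simp add: abs_mult mult.assoc)
   moreover have "real (frakQ c S N) \<le> real N" using frakQ_le[OF assms(1)] by simp
   moreover have "\<bar>a - b\<bar> \<le> n + k" if "\<bar>b\<bar> \<le> k" "a \<le> n" "a \<ge> 0" for a b n k :: real using that by linarith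
   ultimately have "\<bar>real (frakQ c S N) - \<kappa> * S powr (1 / 2) * real N powr (1 - c / 2)\<bar> \<le> real N + \<bar>\<kappa>\<bar> * real N" by simp
   also have "... = (1 + \<bar>\<kappa>\<bar>) * 1 * real N" by (simp add: distrib_right)
   also have "... \<le> (1 + \<bar>\<kappa>\<bar>) * real N powr \<epsilon> * E N S"
    using NE N \<epsilon> by (intro mult_mono) (auto intro!: ge_one_powr_ge_zero)
   finally show "\<bar>real (frakQ c S N) - 12 * \<gamma> / (pi ^ 2 * (2 * \<gamma> - 1)) * S powr (1 / 2) * real N powr (1 - c / 2)\<bar> \<le> (1 + \<bar>\<kappa>\<bar>) * real N powr \<epsilon> * E N S"
    by (simp only: \<kappa>_def)
  qed
 qed
 then show "\<exists>C::real. \<forall>(N::nat) (S::real).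
     N \<ge> 1 --> 1 \<le> S --> S \<le> real N powr c -->
     \<bar>real (frakQ c S N)
       - 12 * \<gamma> / (pi ^ 2 * (2 * \<gamma> - 1)) * S powr (1 / 2) * real N powr (1 - c / 2)\<bar>
     \<le> C * real N powr \<epsilon> *
       (S powr (1 / 5) * real N powr ((1 + 2 * c) / 5)
       + S powr (5 / 8) * real N powr (3 * c / 8)
       + S powr (1 / 8) * real N powr ((2 + 3 * c) / 8)
       + S * real N powr (1 - c))"
  unfolding E_def .
qed

end
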